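(* Let $(\mu_n)_{n\in\mathbb N\cup\{\infty\}}\subset\mathscr K(X)$ be such that $\mu_n\to\mu_\infty$ vaguely and $G^{\mu_n}1\to G^{\mu_\infty}1$ uniformly on $X$. Let $F$ be the fine support of $\mu_\infty$. (1) Let $u$ belong to the closure in $C_0(X)$ of the range of $\check R^\infty_\alpha$ on $C_0(X)$. Then $\lim_{n\to\infty}\|\check{\bf P}^n_tu-\check{\bf P}^\infty_tu\|_\infty=0$ for all $t\ge0$. Moreover, the convergence is uniform in $t$ on compact intervals of $[0,\infty)$. (2) Assume that $F$ is closed and let $u\in C_0(X)$. Then $\lim_{n\to\infty}\|\check{\bf P}^n_tP_Fu-\check{\bf P}^\infty_tu\|_\infty=0$ for all $t\ge0$. Moreover, the convergence is uniform in $t$ on compact intervals of $[0,\infty)$.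
   Context: $X$ is a locally compact separable metric space, $m$ a positive Radon measure on the Borel sets of $X$ with full support, $X_\partial=X\cup\{\partial\}$ the one-point compactification; every function $u$ on $X$ is extended by $u(\partial)=0$. $\mathscr B_b(X)$ denotes the bounded Borel functions on $X$ with the sup norm $\|\cdot\|_\infty$, and $C_0(X)$ the continuous functions vanishing at infinity. $\mathbb X=(\Omega,\mathscr M,\mathscr M_t,(\mathbb P_x)_{x\in X_\partial},(\mathbb X_t)_{0\le t\le\infty},(\theta_t),\zeta)$ is a standard process in the sense of Blumenthal–Getoor (not necessarily symmetric) with state space $X$ and cemetery $\partial$ (with $\mathbb X_\infty=\partial$). It is transient and has a dual standard process $\hat{\mathbb X}$ (duality with respect to $m$) with the same properties. Its transition semigroup ${\bf P}_tu(x)=\mathbb E_x[u(\mathbb X_t)]$ has a jointly measurable density $p_t(x,y)$ with respect to $m$, with $p_t(x,y)>0$ for all $t>0$, $x,y\in X$. For $\alpha\ge0$, $G_\alpha(x,y)=\int_0^\infty e^{-\alpha t}p_t(x,y)\,dt$, $G:=G_0\not\equiv\infty$, and $G:X\times X\to(0,\infty]$ is lower semicontinuous. For a positive Radon measure $\mu$ on $X$, $G^\mu u(x)=\int_XG(x,y)u(y)\,d\mu(y)$; $\mu$ is $G$-Kato if $G^\mu1\in C_0(X)$, and $\mathscr K(X)$ is the set of $G$-Kato measures. Each $\mu\in\mathscr K(X)$ has a unique (up to equivalence) positive continuous additive functional (PCAF) ${\bf A}$ of $\mathbb X$ with Revuz measure $\mu$; it satisfies $\mathbb E_x[\int_0^\infty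 e^{-\alpha t}u(\mathbb X_t)\,d{\bf A}_t]=\int_XG_\alpha(x,y)u(y)\,d\mu(y)$ for $u\in\mathscr B_b(X)$, $\alpha\ge0$, $x\in X$. For $n\in\mathbb N\cup\{\infty\}$ let ${\bf A}^n$ be the PCAF of $\mu_n$, $\tau^n_t=\inf\{s\ge0:{\bf A}^n_s>t\}$, and for $u\in\mathscr B_b(X)$, $x\in X$, $\check{\bf P}^n_tu(x)=\mathbb E_x[u(\mathbb X_{\tau^n_t})]$ and $\check R^n_\alpha u(x)=\mathbb E_x[\int_0^\infty e^{-\alpha t}u(\mathbb X_{\tau^n_t})\,dt]$ (which maps $C_0(X)$ into $C_0(X)$, with range independent of $\alpha$). The fine support of $\mu\in\mathscr K(X)$ is the smallest nearly Borel finely closed set $B\subset X$ with $\mu(B^c)=0$; it equals $\{x\in X:\mathbb P_x(\tau_0=0)=1\}$, where $\tau_0=\inf\{s\ge0:{\bf A}_s>0\}$. With $\sigma_F=\inf\{t>0:\mathbb X_t\in F\}$, $P_Fu(x)=\mathbb E_x[u(\mathbb X_{\sigma_F})]$. Vague convergence means convergence of integrals of continuous functions with compact support. *)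

theory Defs
  imports "HOL-Probability.Probability"
begin

section \<open>Functions and measures on the state space\<close>

text \<open>The state space is the type \<open>'a\<close>; its one-point compactification is
  \<^const>\<open>Alexandroff_compactification\<close> of its topology, on \<open>'a option\<close>, with cemetery
  \<^term>\<open>None\<close> (an isolated point when the state space is compact).\<close>

abbreviation (input) cem_top :: "'a::topological_space option topology" where
  "cem_top \<equiv> Alexandroff_compactification euclidean"

definition borel_cem :: "'a::topological_space option measure" where
  "borel_cem = sigma UNIV {U. openin cem_top U}"

definition ext0 :: "('a \<Rightarrow> 'b::zero) \<Rightarrow> 'a option \<Rightarrow> 'b" where
  "ext0 u z = (case z of None \<Rightarrow> 0 | Some x \<Rightarrow> u x)"

definition sup_norm :: "('a \<Rightarrow> real) \<Rightarrow> ennreal" where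
  "sup_norm f = (SUP x. ennreal \<bar>f x\<bar>)"

definition C0 :: "('a::topological_space \<Rightarrow> real) set" where
  "C0 = {u. continuous_on UNIV u \<and> (\<forall>e>0. \<exists>K. compact K \<and> (\<forall>x. x \<notin> K \<longrightarrow> \<bar>u x\<bar> < e))}"

definition Cc :: "('a::topological_space \<Rightarrow> real) set" where
  "Cc = {u. continuous_on UNIV u \<and> compact (closure {x. u x \<noteq> 0})}"

definition C0_closure :: "('a::topological_space \<Rightarrow> real) set \<Rightarrow> ('a \<Rightarrow> real) set" where
  "C0_closure S = {u \<in> C0. \<forall>e>0. \<exists>v\<in>S. sup_norm (\<lambda>x. v x - u x) < e}"

text \<open>On a locally compact separable metric space, inner and outer regularity follow from
  finiteness on compact sets.\<close>

definition radon_measure :: "'a::topological_space measure \<Rightarrow> bool" where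
  "radon_measure \<mu> \<longleftrightarrow> sets \<mu> = sets borel \<and> (\<forall>K. compact K \<longrightarrow> emeasure \<mu> K < \<infinity>)"

definition full_support :: "'a::topological_space measure \<Rightarrow> bool" where
  "full_support \<mu> \<longleftrightarrow> (\<forall>U. open U \<longrightarrow> U \<noteq> {} \<longrightarrow> 0 < emeasure \<mu> U)"

definition vague_conv :: "(nat \<Rightarrow> 'a::topological_space measure) \<Rightarrow> 'a measure \<Rightarrow> bool" where
  "vague_conv \<mu> \<nu> \<longleftrightarrow> (\<forall>f\<in>Cc. (\<lambda>n. integral\<^sup>L (\<mu> n) f) \<longlonglongrightarrow> integral\<^sup>L \<nu> f)"

section \<open>Standard processes\<close>

text \<open>Time runs through \<open>[0, \<infinity>]\<close>, i.e. the type \<^typ>\<open>ennreal\<close>.\<close>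

record ('w, 'a) process =
  Evt :: "'w measure"                          \<comment> \<open>only its space and measurable sets matter\<close>
  Flt :: "ennreal \<Rightarrow> 'w measure"               \<comment> \<open>filtration\<close>
  Law :: "'a option \<Rightarrow> 'w measure"
  Pos :: "ennreal \<Rightarrow> 'w \<Rightarrow> 'a option"
  Shift :: "ennreal \<Rightarrow> 'w \<Rightarrow> 'w"

definition lifetime :: "('w, 'a) process \<Rightarrow> 'w \<Rightarrow> ennreal" where
  "lifetime X \<omega> = Inf {t. Pos X t \<omega> = None}"

text \<open>The measure of an event under the initial distribution \<open>\<nu>\<close>. The integrand is only
  universally measurable, whence the completion.\<close>

definition init_prob :: "('w, 'a) process \<Rightarrow> 'a option measure \<Rightarrow> 'w set \<Rightarrow> ennreal" where
  "init_prob X \<nu> N = (\<integral>\<^sup>+z. emeasure (Law X z) N \<partial>completion \<nu>)"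

text \<open>The sets that, for every initial distribution, differ from a member of \<open>S\<close> by a subset of
  a null set from \<open>T\<close>.\<close>

definition completed ::
  "('w, 'a::topological_space) process \<Rightarrow> 'w set set \<Rightarrow> 'w set set \<Rightarrow> 'w set set" where
  "completed X S T = {D. D \<subseteq> space (Evt X) \<and>
     (\<forall>\<nu>. prob_space \<nu> \<longrightarrow> sets \<nu> = sets borel_cem \<longrightarrow>
        (\<exists>B\<in>S. \<exists>N\<in>T. init_prob X \<nu> N = 0 \<and> (D - B) \<union> (B - D) \<subseteq> N))}"

text \<open>The natural filtration, and its completion by the null sets of the natural
  \<open>\<sigma>\<close>-algebra.\<close>

definition nat_filt :: "('w, 'a::topological_space) process \<Rightarrow> ennreal \<Rightarrow> 'w measure" where
  "nat_filt X t = sigma (space (Evt X))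
     {Pos X s -` B \<inter> space (Evt X) | s B. s \<le> t \<and> B \<in> sets borel_cem}"

definition nat_filt_compl :: "('w, 'a::topological_space) process \<Rightarrow> ennreal \<Rightarrow> 'w measure" where
  "nat_filt_compl X t =
     sigma (space (Evt X)) (completed X (sets (nat_filt X t)) (sets (nat_filt X \<infinity>)))"

text \<open>Blumenthal and Getoor's definition. The Markov property is the case of constant \<open>T\<close> in
  \<open>strong_markov\<close>.\<close>

locale standard_process = filtration "space (Evt X)" "Flt X"
  for X :: "('w, 'a::{metric_space, second_countable_topology}) process" +
  assumes filt_events: "sets (Flt X t) \<subseteq> sets (Evt X)"
    and prob_law: "prob_space (Law X z)"
    and sets_law: "sets (Law X z) = sets (Evt X)"
    and law_univ_measurable:
      "\<lbrakk>N \<in> sets (Evt X); prob_space \<nu>; sets \<nu> = sets borel_cem\<rbrakk>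
        \<Longrightarrow> (\<lambda>z. emeasure (Law X z) N) \<in> borel_measurable (completion \<nu>)"
    and adapted: "Pos X t \<in> measurable (Flt X t) borel_cem"
    and law_borel:
      "B \<in> sets borel \<Longrightarrow>
        (\<lambda>x. emeasure (Law X (Some x)) {\<omega>\<in>space (Evt X). Pos X t \<omega> \<in> Some ` B})
          \<in> borel_measurable borel"
    and normal: "AE \<omega> in Law X z. Pos X 0 \<omega> = z"
    and pos_infinity: "\<omega> \<in> space (Evt X) \<Longrightarrow> Pos X \<infinity> \<omega> = None"
    and cemetery_trap:
      "\<lbrakk>\<omega> \<in> space (Evt X); s \<le> t; Pos X s \<omega> = None\<rbrakk> \<Longrightarrow> Pos X t \<omega> = None"
    and shift_space: "\<omega> \<in> space (Evt X) \<Longrightarrow> Shift X t \<omega> \<in> space (Evt X)"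
    and pos_shift: "\<omega> \<in> space (Evt X) \<Longrightarrow> Pos X s (Shift X t \<omega>) = Pos X (t + s) \<omega>"
    and filt_right_continuous:
      "t < \<infinity> \<Longrightarrow> (\<Inter>s\<in>{t<..}. sets (Flt X s)) = sets (Flt X t)"
    and filt_complete: "completed X (sets (Flt X t)) (sets (Evt X)) = sets (Flt X t)"
    and right_continuous:
      "\<lbrakk>\<omega> \<in> space (Evt X); t < \<infinity>\<rbrakk>
        \<Longrightarrow> limitin cem_top (\<lambda>s. Pos X s \<omega>) (Pos X t \<omega>) (at_right t)"
    and left_limits:
      "AE \<omega> in Law X z. \<forall>t. 0 < t \<longrightarrow> t < lifetime X \<omega> \<longrightarrow>
         (\<exists>l. limitin cem_top (\<lambda>s. Pos X s \<omega>) l (at_left t))"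
    and pos_stopping:
      "stopping_time (Flt X) T \<Longrightarrow> (\<lambda>\<omega>. Pos X (T \<omega>) \<omega>) \<in> measurable (pre_sigma T) borel_cem"
    and strong_markov:
      "\<lbrakk>stopping_time (Flt X) T; D \<in> sets (pre_sigma T); C \<in> sets borel_cem\<rbrakk>
        \<Longrightarrow> emeasure (Law X z) {\<omega>\<in>D. Pos X (T \<omega> + t) \<omega> \<in> C} =
            (\<integral>\<^sup>+\<omega>\<in>D. emeasure (Law X (Pos X (T \<omega>) \<omega>))
                        {\<omega>'\<in>space (Evt X). Pos X t \<omega>' \<in> C} \<partial>Law X z)"
    and quasi_left_continuous:
      "\<lbrakk>\<And>k. stopping_time (Flt X) (S k); \<And>\<omega>. \<omega> \<in> space (Evt X) \<Longrightarrow> incseq (\<lambda>k. S k \<omega>)\<rbrakk>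
        \<Longrightarrow> AE \<omega> in Law X z. (SUP k. S k \<omega>) < lifetime X \<omega> \<longrightarrow>
              limitin cem_top (\<lambda>k. Pos X (S k \<omega>) \<omega>) (Pos X (SUP k. S k \<omega>) \<omega>) sequentially"

definition trans_op ::
  "('w, 'a) process \<Rightarrow> real \<Rightarrow> ('a \<Rightarrow> ennreal) \<Rightarrow> 'a \<Rightarrow> ennreal" where
  "trans_op X t f x = (\<integral>\<^sup>+\<omega>. ext0 f (Pos X (ennreal t) \<omega>) \<partial>Law X (Some x))"

text \<open>Transience in Getoor's sense: some strictly positive function has a finite potential.\<close>

definition transient :: "('w, 'a::topological_space) process \<Rightarrow> bool" where
  "transient X \<longleftrightarrow> (\<exists>g\<in>borel_measurable borel. (\<forall>x. 0 < g x) \<and>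
     (\<forall>x. (\<integral>\<^sup>+t\<in>{0..}. trans_op X t g x \<partial>lborel) < \<infinity>))"

definition in_duality ::
  "('w, 'a::topological_space) process \<Rightarrow> ('v, 'a) process \<Rightarrow> 'a measure \<Rightarrow> bool" where
  "in_duality X Y m \<longleftrightarrow>
     (\<forall>t\<ge>0. \<forall>f\<in>borel_measurable borel. \<forall>g\<in>borel_measurable borel.
        (\<integral>\<^sup>+x. trans_op X t f x * g x \<partial>m) = (\<integral>\<^sup>+x. f x * trans_op Y t g x \<partial>m))"

section \<open>Transition density, Green function and Kato measures\<close>

definition transition_density ::
  "('w, 'a::topological_space) process \<Rightarrow> 'a measure \<Rightarrow> (real \<Rightarrow> 'a \<Rightarrow> 'a \<Rightarrow> ennreal) \<Rightarrow> bool"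
where
  "transition_density X m p \<longleftrightarrow>
     (\<lambda>(t, x, y). p t x y)
       \<in> borel_measurable (restrict_space borel {0<..} \<Otimes>\<^sub>M borel \<Otimes>\<^sub>M borel) \<and>
     (\<forall>t>0. \<forall>x. \<forall>f\<in>borel_measurable borel.
        trans_op X t f x = (\<integral>\<^sup>+y. p t x y * f y \<partial>m))"

definition green :: "(real \<Rightarrow> 'a \<Rightarrow> 'a \<Rightarrow> ennreal) \<Rightarrow> real \<Rightarrow> 'a \<Rightarrow> 'a \<Rightarrow> ennreal" where
  "green p \<alpha> x y = (\<integral>\<^sup>+t\<in>{0<..}. ennreal (exp (- \<alpha> * t)) * p t x y \<partial>lborel)"

definition lower_semicont :: "('a::topological_space \<Rightarrow> ennreal) \<Rightarrow> bool" where
  "lower_semicont f \<longleftrightarrow> (\<forall>c. open {z. c < f z})"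

definition green_pot ::
  "(real \<Rightarrow> 'a \<Rightarrow> 'a \<Rightarrow> ennreal) \<Rightarrow> real \<Rightarrow> 'a measure \<Rightarrow> ('a \<Rightarrow> ennreal) \<Rightarrow> 'a \<Rightarrow> ennreal" where
  "green_pot p \<alpha> \<mu> f x = (\<integral>\<^sup>+y. green p \<alpha> x y * f y \<partial>\<mu>)"

definition kato :: "(real \<Rightarrow> 'a::topological_space \<Rightarrow> 'a \<Rightarrow> ennreal) \<Rightarrow> 'a measure set" where
  "kato p = {\<mu>. radon_measure \<mu> \<and> (\<forall>x. green_pot p 0 \<mu> (\<lambda>_. 1) x < \<infinity>) \<and>
     (\<lambda>x. enn2real (green_pot p 0 \<mu> (\<lambda>_. 1) x)) \<in> C0}"

section \<open>Additive functionals and the Revuz correspondence\<close>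

text \<open>Positive continuous additive functionals in the strict sense (no exceptional set of
  starting points), with a defining set \<open>\<Lambda>\<close>. Continuity at \<open>t = \<infinity>\<close> is the convention that the
  terminal value is the limit.\<close>

definition pcaf ::
  "('w, 'a::topological_space) process \<Rightarrow> (ennreal \<Rightarrow> 'w \<Rightarrow> ennreal) \<Rightarrow> bool" where
  "pcaf X A \<longleftrightarrow>
     (\<forall>t. A t \<in> borel_measurable (nat_filt_compl X t)) \<and>
     (\<exists>\<Lambda>\<in>sets (nat_filt_compl X \<infinity>).
        (\<forall>x. emeasure (Law X (Some x)) \<Lambda> = 1) \<and>
        (\<forall>t<\<infinity>. Shift X t ` \<Lambda> \<subseteq> \<Lambda>) \<and>
        (\<forall>\<omega>\<in>\<Lambda>.
           A 0 \<omega> = 0 \<and>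
           mono (\<lambda>t. A t \<omega>) \<and>
           continuous_on UNIV (\<lambda>t. A t \<omega>) \<and>
           (\<forall>t < lifetime X \<omega>. A t \<omega> < \<infinity>) \<and>
           (\<forall>t \<ge> lifetime X \<omega>. A t \<omega> = A (lifetime X \<omega>) \<omega>) \<and>
           (\<forall>t<\<infinity>. \<forall>s<\<infinity>. A (t + s) \<omega> = A t \<omega> + A s (Shift X t \<omega>))))"

text \<open>The Lebesgue--Stieltjes integral of \<open>f\<close> over \<open>[0, \<infinity>)\<close> against a continuous nondecreasing
  function \<open>a\<close> with \<open>a 0 = 0\<close>. Since \<open>a\<close> may reach \<open>\<infinity>\<close> while \<^const>\<open>interval_measure\<close> needs a
  real-valued function, \<open>a\<close> is truncated at level \<open>k\<close>; the measures increase with \<open>k\<close>. There is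
  no mass on the negative half-line, where \<^term>\<open>ennreal s = 0\<close>.\<close>

definition stieltjes_integral :: "(real \<Rightarrow> ennreal) \<Rightarrow> (ennreal \<Rightarrow> ennreal) \<Rightarrow> ennreal" where
  "stieltjes_integral f a =
     (SUP k::nat. \<integral>\<^sup>+t. f t \<partial>interval_measure (\<lambda>s. enn2real (min (a (ennreal s)) (of_nat k))))"

text \<open>\<open>\<mu>\<close> is the Revuz measure of \<open>A\<close>:
  \<open>\<integral> f d\<mu> = lim\<^bsub>t \<rightarrow> 0\<^esub> t\<^sup>-\<^sup>1 E\<^sub>m[\<integral>\<^sub>0\<^sup>t f(X\<^sub>s) dA\<^sub>s]\<close>.\<close>

definition revuz_measure ::
  "('w, 'a::topological_space) process \<Rightarrow> 'a measure \<Rightarrow> (ennreal \<Rightarrow> 'w \<Rightarrow> ennreal)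
     \<Rightarrow> 'a measure \<Rightarrow> bool" where
  "revuz_measure X m A \<mu> \<longleftrightarrow> sets \<mu> = sets borel \<and>
     (\<forall>f\<in>borel_measurable borel.
        ((\<lambda>t::real.
           (\<integral>\<^sup>+x. (\<integral>\<^sup>+\<omega>. stieltjes_integral
                (\<lambda>s. indicator {0..t} s * ext0 f (Pos X (ennreal s) \<omega>)) (\<lambda>s. A s \<omega>)
              \<partial>Law X (Some x)) \<partial>completion m) / ennreal t)
         \<longlongrightarrow> (\<integral>\<^sup>+y. f y \<partial>\<mu>)) (at_right 0))"

text \<open>\<open>E\<^sub>x[\<integral>\<^sub>0\<^sup>\<infinity> e\<^sup>-\<^sup>\<alpha>\<^sup>t u(X\<^sub>t) dA\<^sub>t] = \<integral> G\<^sub>\<alpha>(x,y) u(y) d\<mu>(y)\<close>, for nonnegative \<open>u\<close>; for finite potentials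
  this is equivalent to the identity for all bounded Borel \<open>u\<close>.\<close>

definition potential_identity ::
  "('w, 'a::topological_space) process \<Rightarrow> (real \<Rightarrow> 'a \<Rightarrow> 'a \<Rightarrow> ennreal)
     \<Rightarrow> (ennreal \<Rightarrow> 'w \<Rightarrow> ennreal) \<Rightarrow> 'a measure \<Rightarrow> bool" where
  "potential_identity X p A \<mu> \<longleftrightarrow>
     (\<forall>u\<in>borel_measurable borel. \<forall>\<alpha>\<ge>0. \<forall>x.
        (\<integral>\<^sup>+\<omega>. stieltjes_integral
             (\<lambda>t. ennreal (exp (- \<alpha> * t)) * ext0 u (Pos X (ennreal t) \<omega>)) (\<lambda>t. A t \<omega>)
           \<partial>Law X (Some x))
        = green_pot p \<alpha> \<mu> u x)"

section \<open>Time change\<close>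

definition inv_clock :: "(ennreal \<Rightarrow> 'w \<Rightarrow> ennreal) \<Rightarrow> real \<Rightarrow> 'w \<Rightarrow> ennreal" where
  "inv_clock A t \<omega> = Inf {s. ennreal t < A s \<omega>}"

definition tc_semigroup ::
  "('w, 'a) process \<Rightarrow> (ennreal \<Rightarrow> 'w \<Rightarrow> ennreal) \<Rightarrow> real \<Rightarrow> ('a \<Rightarrow> real) \<Rightarrow> 'a \<Rightarrow> real" where
  "tc_semigroup X A t u x = (\<integral>\<omega>. ext0 u (Pos X (inv_clock A t \<omega>) \<omega>) \<partial>Law X (Some x))"

definition tc_resolvent ::
  "('w, 'a) process \<Rightarrow> (ennreal \<Rightarrow> 'w \<Rightarrow> ennreal) \<Rightarrow> real \<Rightarrow> ('a \<Rightarrow> real) \<Rightarrow> 'a \<Rightarrow> real" where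
  "tc_resolvent X A \<alpha> u x =
     (\<integral>\<omega>. (LINT t:{0..}|lborel. exp (- \<alpha> * t) * ext0 u (Pos X (inv_clock A t \<omega>) \<omega>))
        \<partial>Law X (Some x))"

section \<open>Hitting times and the fine support\<close>

definition hitting_time :: "('w, 'a) process \<Rightarrow> 'a set \<Rightarrow> 'w \<Rightarrow> ennreal" where
  "hitting_time X B \<omega> = Inf {t. 0 < t \<and> Pos X t \<omega> \<in> Some ` B}"

definition hitting_op :: "('w, 'a) process \<Rightarrow> 'a set \<Rightarrow> ('a \<Rightarrow> real) \<Rightarrow> 'a \<Rightarrow> real" where
  "hitting_op X B u x = (\<integral>\<omega>. ext0 u (Pos X (hitting_time X B \<omega>) \<omega>) \<partial>Law X (Some x))"

definition nearly_borel :: "('w, 'a::topological_space) process \<Rightarrow> 'a set \<Rightarrow> bool" where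
  "nearly_borel X B \<longleftrightarrow>
     (\<forall>\<nu>. prob_space \<nu> \<longrightarrow> sets \<nu> = sets borel_cem \<longrightarrow>
        (\<exists>B1\<in>sets borel. \<exists>B2\<in>sets borel. B1 \<subseteq> B \<and> B \<subseteq> B2 \<and>
           (\<exists>N\<in>sets (Evt X). init_prob X \<nu> N = 0 \<and>
              {\<omega>\<in>space (Evt X). \<exists>t. Pos X t \<omega> \<in> Some ` (B2 - B1)} \<subseteq> N)))"

text \<open>The complement of \<open>B\<close> is finely open: \<open>B\<close> is thin at every point outside \<open>B\<close>.\<close>

definition finely_closed :: "('w, 'a::topological_space) process \<Rightarrow> 'a set \<Rightarrow> bool" where
  "finely_closed X B \<longleftrightarrow>
     (\<forall>x. x \<notin> B \<longrightarrow> (\<exists>D. nearly_borel X D \<and> B \<subseteq> D \<and>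
        (AE \<omega> in Law X (Some x). 0 < hitting_time X D \<omega>)))"

text \<open>Nearly Borel sets are only universally measurable, whence the completion.\<close>

definition fine_carrier ::
  "('w, 'a::topological_space) process \<Rightarrow> 'a measure \<Rightarrow> 'a set \<Rightarrow> bool" where
  "fine_carrier X \<mu> B \<longleftrightarrow>
     nearly_borel X B \<and> finely_closed X B \<and> - B \<in> null_sets (completion \<mu>)"

definition is_fine_support ::
  "('w, 'a::topological_space) process \<Rightarrow> 'a measure \<Rightarrow> 'a set \<Rightarrow> bool" where
  "is_fine_support X \<mu> F \<longleftrightarrow>
     fine_carrier X \<mu> F \<and> (\<forall>B. fine_carrier X \<mu> B \<longrightarrow> F \<subseteq> B)"

end

theory Submission
  imports Defs "HOL-Computational_Algebra.Polynomial"
begin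

text \<open>
  Let \<open>V\<close> be the potential operator of \<open>\<mu>\<close> and \<open>K\<^sub>x\<close> the occupation measure
  \<open>dt P\<^sub>x(X\<^bsub>\<tau>\<^sub>t\<^esub> \<in> dy)\<close> of the time-changed process. The Markov property gives
  \<open>\<integral> t\<^sup>k/k! f dK\<^sub>x = V\<^sup>k\<^sup>+\<^sup>1 f(x)\<close>, so a bound \<open>N\<close> on \<open>V 1\<close> yields \<open>\<integral> exp (t/2N) dK\<^sub>x \<le> 2N\<close>.
  Polynomials are therefore dense in time, uniformly over all \<open>K\<^sub>x\<close> with the same \<open>N\<close>: both
  \<open>V f \<mapsto> P\<^sub>t V f = \<integral> 1\<^bsub>[t,\<infinity>)\<^esub> f dK\<close> and the resolvents are uniform limits of polynomials in \<open>V\<close>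
  applied to \<open>f\<close>. Lower semicontinuity of \<open>G\<close>, vague convergence and uniform convergence of
  \<open>V\<^sub>n 1\<close> imply that \<open>V\<^sub>n f\<close> tends to \<open>V f\<close> uniformly for \<open>f\<close> in \<open>C\<^sub>0\<close>, whence \<open>P\<^sup>n\<^sub>t w\<close> tends to
  \<open>P\<^sub>t w\<close> for every \<open>w\<close> in the closure of \<open>V C\<^sub>0\<close>; this closure contains the range of the resolvent.

  For closed \<open>F\<close> it suffices to approximate the hitting operator applied to \<open>u\<close> by potentials. Let \<open>U\<close>
  be a finite potential of a strictly positive function and \<open>S\<close> the set of points at which the clock starts at
  once, described as the set where the lower semicontinuous excessive regularization of \<open>U\<close>
  along the time change equals \<open>U\<close>. Then \<open>S\<close> is a fine carrier of \<open>\<mu>\<close>, so \<open>F \<subseteq> S\<close>. Since the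
  time-changed process lives on \<open>F\<close> and starts at once from points of \<open>F\<close>, the hitting time of \<open>F\<close>
  is \<open>\<tau>\<^sub>0\<close>, and the hitting operator is \<open>P\<^sub>0\<close>. Minima of potentials are excessive, hence by Dini
  uniform limits on \<open>F\<close> of their averages, i.e. of potentials; so the restrictions of \<open>V C\<^sub>0\<close> to \<open>F\<close> have a
  closure that is a lattice, and it contains every \<open>u\<close> because the averages of \<open>u\<close> converge
  to \<open>u\<close> pointwise on \<open>F\<close>. Finally \<open>P\<^sub>0 V h = V h\<close>.
\<close>

section \<open>Polynomial approximation with an exponential weight\<close>

text \<open>At time 0 the time-changed semigroup need not be the identity, so strong continuity on
  \<open>C0\<close> cannot be presupposed; generators are avoided and all estimates are made on
  occupation measures. Two bounds carry them: total mass at most \<open>N\<close>, and mass at most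
  d on a time slab of length d. The latter absorbs the jump of the indicator of [t, \<infinity>).
  One \<open>N\<close> serves all n, because the potentials of 1 are bounded and converge uniformly.
  Additive functionals are measurable only for a completed filtration and behave well only off an
  exceptional set, and probabilities of general events are only universally measurable in the
  starting point. Hence the functionals are altered on a set that is null under every law, and the
  strong Markov property is rebuilt from cylinder sets, where Borel dependence on the starting point
  is available, up to completed functionals. The regularization of \<open>U\<close> is kept lower
  semicontinuous because its superlevel sets are then open: right continuous paths enter them at
  rational times, where a maximal inequality applies.\<close>

definition wapprox :: "real \<Rightarrow> (real \<Rightarrow> real) \<Rightarrow> bool" where
  "wapprox l \<phi> \<longleftrightarrow> (\<forall>e>0. \<exists>q. \<forall>t\<ge>0. \<bar>\<phi> t - poly q t\<bar> \<le> e * exp (l * t))"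

lemma wapprox_poly: "(\<And>t. \<phi> t = poly q t) \<Longrightarrow> wapprox l \<phi>"
  unfolding wapprox_def by (auto intro!: exI[of _ q])

lemma wapprox_limit:
  assumes "\<And>e. e > 0 \<Longrightarrow> \<exists>\<eta>. wapprox l \<eta> \<and> (\<forall>t\<ge>0. \<bar>\<phi> t - \<eta> t\<bar> \<le> e * exp (l * t))"
  shows "wapprox l \<phi>"
  unfolding wapprox_def
proof safe
  fix e :: real assume "e > 0"
  then obtain \<eta> where \<eta>: "wapprox l \<eta>" "\<And>t. t \<ge> 0 \<Longrightarrow> \<bar>\<phi> t - \<eta> t\<bar> \<le> e/2 * exp (l * t)"
    using assms[of "e/2"] by auto
  then obtain q where q: "\<And>t. t \<ge> 0 \<Longrightarrow> \<bar>\<eta> t - poly q t\<bar> \<le> e/2 * exp (l * t)"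
    unfolding wapprox_def using \<open>e > 0\<close> by (meson half_gt_zero)
  show "\<exists>q. \<forall>t\<ge>0. \<bar>\<phi> t - poly q t\<bar> \<le> e * exp (l * t)"
  proof (intro exI[of _ q] allI impI)
    fix t :: real assume "t \<ge> 0"
    have "e * exp (l * t) = e/2 * exp (l * t) + e/2 * exp (l * t)" by simp
    then show "\<bar>\<phi> t - poly q t\<bar> \<le> e * exp (l * t)"
      using \<eta>(2)[OF \<open>t \<ge> 0\<close>] q[OF \<open>t \<ge> 0\<close>] by linarith
  qed
qed

lemma wapprox_add:
  assumes "wapprox l \<phi>" "wapprox l \<eta>"
  shows "wapprox l (\<lambda>t. \<phi> t + \<eta> t)"
  unfolding wapprox_def
proof safe
  fix e :: real assume "e > 0"
  then obtain q r where q: "\<And>t. t \<ge> 0 \<Longrightarrow> \<bar>\<phi> t - poly q t\<bar> \<le> e/2 * exp (l * t)"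
    and r: "\<And>t. t \<ge> 0 \<Longrightarrow> \<bar>\<eta> t - poly r t\<bar> \<le> e/2 * exp (l * t)"
    using assms unfolding wapprox_def by (meson half_gt_zero)
  show "\<exists>q. \<forall>t\<ge>0. \<bar>\<phi> t + \<eta> t - poly q t\<bar> \<le> e * exp (l * t)"
  proof (intro exI[of _ "q + r"] allI impI)
    fix t :: real assume t: "t \<ge> 0"
    have "e * exp (l * t) = e/2 * exp (l * t) + e/2 * exp (l * t)" by simp
    then show "\<bar>\<phi> t + \<eta> t - poly (q + r) t\<bar> \<le> e * exp (l * t)"
      using q[OF t] r[OF t] unfolding poly_add by linarith
  qed
qed

lemma wapprox_cmult:
  assumes "wapprox l \<phi>"
  shows "wapprox l (\<lambda>t. c * \<phi> t)"
  unfolding wapprox_def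
proof safe
  fix e :: real assume "e > 0"
  then have "e / (\<bar>c\<bar> + 1) > 0" by simp
  then obtain q where q: "\<And>t. t \<ge> 0 \<Longrightarrow> \<bar>\<phi> t - poly q t\<bar> \<le> e / (\<bar>c\<bar> + 1) * exp (l * t)"
    using assms unfolding wapprox_def by meson
  show "\<exists>q. \<forall>t\<ge>0. \<bar>c * \<phi> t - poly q t\<bar> \<le> e * exp (l * t)"
  proof (intro exI[of _ "smult c q"] allI impI)
    fix t :: real assume t: "t \<ge> 0"
    have "\<bar>c * \<phi> t - poly (smult c q) t\<bar> = \<bar>c\<bar> * \<bar>\<phi> t - poly q t\<bar>"
      by (simp add: abs_mult[symmetric] right_diff_distrib)
    also have "\<dots> \<le> (\<bar>c\<bar> + 1) * (e / (\<bar>c\<bar> + 1) * exp (l * t))"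
      using q[OF t] by (intro mult_mono) auto
    also have "\<dots> = e * exp (l * t)" by (simp add: field_simps)
    finally show "\<bar>c * \<phi> t - poly (smult c q) t\<bar> \<le> e * exp (l * t)" .
  qed
qed

lemma wapprox_zero: "wapprox l (\<lambda>t. 0)"
  by (rule wapprox_poly[of _ 0]) simp

lemma wapprox_sum:
  assumes "\<And>i. i \<in> I \<Longrightarrow> wapprox l (\<phi> i)"
  shows "wapprox l (\<lambda>t. \<Sum>i\<in>I. \<phi> i t)"
  using assms
  by (induction I rule: infinite_finite_induct) (auto intro: wapprox_zero wapprox_add)

lemma power_div_fact_le_exp:
  assumes "0 \<le> (x::real)" shows "x ^ n / fact n \<le> exp x"
proof -
  have s: "(\<lambda>n. x ^ n / fact n) sums exp x"
    using exp_converges[of x] by (simp add: scaleR_conv_of_real field_simps)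
  then have "(\<Sum>i\<in>{n}. x ^ i / fact i) \<le> (\<Sum>i. x ^ i / fact i)"
    using assms by (intro sum_le_suminf) (auto simp: sums_iff)
  then show ?thesis using s by (simp add: sums_iff)
qed

text \<open>By induction on \<open>j\<close>: replacing one factor \<open>exp (- b t)\<close> by a Taylor polynomial leaves
  a combination of functions covered by the induction hypothesis.\<close>

lemma wapprox_power_exp:
  assumes b: "0 < b" "4 * b \<le> l"
  shows "wapprox l (\<lambda>t. t ^ k * exp (- (real j * b * t)))"
proof (induction j arbitrary: k)
  case 0
  show ?case by (rule wapprox_poly[of _ "monom 1 k"]) (simp add: poly_monom)
next
  case (Suc j)
  \<comment> \<open>This constant normalizes the power: t^k equals \<open>?C\<close> times (b t)^k /
    k!, a single term of the series of exp (b t).\<close>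
  let ?C = "fact k * (1 / b) ^ k"
  have Cpos: "?C > 0" using b by simp
  show ?case
  proof (rule wapprox_limit)
    fix e :: real assume e: "e > 0"
    obtain n where n: "(1/2::real) ^ n < e / ?C"
      using real_arch_pow_inv[of "e / ?C" "1/2"] e Cpos by auto
    let ?\<eta> = "\<lambda>t. \<Sum>i<n. ((- b) ^ i / fact i) * (t ^ (k + i) * exp (- (real j * b * t)))"
    have "wapprox l ?\<eta>"
      by (intro wapprox_sum wapprox_cmult Suc.IH)
    moreover have "\<bar>t ^ k * exp (- (real (Suc j) * b * t)) - ?\<eta> t\<bar> \<le> e * exp (l * t)" if t: "t \<ge> 0" for t
    proof -
      obtain s where s: "\<bar>s\<bar> \<le> \<bar>- (b * t)\<bar>"
        "exp (- (b * t)) = (\<Sum>m<n. (- (b * t)) ^ m / fact m) + exp s / fact n * (- (b * t)) ^ n"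
        using Maclaurin_exp_le[of "- (b * t)" n] by auto
      have 1: "?\<eta> t = t ^ k * exp (- (real j * b * t)) * (\<Sum>m<n. (- (b * t)) ^ m / fact m)"
      proof -
        have "(- (b * t)) ^ m = (- b) ^ m * t ^ m" for m
          by (metis mult_minus_left power_mult_distrib)
        then show ?thesis by (simp add: sum_distrib_left power_add algebra_simps)
      qed
      have 2: "exp (- (real (Suc j) * b * t)) = exp (- (real j * b * t)) * exp (- (b * t))"
        by (simp add: exp_add[symmetric] algebra_simps)
      have 3: "t ^ k * exp (- (real (Suc j) * b * t)) - ?\<eta> t
          = t ^ k * exp (- (real j * b * t)) * (exp s / fact n * (- (b * t)) ^ n)"
        unfolding 1 2 by (simp add: s(2) algebra_simps)
      have "\<bar>t ^ k * exp (- (real (Suc j) * b * t)) - ?\<eta> t\<bar>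
          = t ^ k * exp (- (real j * b * t)) * (exp s / fact n * (b * t) ^ n)"
        unfolding 3 using t b by (simp add: abs_mult power_abs)
      also have "\<dots> \<le> t ^ k * 1 * (exp (b * t) / fact n * (b * t) ^ n)"
        using t b s(1) by (intro mult_mono divide_right_mono) auto
      \<comment> \<open>The small factor (1/2)^n is bought by writing (b t)^n as (1/2)^n (2 b t)^n.
        The three exponential bounds that follow use up b t, b t and 2 b t, which is where the
        hypothesis \<open>4 * b \<le> l\<close> comes from.\<close>
      also have "\<dots> = ?C * ((b * t) ^ k / fact k) * exp (b * t) * ((1/2) ^ n * ((2 * (b * t)) ^ n / fact n))"
        using b by (simp add: field_simps power_mult_distrib)
      also have "\<dots> \<le> ?C * exp (b * t) * exp (b * t) * ((1/2) ^ n * exp (2 * (b * t)))"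
        using t b Cpos
        by (intro mult_mono power_div_fact_le_exp mult_nonneg_nonneg divide_nonneg_nonneg) auto
      also have "\<dots> = (?C * (1/2) ^ n) * exp (4 * b * t)"
        by (simp add: exp_add[symmetric] algebra_simps)
      also have "\<dots> \<le> e * exp (l * t)"
      proof (intro mult_mono)
        show "?C * (1/2) ^ n \<le> e" using n Cpos by (simp add: pos_less_divide_eq mult.commute less_imp_le)
        show "exp (4 * b * t) \<le> exp (l * t)" using t b by (auto intro: mult_right_mono)
      qed (use e in auto)
      finally show ?thesis .
    qed
    ultimately show "\<exists>\<eta>. wapprox l \<eta> \<and>
        (\<forall>t\<ge>0. \<bar>t ^ k * exp (- (real (Suc j) * b * t)) - \<eta> t\<bar> \<le> e * exp (l * t))"
      by blast
  qed
qed

lemma wapprox_exp: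
  assumes "0 < l" "0 \<le> a"
  shows "wapprox l (\<lambda>t. exp (- a * t))"
proof (cases "a = 0")
  case True
  then show ?thesis by (intro wapprox_poly[of _ 1]) simp
next
  case False
  \<comment> \<open>The exponent a is cut into j equal pieces a / j, each at most l / 4, as
    \<open>wapprox_power_exp\<close> demands.\<close>
  obtain j where j: "4 * a / l < real j" using reals_Archimedean2 by blast
  then have "j > 0" using assms False by (metis divide_nonneg_pos gr0I mult_nonneg_nonneg not_less of_nat_0 zero_le_numeral)
  have "wapprox l (\<lambda>t. t ^ 0 * exp (- (real j * (a / real j) * t)))"
    using assms False j \<open>j > 0\<close> by (intro wapprox_power_exp) (auto simp: field_simps)
  then show ?thesis using \<open>j > 0\<close> by simp
qed

text \<open>In the variable r = exp (- l t / 4), which stays in [0, 1], Weierstrass replaces \<psi>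
  by a polynomial; the powers of r are exponentials covered by \<open>wapprox_power_exp\<close> with
  k = 0 and with the largest admissible b.\<close>

lemma wapprox_continuous:
  assumes "0 < l" and \<psi>: "continuous_on {0..1} \<psi>"
  shows "wapprox l (\<lambda>t. \<psi> (exp (- (l / 4 * t))))"
proof (rule wapprox_limit)
  fix e :: real assume e: "e > 0"
  obtain g where g: "real_polynomial_function g" "\<And>x. x \<in> {0..1} \<Longrightarrow> \<bar>\<psi> x - g x\<bar> < e"
    using Stone_Weierstrass_real_polynomial_function[OF _ \<psi> e] by auto
  obtain a n where an: "g = (\<lambda>x. \<Sum>i\<le>n. a i * x ^ i)"
    using g(1) unfolding real_polynomial_function_iff_sum by blast
  have "wapprox l (\<lambda>t. \<Sum>i\<le>n. a i * (t ^ 0 * exp (- (real i * (l/4) * t))))"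
    using \<open>0 < l\<close> by (intro wapprox_sum wapprox_cmult wapprox_power_exp) auto
  then have "wapprox l (\<lambda>t. g (exp (- (l / 4 * t))))"
    unfolding an by (simp add: exp_of_nat_mult[symmetric] mult.assoc)
  moreover have "\<bar>\<psi> (exp (- (l / 4 * t))) - g (exp (- (l / 4 * t)))\<bar> \<le> e * exp (l * t)" if "t \<ge> 0" for t
  proof -
    have "\<bar>\<psi> (exp (- (l / 4 * t))) - g (exp (- (l / 4 * t)))\<bar> \<le> e"
      using g(2)[of "exp (- (l / 4 * t))"] that \<open>0 < l\<close> by auto
    also have "\<dots> \<le> e * exp (l * t)" using e that \<open>0 < l\<close> by simp
    finally show ?thesis .
  qed
  ultimately show "\<exists>\<eta>. wapprox l \<eta> \<and> (\<forall>t\<ge>0. \<bar>\<psi> (exp (- (l / 4 * t))) - \<eta> t\<bar> \<le> e * exp (l * t))"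
    by blast
qed

text \<open>The indicator function of \<open>[t, \<infinity>)\<close> is approximated by a ramp in the variable
  \<open>exp (- l s / 4)\<close>, which differs from it only on \<open>[t, t + d]\<close>.\<close>

lemma wapprox_ramp:
  assumes "0 < l" "0 \<le> t" "0 < d"
  obtains \<phi> where "wapprox l \<phi>" "continuous_on UNIV \<phi>" "\<And>s. 0 \<le> \<phi> s" "\<And>s. \<phi> s \<le> 1"
    "\<And>s. \<bar>indicator {t..} s - \<phi> s\<bar> \<le> indicator {t..t + d} s"
proof
  let ?a = "exp (- (l / 4 * t))" and ?b = "exp (- (l / 4 * (t + d)))"
  let ?\<psi> = "\<lambda>r. max 0 (min 1 ((?a - r) / (?a - ?b)))"
  have ab: "?b < ?a" using assms by simp
  show "wapprox l (\<lambda>s. ?\<psi> (exp (- (l / 4 * s))))"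
    using ab assms by (intro wapprox_continuous continuous_intros) auto
  show "continuous_on UNIV (\<lambda>s. ?\<psi> (exp (- (l / 4 * s))))"
    using ab by (intro continuous_intros) auto
  fix s :: real
  show "0 \<le> ?\<psi> (exp (- (l / 4 * s)))" "?\<psi> (exp (- (l / 4 * s))) \<le> 1" by auto
  have 1: "?\<psi> (exp (- (l / 4 * s))) = 0" if "s < t"
  proof -
    have "?a < exp (- (l / 4 * s))" using that assms by simp
    then have "(?a - exp (- (l / 4 * s))) / (?a - ?b) \<le> 0" using ab by (simp add: divide_nonpos_pos)
    then show ?thesis by simp
  qed
  have 2: "?\<psi> (exp (- (l / 4 * s))) = 1" if "t + d < s"
  proof -
    have "exp (- (l / 4 * s)) < ?b" using that assms by simp
    then have "(?a - exp (- (l / 4 * s))) / (?a - ?b) \<ge> 1" using ab by simp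
    then show ?thesis by simp
  qed
  show "\<bar>indicator {t..} s - ?\<psi> (exp (- (l / 4 * s)))\<bar> \<le> indicator {t..t + d} s"
    using 1 2 assms by (cases "s < t"; cases "t + d < s") (auto simp: indicator_def)
qed

section \<open>Occupation kernels\<close>

definition bmeas :: "('a::topological_space \<Rightarrow> real) set" where
  "bmeas = {f. f \<in> borel_measurable borel \<and> (\<exists>C. \<forall>x. \<bar>f x\<bar> \<le> C)}"

lemma bmeasI: "f \<in> borel_measurable borel \<Longrightarrow> (\<And>x. \<bar>f x\<bar> \<le> C) \<Longrightarrow> f \<in> bmeas"
  by (auto simp: bmeas_def)

lemma bmeasD: "f \<in> bmeas \<Longrightarrow> f \<in> borel_measurable borel"
  by (simp add: bmeas_def)

lemma bmeasE:
  assumes "f \<in> bmeas"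
  obtains C where "0 \<le> C" "\<And>x. \<bar>f x\<bar> \<le> C"
  using assms unfolding bmeas_def by (smt (verit) mem_Collect_eq)

lemma bmeas_add: "f \<in> bmeas \<Longrightarrow> g \<in> bmeas \<Longrightarrow> (\<lambda>x. f x + g x) \<in> bmeas"
proof -
  assume f: "f \<in> bmeas" and g: "g \<in> bmeas"
  obtain C where C: "\<And>x. \<bar>f x\<bar> \<le> C" by (rule bmeasE[OF f]) blast
  obtain D where D: "\<And>x. \<bar>g x\<bar> \<le> D" by (rule bmeasE[OF g]) blast
  have "\<bar>f x + g x\<bar> \<le> C + D" for x
    using abs_triangle_ineq[of "f x" "g x"] C[of x] D[of x] by linarith
  then show ?thesis using f g by (intro bmeasI[of _ "C + D"]) (auto dest!: bmeasD)
qed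

lemma bmeas_cmult: "f \<in> bmeas \<Longrightarrow> (\<lambda>x. c * f x) \<in> bmeas"
proof -
  assume f: "f \<in> bmeas"
  then obtain C where C: "0 \<le> C" "\<And>x. \<bar>f x\<bar> \<le> C" by (metis bmeasE)
  have "\<bar>c * f x\<bar> \<le> \<bar>c\<bar> * C" for x by (simp add: abs_mult mult_left_mono C)
  then show ?thesis using f by (intro bmeasI[of _ "\<bar>c\<bar> * C"]) (auto dest!: bmeasD)
qed

lemma bmeas_diff: "f \<in> bmeas \<Longrightarrow> g \<in> bmeas \<Longrightarrow> (\<lambda>x. f x - g x) \<in> bmeas"
  using bmeas_add[of f "\<lambda>x. (-1) * g x"] bmeas_cmult[of g "-1"] by simp

definition pot :: "('a \<Rightarrow> (real \<times> 'a) measure) \<Rightarrow> ('a \<Rightarrow> real) \<Rightarrow> 'a \<Rightarrow> real" where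
  "pot K f x = (\<integral>z. f (snd z) \<partial>K x)"

text \<open>Three weights matter: t^k / k! gives a power of the potential operator, exp (- \<alpha>
  t) the resolvent, and the indicator of [t, \<infinity>) the semigroup at time t applied to a
  potential.\<close>

definition wint ::
  "('a \<Rightarrow> (real \<times> 'a) measure) \<Rightarrow> (real \<Rightarrow> real) \<Rightarrow> ('a \<Rightarrow> real) \<Rightarrow> 'a \<Rightarrow> real" where
  "wint K \<phi> f x = (\<integral>z. \<phi> (fst z) * f (snd z) \<partial>K x)"

text \<open>\<open>K x\<close> stands for the occupation measure \<open>P\<^sub>t(x, dy) dt\<close> of a sub-Markov semigroup; the
  Markov property enters only through \<open>\<integral> t\<^sup>k (P\<^sub>t V f)(x) dt = \<integral> t\<^sup>k\<^sup>+\<^sup>1/(k+1) (P\<^sub>t f)(x) dt\<close>, where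
  \<open>V\<close> is the potential operator.\<close>

locale occupation =
  fixes K :: "'a::{metric_space, second_countable_topology} \<Rightarrow> (real \<times> 'a) measure" and N :: real
  assumes N_ge1: "1 \<le> N"
    and sets_K: "\<And>x. sets (K x) = sets borel"
    and time_nonneg: "\<And>x. AE z in K x. 0 \<le> fst z"
    and mass: "\<And>x. emeasure (K x) UNIV \<le> ennreal N"
    and slice: "\<And>x a b. a \<le> b \<Longrightarrow> emeasure (K x) ({a..b} \<times> UNIV) \<le> ennreal (b - a)"
    and measurable_pot_nn: "\<And>f. f \<in> borel_measurable borel \<Longrightarrow>
      (\<lambda>x. \<integral>\<^sup>+z. f (snd z) \<partial>K x) \<in> borel_measurable borel"
    and markov: "\<And>f k x. f \<in> borel_measurable borel \<Longrightarrow>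
      (\<integral>\<^sup>+z. ennreal (fst z ^ k) * (\<integral>\<^sup>+w. f (snd w) \<partial>K (snd z)) \<partial>K x) =
      (\<integral>\<^sup>+z. ennreal (fst z ^ Suc k / real (Suc k)) * f (snd z) \<partial>K x)"
begin

lemma space_K: "space (K x) = UNIV"
  using sets_eq_imp_space_eq[OF sets_K[of x]] by simp

lemma measurable_K_fst [measurable]: "fst \<in> borel_measurable (K x)"
  by (subst measurable_cong_sets[OF sets_K refl])
     (intro borel_measurable_continuous_onI continuous_on_fst continuous_on_id)

lemma measurable_K_snd [measurable]: "snd \<in> borel_measurable (K x)"
  by (subst measurable_cong_sets[OF sets_K refl])
     (intro borel_measurable_continuous_onI continuous_on_snd continuous_on_id)

lemma finite_K: "finite_measure (K x)"
  using mass[of x] by (intro finite_measureI) (auto simp: space_K top_unique)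

definition mom :: "nat \<Rightarrow> ('a \<Rightarrow> ennreal) \<Rightarrow> 'a \<Rightarrow> ennreal" where
  "mom k f x = (\<integral>\<^sup>+z. ennreal (fst z ^ k / fact k) * f (snd z) \<partial>K x)"

text \<open>This is the assumption \<open>markov\<close> divided by k!: raising the power of time by
  one amounts to inserting one more potential operator.\<close>

lemma mom_Suc:
  assumes [measurable]: "f \<in> borel_measurable borel"
  shows "mom (Suc k) f x = mom k (\<lambda>y. \<integral>\<^sup>+w. f (snd w) \<partial>K y) x"
proof -
  note [measurable] = measurable_pot_nn[OF assms]
  have "mom k (\<lambda>y. \<integral>\<^sup>+w. f (snd w) \<partial>K y) x
      = (\<integral>\<^sup>+z. ennreal (1 / fact k) * (ennreal (fst z ^ k) * (\<integral>\<^sup>+w. f (snd w) \<partial>K (snd z))) \<partial>K x)"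
    unfolding mom_def
    by (intro nn_integral_cong) (simp add: ennreal_mult'[symmetric] mult.assoc[symmetric])
  also have "\<dots> = ennreal (1 / fact k) *
      (\<integral>\<^sup>+z. ennreal (fst z ^ Suc k / real (Suc k)) * f (snd z) \<partial>K x)"
    by (subst nn_integral_cmult) (auto simp only: markov[OF assms], measurable)
  also have "\<dots> = (\<integral>\<^sup>+z. ennreal (1 / fact k) * (ennreal (fst z ^ Suc k / real (Suc k)) * f (snd z)) \<partial>K x)"
    by (subst nn_integral_cmult) (auto, measurable)
  also have "\<dots> = mom (Suc k) f x"
    unfolding mom_def
    by (intro nn_integral_cong) (simp add: ennreal_mult'[symmetric] mult.assoc[symmetric] mult.commute[of _ "fact k"])
  finally show ?thesis by simp
qed

lemma mom_const_le: "mom k (\<lambda>_. 1) x \<le> ennreal (N ^ Suc k)"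
proof (induction k)
  case 0
  show ?case using mass[of x] by (simp add: mom_def space_K)
next
  case (Suc k)
  have "mom (Suc k) (\<lambda>_. 1) x \<le> mom k (\<lambda>_. ennreal N) x"
    unfolding mom_Suc[OF borel_measurable_const] unfolding mom_def
    by (intro nn_integral_mono mult_left_mono) (simp_all add: space_K mass)
  also have "\<dots> = ennreal N * mom k (\<lambda>_. 1) x"
    unfolding mom_def by (simp add: nn_integral_cmult[symmetric] mult.commute)
  also have "\<dots> \<le> ennreal N * ennreal (N ^ Suc k)"
    by (intro mult_left_mono Suc.IH) simp
  finally show ?case using N_ge1 by (simp add: ennreal_mult[symmetric])
qed

text \<open>The k-th normalized moment is at most N^(k+1), so the exponential moment with this rate
  is dominated by a geometric series of ratio 1/2 with sum 2 N.\<close>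

definition rate :: real where "rate = 1 / (2 * N)"

lemma rate_pos: "0 < rate"
  using N_ge1 by (simp add: rate_def)

lemma exp_moment: "(\<integral>\<^sup>+z. ennreal (exp (rate * fst z)) \<partial>K x) \<le> ennreal (2 * N)"
proof -
  have "(\<integral>\<^sup>+z. ennreal (exp (rate * fst z)) \<partial>K x)
      = (\<integral>\<^sup>+z. (\<Sum>k. ennreal (rate ^ k) * (ennreal (fst z ^ k / fact k) * 1)) \<partial>K x)"
  proof (rule nn_integral_cong_AE, use time_nonneg[of x] in eventually_elim)
    fix z :: "real \<times> 'a" assume z: "0 \<le> fst z"
    have s: "(\<lambda>n. (rate * fst z) ^ n / fact n) sums exp (rate * fst z)"
      using exp_converges[of "rate * fst z"] by (simp add: scaleR_conv_of_real field_simps)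
    have "(\<Sum>k. ennreal ((rate * fst z) ^ k / fact k)) = ennreal (exp (rate * fst z))"
      using s z rate_pos by (subst suminf_ennreal2) (auto simp: sums_iff)
    then show "ennreal (exp (rate * fst z))
        = (\<Sum>k. ennreal (rate ^ k) * (ennreal (fst z ^ k / fact k) * 1))"
      using z rate_pos by (simp add: ennreal_mult[symmetric] power_mult_distrib)
  qed
  also have "\<dots> = (\<Sum>k. ennreal (rate ^ k) * mom k (\<lambda>_. 1) x)"
    unfolding mom_def by (simp add: nn_integral_suminf nn_integral_cmult)
  also have "\<dots> \<le> (\<Sum>k. ennreal (rate ^ k) * ennreal (N ^ Suc k))"
    by (intro suminf_le mult_left_mono mom_const_le) auto
  also have "\<dots> = (\<Sum>k. ennreal (N * (1/2) ^ k))"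
  proof (intro suminf_cong)
    fix k
    have "rate ^ k * N ^ Suc k = N * (rate * N) ^ k" by (simp add: power_mult_distrib)
    also have "rate * N = 1/2" using N_ge1 by (simp add: rate_def)
    finally show "ennreal (rate ^ k) * ennreal (N ^ Suc k) = ennreal (N * (1/2) ^ k)"
      using rate_pos N_ge1 by (subst ennreal_mult[symmetric]) auto
  qed
  also have "\<dots> = ennreal (\<Sum>k. N * (1/2) ^ k)"
    using N_ge1 by (intro suminf_ennreal2) (auto intro!: summable_mult summable_geometric)
  also have "(\<Sum>k. N * (1/2) ^ k) = 2 * N"
    using sums_mult[OF geometric_sums[of "1/2::real"], of N] by (simp add: sums_iff)
  finally show ?thesis .
qed

lemma integrable_exp: "integrable (K x) (\<lambda>z. exp (rate * fst z))"
  using exp_moment[of x] by (intro integrableI_bounded) (auto simp: le_less_trans)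

lemma integral_exp_le: "(\<integral>z. exp (rate * fst z) \<partial>K x) \<le> 2 * N"
  using exp_moment[of x] N_ge1
  by (subst integral_eq_nn_integral) (auto intro!: enn2real_leI)

lemma
  assumes [measurable]: "\<phi> \<in> borel_measurable borel"
    and \<phi>: "\<And>t. 0 \<le> t \<Longrightarrow> \<bar>\<phi> t\<bar> \<le> c * exp (rate * t)"
    and f: "f \<in> borel_measurable borel" "\<And>y. \<bar>f y\<bar> \<le> C"
  shows integrable_weight: "integrable (K x) (\<lambda>z. \<phi> (fst z) * f (snd z))"
    and wint_bound: "\<bar>wint K \<phi> f x\<bar> \<le> c * C * (2 * N)"
proof -
  note [measurable] = f(1)
  have "0 \<le> C" using f(2) by (meson abs_ge_zero order_trans)
  moreover have "0 \<le> c" using \<phi>[of 0] by (simp add: order_trans[OF abs_ge_zero])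
  ultimately have nn: "0 \<le> C" "0 \<le> c" by auto
  have b: "AE z in K x. \<bar>\<phi> (fst z) * f (snd z)\<bar> \<le> c * C * exp (rate * fst z)"
    using time_nonneg[of x]
  proof eventually_elim
    fix z :: "real \<times> 'a" assume "0 \<le> fst z"
    then have "\<bar>\<phi> (fst z)\<bar> * \<bar>f (snd z)\<bar> \<le> (c * exp (rate * fst z)) * C"
      using \<phi>[of "fst z"] f(2)[of "snd z"] nn by (intro mult_mono) auto
    then show "\<bar>\<phi> (fst z) * f (snd z)\<bar> \<le> c * C * exp (rate * fst z)"
      by (simp add: abs_mult algebra_simps)
  qed
  show i: "integrable (K x) (\<lambda>z. \<phi> (fst z) * f (snd z))"
    by (rule Bochner_Integration.integrable_bound[OF integrable_mult_right[where c = "c * C", OF integrable_exp]])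
       (use b in \<open>auto elim!: eventually_mono\<close>)
  have "\<bar>wint K \<phi> f x\<bar> \<le> (\<integral>z. \<bar>\<phi> (fst z) * f (snd z)\<bar> \<partial>K x)"
    unfolding wint_def by (rule integral_abs_bound)
  also have "\<dots> \<le> (\<integral>z. c * C * exp (rate * fst z) \<partial>K x)"
    using b by (intro integral_mono_AE integrable_abs i integrable_mult_right integrable_exp) auto
  also have "\<dots> = c * C * (\<integral>z. exp (rate * fst z) \<partial>K x)" by simp
  also have "\<dots> \<le> c * C * (2 * N)"
    by (intro mult_left_mono integral_exp_le mult_nonneg_nonneg nn)
  finally show "\<bar>wint K \<phi> f x\<bar> \<le> c * C * (2 * N)" .
qed

lemma poly_growth: "\<exists>c. \<forall>t\<ge>0. \<bar>poly q t\<bar> \<le> c * exp (rate * t)"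
proof (intro exI allI impI)
  fix t :: real assume t: "t \<ge> 0"
  have 1: "t ^ i \<le> fact i / rate ^ i * exp (rate * t)" for i
    using power_div_fact_le_exp[of "rate * t" i] t rate_pos
    by (simp add: power_mult_distrib field_simps)
  have "\<bar>poly q t\<bar> \<le> (\<Sum>i\<le>degree q. \<bar>coeff q i\<bar> * t ^ i)"
    unfolding poly_altdef using t by (intro sum_abs[THEN order_trans]) (simp add: abs_mult)
  also have "\<dots> \<le> (\<Sum>i\<le>degree q. \<bar>coeff q i\<bar> * (fact i / rate ^ i * exp (rate * t)))"
    by (intro sum_mono mult_left_mono 1) simp
  also have "\<dots> = (\<Sum>i\<le>degree q. \<bar>coeff q i\<bar> * fact i / rate ^ i) * exp (rate * t)"
    by (simp add: sum_distrib_right sum_distrib_left mult_ac)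
  finally show "\<bar>poly q t\<bar> \<le> (\<Sum>i\<le>degree q. \<bar>coeff q i\<bar> * fact i / rate ^ i) * exp (rate * t)" .
qed

lemma measurable_poly [measurable]: "(poly q :: real \<Rightarrow> real) \<in> borel_measurable borel"
  by (intro borel_measurable_continuous_onI continuous_on_poly continuous_on_id)

lemma integrable_poly:
  assumes "f \<in> bmeas"
  shows "integrable (K x) (\<lambda>z. poly q (fst z) * f (snd z))"
proof -
  obtain c where "\<And>t. t \<ge> 0 \<Longrightarrow> \<bar>poly q t\<bar> \<le> c * exp (rate * t)" using poly_growth by blast
  moreover obtain C where "\<And>y. \<bar>f y\<bar> \<le> C" using assms by (metis bmeasE)
  ultimately show ?thesis
    by (intro integrable_weight[OF measurable_poly _ bmeasD[OF assms]])
qed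

lemma integrable_pot: "f \<in> bmeas \<Longrightarrow> integrable (K x) (\<lambda>z. f (snd z))"
  using integrable_poly[of f x 1] by simp

lemma pot_add: "f \<in> bmeas \<Longrightarrow> g \<in> bmeas \<Longrightarrow> pot K (\<lambda>y. f y + g y) x = pot K f x + pot K g x"
  unfolding pot_def by (intro Bochner_Integration.integral_add integrable_pot)

lemma pot_diff: "f \<in> bmeas \<Longrightarrow> g \<in> bmeas \<Longrightarrow> pot K (\<lambda>y. f y - g y) x = pot K f x - pot K g x"
  unfolding pot_def by (intro Bochner_Integration.integral_diff integrable_pot)

lemma pot_cmult: "pot K (\<lambda>y. c * f y) x = c * pot K f x"
  unfolding pot_def by simp

lemma pot_bound:
  assumes f: "f \<in> borel_measurable borel" "\<And>y. \<bar>f y\<bar> \<le> C"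
  shows "\<bar>pot K f x\<bar> \<le> C * N"
proof -
  interpret finite_measure "K x" by (rule finite_K)
  have "f \<in> bmeas" using f by (rule bmeasI)
  have "0 \<le> C" using f(2) by (meson abs_ge_zero order_trans)
  have "\<bar>pot K f x\<bar> \<le> (\<integral>z. \<bar>f (snd z)\<bar> \<partial>K x)"
    unfolding pot_def by (rule integral_abs_bound)
  also have "\<dots> \<le> (\<integral>z. C \<partial>K x)"
    by (intro integral_mono integrable_abs integrable_pot \<open>f \<in> bmeas\<close> integrable_const f)
  also have "\<dots> = C * measure (K x) UNIV" by (simp add: space_K)
  also have "\<dots> \<le> C * N"
    using mass[of x] N_ge1 \<open>0 \<le> C\<close> unfolding measure_def by (intro mult_left_mono enn2real_leI) auto
  finally show ?thesis .
qed

lemma ennreal_pot: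
  assumes "f \<in> bmeas" "\<And>y. 0 \<le> f y"
  shows "ennreal (pot K f x) = (\<integral>\<^sup>+z. ennreal (f (snd z)) \<partial>K x)"
  unfolding pot_def using assms by (intro nn_integral_eq_integral[symmetric] integrable_pot) auto

lemma pot_nonneg: "(\<And>y. 0 \<le> f y) \<Longrightarrow> 0 \<le> pot K f x"
  unfolding pot_def by (intro integral_nonneg_AE) auto

text \<open>The Markov property is available for nonnegative integrals only; this decomposition
  carries its consequences over to bounded functions of either sign.\<close>

lemma pos_neg_parts:
  assumes f: "f \<in> bmeas"
  obtains g h where "g \<in> bmeas" "h \<in> bmeas" "\<And>y. 0 \<le> g y" "\<And>y. 0 \<le> h y" "f = (\<lambda>y. g y - h y)"
proof
  note [measurable] = bmeasD[OF f]
  obtain C where C: "0 \<le> C" "\<And>y. \<bar>f y\<bar> \<le> C" by (rule bmeasE[OF f]) blast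
  have "\<bar>max 0 (f y)\<bar> \<le> C" "\<bar>max 0 (- f y)\<bar> \<le> C" for y using C(1) C(2)[of y] by auto
  then show "(\<lambda>y. max 0 (f y)) \<in> bmeas" "(\<lambda>y. max 0 (- f y)) \<in> bmeas"
    by (auto intro!: bmeasI[of _ C])
  show "f = (\<lambda>y. max 0 (f y) - max 0 (- f y))" by (auto simp: max_def)
qed auto

lemma pot_bmeas:
  assumes f: "f \<in> bmeas"
  shows "pot K f \<in> bmeas"
proof -
  have nn: "pot K g \<in> borel_measurable borel" if g: "g \<in> bmeas" "\<And>y. 0 \<le> g y" for g
  proof -
    have "pot K g = (\<lambda>x. enn2real (\<integral>\<^sup>+z. ennreal (g (snd z)) \<partial>K x))"
      by (intro ext) (simp add: ennreal_pot[OF g, symmetric] pot_nonneg[OF g(2)])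
    then show ?thesis
      using measurable_pot_nn[of "\<lambda>y. ennreal (g y)"] bmeasD[OF g(1)] by simp
  qed
  obtain g h where gh: "g \<in> bmeas" "h \<in> bmeas" "\<And>y. 0 \<le> g y" "\<And>y. 0 \<le> h y" "f = (\<lambda>y. g y - h y)"
    by (rule pos_neg_parts[OF f]) blast
  have "pot K f = (\<lambda>x. pot K g x - pot K h x)"
    unfolding gh(5) using pot_diff[OF gh(1,2)] by auto
  then have "pot K f \<in> borel_measurable borel" using nn gh by auto
  moreover obtain C where "\<And>y. \<bar>f y\<bar> \<le> C" using f by (metis bmeasE)
  ultimately show ?thesis using pot_bound bmeasD[OF f] by (intro bmeasI[of _ "C * N"]) auto
qed

lemma wint_poly_add:
  "f \<in> bmeas \<Longrightarrow> g \<in> bmeas \<Longrightarrow> wint K (poly q) (\<lambda>y. f y - g y) x = wint K (poly q) f x - wint K (poly q) g x"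
  unfolding wint_def
  by (subst Bochner_Integration.integral_diff[symmetric]) (auto intro!: integrable_poly simp: right_diff_distrib)

lemma wint_monom_Suc:
  assumes f: "f \<in> bmeas"
  shows "wint K (poly (monom (1 / fact k) k)) (pot K f) x
       = wint K (poly (monom (1 / fact (Suc k)) (Suc k))) f x"
proof -
  have nn: "wint K (poly (monom (1 / fact k) k)) g x = enn2real (mom k (\<lambda>y. ennreal (g y)) x)"
    if g: "g \<in> bmeas" "\<And>y. 0 \<le> g y" for g k
  proof -
    have "wint K (poly (monom (1 / fact k) k)) g x
        = enn2real (\<integral>\<^sup>+z. ennreal (poly (monom (1 / fact k) k) (fst z) * g (snd z)) \<partial>K x)"
      unfolding wint_def using time_nonneg[of x] g
      by (intro integral_eq_nn_integral borel_measurable_integrable[OF integrable_poly])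
         (auto elim!: eventually_mono simp: poly_monom)
    also have "(\<integral>\<^sup>+z. ennreal (poly (monom (1 / fact k) k) (fst z) * g (snd z)) \<partial>K x)
        = mom k (\<lambda>y. ennreal (g y)) x"
      unfolding mom_def using time_nonneg[of x] g(2)
      by (intro nn_integral_cong_AE) (auto elim!: eventually_mono simp: poly_monom ennreal_mult[symmetric])
    finally show ?thesis .
  qed
  have *: "wint K (poly (monom (1 / fact k) k)) (pot K g) x
       = wint K (poly (monom (1 / fact (Suc k)) (Suc k))) g x" if g: "g \<in> bmeas" "\<And>y. 0 \<le> g y" for g
    unfolding nn[OF g] nn[OF pot_bmeas[OF g(1)] pot_nonneg[OF g(2)]]
    using bmeasD[OF g(1)] by (subst mom_Suc) (auto simp: ennreal_pot[OF g])
  obtain g h where gh: "g \<in> bmeas" "h \<in> bmeas" "\<And>y. 0 \<le> g y" "\<And>y. 0 \<le> h y" "f = (\<lambda>y. g y - h y)"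
    by (rule pos_neg_parts[OF f]) blast
  have "pot K f = (\<lambda>x. pot K g x - pot K h x)"
    unfolding gh(5) using pot_diff[OF gh(1,2)] by auto
  then have "wint K (poly (monom (1 / fact k) k)) (pot K f) x
      = wint K (poly (monom (1 / fact k) k)) (pot K g) x - wint K (poly (monom (1 / fact k) k)) (pot K h) x"
    using wint_poly_add[OF pot_bmeas pot_bmeas, OF gh(1,2)] by simp
  also have "\<dots> = wint K (poly (monom (1 / fact (Suc k)) (Suc k))) f x"
    unfolding *[OF gh(1,3)] *[OF gh(2,4)] gh(5) using gh by (subst wint_poly_add) auto
  finally show ?thesis .
qed

lemma wint_monom: "f \<in> bmeas \<Longrightarrow> wint K (poly (monom (1 / fact k) k)) f x = (pot K ^^ Suc k) f x"
proof (induction k arbitrary: f)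
  case 0
  then show ?case by (simp add: wint_def pot_def)
next
  case (Suc k)
  then have "wint K (poly (monom (1 / fact (Suc k)) (Suc k))) f x = (pot K ^^ Suc k) (pot K f) x"
    by (simp only: wint_monom_Suc[symmetric] Suc.IH pot_bmeas)
  then show ?case by (simp add: funpow_swap1)
qed

lemma wint_poly:
  assumes f: "f \<in> bmeas"
  shows "wint K (poly q) f x = (\<Sum>k\<le>degree q. coeff q k * fact k * (pot K ^^ Suc k) f x)"
proof -
  have "wint K (poly q) f x
      = (\<integral>z. (\<Sum>k\<le>degree q. coeff q k * fact k * (poly (monom (1 / fact k) k) (fst z) * f (snd z))) \<partial>K x)"
    unfolding wint_def by (simp add: poly_altdef[of q] poly_monom sum_distrib_right mult.assoc)
  also have "\<dots> = (\<Sum>k\<le>degree q. coeff q k * fact k * wint K (poly (monom (1 / fact k) k)) f x)"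
    unfolding wint_def
    by (subst Bochner_Integration.integral_sum) (auto intro!: integrable_mult_right integrable_poly f)
  finally show ?thesis using wint_monom[OF f] by simp
qed

lemma funpow_pot_bmeas: "f \<in> bmeas \<Longrightarrow> (pot K ^^ k) f \<in> bmeas"
  by (induction k) (auto intro: pot_bmeas)

text \<open>Each application of the potential operator costs at most a factor \<open>N\<close> in
  the sup norm.\<close>

lemma funpow_pot_diff_bound:
  assumes "f \<in> bmeas" "g \<in> bmeas" "\<And>y. \<bar>f y - g y\<bar> \<le> e"
  shows "\<bar>(pot K ^^ k) f x - (pot K ^^ k) g x\<bar> \<le> e * N ^ k"
  using assms
proof (induction k arbitrary: x)
  case (Suc k)
  note fg = funpow_pot_bmeas[OF Suc.prems(1), of k] funpow_pot_bmeas[OF Suc.prems(2), of k]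
  have "\<bar>pot K (\<lambda>y. (pot K ^^ k) f y - (pot K ^^ k) g y) x\<bar> \<le> e * N ^ k * N"
    using Suc fg by (intro pot_bound bmeasD[OF bmeas_diff]) auto
  then show ?case using fg by (simp add: pot_diff mult.commute mult.left_commute)
qed simp

end

lemma uniform_limit_sum_cmult:
  fixes f :: "'i \<Rightarrow> nat \<Rightarrow> 'b \<Rightarrow> real"
  assumes "finite I" "\<And>i. i \<in> I \<Longrightarrow> uniform_limit S (f i) (g i) sequentially"
  shows "uniform_limit S (\<lambda>n x. \<Sum>i\<in>I. c i * f i n x) (\<lambda>x. \<Sum>i\<in>I. c i * g i x) sequentially"
  using assms
proof (induction I rule: finite_induct)
  case (insert i I)
  then show ?case
    by (auto intro!: uniform_limit_add bounded_linear.uniform_limit[OF bounded_linear_mult_right])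
qed (simp add: uniform_limit_const)

text \<open>Tolerances below are divided by C + 1 instead of the bound C, which may be 0; this
  absorbs the resulting quotient.\<close>

lemma mult_div_Suc_le: "0 \<le> (C::real) \<Longrightarrow> 0 \<le> e \<Longrightarrow> e * (C / (C + 1)) \<le> e"
  by (simp add: field_simps)

lemma (in occupation) pot_sum:
  "(\<And>i. i \<in> I \<Longrightarrow> f i \<in> bmeas) \<Longrightarrow> pot K (\<lambda>y. \<Sum>i\<in>I. f i y) x = (\<Sum>i\<in>I. pot K (f i) x)"
  unfolding pot_def by (intro Bochner_Integration.integral_sum integrable_pot)

lemma (in occupation) wint_diff_bound:
  assumes \<phi>: "wapprox rate \<phi>" "\<phi> \<in> borel_measurable borel"
    and q: "\<And>t. 0 \<le> t \<Longrightarrow> \<bar>\<phi> t - poly q t\<bar> \<le> e * exp (rate * t)"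
    and f: "f \<in> borel_measurable borel" "\<And>y. \<bar>f y\<bar> \<le> C"
  shows "\<bar>wint K \<phi> f x - wint K (poly q) f x\<bar> \<le> e * C * (2 * N)"
    and "integrable (K x) (\<lambda>z. \<phi> (fst z) * f (snd z))"
proof -
  note [measurable] = \<phi>(2)
  have fb: "f \<in> bmeas" using f by (rule bmeasI)
  have 1: "integrable (K x) (\<lambda>z. (\<phi> (fst z) - poly q (fst z)) * f (snd z))"
    using integrable_weight[of "\<lambda>t. \<phi> t - poly q t" e f C x] q f by auto
  have 2: "integrable (K x) (\<lambda>z. (\<phi> (fst z) - poly q (fst z)) * f (snd z) + poly q (fst z) * f (snd z))"
    by (intro Bochner_Integration.integrable_add 1 integrable_poly fb)
  then show 3: "integrable (K x) (\<lambda>z. \<phi> (fst z) * f (snd z))"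
    by (simp add: algebra_simps)
  have "wint K \<phi> f x - wint K (poly q) f x = wint K (\<lambda>t. \<phi> t - poly q t) f x"
    unfolding wint_def left_diff_distrib
    by (intro Bochner_Integration.integral_diff[symmetric] 3 integrable_poly fb)
  also have "\<bar>\<dots>\<bar> \<le> e * C * (2 * N)"
    using wint_bound[of "\<lambda>t. \<phi> t - poly q t" e f C x] q f by auto
  finally show "\<bar>wint K \<phi> f x - wint K (poly q) f x\<bar> \<le> e * C * (2 * N)" .
qed

text \<open>A slab of d units of time carries mass at most d whatever the starting point. This makes
  a discontinuity of the weight harmless, although the polynomials approximate only continuous
  weights.\<close>

lemma (in occupation) wint_slice_bound:
  assumes [measurable]: "\<phi> \<in> borel_measurable borel"
    and "0 \<le> d" "\<And>s. \<bar>\<phi> s\<bar> \<le> indicator {t..t + d} s"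
    and f: "f \<in> borel_measurable borel" "\<And>y. \<bar>f y\<bar> \<le> C"
  shows "\<bar>wint K \<phi> f x\<bar> \<le> d * C"
proof -
  interpret finite_measure "K x" by (rule finite_K)
  note [measurable] = f(1)
  have "0 \<le> C" using f(2) by (meson abs_ge_zero order_trans)
  have b: "\<bar>\<phi> (fst z) * f (snd z)\<bar> \<le> C * indicator ({t..t + d} \<times> UNIV) z" for z
  proof -
    have "\<bar>\<phi> (fst z)\<bar> * \<bar>f (snd z)\<bar> \<le> indicator {t..t + d} (fst z) * C"
      using assms(3) f(2) by (intro mult_mono) auto
    then show ?thesis by (auto simp: abs_mult indicator_def mem_Times_iff)
  qed
  have s: "{t..t + d} \<times> UNIV \<in> sets (K x)"
    unfolding sets_K by (intro borel_closed closed_Times) auto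
  have i: "integrable (K x) (\<lambda>z. C * indicator ({t..t + d} \<times> UNIV) z)"
    using s by (intro integrable_mult_right integrable_real_indicator) (auto simp: emeasure_eq_measure)
  have "\<bar>wint K \<phi> f x\<bar> \<le> (\<integral>z. \<bar>\<phi> (fst z) * f (snd z)\<bar> \<partial>K x)"
    unfolding wint_def by (rule integral_abs_bound)
  also have "\<dots> \<le> (\<integral>z. C * indicator ({t..t + d} \<times> UNIV) z \<partial>K x)"
    using b \<open>0 \<le> C\<close> by (intro integral_mono' i) auto
  also have "\<dots> = C * measure (K x) ({t..t + d} \<times> UNIV)" using s by (simp add: space_K)
  also have "\<dots> \<le> C * d"
    using slice[of t "t + d" x] \<open>0 \<le> C\<close> \<open>0 \<le> d\<close> unfolding measure_def
    by (intro mult_left_mono enn2real_leI) auto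
  finally show ?thesis by (simp add: mult.commute)
qed

lemma (in occupation) integrable_bounded_weight:
  assumes "\<phi> \<in> borel_measurable borel" "\<And>s. \<bar>\<phi> s\<bar> \<le> 1" "f \<in> bmeas"
  shows "integrable (K x) (\<lambda>z. \<phi> (fst z) * f (snd z))"
proof -
  obtain C where C: "\<And>y. \<bar>f y\<bar> \<le> C" by (rule bmeasE[OF assms(3)]) blast
  have "\<bar>\<phi> t\<bar> \<le> 1 * exp (rate * t)" if "0 \<le> t" for t
    using assms(2)[of t] that rate_pos by (smt (verit) mult_nonneg_nonneg one_le_exp_iff)
  then show ?thesis
    using C by (intro integrable_weight[where c = 1, OF assms(1) _ bmeasD[OF assms(3)]]) auto
qed

text \<open>The two steps differ on a slab of length t - s. The Lipschitz constant C depends neither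
  on the kernel nor on the point, so convergence on a finite grid of times will imply convergence
  uniform on compact time intervals.\<close>

lemma (in occupation) wint_step_lipschitz:
  assumes f: "f \<in> bmeas" "\<And>y. \<bar>f y\<bar> \<le> C" and "s \<le> t"
  shows "\<bar>wint K (indicator {s..}) f x - wint K (indicator {t..}) f x\<bar> \<le> (t - s) * C"
proof -
  have "wint K (indicator {s..}) f x - wint K (indicator {t..}) f x
      = wint K (\<lambda>r. indicator {s..} r - indicator {t..} r) f x"
    unfolding wint_def left_diff_distrib
    by (intro Bochner_Integration.integral_diff[symmetric] integrable_bounded_weight f)
       (auto simp: indicator_def)
  also have "\<bar>\<dots>\<bar> \<le> (t - s) * C"
    using \<open>s \<le> t\<close> f bmeasD[OF f(1)] by (intro wint_slice_bound[of _ _ s]) (auto simp: indicator_def)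
  finally show ?thesis .
qed

text \<open>The weight exp (t / 2N) and its integral bound 2 N involve the kernel only through
  \<open>N\<close>, so one polynomial works for all kernels with this \<open>N\<close>, all points
  and all functions bounded by C. It is therefore fixed before n tends to infinity.\<close>

lemma step_approx:
  assumes N: "1 \<le> N" and t: "0 \<le> t" and e: "0 < e" and C: "0 \<le> C"
  obtains q where "\<And>(K :: 'a::{metric_space, second_countable_topology} \<Rightarrow> (real \<times> 'a) measure) f x.
    occupation K N \<Longrightarrow> f \<in> borel_measurable borel \<Longrightarrow> (\<And>y. \<bar>f y\<bar> \<le> C) \<Longrightarrow>
    \<bar>wint K (indicator {t..}) f x - wint K (poly q) f x\<bar> \<le> e"
proof -
  let ?l = "1 / (2 * N)"
  \<comment> \<open>Each of the two errors gets e / 2: the ramp differs from the step on a slab of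
    mass at most d, and the polynomial from the ramp by e' in the weighted norm, whose integral is
    at most 2 N.\<close>
  define d where "d = e / (2 * (C + 1))"
  define e' where "e' = e / (4 * N * (C + 1))"
  have l: "0 < ?l" and d: "0 < d" and e': "0 < e'" using N e C by (auto simp: d_def e'_def)
  obtain \<phi> where \<phi>: "wapprox ?l \<phi>" "continuous_on UNIV \<phi>" "\<And>s. 0 \<le> \<phi> s" "\<And>s. \<phi> s \<le> 1"
    "\<And>s. \<bar>indicator {t..} s - \<phi> s\<bar> \<le> indicator {t..t + d} s"
    by (rule wapprox_ramp[OF l t d]) blast
  obtain q where q: "\<And>t. 0 \<le> t \<Longrightarrow> \<bar>\<phi> t - poly q t\<bar> \<le> e' * exp (?l * t)"
    using \<phi>(1) e' unfolding wapprox_def by meson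
  note [measurable] = borel_measurable_continuous_onI[OF \<phi>(2)]
  show thesis
  proof (rule that[of q])
    fix K :: "'a \<Rightarrow> (real \<times> 'a) measure" and f :: "'a \<Rightarrow> real" and x
    assume K: "occupation K N" and f: "f \<in> borel_measurable borel" "\<And>y. \<bar>f y\<bar> \<le> C"
    interpret occupation K N by fact
    have fb: "f \<in> bmeas" using f by (rule bmeasI)
    have "\<bar>wint K \<phi> f x - wint K (poly q) f x\<bar> \<le> e' * C * (2 * N)"
      using \<phi>(1) q f by (intro wint_diff_bound) (auto simp: rate_def)
    also have "\<dots> = e / 2 * (C / (C + 1))" using N C by (simp add: e'_def divide_simps)
    also have "\<dots> \<le> e / 2" using C e by (intro mult_div_Suc_le) auto
    finally have 1: "\<bar>wint K \<phi> f x - wint K (poly q) f x\<bar> \<le> e / 2" .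
    have "wint K (indicator {t..}) f x - wint K \<phi> f x = wint K (\<lambda>s. indicator {t..} s - \<phi> s) f x"
      unfolding wint_def left_diff_distrib
      by (intro Bochner_Integration.integral_diff[symmetric] integrable_bounded_weight fb)
         (auto simp: indicator_def \<phi>)
    also have "\<bar>\<dots>\<bar> \<le> d * C"
      using \<phi>(5) f d by (intro wint_slice_bound) auto
    also have "\<dots> = e / 2 * (C / (C + 1))" by (simp add: d_def)
    also have "\<dots> \<le> e / 2" using C e by (intro mult_div_Suc_le) auto
    finally show "\<bar>wint K (indicator {t..}) f x - wint K (poly q) f x\<bar> \<le> e" using 1 by linarith
  qed
qed

text \<open>Two instances of \<open>H\<close> occur: \<open>C0\<close>, for convergence and density,
  and \<open>bmeas\<close>, to see that weighted integrals of merely measurable functions are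
  continuous.\<close>

locale potential_space = occupation +
  fixes H :: "('a::{metric_space, second_countable_topology} \<Rightarrow> real) set"
  assumes H_bmeas: "H \<subseteq> bmeas"
    and H_pot: "f \<in> H \<Longrightarrow> pot K f \<in> H"
    and H_add: "f \<in> H \<Longrightarrow> g \<in> H \<Longrightarrow> (\<lambda>x. f x + g x) \<in> H"
    and H_cmult: "f \<in> H \<Longrightarrow> (\<lambda>x. c * f x) \<in> H"
begin

lemma H_funpow: "f \<in> H \<Longrightarrow> (pot K ^^ k) f \<in> H"
  by (induction k) (auto intro: H_pot)

lemma H_sum:
  assumes "\<And>i. i \<in> I \<Longrightarrow> f i \<in> H" "finite I" "I \<noteq> {}"
  shows "(\<lambda>x. \<Sum>i\<in>I. f i x) \<in> H"
  using assms(2,3,1) by (induction I rule: finite_ne_induct) (auto intro: H_add)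

text \<open>In the expansion by \<open>wint_poly\<close> every term contains at least one potential
  operator; pulling out the outermost one leaves a combination of powers applied to f, which stays
  in \<open>H\<close>.\<close>

lemma wint_poly_potential:
  assumes "f \<in> H"
  obtains g where "g \<in> H" "\<And>x. wint K (poly q) f x = pot K g x"
proof
  let ?g = "\<lambda>k x. coeff q k * fact k * (pot K ^^ k) f x"
  let ?I = "{..degree q}"
  have f: "f \<in> bmeas" using assms H_bmeas by auto
  show "(\<lambda>x. \<Sum>k\<in>?I. ?g k x) \<in> H" by (intro H_sum H_cmult H_funpow assms) auto
  show "wint K (poly q) f x = pot K (\<lambda>x. \<Sum>k\<in>?I. ?g k x) x" for x
    unfolding wint_poly[OF f]
    by (subst pot_sum) (auto intro!: bmeas_cmult funpow_pot_bmeas f simp: pot_cmult)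
qed

text \<open>This places the resolvent of every order a in the closure of the potentials, also for
  large a, where its Neumann series in the potential operator need not converge.\<close>

lemma wint_exp_closure:
  assumes f: "f \<in> H" and "0 \<le> a" "0 < e"
  obtains g where "g \<in> H" "\<And>x. \<bar>wint K (\<lambda>t. exp (- a * t)) f x - pot K g x\<bar> \<le> e"
proof -
  have fb: "f \<in> bmeas" using f H_bmeas by auto
  obtain C where C: "0 \<le> C" "\<And>y. \<bar>f y\<bar> \<le> C" by (rule bmeasE[OF fb]) blast
  define e' where "e' = e / (2 * N * (C + 1))"
  have e': "0 < e'" using C N_ge1 \<open>0 < e\<close> by (simp add: e'_def)
  have w: "wapprox rate (\<lambda>t. exp (- a * t))" by (rule wapprox_exp[OF rate_pos \<open>0 \<le> a\<close>])
  then obtain q where q: "\<And>t. 0 \<le> t \<Longrightarrow> \<bar>exp (- a * t) - poly q t\<bar> \<le> e' * exp (rate * t)"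
    using e' unfolding wapprox_def by meson
  obtain g where g: "g \<in> H" "\<And>x. wint K (poly q) f x = pot K g x"
    by (rule wint_poly_potential[OF f]) blast
  show thesis
  proof (rule that[OF g(1)])
    fix x
    have "\<bar>wint K (\<lambda>t. exp (- a * t)) f x - wint K (poly q) f x\<bar> \<le> e' * C * (2 * N)"
      using w q C bmeasD[OF fb] by (intro wint_diff_bound) auto
    also have "\<dots> = e * (C / (C + 1))" using N_ge1 by (simp add: e'_def)
    also have "\<dots> \<le> e" using C \<open>0 < e\<close> by (intro mult_div_Suc_le) auto
    finally show "\<bar>wint K (\<lambda>t. exp (- a * t)) f x - pot K g x\<bar> \<le> e" by (simp add: g)
  qed
qed

lemma wint_step_closure:
  assumes f: "f \<in> H" and "0 \<le> t" "0 < e"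
  obtains g where "g \<in> H" "\<And>x. \<bar>wint K (indicator {t..}) f x - pot K g x\<bar> \<le> e"
proof -
  have fb: "f \<in> bmeas" using f H_bmeas by auto
  obtain C where C: "0 \<le> C" "\<And>y. \<bar>f y\<bar> \<le> C" by (rule bmeasE[OF fb]) blast
  obtain q where q: "\<And>(K :: 'a \<Rightarrow> (real \<times> 'a) measure) f x.
    occupation K N \<Longrightarrow> f \<in> borel_measurable borel \<Longrightarrow> (\<And>y. \<bar>f y\<bar> \<le> C) \<Longrightarrow>
    \<bar>wint K (indicator {t..}) f x - wint K (poly q) f x\<bar> \<le> e"
    by (rule step_approx[OF N_ge1 \<open>0 \<le> t\<close> \<open>0 < e\<close> C(1)]) blast
  obtain g where g: "g \<in> H" "\<And>x. wint K (poly q) f x = pot K g x"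
    by (rule wint_poly_potential[OF f]) blast
  show thesis
    using q[OF occupation_axioms bmeasD[OF fb] C(2)] by (intro that[OF g(1)]) (auto simp: g)
qed

end

locale occupation_limit = potential_space +
  fixes Kn :: "nat \<Rightarrow> 'a::{metric_space, second_countable_topology} \<Rightarrow> (real \<times> 'a) measure"
  assumes Kn: "\<And>n. occupation (Kn n) N"
    and pot_conv: "\<And>f. f \<in> H \<Longrightarrow> uniform_limit UNIV (\<lambda>n. pot (Kn n) f) (pot K f) sequentially"
begin

text \<open>Induction through the splitting V_n^(k+1) f - V^(k+1) f = V_n^k (V_n f - V f) + (V_n^k -
  V^k) V f. The first part is controlled by the common bound \<open>N\<close>, the second by the
  induction hypothesis at V f, which is why \<open>H\<close> must be invariant under V.\<close>

lemma funpow_pot_conv: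
  "f \<in> H \<Longrightarrow> uniform_limit UNIV (\<lambda>n. (pot (Kn n) ^^ k) f) ((pot K ^^ k) f) sequentially"
proof (induction k arbitrary: f)
  case 0
  then show ?case by (simp add: uniform_limit_const)
next
  case (Suc k)
  have fb: "f \<in> bmeas" using Suc.prems H_bmeas by auto
  show ?case
  proof (rule uniform_limitI)
    fix e :: real assume e: "e > 0"
    have Npos: "N ^ k > 0" using N_ge1 by simp
    have 1: "\<forall>\<^sub>F n in sequentially. \<forall>x\<in>UNIV. dist (pot (Kn n) f x) (pot K f x) < e / 2 / N ^ k"
      using pot_conv[OF Suc.prems] e Npos by (intro uniform_limitD) auto
    have 2: "\<forall>\<^sub>F n in sequentially. \<forall>x\<in>UNIV. dist ((pot (Kn n) ^^ k) (pot K f) x) ((pot K ^^ k) (pot K f) x) < e / 2"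
      using Suc.IH[OF H_pot[OF Suc.prems]] e by (intro uniform_limitD) auto
    from 1 2 show "\<forall>\<^sub>F n in sequentially. \<forall>x\<in>UNIV. dist ((pot (Kn n) ^^ Suc k) f x) ((pot K ^^ Suc k) f x) < e"
    proof eventually_elim
      case (elim n)
      interpret n: occupation "Kn n" N by (rule Kn)
      have "\<bar>(pot (Kn n) ^^ k) (pot (Kn n) f) x - (pot (Kn n) ^^ k) (pot K f) x\<bar> \<le> e / 2 / N ^ k * N ^ k" for x
        using elim(1) by (intro n.funpow_pot_diff_bound n.pot_bmeas pot_bmeas fb) (auto simp: dist_real_def less_imp_le)
      then have **: "\<bar>(pot (Kn n) ^^ k) (pot (Kn n) f) x - (pot (Kn n) ^^ k) (pot K f) x\<bar> \<le> e / 2" for x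
        using N_ge1 by simp
      have "dist ((pot (Kn n) ^^ k) (pot (Kn n) f) x) ((pot K ^^ k) (pot K f) x) < e" for x
      proof -
        have "dist ((pot (Kn n) ^^ k) (pot K f) x) ((pot K ^^ k) (pot K f) x) < e / 2" using elim(2) by simp
        with **[of x]
        show ?thesis unfolding dist_real_def by linarith
      qed
      then show ?case unfolding funpow_Suc_right o_def by auto
    qed
  qed
qed

lemma wint_poly_conv:
  assumes "f \<in> H"
  shows "uniform_limit UNIV (\<lambda>n. wint (Kn n) (poly q) f) (wint K (poly q) f) sequentially"
proof -
  have fb: "f \<in> bmeas" using assms H_bmeas by auto
  have "wint (Kn n) (poly q) f = (\<lambda>x. \<Sum>k\<le>degree q. coeff q k * fact k * (pot (Kn n) ^^ Suc k) f x)" for n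
    using occupation.wint_poly[OF Kn fb] by auto
  moreover have "wint K (poly q) f = (\<lambda>x. \<Sum>k\<le>degree q. coeff q k * fact k * (pot K ^^ Suc k) f x)"
    using wint_poly[OF fb] by auto
  ultimately show ?thesis
    by (simp only:) (intro uniform_limit_sum_cmult funpow_pot_conv assms finite_atMost)
qed

lemma wint_step_conv:
  assumes f: "f \<in> H" and t: "0 \<le> t"
  shows "uniform_limit UNIV (\<lambda>n. wint (Kn n) (indicator {t..}) f) (wint K (indicator {t..}) f) sequentially"
proof (rule uniform_limitI)
  fix e :: real assume e: "e > 0"
  have fb: "f \<in> bmeas" using f H_bmeas by auto
  obtain C where C: "0 \<le> C" "\<And>y. \<bar>f y\<bar> \<le> C" by (rule bmeasE[OF fb]) blast
  obtain q where q: "\<And>(K :: 'a \<Rightarrow> (real \<times> 'a) measure) f x.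
    occupation K N \<Longrightarrow> f \<in> borel_measurable borel \<Longrightarrow> (\<And>y. \<bar>f y\<bar> \<le> C) \<Longrightarrow>
    \<bar>wint K (indicator {t..}) f x - wint K (poly q) f x\<bar> \<le> e / 3"
    using step_approx[OF N_ge1 t _ C(1), of "e / 3"] e by (auto simp: that)
  have "\<forall>\<^sub>F n in sequentially. \<forall>x\<in>UNIV. dist (wint (Kn n) (poly q) f x) (wint K (poly q) f x) < e / 3"
    using wint_poly_conv[OF f] e by (intro uniform_limitD) auto
  then show "\<forall>\<^sub>F n in sequentially. \<forall>x\<in>UNIV.
      dist (wint (Kn n) (indicator {t..}) f x) (wint K (indicator {t..}) f x) < e"
  proof eventually_elim
    case (elim n)
    show ?case
    proof
      fix x
      have "dist (wint (Kn n) (poly q) f x) (wint K (poly q) f x) < e / 3" using elim by simp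
      then show "dist (wint (Kn n) (indicator {t..}) f x) (wint K (indicator {t..}) f x) < e"
        using q[OF Kn bmeasD[OF fb] C(2), of n x] q[OF occupation_axioms bmeasD[OF fb] C(2), of x]
        unfolding dist_real_def by linarith
    qed
  qed
qed

lemma wint_step_conv_compact:
  assumes f: "f \<in> H" and e: "0 < e"
  shows "\<forall>\<^sub>F n in sequentially. \<forall>t\<in>{0..b}. \<forall>x.
    \<bar>wint (Kn n) (indicator {t..}) f x - wint K (indicator {t..}) f x\<bar> \<le> e"
proof -
  have fb: "f \<in> bmeas" using f H_bmeas by auto
  obtain C where C: "0 \<le> C" "\<And>y. \<bar>f y\<bar> \<le> C" by (rule bmeasE[OF fb]) blast
  \<comment> \<open>The mesh of the time grid: moving t down to the nearest grid point changes the
    quantity of either kernel by at most d C, hence by at most e / 3.\<close>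
  define d where "d = e / (3 * (C + 1))"
  have d: "0 < d" "d * C \<le> e / 3" using C e by (auto simp: d_def field_simps)
  define m where "m = nat \<lceil>b / d\<rceil>"
  have "\<forall>\<^sub>F n in sequentially. \<forall>i\<in>{..m}. \<forall>x\<in>UNIV.
      dist (wint (Kn n) (indicator {real i * d..}) f x) (wint K (indicator {real i * d..}) f x) < e / 3"
    using e d by (intro eventually_ball_finite ballI uniform_limitD[OF wint_step_conv[OF f]]) auto
  then show ?thesis
  proof eventually_elim
    case (elim n)
    show ?case
    proof (intro ballI allI)
      fix t x assume t: "t \<in> {0..b}"
      define i where "i = nat \<lfloor>t / d\<rfloor>"
      have i: "real i \<le> t / d" "t / d < real i + 1"
        using t d unfolding i_def by (auto simp: of_nat_nat)
      have "real i \<le> b / d" using i(1) t d by (meson atLeastAtMost_iff divide_right_mono less_imp_le order_trans)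
      then have "i \<le> m" unfolding m_def by linarith
      have s: "real i * d \<le> t" "t - real i * d \<le> d" using i d by (auto simp: field_simps)
      have "(t - real i * d) * C \<le> d * C" using s C by (intro mult_right_mono) auto
      then have s': "(t - real i * d) * C \<le> e / 3" using d by linarith
      have "\<bar>wint (Kn n) (indicator {real i * d..}) f x - wint K (indicator {real i * d..}) f x\<bar> < e / 3"
        using elim \<open>i \<le> m\<close> by (auto simp: dist_real_def)
      then show "\<bar>wint (Kn n) (indicator {t..}) f x - wint K (indicator {t..}) f x\<bar> \<le> e"
        using occupation.wint_step_lipschitz[OF Kn fb C(2) s(1), of n x]
          wint_step_lipschitz[OF fb C(2) s(1), of x] s' by linarith
    qed
  qed
qed

end

section \<open>Potentials of Kato measures\<close>

lemma C0_bmeas: "u \<in> C0 \<Longrightarrow> u \<in> (bmeas :: ('a::metric_space \<Rightarrow> real) set)"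
proof -
  assume u: "u \<in> C0"
  then have c: "continuous_on UNIV u" by (simp add: C0_def)
  obtain K where K: "compact K" "\<And>x. x \<notin> K \<Longrightarrow> \<bar>u x\<bar> < 1"
    using u unfolding C0_def by (auto dest!: spec[of _ "1::real"])
  have "compact (u ` K)" by (intro compact_continuous_image continuous_on_subset[OF c] K) auto
  then obtain B where B: "\<And>x. x \<in> K \<Longrightarrow> \<bar>u x\<bar> \<le> B"
    by (metis bounded_iff compact_imp_bounded image_eqI real_norm_def)
  have "\<bar>u x\<bar> \<le> max 1 B" for x using K(2)[of x] B[of x] by (cases "x \<in> K") auto
  then show ?thesis by (intro bmeasI[of _ "max 1 B"] borel_measurable_continuous_onI c)
qed

lemma C0_bound:
  assumes "g \<in> C0" "continuous_on UNIV f" "\<And>x. \<bar>f x\<bar> \<le> c * \<bar>g x\<bar>"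
  shows "f \<in> C0"
proof -
  have "\<exists>K. compact K \<and> (\<forall>x. x \<notin> K \<longrightarrow> \<bar>f x\<bar> < e)" if e: "e > 0" for e
  proof -
    define d where "d = \<bar>c\<bar> + 1"
    have d: "d > 0" by (simp add: d_def)
    have "e / d > 0" using e d by simp
    then obtain K where K: "compact K" "\<And>x. x \<notin> K \<Longrightarrow> \<bar>g x\<bar> < e / d"
      using assms(1) unfolding C0_def by blast
    have "\<bar>f x\<bar> < e" if "x \<notin> K" for x
    proof -
      have "c * \<bar>g x\<bar> \<le> d * \<bar>g x\<bar>" by (intro mult_right_mono) (auto simp: d_def)
      then have "\<bar>f x\<bar> \<le> d * \<bar>g x\<bar>" using assms(3)[of x] by linarith
      also have "\<dots> < d * (e / d)"
        using K(2)[OF that] d by (intro mult_strict_left_mono) auto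
      finally show ?thesis using d by simp
    qed
    then show ?thesis using K(1) by blast
  qed
  then show ?thesis using assms(2) by (auto simp: C0_def)
qed

lemma C0_add: assumes f: "f \<in> C0" and g: "g \<in> C0" shows "(\<lambda>x. f x + g x) \<in> (C0 :: ('a::t2_space \<Rightarrow> real) set)"
proof -
  have "\<exists>K. compact K \<and> (\<forall>x. x \<notin> K \<longrightarrow> \<bar>f x + g x\<bar> < e)" if e: "e > 0" for e
  proof -
    obtain K where K: "compact K" "\<And>x. x \<notin> K \<Longrightarrow> \<bar>f x\<bar> < e / 2"
      using f e half_gt_zero unfolding C0_def by blast
    obtain L where L: "compact L" "\<And>x. x \<notin> L \<Longrightarrow> \<bar>g x\<bar> < e / 2"
      using g e half_gt_zero unfolding C0_def by blast
    have "\<bar>f x + g x\<bar> < e" if "x \<notin> K \<union> L" for x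
      using K(2)[of x] L(2)[of x] that by (auto simp: abs_if split: if_splits)
    then show ?thesis using K L by (intro exI[of _ "K \<union> L"]) auto
  qed
  then show ?thesis using f g by (auto simp: C0_def intro!: continuous_intros)
qed

lemma C0_cmult: "f \<in> C0 \<Longrightarrow> (\<lambda>x. c * f x) \<in> C0"
  by (rule C0_bound[of f _ "\<bar>c\<bar>"]) (auto simp: C0_def abs_mult intro!: continuous_intros)

lemma C0_abs: "f \<in> C0 \<Longrightarrow> (\<lambda>x. \<bar>f x\<bar>) \<in> C0"
  by (rule C0_bound[of f _ 1]) (auto simp: C0_def intro!: continuous_intros)

lemma C0_diff: "f \<in> C0 \<Longrightarrow> g \<in> C0 \<Longrightarrow> (\<lambda>x. f x - g x) \<in> (C0 :: ('a::t2_space \<Rightarrow> real) set)"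
  using C0_add[of f "\<lambda>x. (-1) * g x"] C0_cmult[of g "-1"] by simp

lemma
  fixes f g :: "'a::t2_space \<Rightarrow> real"
  assumes "f \<in> C0" "g \<in> C0"
  shows C0_max: "(\<lambda>x. max (f x) (g x)) \<in> C0" and C0_min: "(\<lambda>x. min (f x) (g x)) \<in> C0"
proof -
  note * = C0_add[OF C0_abs[OF assms(1)] C0_abs[OF assms(2)]]
  have c: "continuous_on UNIV f" "continuous_on UNIV g" using assms by (auto simp: C0_def)
  show "(\<lambda>x. max (f x) (g x)) \<in> C0"
    by (rule C0_bound[OF *, of _ 1]) (intro continuous_intros c, auto)
  show "(\<lambda>x. min (f x) (g x)) \<in> C0"
    by (rule C0_bound[OF *, of _ 1]) (intro continuous_intros c, auto)
qed

lemma C0_limit: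
  fixes f :: "'a::t2_space \<Rightarrow> real"
  assumes f: "\<And>e. 0 < e \<Longrightarrow> \<exists>h\<in>C0. \<forall>x. \<bar>f x - h x\<bar> \<le> e"
  shows "f \<in> C0"
proof -
  have "\<exists>h. h \<in> C0 \<and> (\<forall>x. \<bar>f x - h x\<bar> \<le> 1 / real (Suc k))" for k using f[of "1 / real (Suc k)"] by auto
  then obtain h where h: "\<And>k. h k \<in> C0" "\<And>k x. \<bar>f x - h k x\<bar> \<le> 1 / real (Suc k)" by metis
  have "uniform_limit UNIV h f sequentially"
  proof (rule uniform_limitI)
    fix e :: real assume "0 < e"
    then obtain k where k: "1 / real (Suc k) < e" using nat_approx_posE by blast
    have "dist (h n x) (f x) < e" if "n \<ge> k" for n x
    proof -
      have "dist (h n x) (f x) \<le> 1 / real (Suc n)" using h(2)[of x n] by (simp add: dist_real_def abs_minus_commute)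
      also have "\<dots> \<le> 1 / real (Suc k)" using that by (intro frac_le) auto
      finally show ?thesis using k by simp
    qed
    then show "\<forall>\<^sub>F n in sequentially. \<forall>x\<in>UNIV. dist (h n x) (f x) < e"
      by (auto simp: eventually_sequentially)
  qed
  moreover have "continuous_on UNIV (h k)" for k using h(1)[of k] by (simp add: C0_def)
  ultimately have "continuous_on UNIV f" by (intro uniform_limit_theorem[where F = sequentially]) auto
  moreover have "\<exists>K. compact K \<and> (\<forall>x. x \<notin> K \<longrightarrow> \<bar>f x\<bar> < e)" if e: "0 < e" for e
  proof -
    obtain g where g: "g \<in> C0" "\<And>x. \<bar>f x - g x\<bar> \<le> e / 2" using f[OF half_gt_zero[OF e]] by blast
    have "\<forall>e>0. \<exists>K. compact K \<and> (\<forall>x. x \<notin> K \<longrightarrow> \<bar>g x\<bar> < e)" using g(1) by (simp add: C0_def)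
    then obtain K where K: "compact K" "\<And>x. x \<notin> K \<Longrightarrow> \<bar>g x\<bar> < e / 2" using half_gt_zero[OF e] by blast
    have "\<bar>f x\<bar> < e" if "x \<notin> K" for x using g(2)[of x] K(2)[OF that] by linarith
    then show ?thesis using K(1) by blast
  qed
  ultimately show ?thesis by (simp add: C0_def)
qed

section \<open>Compact exhaustion and cutoff functions\<close>

lemma compact_exhaustion:
  assumes lc: "locally_compact_space (euclidean :: 'a::{metric_space, second_countable_topology} topology)"
  obtains U :: "nat \<Rightarrow> 'a::{metric_space, second_countable_topology} set"
  where "\<And>n. open (U n)" "\<And>n. compact (closure (U n))" "incseq U" "(\<Union>n. U n) = UNIV"
proof -
  let ?\<F> = "{V :: 'a set. open V \<and> compact (closure V)}"
  have ex: "\<exists>V\<in>?\<F>. x \<in> V" for x :: 'a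
  proof -
    obtain V K where VK: "open V" "compact K" "x \<in> V" "V \<subseteq> K"
      using lc unfolding locally_compact_space_def
      by (simp add: compactin_euclidean_iff) (metis (no_types))
    have "closure V \<subseteq> K" using VK by (intro closure_minimal compact_imp_closed)
    then have "compact (closure V)" using VK by (metis closed_closure compact_Int_closed inf.absorb_iff2)
    then show ?thesis using VK by blast
  qed
  obtain \<G> where \<G>: "\<G> \<subseteq> ?\<F>" "countable \<G>" "\<Union>\<G> = \<Union>?\<F>"
    using Lindelof[of ?\<F>] by auto
  have un: "\<Union>\<G> = UNIV" unfolding \<G>(3) using ex by blast
  then have ne: "\<G> \<noteq> {}" by auto
  define U where "U n = (\<Union>i\<le>n. from_nat_into \<G> i)" for n
  have mem: "from_nat_into \<G> i \<in> ?\<F>" for i using from_nat_into[OF ne, of i] \<G>(1) by auto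
  show thesis
  proof
    show "open (U n)" for n using mem by (auto simp: U_def)
    show "compact (closure (U n))" for n
    proof -
      have "closure (U n) \<subseteq> (\<Union>i\<le>n. closure (from_nat_into \<G> i))"
        unfolding U_def using closure_subset by (intro closure_minimal closed_UN) fastforce+
      moreover have "compact (\<Union>i\<le>n. closure (from_nat_into \<G> i))" using mem by (intro compact_UN) auto
      ultimately show ?thesis by (metis closed_closure compact_Int_closed inf.absorb_iff2)
    qed
    show "incseq U" unfolding incseq_def U_def by (intro allI impI UN_mono) auto
    have "(\<Union>n. U n) = \<Union>(range (from_nat_into \<G>))" by (auto simp: U_def)
    also have "\<dots> = UNIV" using un range_from_nat_into[OF ne \<G>(2)] by simp
    finally show "(\<Union>n. U n) = UNIV" .
  qed
qed

text \<open>The function min 1 (j dist (y, complement of U_j)) increases with j because both factors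
  do, and it reaches 1 at each point, where the distance is eventually bounded below by a positive
  number.\<close>

lemma cutoff_sequence:
  assumes lc: "locally_compact_space (euclidean :: 'a::{metric_space, second_countable_topology} topology)"
  obtains c :: "nat \<Rightarrow> 'a::{metric_space, second_countable_topology} \<Rightarrow> real"
  where "\<And>j. c j \<in> Cc" "\<And>j y. 0 \<le> c j y" "\<And>j y. c j y \<le> 1"
    "\<And>j y. c j y \<le> c (Suc j) y" "\<And>y. \<forall>\<^sub>F j in sequentially. c j y = 1"
proof -
  obtain U :: "nat \<Rightarrow> 'a set" where U: "\<And>n. open (U n)" "\<And>n. compact (closure (U n))" "incseq U" "(\<Union>n. U n) = UNIV"
    by (rule compact_exhaustion[OF lc]) blast
  \<comment> \<open>The distance to the empty set is 0 by convention, so the case where U_j is the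
    whole space, which is then compact, gets the value 1 separately.\<close>
  define c where "c j y = (if U j = UNIV then 1 else min 1 (real j * infdist y (- U j)))" for j y
  have zero: "c j y = 0" if "y \<notin> U j" for j y
    using that by (auto simp: c_def)
  show thesis
  proof
    show "0 \<le> c j y" "c j y \<le> 1" for j y by (auto simp: c_def infdist_nonneg)
    show "c j \<in> Cc" for j
    proof -
      have "continuous_on UNIV (c j)"
        unfolding c_def by (cases "U j = UNIV") (auto intro!: continuous_intros)
      moreover have "closure {x. c j x \<noteq> 0} \<subseteq> closure (U j)" using zero by (intro closure_mono) auto
      then have "compact (closure {x. c j x \<noteq> 0})" using U(2)[of j]
        by (metis closed_closure compact_Int_closed inf.absorb_iff2)
      ultimately show ?thesis by (simp add: Cc_def)
    qed
    have mono: "infdist y (- U i) \<le> infdist y (- U j)" if "i \<le> j" "U j \<noteq> UNIV" for y i j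
      using that U(3) by (intro infdist_mono) (auto simp: incseq_def)
    show "c j y \<le> c (Suc j) y" for j y
    proof (cases "U (Suc j) = UNIV")
      case False
      then have "U j \<noteq> UNIV" using U(3) by (metis incseq_SucD top.extremum_unique)
      moreover have "real j * infdist y (- U j) \<le> real (Suc j) * infdist y (- U (Suc j))"
        using mono[of j "Suc j" y] False by (intro mult_mono) (auto simp: infdist_nonneg)
      ultimately show ?thesis using False by (auto simp: c_def min_def)
    qed (auto simp: c_def)
    show "\<forall>\<^sub>F j in sequentially. c j y = 1" for y
    proof -
      obtain i where i: "y \<in> U i" using U(4) by auto
      obtain k where k: "c j y = 1" if "j \<ge> k" for j
      proof (cases "\<exists>j. U j = UNIV")
        case True
        then obtain k where "U k = UNIV" by auto
        then have "U j = UNIV" if "j \<ge> k" for j using U(3) that by (metis incseqD top.extremum_unique)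
        then show thesis using that[of k] by (auto simp: c_def)
      next
        case False
        then have "infdist y (- U i) > 0"
          using i U(1)[of i] infdist_pos_not_in_closed[of "- U i" y] by auto
        then obtain l where l: "real l * infdist y (- U i) \<ge> 1"
          by (metis less_imp_le mult.commute reals_Archimedean3)
        show thesis
        proof (rule that[of "max i l"])
          fix j assume j: "j \<ge> max i l"
          have "1 \<le> real l * infdist y (- U i)" by fact
          also have "\<dots> \<le> real j * infdist y (- U j)"
            using j False mono[of i j y] by (intro mult_mono) (auto simp: infdist_nonneg)
          finally show "c j y = 1" by (simp add: c_def)
        qed
      qed
      show ?thesis using k by (auto simp: eventually_sequentially)
    qed
  qed
qed

lemma integrable_Cc:
  assumes \<mu>: "radon_measure \<mu>" and f: "f \<in> Cc"
  shows "integrable \<mu> f"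
proof -
  let ?K = "closure {x. f x \<noteq> 0}"
  have s: "sets \<mu> = sets borel" and fin: "emeasure \<mu> ?K < \<infinity>"
    using \<mu> f by (auto simp: radon_measure_def Cc_def)
  have c: "continuous_on UNIV f" "compact ?K" using f by (auto simp: Cc_def)
  have "compact (f ` ?K)" by (intro compact_continuous_image continuous_on_subset[OF c(1)] c) auto
  then obtain B where B: "\<And>x. x \<in> ?K \<Longrightarrow> \<bar>f x\<bar> \<le> B"
    by (metis bounded_iff compact_imp_bounded image_eqI real_norm_def)
  have [measurable]: "f \<in> borel_measurable \<mu>"
    by (subst measurable_cong_sets[OF s refl]) (intro borel_measurable_continuous_onI c)
  have K: "?K \<in> sets \<mu>" by (simp add: s)
  show ?thesis
  proof (rule Bochner_Integration.integrable_bound)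
    show "integrable \<mu> (\<lambda>x. \<bar>B\<bar> * indicator ?K x)"
      using K fin by (intro integrable_mult_right integrable_real_indicator) auto
    show "AE x in \<mu>. norm (f x) \<le> norm (\<bar>B\<bar> * indicator ?K x)"
    proof (intro AE_I2)
      fix x show "norm (f x) \<le> norm (\<bar>B\<bar> * indicator ?K x)"
        using B[of x] closure_subset[of "{x. f x \<noteq> 0}"] by (cases "x \<in> ?K") auto
    qed
  qed auto
qed

lemma Cc_mult: "f \<in> Cc \<Longrightarrow> continuous_on UNIV g \<Longrightarrow> (\<lambda>x. g x * f x) \<in> (Cc :: ('a::t2_space \<Rightarrow> real) set)"
proof -
  assume f: "f \<in> Cc" and g: "continuous_on UNIV g"
  have "closure {x. g x * f x \<noteq> 0} \<subseteq> closure {x. f x \<noteq> 0}" by (intro closure_mono) auto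
  then have "compact (closure {x. g x * f x \<noteq> 0})"
    using f by (metis (mono_tags, lifting) Cc_def closed_closure compact_Int_closed inf.absorb_iff2 mem_Collect_eq)
  then show ?thesis using f g by (auto simp: Cc_def intro!: continuous_intros)
qed

text \<open>The Pasch-Hausdorff envelope of the truncation of g at k: the largest function below it
  with Lipschitz constant k. The truncation makes it real-valued even where g is infinite.\<close>

definition lip_minorant :: "('b::metric_space \<Rightarrow> ennreal) \<Rightarrow> nat \<Rightarrow> 'b \<Rightarrow> real" where
  "lip_minorant g k z = (INF z'. enn2real (min (g z') (of_nat k)) + real k * dist z z')"

lemma lip_minorant_bdd: "bdd_below (range (\<lambda>z'. enn2real (min (g z') (of_nat k)) + real k * dist z z'))"
  by (intro bdd_belowI[of _ 0]) auto

lemma lip_minorant_nonneg: "0 \<le> lip_minorant g k z"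
  unfolding lip_minorant_def by (intro cINF_greatest) auto

lemma lip_minorant_le: "ennreal (lip_minorant g k z) \<le> g z"
proof -
  have "lip_minorant g k z \<le> enn2real (min (g z) (of_nat k)) + real k * dist z z"
    unfolding lip_minorant_def by (intro cINF_lower lip_minorant_bdd) auto
  then have "ennreal (lip_minorant g k z) \<le> ennreal (enn2real (min (g z) (of_nat k)))"
    by (intro ennreal_leI) simp
  also have "\<dots> = min (g z) (of_nat k)"
    by (intro ennreal_enn2real) (auto simp: min_less_iff_disj of_nat_less_top)
  finally show ?thesis by simp
qed

lemma lip_minorant_lipschitz: "lip_minorant g k z \<le> lip_minorant g k w + real k * dist z w"
proof -
  have "lip_minorant g k z - real k * dist z w \<le> lip_minorant g k w"
    unfolding lip_minorant_def[of g k w]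
  proof (intro cINF_greatest)
    fix z'
    have "lip_minorant g k z \<le> enn2real (min (g z') (of_nat k)) + real k * dist z z'"
      unfolding lip_minorant_def by (intro cINF_lower lip_minorant_bdd) auto
    also have "\<dots> \<le> enn2real (min (g z') (of_nat k)) + real k * (dist z w + dist w z')"
      by (intro add_left_mono mult_left_mono dist_triangle) auto
    finally show "lip_minorant g k z - real k * dist z w \<le> enn2real (min (g z') (of_nat k)) + real k * dist w z'"
      by (simp add: algebra_simps)
  qed auto
  then show ?thesis by simp
qed

lemma continuous_lip_minorant: "continuous_on S (lip_minorant g k)"
proof -
  have "(real k)-lipschitz_on S (lip_minorant g k)"
    using lip_minorant_lipschitz[of g k]
    by (intro lipschitz_onI) (smt (verit) dist_commute dist_real_def, simp)
  then show ?thesis by (rule lipschitz_on_continuous_on)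
qed

lemma lip_minorant_mono: "lip_minorant g k z \<le> lip_minorant g (Suc k) z"
  unfolding lip_minorant_def[of g "Suc k"]
proof (intro cINF_greatest)
  fix z'
  have "lip_minorant g k z \<le> enn2real (min (g z') (of_nat k)) + real k * dist z z'"
    unfolding lip_minorant_def by (intro cINF_lower lip_minorant_bdd) auto
  also have "\<dots> \<le> enn2real (min (g z') (of_nat (Suc k))) + real (Suc k) * dist z z'"
  proof (intro add_mono mult_right_mono enn2real_mono)
    show "min (g z') (of_nat k) \<le> min (g z') (of_nat (Suc k))" by (intro min.mono) (auto simp: of_nat_mono)
    show "min (g z') (of_nat (Suc k)) < \<top>" by (auto simp: min_less_iff_disj of_nat_less_top simp del: of_nat_Suc)
  qed auto
  finally show "lip_minorant g k z \<le> enn2real (min (g z') (of_nat (Suc k))) + real (Suc k) * dist z z'" .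
qed auto

lemma lip_minorant_SUP:
  assumes g: "lower_semicont g"
  shows "(SUP k. ennreal (lip_minorant g k z)) = g z"
proof (intro antisym SUP_least lip_minorant_le le_SUP_iff[THEN iffD2] allI impI)
  fix y assume "y < g z"
  then obtain y' where y': "y < y'" "y' < g z" using dense by blast
  then obtain c where c: "y' = ennreal c" "0 \<le> c" by (cases y') auto
  have "open {w. y' < g w}" using g by (simp add: lower_semicont_def)
  then obtain d where d: "d > 0" "\<And>w. dist w z < d \<Longrightarrow> y' < g w"
    using y'(2) unfolding open_dist by auto
  \<comment> \<open>Two demands on k: the truncation must not cut below c inside the ball where g
    exceeds c, and the penalty k d must reach c outside it.\<close>
  obtain k where k: "c \<le> real k" "c \<le> real k * d"
  proof -
    obtain k where k: "max c (c / d) \<le> real k" using real_arch_simple by blast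
    then show thesis using d by (intro that[of k]) (auto simp: field_simps)
  qed
  have "c \<le> lip_minorant g k z"
    unfolding lip_minorant_def
  proof (intro cINF_greatest)
    fix w
    show "c \<le> enn2real (min (g w) (of_nat k)) + real k * dist z w"
    proof (cases "dist w z < d")
      case True
      then have "ennreal c \<le> min (g w) (of_nat k)"
        using d(2)[of w] k by (auto simp: c ennreal_of_nat_eq_real_of_nat less_imp_le)
      then have "enn2real (ennreal c) \<le> enn2real (min (g w) (of_nat k))"
        by (intro enn2real_mono) (auto simp: min_less_iff_disj of_nat_less_top)
      then show ?thesis using c by (auto intro: order_trans)
    next
      case False
      then have "real k * d \<le> real k * dist z w" by (intro mult_left_mono) (auto simp: dist_commute)
      then show ?thesis using k by (smt (verit) enn2real_nonneg)
    qed
  qed auto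
  then have "y' \<le> ennreal (lip_minorant g k z)" unfolding c by (rule ennreal_leI)
  then show "\<exists>k\<in>UNIV. y < ennreal (lip_minorant g k z)" using y'(1) by (auto intro: less_le_trans)
qed

section \<open>Lower semicontinuous kernels and their potentials\<close>

lemma measurable_lower_semicont:
  fixes g :: "'b::second_countable_topology \<Rightarrow> ennreal"
  assumes "lower_semicont g" shows "g \<in> borel_measurable borel"
  using assms unfolding lower_semicont_def by (intro borel_measurableI_greater) auto

lemma lower_semicont_section:
  assumes "lower_semicont (\<lambda>(x, y). G x y)"
  shows "lower_semicont (\<lambda>y. G x y)" "lower_semicont (\<lambda>x. G x y)"
proof -
  have o: "open {z. c < (case z of (x, y) \<Rightarrow> G x y)}" for c
    using assms by (simp add: lower_semicont_def)
  have "open ((\<lambda>y. (x, y)) -` {z. c < (case z of (x, y) \<Rightarrow> G x y)})" for c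
    by (intro open_vimage o continuous_intros)
  then show "lower_semicont (\<lambda>y. G x y)" by (simp add: lower_semicont_def vimage_def)
  have "open ((\<lambda>x. (x, y)) -` {z. c < (case z of (x, y) \<Rightarrow> G x y)})" for c
    by (intro open_vimage o continuous_intros)
  then show "lower_semicont (\<lambda>x. G x y)" by (simp add: lower_semicont_def vimage_def)
qed

text \<open>Fatou's lemma along a convergent sequence of points; in a metric space sequences decide
  whether a sublevel set is closed.\<close>

lemma lower_semicont_nn_integral:
  fixes G :: "'a::{metric_space, second_countable_topology} \<Rightarrow> 'a \<Rightarrow> ennreal"
  assumes G: "lower_semicont (\<lambda>(x, y). G x y)" and \<mu>: "sets \<mu> = sets borel"
  shows "lower_semicont (\<lambda>x. \<integral>\<^sup>+y. G x y \<partial>\<mu>)"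
proof -
  have m: "(\<lambda>y. G x y) \<in> borel_measurable \<mu>" for x
    using measurable_lower_semicont[OF lower_semicont_section(1)[OF G]]
    by (subst measurable_cong_sets[OF \<mu> refl])
  have "closed {x. (\<integral>\<^sup>+y. G x y \<partial>\<mu>) \<le> c}" for c
    unfolding closed_sequential_limits
  proof (intro allI impI, elim conjE)
    fix X l assume X: "\<forall>n. X n \<in> {x. (\<integral>\<^sup>+y. G x y \<partial>\<mu>) \<le> c}" "X \<longlonglongrightarrow> l"
    have "G l y \<le> liminf (\<lambda>n. G (X n) y)" for y
      unfolding le_Liminf_iff
    proof (intro allI impI)
      fix b assume "b < G l y"
      then show "\<forall>\<^sub>F n in sequentially. b < G (X n) y"
        using lower_semicont_section(2)[OF G, of y] X(2)
        by (auto simp: lower_semicont_def dest: topological_tendstoD[of _ _ _ "{x. b < G x y}"])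
    qed
    then have "(\<integral>\<^sup>+y. G l y \<partial>\<mu>) \<le> (\<integral>\<^sup>+y. liminf (\<lambda>n. G (X n) y) \<partial>\<mu>)"
      by (intro nn_integral_mono)
    also have "\<dots> \<le> liminf (\<lambda>n. \<integral>\<^sup>+y. G (X n) y \<partial>\<mu>)"
      by (intro nn_integral_liminf m)
    also have "\<dots> \<le> liminf (\<lambda>n. c)"
      using X(1) by (intro Liminf_mono) auto
    finally show "l \<in> {x. (\<integral>\<^sup>+y. G x y \<partial>\<mu>) \<le> c}" by (simp add: Liminf_const)
  qed
  then have "open (- {x. (\<integral>\<^sup>+y. G x y \<partial>\<mu>) \<le> c})" for c by (rule open_Compl)
  then show ?thesis by (simp add: lower_semicont_def Compl_eq not_le)
qed

lemma lower_semicont_potential: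
  fixes G :: "'a::{metric_space, second_countable_topology} \<Rightarrow> 'a \<Rightarrow> ennreal"
  assumes G: "lower_semicont (\<lambda>(x, y). G x y)" and \<mu>: "sets \<mu> = sets borel"
    and f: "f \<in> borel_measurable borel"
  shows "lower_semicont (\<lambda>x. \<integral>\<^sup>+y. G x y * f y \<partial>\<mu>)"
proof -
  have "(\<integral>\<^sup>+y. G x y * f y \<partial>\<mu>) = (\<integral>\<^sup>+y. G x y \<partial>density \<mu> f)" for x
    using f measurable_lower_semicont[OF lower_semicont_section(1)[OF G]]
    by (subst nn_integral_density) (auto simp: measurable_cong_sets[OF \<mu> refl] mult.commute)
  then show ?thesis using lower_semicont_nn_integral[OF G, of "density \<mu> f"] \<mu> by simp
qed


text \<open>The second alternative covers values below e: there \<open>ennreal\<close> sends the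
  negative difference to 0, and a strict inequality would be false where a vanishes.\<close>

lemma lower_semicont_real_bound:
  assumes "lower_semicont a" "a l < \<infinity>" "0 < e"
  shows "\<forall>\<^sub>F x in nhds l. ennreal (enn2real (a l) - e) < a x \<or> enn2real (a l) < e"
proof (cases "enn2real (a l) < e")
  case False
  have "ennreal (enn2real (a l) - e) < ennreal (enn2real (a l))"
    using assms(3) False by (intro ennreal_lessI) auto
  also have "\<dots> = a l" using assms(2) by simp
  finally have "l \<in> {x. ennreal (enn2real (a l) - e) < a x}" by simp
  moreover have "open {x. ennreal (enn2real (a l) - e) < a x}"
    using assms(1) by (simp add: lower_semicont_def)
  ultimately show ?thesis by (auto dest!: eventually_nhds_in_open elim!: eventually_mono)
qed simp

text \<open>Each summand is the continuous sum minus a lower semicontinuous function, hence also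
  upper semicontinuous.\<close>

lemma continuous_of_lower_semicont_sum:
  fixes a b :: "'a::t2_space \<Rightarrow> ennreal"
  assumes a: "lower_semicont a" and b: "lower_semicont b"
    and sum: "\<And>x. a x + b x = ennreal (s x)" and s: "continuous_on UNIV s" "\<And>x. 0 \<le> s x"
  shows "continuous_on UNIV (\<lambda>x. enn2real (a x))"
proof -
  have fin: "a x < \<infinity>" "b x < \<infinity>" for x
  proof -
    have "a x + b x \<noteq> \<top>" by (simp add: sum)
    then show "a x < \<infinity>" "b x < \<infinity>" by (auto simp: less_top)
  qed
  have sum': "enn2real (a x) + enn2real (b x) = s x" for x
    using sum[of x] fin[of x] s(2)[of x] by (metis enn2real_ennreal enn2real_plus infinity_ennreal_def)
  have "((\<lambda>x. enn2real (a x)) \<longlongrightarrow> enn2real (a l)) (nhds l)" for l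
  proof (rule tendstoI)
    fix e :: real assume e: "0 < e"
    have s': "\<forall>\<^sub>F x in nhds l. dist (s x) (s l) < e / 2"
    proof -
      have "isCont s l" using s(1) by (simp add: continuous_on_eq_continuous_at)
      then show ?thesis using e by (intro tendstoD[of s]) (auto simp: isCont_def tendsto_nhds_iff)
    qed
    have e2: "0 < e / 2" using e by simp
    from s' lower_semicont_real_bound[OF a fin(1)[of l] e2] lower_semicont_real_bound[OF b fin(2)[of l] e2]
    show "\<forall>\<^sub>F x in nhds l. dist (enn2real (a x)) (enn2real (a l)) < e"
    proof eventually_elim
      case (elim x)
      have *: "c - e / 2 \<le> enn2real w" if "ennreal (c - e / 2) < w \<or> c < e / 2" "w < \<infinity>" for w c
      proof (cases "c < e / 2")
        case False
        then have "ennreal (c - e / 2) < ennreal (enn2real w)" using that by simp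
        then show ?thesis using False by (simp add: ennreal_less_iff)
      qed (smt (verit) enn2real_nonneg)
      have "enn2real (a l) - e / 2 \<le> enn2real (a x)" "enn2real (b l) - e / 2 \<le> enn2real (b x)"
        using elim fin by (auto intro!: *)
      then show ?case using sum'[of x] sum'[of l] elim(1) e unfolding dist_real_def by linarith
    qed
  qed
  then show ?thesis by (auto simp: continuous_on_eq_continuous_at continuous_at tendsto_nhds_iff)
qed

section \<open>Potentials of Kato measures and their vague limits\<close>

locale green_kernel =
  fixes G :: "'a::{metric_space, second_countable_topology} \<Rightarrow> 'a \<Rightarrow> ennreal"
  assumes lc: "locally_compact_space (euclidean :: 'a topology)"
    and lsc: "lower_semicont (\<lambda>(x, y). G x y)"
begin

definition gpot :: "'a measure \<Rightarrow> ('a \<Rightarrow> real) \<Rightarrow> 'a \<Rightarrow> ennreal" where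
  "gpot \<mu> f x = (\<integral>\<^sup>+y. G x y * ennreal (f y) \<partial>\<mu>)"

definition kato_measure :: "'a measure \<Rightarrow> bool" where
  "kato_measure \<mu> \<longleftrightarrow> radon_measure \<mu> \<and> (\<forall>x. gpot \<mu> (\<lambda>_. 1) x < \<infinity>) \<and>
    (\<lambda>x. enn2real (gpot \<mu> (\<lambda>_. 1) x)) \<in> C0"

lemma measurable_G: "sets \<mu> = sets borel \<Longrightarrow> (\<lambda>y. G x y) \<in> borel_measurable \<mu>"
  using measurable_lower_semicont[OF lower_semicont_section(1)[OF lsc]]
  by (subst measurable_cong_sets[of \<mu> borel]) auto

lemma gpot_add:
  assumes "sets \<mu> = sets borel" "f \<in> borel_measurable borel" "g \<in> borel_measurable borel"
    "\<And>y. 0 \<le> f y" "\<And>y. 0 \<le> g y"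
  shows "gpot \<mu> (\<lambda>y. f y + g y) x = gpot \<mu> f x + gpot \<mu> g x"
  using assms measurable_G[OF assms(1)] unfolding gpot_def
  by (subst nn_integral_add[symmetric])
     (auto simp: distrib_left measurable_cong_sets[OF assms(1) refl])

lemma gpot_cmult:
  assumes "sets \<mu> = sets borel" "f \<in> borel_measurable borel" "0 \<le> c"
  shows "gpot \<mu> (\<lambda>y. c * f y) x = ennreal c * gpot \<mu> f x"
proof -
  have "(\<lambda>y. G x y * ennreal (f y)) \<in> borel_measurable \<mu>"
    using measurable_G[OF assms(1)] assms by (auto simp: measurable_cong_sets[OF assms(1) refl])
  then show ?thesis
    unfolding gpot_def using assms(3)
    by (subst nn_integral_cmult[symmetric]) (simp_all add: ennreal_mult' mult.left_commute)
qed

lemma gpot_mono: "(\<And>y. f y \<le> g y) \<Longrightarrow> gpot \<mu> f x \<le> gpot \<mu> g x"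
  unfolding gpot_def by (intro nn_integral_mono mult_left_mono ennreal_leI) auto

lemma lower_semicont_gpot:
  "sets \<mu> = sets borel \<Longrightarrow> f \<in> borel_measurable borel \<Longrightarrow> lower_semicont (gpot \<mu> f)"
  unfolding gpot_def by (intro lower_semicont_potential lsc) auto

text \<open>The potentials of f and C - f are lower semicontinuous and add up to C times the
  potential of 1, which is continuous; domination by that multiple gives decay at infinity.
  Continuity of f plays no part, so this is a strong Feller property.\<close>

lemma gpot_C0:
  assumes \<mu>: "kato_measure \<mu>" and f: "f \<in> borel_measurable borel" "\<And>y. 0 \<le> f y" "\<And>y. f y \<le> C"
  shows "(\<lambda>x. enn2real (gpot \<mu> f x)) \<in> C0" and "gpot \<mu> f x < \<infinity>"
proof -
  have s: "sets \<mu> = sets borel" using \<mu> by (simp add: kato_measure_def radon_measure_def)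
  have C: "0 \<le> C" using f(2,3) order_trans by blast
  let ?s = "\<lambda>x. C * enn2real (gpot \<mu> (\<lambda>_. 1) x)"
  have fin: "gpot \<mu> (\<lambda>_. 1) x < \<infinity>" for x using \<mu> by (simp add: kato_measure_def)
  have C1: "gpot \<mu> (\<lambda>_. C) x = ennreal (?s x)" for x
    using gpot_cmult[OF s, of "\<lambda>_. 1" C x] C fin[of x] by (simp add: ennreal_mult'')
  have le: "gpot \<mu> f x \<le> ennreal (?s x)" for x
    unfolding C1[symmetric] by (intro gpot_mono f)
  show "gpot \<mu> f x < \<infinity>" using le[of x] by (auto simp: le_less_trans)
  have "continuous_on UNIV (\<lambda>x. enn2real (gpot \<mu> f x))"
  proof (rule continuous_of_lower_semicont_sum)
    show "lower_semicont (gpot \<mu> f)" by (intro lower_semicont_gpot s f)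
    show "lower_semicont (gpot \<mu> (\<lambda>y. C - f y))" using f by (intro lower_semicont_gpot s) auto
    show "gpot \<mu> f x + gpot \<mu> (\<lambda>y. C - f y) x = ennreal (?s x)" for x
      using f by (subst gpot_add[OF s, symmetric]) (auto simp: C1)
    show "continuous_on UNIV ?s" using \<mu> by (auto simp: kato_measure_def C0_def intro!: continuous_intros)
    show "0 \<le> ?s x" for x using C by simp
  qed
  moreover have "\<bar>enn2real (gpot \<mu> f x)\<bar> \<le> C * \<bar>enn2real (gpot \<mu> (\<lambda>_. 1) x)\<bar>" for x
  proof -
    have "enn2real (gpot \<mu> f x) \<le> enn2real (ennreal (?s x))" by (intro enn2real_mono le) simp
    also have "\<dots> = ?s x" using C by (intro enn2real_ennreal mult_nonneg_nonneg) auto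
    finally show ?thesis by simp
  qed
  moreover have "(\<lambda>x. enn2real (gpot \<mu> (\<lambda>_. 1) x)) \<in> C0" using \<mu> by (simp add: kato_measure_def)
  ultimately show "(\<lambda>x. enn2real (gpot \<mu> f x)) \<in> C0" by (rule C0_bound[rotated])
qed


text \<open>The kernel is minorized by a Lipschitz function times a cutoff. Compact support lets
  vague convergence act at the point z, and the Lipschitz bound moves the estimate to all x near z
  at a cost independent of n.\<close>

lemma gpot_lower_bound:
  assumes \<mu>: "radon_measure \<mu>" "\<And>n. radon_measure (\<nu> n)" "vague_conv \<nu> \<mu>"
    and w: "continuous_on UNIV w" "\<And>y. 0 \<le> w y"
    and c: "0 \<le> c" "ennreal c < gpot \<mu> w z"
  shows "\<exists>d>0. \<forall>\<^sub>F n in sequentially. \<forall>x. dist x z < d \<longrightarrow> ennreal c < gpot (\<nu> n) w x"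
proof -
  have s: "sets \<mu> = sets borel" "\<And>n. sets (\<nu> n) = sets borel" using \<mu> by (auto simp: radon_measure_def)
  obtain cf :: "nat \<Rightarrow> 'a \<Rightarrow> real"
    where cf: "\<And>j. cf j \<in> Cc" "\<And>j y. 0 \<le> cf j y" "\<And>j y. cf j y \<le> 1"
      "\<And>j y. cf j y \<le> cf (Suc j) y" "\<And>y. \<forall>\<^sub>F j in sequentially. cf j y = 1"
    by (rule cutoff_sequence[OF lc]) blast
  \<comment> \<open>Taken on the product space, the minorant is Lipschitz in x with a constant that
    does not depend on y.\<close>
  define g where "g k x y = lip_minorant (\<lambda>(x, y). G x y) k (x, y)" for k x y
  have g_le: "ennreal (g k x y) \<le> G x y" for k x y
    using lip_minorant_le[of "\<lambda>(x, y). G x y" k "(x, y)"] by (simp add: g_def)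
  have g_nn: "0 \<le> g k x y" for k x y by (simp add: g_def lip_minorant_nonneg)
  have g_mono: "g k x y \<le> g (Suc k) x y" for k x y by (simp add: g_def lip_minorant_mono)
  have g_lip: "g k x' y \<le> g k x y + real k * dist x' x" for k x x' y
    using lip_minorant_lipschitz[of "\<lambda>(x, y). G x y" k "(x', y)" "(x, y)"] by (simp add: g_def dist_Pair_Pair)
  have g_cont: "continuous_on UNIV (g k x)" for k x
    unfolding g_def by (intro continuous_on_compose2[OF continuous_lip_minorant[of UNIV]] continuous_intros) auto
  define \<psi> where "\<psi> k y = w y * cf k y" for k y
  have \<psi>: "\<psi> k \<in> Cc" "0 \<le> \<psi> k y" for k y
    using cf w unfolding \<psi>_def by (auto intro: Cc_mult)
  define h where "h k x y = g k x y * \<psi> k y" for k x y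
  have h: "h k x \<in> Cc" "0 \<le> h k x y" for k x y
    unfolding h_def by (auto intro!: Cc_mult \<psi> g_cont mult_nonneg_nonneg g_nn)
  have h_le: "ennreal (h k x y) \<le> G x y * ennreal (w y)" for k x y
  proof -
    have "ennreal (h k x y) = ennreal (g k x y) * ennreal (\<psi> k y)"
      using g_nn \<psi> by (simp add: h_def ennreal_mult)
    also have "\<dots> \<le> G x y * ennreal (w y)"
      using w cf(3) by (intro mult_mono g_le ennreal_leI) (auto simp: \<psi>_def mult_left_le)
    finally show ?thesis .
  qed
  have "(\<lambda>k. \<integral>\<^sup>+y. ennreal (h k z y) \<partial>\<mu>) \<longlonglongrightarrow> gpot \<mu> w z"
    unfolding gpot_def
  proof (rule nn_integral_LIMSEQ)
    show "incseq (\<lambda>k y. ennreal (h k z y))"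
      unfolding h_def \<psi>_def
      by (intro incseq_SucI le_funI ennreal_leI mult_mono g_mono cf mult_nonneg_nonneg g_nn w) auto
    show "(\<lambda>y. ennreal (h k z y)) \<in> borel_measurable \<mu>" for k
      using h(1)[of k z] unfolding measurable_cong_sets[OF s(1) refl]
      by (auto simp: Cc_def intro!: borel_measurable_continuous_onI[THEN measurable_compose[OF _ measurable_ennreal]])
    fix y
    have "(\<lambda>k. ennreal (g k z y)) \<longlonglongrightarrow> (SUP k. ennreal (g k z y))"
      by (intro LIMSEQ_SUP incseq_SucI ennreal_leI g_mono)
    moreover have "(SUP k. ennreal (g k z y)) = G z y"
      using lip_minorant_SUP[OF lsc, of "(z, y)"] by (simp add: g_def)
    ultimately have "(\<lambda>k. ennreal (g k z y)) \<longlonglongrightarrow> G z y" by simp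
    then have "(\<lambda>k. ennreal (g k z y) * ennreal (cf k y)) \<longlonglongrightarrow> G z y * ennreal 1"
      using cf(5)[of y] by (simp, elim Lim_transform_eventually) (auto elim!: eventually_mono)
    then have "(\<lambda>k. ennreal (w y) * (ennreal (g k z y) * ennreal (cf k y))) \<longlonglongrightarrow> ennreal (w y) * (G z y * ennreal 1)"
      by (intro ennreal_tendsto_cmult) auto
    moreover have "ennreal (w y) * (ennreal (g k z y) * ennreal (cf k y)) = ennreal (h k z y)" for k
      using g_nn w cf(2) by (simp add: h_def \<psi>_def ennreal_mult[symmetric] mult_ac)
    ultimately show "(\<lambda>k. ennreal (h k z y)) \<longlonglongrightarrow> G z y * ennreal (w y)"
      by (simp add: mult.commute)
  qed
  then have "\<forall>\<^sub>F k in sequentially. ennreal c < (\<integral>\<^sup>+y. ennreal (h k z y) \<partial>\<mu>)"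
    using c(2) by (rule order_tendstoD)
  then obtain k where k: "ennreal c < (\<integral>\<^sup>+y. ennreal (h k z y) \<partial>\<mu>)"
    by (auto simp: eventually_sequentially)
  have int: "(\<integral>\<^sup>+y. ennreal (h k x y) \<partial>\<rho>) = ennreal (\<integral>y. h k x y \<partial>\<rho>)" if "radon_measure \<rho>" for x \<rho>
    using h that by (intro nn_integral_eq_integral integrable_Cc) auto
  define J where "J = (\<integral>y. h k z y \<partial>\<mu>)"
  \<comment> \<open>A bound for the mass of the cutoff under \<open>\<nu> n\<close>, valid for large
    n; it multiplies the Lipschitz error.\<close>
  define B where "B = (\<integral>y. \<psi> k y \<partial>\<mu>) + 1"
  have B: "1 \<le> B" unfolding B_def using \<psi>(2) by (simp add: integral_nonneg_AE)
  have J: "c < J" using k c(1) unfolding int[OF \<mu>(1)] J_def[symmetric] by (simp add: ennreal_less_iff)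
  define e where "e = (J - c) / 3"
  have e: "e > 0" using J by (simp add: e_def)
  \<comment> \<open>With this radius the Lipschitz error is at most e; the summand 1 prevents
    division by 0 when k = 0. Vague convergence costs another e, and one e is left over for
    strictness.\<close>
  define d where "d = e / (real k * B + 1)"
  have kB: "0 < real k * B + 1" using B by (auto intro: add_nonneg_pos)
  have d: "d > 0" "real k * d * B \<le> e"
  proof -
    show "d > 0" using e kB by (simp add: d_def)
    have "real k * d * B = e * (real k * B) / (real k * B + 1)" by (simp add: d_def)
    also have "\<dots> \<le> e" using e kB by (subst pos_divide_le_eq) (auto simp: algebra_simps)
    finally show "real k * d * B \<le> e" .
  qed
  have "(\<lambda>n. \<integral>y. h k z y \<partial>\<nu> n) \<longlonglongrightarrow> J" "(\<lambda>n. \<integral>y. \<psi> k y \<partial>\<nu> n) \<longlonglongrightarrow> (\<integral>y. \<psi> k y \<partial>\<mu>)"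
    using \<mu>(3) h \<psi> unfolding vague_conv_def J_def by auto
  then have "\<forall>\<^sub>F n in sequentially. J - e < (\<integral>y. h k z y \<partial>\<nu> n)" "\<forall>\<^sub>F n in sequentially. (\<integral>y. \<psi> k y \<partial>\<nu> n) < B"
    using e by (auto intro!: order_tendstoD simp: B_def)
  then have "\<forall>\<^sub>F n in sequentially. \<forall>x. dist x z < d \<longrightarrow> ennreal c < gpot (\<nu> n) w x"
  proof eventually_elim
    case (elim n)
    show ?case
    proof (intro allI impI)
      fix x assume x: "dist x z < d"
      have "(\<integral>y. h k z y - real k * d * \<psi> k y \<partial>\<nu> n) \<le> (\<integral>y. h k x y \<partial>\<nu> n)"
      proof (intro integral_mono Bochner_Integration.integrable_diff integrable_mult_right integrable_Cc \<mu> h \<psi>)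
        fix y
        have "g k z y \<le> g k x y + real k * d"
          using g_lip[of k z y x] x mult_left_mono[of "dist z x" d "real k"] by (auto simp: dist_commute)
        then have "g k z y * \<psi> k y \<le> (g k x y + real k * d) * \<psi> k y" by (intro mult_right_mono \<psi>)
        then show "h k z y - real k * d * \<psi> k y \<le> h k x y" by (simp add: h_def algebra_simps)
      qed
      moreover have "(\<integral>y. h k z y - real k * d * \<psi> k y \<partial>\<nu> n)
          = (\<integral>y. h k z y \<partial>\<nu> n) - real k * d * (\<integral>y. \<psi> k y \<partial>\<nu> n)"
        by (subst Bochner_Integration.integral_diff) (auto intro!: integrable_Cc \<mu> h \<psi>)
      moreover have "real k * d * (\<integral>y. \<psi> k y \<partial>\<nu> n) \<le> real k * d * B"
        using elim(2) d by (intro mult_left_mono) auto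
      moreover have "c = J - 3 * e" by (simp add: e_def field_simps)
      ultimately have "c < (\<integral>y. h k x y \<partial>\<nu> n)" using elim(1) d(2) e by linarith
      then have "ennreal c < ennreal (\<integral>y. h k x y \<partial>\<nu> n)" using c(1) by (simp add: ennreal_less_iff)
      also have "\<dots> = (\<integral>\<^sup>+y. ennreal (h k x y) \<partial>\<nu> n)" by (simp add: int \<mu>)
      also have "\<dots> \<le> gpot (\<nu> n) w x" unfolding gpot_def by (intro nn_integral_mono h_le)
      finally show "ennreal c < gpot (\<nu> n) w x" .
    qed
  qed
  then show ?thesis using d by blast
qed

text \<open>Semicontinuity bounds limits only from below. Applied to u and to 1 - u, whose
  potentials add up to the uniformly convergent potential of 1, it also yields the upper bound.
  Compactness makes the local estimates uniform, and outside a compact set everything is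
  small.\<close>

lemma gpot_uniform:
  assumes \<mu>: "kato_measure \<mu>" "\<And>n. kato_measure (\<nu> n)" "vague_conv \<nu> \<mu>"
    and one: "uniform_limit UNIV (\<lambda>n x. enn2real (gpot (\<nu> n) (\<lambda>_. 1) x)) (\<lambda>x. enn2real (gpot \<mu> (\<lambda>_. 1) x)) sequentially"
    and u: "continuous_on UNIV u" "\<And>y. 0 \<le> u y" "\<And>y. u y \<le> 1"
  shows "uniform_limit UNIV (\<lambda>n x. enn2real (gpot (\<nu> n) u x)) (\<lambda>x. enn2real (gpot \<mu> u x)) sequentially"
proof -
  have r: "radon_measure \<mu>" "\<And>n. radon_measure (\<nu> n)" using \<mu> by (auto simp: kato_measure_def)
  have s: "sets \<mu> = sets borel" "\<And>n. sets (\<nu> n) = sets borel" using r by (auto simp: radon_measure_def)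
  have um: "u \<in> borel_measurable borel" by (rule borel_measurable_continuous_onI[OF u(1)])
  let ?v = "\<lambda>y. 1 - u y"
  define a where "a x = enn2real (gpot \<mu> u x)" for x
  define b where "b x = enn2real (gpot \<mu> ?v x)" for x
  define t where "t x = enn2real (gpot \<mu> (\<lambda>_. 1) x)" for x
  define an where "an n x = enn2real (gpot (\<nu> n) u x)" for n x
  define bn where "bn n x = enn2real (gpot (\<nu> n) ?v x)" for n x
  define tn where "tn n x = enn2real (gpot (\<nu> n) (\<lambda>_. 1) x)" for n x
  have vm: "?v \<in> borel_measurable borel" "\<And>y. 0 \<le> ?v y" "\<And>y. ?v y \<le> 1" using um u by auto
  have split: "enn2real (gpot \<rho> u x) + enn2real (gpot \<rho> ?v x) = enn2real (gpot \<rho> (\<lambda>_. 1) x)"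
    if "kato_measure \<rho>" for \<rho> x
  proof -
    have "gpot \<rho> (\<lambda>y. u y + ?v y) x = gpot \<rho> u x + gpot \<rho> ?v x"
      using that um vm u(2) by (intro gpot_add) (auto simp: kato_measure_def radon_measure_def)
    then show ?thesis
      using gpot_C0(2)[OF that um u(2,3), of x] gpot_C0(2)[OF that vm, of x] by (simp add: enn2real_plus)
  qed
  have ab: "a x + b x = t x" "an n x + bn n x = tn n x" for n x
    unfolding a_def b_def t_def an_def bn_def tn_def by (intro split \<mu>)+
  have a: "a \<in> C0" unfolding a_def by (rule gpot_C0(1)[OF \<mu>(1) um u(2,3)])
  have t: "t \<in> C0" using \<mu>(1) unfolding t_def kato_measure_def by auto
  have nn: "0 \<le> a x" "0 \<le> b x" "0 \<le> an n x" "0 \<le> bn n x" for n x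
    by (auto simp: a_def b_def an_def bn_def)
  have lower: "\<exists>d>0. \<forall>\<^sub>F n in sequentially. \<forall>x. dist x z < d \<longrightarrow>
      enn2real (gpot \<mu> w z) - e \<le> enn2real (gpot (\<nu> n) w x)"
    if w: "continuous_on UNIV w" "\<And>y. 0 \<le> w y" "\<And>y. w y \<le> 1" and e: "0 < e" for w z e
  proof (cases "enn2real (gpot \<mu> w z) < e")
    case True
    then have "enn2real (gpot \<mu> w z) - e \<le> enn2real (gpot (\<nu> n) w x)" for n x
      by (smt (verit) enn2real_nonneg)
    then show ?thesis by (intro exI[of _ 1]) auto
  next
    case False
    have wm: "w \<in> borel_measurable borel" by (rule borel_measurable_continuous_onI[OF w(1)])
    have fin: "gpot \<mu> w z < \<infinity>" "gpot (\<nu> n) w x < \<infinity>" for n x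
      by (intro gpot_C0(2)[OF _ wm w(2,3)] \<mu>)+
    have "ennreal (enn2real (gpot \<mu> w z) - e) < ennreal (enn2real (gpot \<mu> w z))"
      using e False by (intro ennreal_lessI) auto
    also have "\<dots> = gpot \<mu> w z" using fin by simp
    finally have *: "ennreal (enn2real (gpot \<mu> w z) - e) < gpot \<mu> w z" .
    have "0 \<le> enn2real (gpot \<mu> w z) - e" using False by simp
    from gpot_lower_bound[OF r \<mu>(3) w(1,2) this *] obtain d where d: "d > 0" "\<forall>\<^sub>F n in sequentially. \<forall>x. dist x z < d \<longrightarrow>
        ennreal (enn2real (gpot \<mu> w z) - e) < gpot (\<nu> n) w x"
      by blast
    have imp: "enn2real (gpot \<mu> w z) - e \<le> enn2real (gpot (\<nu> n) w x)"
      if "ennreal (enn2real (gpot \<mu> w z) - e) < gpot (\<nu> n) w x" for n x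
      using enn2real_mono[OF less_imp_le[OF that]] fin(2)[of n x] False by simp
    show ?thesis using d imp by (intro exI[of _ d]) (auto elim!: eventually_mono)
  qed
  have local: "\<exists>d>0. \<forall>\<^sub>F n in sequentially. \<forall>x. dist x z < d \<longrightarrow> \<bar>an n x - a x\<bar> \<le> 4 * e"
    if e: "0 < e" for z e
  proof -
    obtain d1 where d1: "d1 > 0" "\<forall>\<^sub>F n in sequentially. \<forall>x. dist x z < d1 \<longrightarrow> a z - e \<le> an n x"
      using lower[OF u e] unfolding a_def an_def by blast
    have vc: "continuous_on UNIV ?v" using u(1) by (intro continuous_intros)
    obtain d2 where d2: "d2 > 0" "\<forall>\<^sub>F n in sequentially. \<forall>x. dist x z < d2 \<longrightarrow> b z - e \<le> bn n x"
      using lower[OF vc vm(2,3) e] unfolding b_def bn_def by blast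
    have "continuous_on UNIV a" "continuous_on UNIV t" using a t by (auto simp: C0_def)
    then obtain d3 d4 where d34: "d3 > 0" "\<And>x. dist x z < d3 \<Longrightarrow> dist (a x) (a z) < e"
       "d4 > 0" "\<And>x. dist x z < d4 \<Longrightarrow> dist (t x) (t z) < e"
      using e unfolding continuous_on_iff by (metis UNIV_I)
    have "\<forall>\<^sub>F n in sequentially. \<forall>x\<in>UNIV. dist (tn n x) (t x) < e"
      using one e unfolding t_def tn_def by (intro uniform_limitD) auto
    \<comment> \<open>The upper estimate is the expensive one: an x = tn x - bn x is at most t x + e
      - (b z - e), and replacing t x by t z and then a z by a x costs e each, 4 e in total.\<close>
    with d1(2) d2(2) have "\<forall>\<^sub>F n in sequentially. \<forall>x. dist x z < Min {d1, d2, d3, d4} \<longrightarrow> \<bar>an n x - a x\<bar> \<le> 4 * e"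
    proof eventually_elim
      case (elim n)
      show ?case
      proof (intro allI impI)
        fix x assume x: "dist x z < Min {d1, d2, d3, d4}"
        have "dist (tn n x) (t x) < e" using elim by simp
        moreover have "a z - e \<le> an n x" "b z - e \<le> bn n x" using x elim(1,2) by auto
        moreover have "dist (a x) (a z) < e" "dist (t x) (t z) < e" using x d34 by auto
        ultimately show "\<bar>an n x - a x\<bar> \<le> 4 * e"
          using ab(1)[of x] ab(1)[of z] ab(2)[of n x] unfolding dist_real_def by linarith
      qed
    qed
    then show ?thesis using d1(1) d2(1) d34(1,3) by (intro exI[of _ "Min {d1, d2, d3, d4}"]) auto
  qed
  show ?thesis
    unfolding a_def[symmetric] an_def[symmetric]
  proof (rule uniform_limitI)
    fix e' :: real assume "0 < e'"
    define e where "e = e' / 5"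
    have e: "0 < e" using \<open>0 < e'\<close> by (simp add: e_def)
    obtain K where K: "compact K" "\<And>x. x \<notin> K \<Longrightarrow> \<bar>t x\<bar> < e" using t e unfolding C0_def by auto
    obtain d where d: "\<And>z. d z > 0" "\<And>z. \<forall>\<^sub>F n in sequentially. \<forall>x. dist x z < d z \<longrightarrow> \<bar>an n x - a x\<bar> \<le> 4 * e"
    proof -
      have "\<forall>z. \<exists>d>0. \<forall>\<^sub>F n in sequentially. \<forall>x. dist x z < d \<longrightarrow> \<bar>an n x - a x\<bar> \<le> 4 * e"
        using local[OF e] by blast
      from choice[OF this] show thesis using that by blast
    qed
    obtain Z where Z: "finite Z" "K \<subseteq> (\<Union>z\<in>Z. ball z (d z))"
    proof (rule compactE_image[OF K(1), of K "\<lambda>z. ball z (d z)"])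
      show "K \<subseteq> (\<Union>z\<in>K. ball z (d z))" using d(1) by auto
    qed (auto intro: that)
    have "\<forall>\<^sub>F n in sequentially. \<forall>z\<in>Z. \<forall>x. dist x z < d z \<longrightarrow> \<bar>an n x - a x\<bar> \<le> 4 * e"
      using Z(1) d(2) by (intro eventually_ball_finite) auto
    moreover have "\<forall>\<^sub>F n in sequentially. \<forall>x\<in>UNIV. dist (tn n x) (t x) < e"
      using one e unfolding t_def tn_def by (intro uniform_limitD) auto
    ultimately show "\<forall>\<^sub>F n in sequentially. \<forall>x\<in>UNIV. dist (an n x) (a x) < e'"
    proof eventually_elim
      case (elim n)
      show ?case
      proof
        fix x
        have "\<bar>an n x - a x\<bar> \<le> 4 * e"
        proof (cases "x \<in> K")
          case True
          then show ?thesis using Z(2) elim(1) by (auto simp: dist_commute)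
        next
          case False
          \<comment> \<open>Off K the total t x is below e and tn n x below 2 e; a x and an n x lie
            between 0 and these totals.\<close>
          have "dist (tn n x) (t x) < e" using elim(2) by simp
          then show ?thesis using K(2)[OF False] ab(1)[of x] ab(2)[of n x] nn(1,2)[where x = x] nn(3,4)[where n = n and x = x]
            unfolding dist_real_def by linarith
        qed
        then show "dist (an n x) (a x) < e'" using \<open>0 < e'\<close> by (simp add: dist_real_def e_def)
      qed
    qed
  qed
qed

end

section \<open>The strong Markov property for path functionals\<close>

lemma space_borel_cem [simp]: "space borel_cem = UNIV"
  by (simp add: borel_cem_def)

lemma sets_borel_cem: "sets borel_cem = sigma_sets UNIV {U. openin cem_top U}"
  by (simp add: borel_cem_def)

lemma open_Some_borel_cem: "open U \<Longrightarrow> Some ` U \<in> sets borel_cem"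
  unfolding sets_borel_cem by (intro sigma_sets.Basic) simp

lemma Some_borel_cem: "B \<in> sets borel \<Longrightarrow> Some ` B \<in> sets borel_cem"
proof -
  assume "B \<in> sets borel"
  then have "B \<in> sigma_sets UNIV {S. open S}" by (simp add: borel_def)
  then show "Some ` B \<in> sets borel_cem"
  proof (induction rule: sigma_sets.induct)
    case (Compl B)
    have "Some ` (UNIV - B) = Some ` UNIV - Some ` B" by auto
    then show ?case using Compl open_Some_borel_cem[of UNIV] by (auto simp del: image_diff_subset)
  next
    case (Union A)
    then show ?case by (auto simp: image_UN)
  qed (auto intro: open_Some_borel_cem)
qed

lemma None_borel_cem [measurable]: "{None} \<in> sets borel_cem"
proof -
  have "{None} = space borel_cem - Some ` UNIV" by (auto simp: image_iff)
  then show ?thesis using open_Some_borel_cem[of UNIV] by (metis open_UNIV sets.compl_sets)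
qed

text \<open>An open set containing the cemetery is the complement of a closed subset of the state
  space, so its preimage is obtained from preimages of open sets by taking differences.\<close>

lemma measurable_borel_cemI:
  fixes f :: "'b \<Rightarrow> 'a::t2_space option"
  assumes "\<And>U. open U \<Longrightarrow> f -` (Some ` U) \<inter> space M \<in> sets M"
  shows "f \<in> measurable M borel_cem"
  unfolding borel_cem_def
proof (rule measurable_measure_of)
  fix V :: "'a option set" assume "V \<in> {U. openin cem_top U}"
  then consider U where "open U" "V = Some ` U" | C where "closed C" "V = insert None (Some ` (- C))"
    by (auto simp: openin_Alexandroff_compactification Compl_eq_Diff_UNIV)
  then show "f -` V \<inter> space M \<in> sets M"
  proof cases
    case 1
    then show ?thesis using assms by simp
  next
    case 2
    have "f -` V \<inter> space M = space M - (f -` (Some ` UNIV) \<inter> space M - f -` (Some ` (- C)) \<inter> space M)"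
      unfolding 2 by (auto simp: image_iff)
    also have "\<dots> \<in> sets M"
      using assms[of UNIV] assms[of "- C"] 2(1) by (intro sets.Diff sets.top) auto
    finally show ?thesis .
  qed
qed auto

lemma measurable_Some [measurable]: "Some \<in> measurable borel (borel_cem :: 'a::t2_space option measure)"
  by (rule measurable_borel_cemI) (auto simp: inj_vimage_image_eq)

text \<open>The cemetery is a measurable point, so the value there is arbitrary; in particular
  functions extended by 0 remain measurable even if they do not vanish at infinity.\<close>

lemma measurable_from_borel_cem:
  assumes "(\<lambda>x. g (Some x)) \<in> measurable borel M" "g None \<in> space M"
  shows "g \<in> measurable borel_cem M"
proof (rule measurableI)
  fix z show "g z \<in> space M" using assms measurable_space[OF assms(1)] by (cases z) auto
next
  fix A assume "A \<in> sets M"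
  then have "(\<lambda>x. g (Some x)) -` A \<in> sets borel" using measurable_sets[OF assms(1), of A] by simp
  moreover have "g -` A \<inter> space borel_cem = Some ` ((\<lambda>x. g (Some x)) -` A) \<union> (if g None \<in> A then {None} else {})"
  proof (intro set_eqI)
    fix z show "z \<in> g -` A \<inter> space borel_cem \<longleftrightarrow> z \<in> Some ` ((\<lambda>x. g (Some x)) -` A) \<union> (if g None \<in> A then {None} else {})"
      by (cases z) auto
  qed
  ultimately show "g -` A \<inter> space borel_cem \<in> sets borel_cem"
    by (simp only:) (intro sets.Un Some_borel_cem, auto intro: None_borel_cem)
qed

lemma measurable_ext0 [measurable (raw)]:
  "f \<in> measurable borel (borel :: 'b::{zero,topological_space} measure) \<Longrightarrow> ext0 f \<in> measurable borel_cem borel"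
  by (rule measurable_from_borel_cem) (auto simp: ext0_def)

lemma ext0_simps [simp]: "ext0 f None = 0" "ext0 f (Some x) = f x"
  by (auto simp: ext0_def)

context standard_process
begin

lemma space_Flt [simp]: "space (Flt X t) = space (Evt X)"
  by (rule space_F)

lemma space_Law [simp]: "space (Law X z) = space (Evt X)"
  using sets_eq_imp_space_eq[OF sets_law] .

lemmas measurable_Law_cong = measurable_cong_sets[OF sets_law refl]

lemma measurable_Flt_Evt: "f \<in> measurable (Flt X t) M \<Longrightarrow> f \<in> measurable (Evt X) M"
  using filt_events[of t] by (auto simp: measurable_def)

lemma measurable_Pos_Evt: "Pos X t \<in> measurable (Evt X) borel_cem"
  by (rule measurable_Flt_Evt[OF adapted])

lemma measurable_Pos_Law [measurable]: "Pos X t \<in> measurable (Law X z) borel_cem"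
  unfolding measurable_Law_cong by (rule measurable_Pos_Evt)

lemma sets_pre_sigma_Evt: "stopping_time (Flt X) T \<Longrightarrow> sets (pre_sigma T) \<subseteq> sets (Evt X)"
proof
  fix D assume T: "stopping_time (Flt X) T" and D: "D \<in> sets (pre_sigma T)"
  have "{\<omega>\<in>D. T \<omega> \<le> \<infinity>} \<in> sets (Flt X \<infinity>)" by (rule sets_pre_sigmaD[OF T D])
  then show "D \<in> sets (Evt X)" using filt_events[of \<infinity>] by auto
qed

lemma measurable_pre_sigma_Evt:
  "stopping_time (Flt X) T \<Longrightarrow> f \<in> measurable (pre_sigma T) M \<Longrightarrow> f \<in> measurable (Evt X) M"
  using sets_pre_sigma_Evt by (auto simp: measurable_def space_pre_sigma)

lemma measurable_Pos_stopping:
  "stopping_time (Flt X) T \<Longrightarrow> (\<lambda>\<omega>. Pos X (T \<omega>) \<omega>) \<in> measurable (Evt X) borel_cem"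
  by (rule measurable_pre_sigma_Evt[OF _ pos_stopping])

lemma stopping_time_add_const:
  assumes T: "stopping_time (Flt X) T"
  shows "stopping_time (Flt X) (\<lambda>\<omega>. T \<omega> + s)"
proof
  fix t
  show "Measurable.pred (Flt X t) (\<lambda>\<omega>. T \<omega> + s \<le> t)"
  proof (cases "t = \<infinity> \<or> \<not> s \<le> t")
    case True
    then show ?thesis
    proof
      assume "\<not> s \<le> t"
      then have "\<not> T \<omega> + s \<le> t" for \<omega> using order_trans[of s "T \<omega> + s" t] by auto
      then show ?thesis by simp
    qed simp
  next
    case False
    then have "T \<omega> + s \<le> t \<longleftrightarrow> T \<omega> \<le> t - s" for \<omega>
      by (auto simp: ennreal_le_minus_iff)
    moreover have "Measurable.pred (Flt X t) (\<lambda>\<omega>. T \<omega> \<le> t - s)"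
      by (intro stopping_time_le_const[OF T]) (simp add: diff_le_self_ennreal)
    ultimately show ?thesis by simp
  qed
qed

subsection \<open>One-dimensional distributions\<close>

definition law_at :: "ennreal \<Rightarrow> 'a option \<Rightarrow> 'a option measure" where
  "law_at t z = distr (Law X z) borel_cem (Pos X t)"

lemma prob_law_at: "prob_space (law_at t z)"
  unfolding law_at_def by (intro prob_space.prob_space_distr prob_law measurable_Pos_Law)

text \<open>The assumption \<open>law_borel\<close> speaks of targets and starting points in the
  state space only. Targets containing the cemetery are handled by complements, and the start at the
  cemetery is a single point.\<close>

lemma measurable_law_at: "law_at t \<in> measurable borel_cem (subprob_algebra borel_cem)"
proof (rule measurable_subprob_algebra)
  show "subprob_space (law_at t z)" for z by (rule prob_space_imp_subprob_space[OF prob_law_at])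
  show "sets (law_at t z) = sets borel_cem" for z by (simp add: law_at_def)
  fix C :: "'a option set" assume C: "C \<in> sets borel_cem"
  have S: "(\<lambda>z. emeasure (law_at t z) (Some ` B)) \<in> borel_measurable borel_cem" if "B \<in> sets borel" for B
  proof (rule measurable_from_borel_cem)
    have "emeasure (law_at t z) (Some ` B) = emeasure (Law X z) {\<omega>\<in>space (Evt X). Pos X t \<omega> \<in> Some ` B}" for z
      unfolding law_at_def using that
      by (subst emeasure_distr) (auto intro!: arg_cong[where f = "emeasure _"] Some_borel_cem)
    then show "(\<lambda>x. emeasure (law_at t (Some x)) (Some ` B)) \<in> borel_measurable borel"
      using law_borel[OF that] by simp
  qed simp
  have B: "Some -` D \<in> sets borel" if "D \<in> sets borel_cem" for D :: "'a option set"
    using measurable_sets[OF measurable_Some that] by simp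
  show "(\<lambda>z. emeasure (law_at t z) C) \<in> borel_measurable borel_cem"
  proof (cases "None \<in> C")
    case False
    then have "C = Some ` (Some -` C)" by (auto simp: image_iff) (metis not_None_eq)
    then show ?thesis using S[OF B[OF C]] by simp
  next
    case True
    then have eq: "C = UNIV - Some ` (Some -` (UNIV - C))" by (auto simp: image_iff) (metis not_None_eq)
    have m: "Some -` (UNIV - C) \<in> sets borel" using C sets.compl_sets[OF C] by (intro B) simp
    have "emeasure (law_at t z) C = 1 - emeasure (law_at t z) (Some ` (Some -` (UNIV - C)))" for z
    proof -
      interpret prob_space "law_at t z" by (rule prob_law_at)
      have "space (law_at t z) = UNIV" "sets (law_at t z) = sets borel_cem" by (simp_all add: law_at_def)
      then show ?thesis
        using emeasure_compl[of "Some ` (Some -` (UNIV - C))" "law_at t z"] emeasure_space_1 Some_borel_cem[OF m]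
        by (subst eq) simp
    qed
    then show ?thesis using S[OF m] by simp
  qed
qed

lemma measurable_nn_integral_law_at:
  "k \<in> borel_measurable borel_cem \<Longrightarrow> (\<lambda>z. \<integral>\<^sup>+\<omega>. k (Pos X t \<omega>) \<partial>Law X z) \<in> borel_measurable borel_cem"
proof -
  assume k: "k \<in> borel_measurable borel_cem"
  have "(\<lambda>z. \<integral>\<^sup>+y. k y \<partial>law_at t z) \<in> borel_measurable borel_cem"
    by (rule measurable_compose[OF measurable_law_at nn_integral_measurable_subprob_algebra[OF k]])
  then show ?thesis unfolding law_at_def using k by (simp add: nn_integral_distr)
qed

text \<open>Restriction to an event by a density keeps the space and the \<sigma>-algebra of the
  law, so that image measures and \<open>bind\<close> apply directly.\<close>

abbreviation restr :: "'w set \<Rightarrow> 'a option \<Rightarrow> 'w measure" where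
  "restr D z \<equiv> density (Law X z) (indicator D)"

lemma space_restr_nonempty: "space (restr D z) \<noteq> {}"
  using prob_space.not_empty[OF prob_law[of z]] by simp

lemma nn_integral_restr:
  "D \<in> sets (Evt X) \<Longrightarrow> f \<in> borel_measurable (Evt X) \<Longrightarrow>
    (\<integral>\<^sup>+\<omega>. f \<omega> \<partial>restr D z) = (\<integral>\<^sup>+\<omega>\<in>D. f \<omega> \<partial>Law X z)"
  by (subst nn_integral_density) (auto simp: measurable_Law_cong mult.commute sets_law)

text \<open>Read as an identity of measures in the target set, \<open>strong_markov\<close> says
  that the law of X at T + t on D is a mixture of one-time laws; integrating any k against both
  sides gives the claim.\<close>

lemma strong_markov_function:
  assumes T: "stopping_time (Flt X) T" and D: "D \<in> sets (pre_sigma T)"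
    and k: "k \<in> borel_measurable borel_cem"
  shows "(\<integral>\<^sup>+\<omega>\<in>D. k (Pos X (T \<omega> + t) \<omega>) \<partial>Law X z)
       = (\<integral>\<^sup>+\<omega>\<in>D. (\<integral>\<^sup>+\<omega>'. k (Pos X t \<omega>') \<partial>Law X (Pos X (T \<omega>) \<omega>)) \<partial>Law X z)"
proof -
  have D': "D \<in> sets (Evt X)" using D sets_pre_sigma_Evt[OF T] by auto
  note m1 = measurable_Pos_stopping[OF stopping_time_add_const[OF T, of t]]
  note m2 = measurable_Pos_stopping[OF T]
  have m1': "(\<lambda>\<omega>. Pos X (T \<omega> + t) \<omega>) \<in> measurable (restr D z) borel_cem"
    using m1 by (simp add: measurable_Law_cong cong: measurable_cong_sets)
  have m3: "(\<lambda>\<omega>. law_at t (Pos X (T \<omega>) \<omega>)) \<in> measurable (restr D z) (subprob_algebra borel_cem)"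
    using measurable_compose[OF m2 measurable_law_at] by (simp add: measurable_Law_cong cong: measurable_cong_sets)
  have eq: "distr (restr D z) borel_cem (\<lambda>\<omega>. Pos X (T \<omega> + t) \<omega>) = restr D z \<bind> (\<lambda>\<omega>. law_at t (Pos X (T \<omega>) \<omega>))"
  proof (rule measure_eqI)
    show "sets (distr (restr D z) borel_cem (\<lambda>\<omega>. Pos X (T \<omega> + t) \<omega>)) = sets (restr D z \<bind> (\<lambda>\<omega>. law_at t (Pos X (T \<omega>) \<omega>)))"
      using space_restr_nonempty by (subst sets_bind) (auto simp: law_at_def)
    fix C :: "'a option set" assume "C \<in> sets (distr (restr D z) borel_cem (\<lambda>\<omega>. Pos X (T \<omega> + t) \<omega>))"
    then have C: "C \<in> sets borel_cem" by simp
    have DC: "{\<omega>\<in>D. Pos X (T \<omega> + t) \<omega> \<in> C} \<in> sets (Evt X)"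
    proof -
      have "{\<omega>\<in>D. Pos X (T \<omega> + t) \<omega> \<in> C} = D \<inter> ((\<lambda>\<omega>. Pos X (T \<omega> + t) \<omega>) -` C \<inter> space (Evt X))"
        using sets.sets_into_space[OF D'] by auto
      then show ?thesis using D' measurable_sets[OF m1 C] by auto
    qed
    have "emeasure (distr (restr D z) borel_cem (\<lambda>\<omega>. Pos X (T \<omega> + t) \<omega>)) C
        = emeasure (restr D z) ((\<lambda>\<omega>. Pos X (T \<omega> + t) \<omega>) -` C \<inter> space (Evt X))"
      using C m1' by (subst emeasure_distr) auto
    also have "\<dots> = (\<integral>\<^sup>+\<omega>. indicator {\<omega>\<in>D. Pos X (T \<omega> + t) \<omega> \<in> C} \<omega> \<partial>Law X z)"
      using D' measurable_sets[OF m1 C]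
      by (subst emeasure_density) (auto simp: sets_law measurable_Law_cong intro!: nn_integral_cong split: split_indicator)
    also have "\<dots> = emeasure (Law X z) {\<omega>\<in>D. Pos X (T \<omega> + t) \<omega> \<in> C}"
      using DC by (simp add: sets_law)
    also have "\<dots> = (\<integral>\<^sup>+\<omega>\<in>D. emeasure (Law X (Pos X (T \<omega>) \<omega>)) {\<omega>'\<in>space (Evt X). Pos X t \<omega>' \<in> C} \<partial>Law X z)"
      by (rule strong_markov[OF T D C])
    also have "\<dots> = (\<integral>\<^sup>+\<omega>\<in>D. emeasure (law_at t (Pos X (T \<omega>) \<omega>)) C \<partial>Law X z)"
      unfolding law_at_def using C
      by (subst emeasure_distr) (auto simp: vimage_def Int_def conj_commute)
    also have "\<dots> = emeasure (restr D z \<bind> (\<lambda>\<omega>. law_at t (Pos X (T \<omega>) \<omega>))) C"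
      using C measurable_compose[OF m2 measurable_compose[OF measurable_law_at measurable_emeasure_subprob_algebra[OF C]]]
      by (subst emeasure_bind[OF space_restr_nonempty m3 C], subst nn_integral_restr[OF D']) auto
    finally show "emeasure (distr (restr D z) borel_cem (\<lambda>\<omega>. Pos X (T \<omega> + t) \<omega>)) C
        = emeasure (restr D z \<bind> (\<lambda>\<omega>. law_at t (Pos X (T \<omega>) \<omega>))) C" .
  qed
  have "(\<integral>\<^sup>+\<omega>\<in>D. k (Pos X (T \<omega> + t) \<omega>) \<partial>Law X z)
      = (\<integral>\<^sup>+y. k y \<partial>distr (restr D z) borel_cem (\<lambda>\<omega>. Pos X (T \<omega> + t) \<omega>))"
    using k m1' measurable_compose[OF m1 k] by (subst nn_integral_distr) (auto simp: nn_integral_restr[OF D'])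
  also have "\<dots> = (\<integral>\<^sup>+\<omega>. \<integral>\<^sup>+y. k y \<partial>law_at t (Pos X (T \<omega>) \<omega>) \<partial>restr D z)"
    unfolding eq by (rule nn_integral_bind[OF k m3])
  also have "\<dots> = (\<integral>\<^sup>+\<omega>. (\<integral>\<^sup>+\<omega>'. k (Pos X t \<omega>') \<partial>Law X (Pos X (T \<omega>) \<omega>)) \<partial>restr D z)"
    unfolding law_at_def using k by (subst nn_integral_distr) auto
  also have "\<dots> = (\<integral>\<^sup>+\<omega>\<in>D. (\<integral>\<^sup>+\<omega>'. k (Pos X t \<omega>') \<partial>Law X (Pos X (T \<omega>) \<omega>)) \<partial>Law X z)"
    by (rule nn_integral_restr[OF D' measurable_compose[OF m2 measurable_nn_integral_law_at[OF k]]])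
  finally show ?thesis .
qed

subsection \<open>Cylinder sets\<close>

definition cyl :: "ennreal set \<Rightarrow> (ennreal \<Rightarrow> 'a option set) \<Rightarrow> 'w set" where
  "cyl J B = {\<omega>\<in>space (Evt X). \<forall>s\<in>J. Pos X s \<omega> \<in> B s}"

lemma Pos_zero: "(\<integral>\<^sup>+\<omega>. f (Pos X 0 \<omega>) \<partial>Law X z) = f z"
proof -
  have "(\<integral>\<^sup>+\<omega>. f (Pos X 0 \<omega>) \<partial>Law X z) = (\<integral>\<^sup>+\<omega>. f z \<partial>Law X z)"
    using normal[of z] by (intro nn_integral_cong_AE) (auto elim!: eventually_mono)
  also have "\<dots> = f z" using prob_space.emeasure_space_1[OF prob_law[of z]] by simp
  finally show ?thesis .
qed

text \<open>Induction on the number of times: the smallest time s0 is split off, the constraint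
  there is added to the event D, and the induction hypothesis is applied at the stopping time T + s0
  with all other times reduced by s0. Measurability in the starting point is carried along because
  it makes the inner probability an admissible integrand for the one-time property.\<close>

lemma cyl_markov_aux:
  assumes "finite J" "\<And>s. B s \<in> sets borel_cem"
  shows "(\<lambda>z. emeasure (Law X z) (cyl J B)) \<in> borel_measurable borel_cem \<and>
    (\<forall>T D z. stopping_time (Flt X) T \<longrightarrow> D \<in> sets (pre_sigma T) \<longrightarrow>
      emeasure (Law X z) {\<omega>\<in>D. \<forall>s\<in>J. Pos X (T \<omega> + s) \<omega> \<in> B s}
      = (\<integral>\<^sup>+\<omega>\<in>D. emeasure (Law X (Pos X (T \<omega>) \<omega>)) (cyl J B) \<partial>Law X z))"
  using assms
proof (induction "card J" arbitrary: J B rule: less_induct)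
  case less
  show ?case
  proof (cases "J = {}")
    case True
    have "emeasure (Law X z) (cyl J B) = 1" for z
      using prob_space.emeasure_space_1[OF prob_law[of z]] True by (simp add: cyl_def)
    moreover have "D \<in> sets (Law X z)" if "stopping_time (Flt X) T" "D \<in> sets (pre_sigma T)" for T D z
      using that sets_pre_sigma_Evt by (auto simp: sets_law)
    ultimately show ?thesis using True by simp
  next
    case False
    define s0 where "s0 = Min J"
    define J' where "J' = (\<lambda>s. s - s0) ` (J - {s0})"
    define B' where "B' r = B (s0 + r)" for r
    have s0: "s0 \<in> J" "\<And>s. s \<in> J \<Longrightarrow> s0 \<le> s" using False less.prems(1) by (auto simp: s0_def)
    have "card J' \<le> card (J - {s0})" unfolding J'_def using less.prems(1) by (intro card_image_le) auto
    also have "\<dots> < card J" using s0 less.prems(1) by (intro psubset_card_mono) auto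
    finally have card: "card J' < card J" .
    have J': "finite J'" using less.prems(1) by (simp add: J'_def)
    have B': "B' s \<in> sets borel_cem" for s by (simp add: B'_def less.prems)
    note IH = less.hyps[of J' B', OF card J' B']
    define k where "k y = indicator (B s0) y * emeasure (Law X y) (cyl J' B')" for y
    have k: "k \<in> borel_measurable borel_cem"
      unfolding k_def using IH[THEN conjunct1] less.prems(2)[of s0] by (intro borel_measurable_times_ennreal borel_measurable_indicator)
    have set_eq: "(\<forall>s\<in>J. Pos X (t + s) \<omega> \<in> B s) \<longleftrightarrow>
        Pos X (t + s0) \<omega> \<in> B s0 \<and> (\<forall>r\<in>J'. Pos X (t + s0 + r) \<omega> \<in> B' r)" for t \<omega>
    proof -
      have a: "t + s0 + (s - s0) = t + s" if "s \<in> J" for s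
        using s0(2)[OF that] by (simp only: add.assoc add_diff_inverse_ennreal)
      have b: "B' (s - s0) = B s" if "s \<in> J" for s
        using s0(2)[OF that] by (simp only: B'_def add_diff_inverse_ennreal)
      have "(\<forall>r\<in>J'. Pos X (t + s0 + r) \<omega> \<in> B' r) \<longleftrightarrow> (\<forall>s\<in>J - {s0}. Pos X (t + s0 + (s - s0)) \<omega> \<in> B' (s - s0))"
        unfolding J'_def by blast
      also have "\<dots> \<longleftrightarrow> (\<forall>s\<in>J - {s0}. Pos X (t + s) \<omega> \<in> B s)"
        using a b by (intro ball_cong refl) (simp only: Diff_iff)
      finally show ?thesis using s0(1) by blast
    qed
    have half: "emeasure (Law X z) {\<omega>\<in>D. \<forall>s\<in>J. Pos X (T \<omega> + s) \<omega> \<in> B s}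
      = (\<integral>\<^sup>+\<omega>\<in>D. (\<integral>\<^sup>+\<omega>'. k (Pos X s0 \<omega>') \<partial>Law X (Pos X (T \<omega>) \<omega>)) \<partial>Law X z)"
      if T: "stopping_time (Flt X) T" and D: "D \<in> sets (pre_sigma T)" for T D z
    proof -
      define D' where "D' = {\<omega>\<in>D. Pos X (T \<omega> + s0) \<omega> \<in> B s0}"
      note T' = stopping_time_add_const[OF T, of s0]
      have DO: "D \<subseteq> space (Evt X)" using sets.sets_into_space[OF D] by (simp add: space_pre_sigma)
      have "D \<in> sets (pre_sigma (\<lambda>\<omega>. T \<omega> + s0))"
        using mono_pre_sigma[OF T T'] D by auto
      moreover have "D' = D \<inter> ((\<lambda>\<omega>. Pos X (T \<omega> + s0) \<omega>) -` B s0 \<inter> space (pre_sigma (\<lambda>\<omega>. T \<omega> + s0)))"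
        using DO by (auto simp: D'_def space_pre_sigma)
      ultimately have D': "D' \<in> sets (pre_sigma (\<lambda>\<omega>. T \<omega> + s0))"
        using measurable_sets[OF pos_stopping[OF T'] less.prems(2)[of s0]] by auto
      have "{\<omega>\<in>D. \<forall>s\<in>J. Pos X (T \<omega> + s) \<omega> \<in> B s} = {\<omega>\<in>D'. \<forall>r\<in>J'. Pos X (T \<omega> + s0 + r) \<omega> \<in> B' r}"
        unfolding D'_def set_eq by auto
      then have "emeasure (Law X z) {\<omega>\<in>D. \<forall>s\<in>J. Pos X (T \<omega> + s) \<omega> \<in> B s}
          = (\<integral>\<^sup>+\<omega>\<in>D'. emeasure (Law X (Pos X (T \<omega> + s0) \<omega>)) (cyl J' B') \<partial>Law X z)"
        using IH[THEN conjunct2, rule_format, OF T' D', of z] by simp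
      also have "\<dots> = (\<integral>\<^sup>+\<omega>\<in>D. k (Pos X (T \<omega> + s0) \<omega>) \<partial>Law X z)"
        by (intro nn_integral_cong) (auto simp: D'_def k_def split: split_indicator)
      also have "\<dots> = (\<integral>\<^sup>+\<omega>\<in>D. (\<integral>\<^sup>+\<omega>'. k (Pos X s0 \<omega>') \<partial>Law X (Pos X (T \<omega>) \<omega>)) \<partial>Law X z)"
        by (rule strong_markov_function[OF T D k])
      finally show ?thesis .
    qed
    \<comment> \<open>The constant stopping time 0 turns the formula just proved into one for the
      cylinder probability itself, from which its measurability is read off.\<close>
    have one: "emeasure (Law X z) (cyl J B) = (\<integral>\<^sup>+\<omega>'. k (Pos X s0 \<omega>') \<partial>Law X z)" for z
    proof -
      have "space (Evt X) \<in> sets (pre_sigma (\<lambda>_. 0))" using sets.top[of "pre_sigma (\<lambda>_. 0)"] by (simp add: space_pre_sigma)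
      from half[OF stopping_time_const this, of z]
      have "emeasure (Law X z) (cyl J B)
          = (\<integral>\<^sup>+\<omega>\<in>space (Evt X). (\<integral>\<^sup>+\<omega>'. k (Pos X s0 \<omega>') \<partial>Law X (Pos X 0 \<omega>)) \<partial>Law X z)"
        by (simp add: cyl_def)
      also have "\<dots> = (\<integral>\<^sup>+\<omega>. (\<integral>\<^sup>+\<omega>'. k (Pos X s0 \<omega>') \<partial>Law X (Pos X 0 \<omega>)) \<partial>Law X z)"
        by (intro nn_integral_cong) simp
      also have "\<dots> = (\<integral>\<^sup>+\<omega>'. k (Pos X s0 \<omega>') \<partial>Law X z)" by (rule Pos_zero)
      finally show ?thesis .
    qed
    show ?thesis
      unfolding one using half measurable_nn_integral_law_at[OF k] by auto
  qed
qed

lemma cyl_markov: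
  assumes "finite J" "\<And>s. B s \<in> sets borel_cem"
  shows measurable_cyl: "(\<lambda>z. emeasure (Law X z) (cyl J B)) \<in> borel_measurable borel_cem"
    and strong_markov_cyl: "stopping_time (Flt X) T \<Longrightarrow> D \<in> sets (pre_sigma T) \<Longrightarrow>
      emeasure (Law X z) {\<omega>\<in>D. \<forall>s\<in>J. Pos X (T \<omega> + s) \<omega> \<in> B s}
      = (\<integral>\<^sup>+\<omega>\<in>D. emeasure (Law X (Pos X (T \<omega>) \<omega>)) (cyl J B) \<partial>Law X z)"
  using cyl_markov_aux[of J B, OF assms] by blast+


subsection \<open>Functionals of the path\<close>

lemma space_nat_filt [simp]: "space (nat_filt X t) = space (Evt X)"
  unfolding nat_filt_def by (subst space_measure_of_conv) simp

lemma sets_nat_filt: "sets (nat_filt X t) = sigma_sets (space (Evt X))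
    {Pos X s -` B \<inter> space (Evt X) | s B. s \<le> t \<and> B \<in> sets borel_cem}"
  unfolding nat_filt_def by (subst sets_measure_of) auto

lemma sets_nat_filt_Flt: "sets (nat_filt X t) \<subseteq> sets (Flt X t)"
  unfolding sets_nat_filt space_Flt[of t, symmetric]
proof (rule sets.sigma_sets_subset, clarsimp simp del: space_Flt)
  fix s and B :: "'a option set" assume "s \<le> t" "B \<in> sets borel_cem"
  then show "Pos X s -` B \<inter> space (Flt X t) \<in> sets (Flt X t)"
    using measurable_sets[OF adapted[of s], of B] sets_F_mono[of s t] by auto
qed

lemma sets_nat_filt_Evt: "sets (nat_filt X t) \<subseteq> sets (Evt X)"
  using sets_nat_filt_Flt filt_events by blast

lemma measurable_Pos_nat_filt: "Pos X s \<in> measurable (nat_filt X \<infinity>) borel_cem"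
  unfolding measurable_def sets_nat_filt by auto

lemma Int_stable_cyl: "Int_stable {cyl J B | J B. finite J \<and> (\<forall>s. B s \<in> sets borel_cem)}"
  unfolding Int_stable_def
proof safe
  fix J J' :: "ennreal set" and B B' :: "ennreal \<Rightarrow> 'a option set"
  assume *: "finite J" "finite J'" "\<forall>s. B s \<in> sets borel_cem" "\<forall>s. B' s \<in> sets borel_cem"
  let ?B = "\<lambda>s. (if s \<in> J then B s else UNIV) \<inter> (if s \<in> J' then B' s else UNIV)"
  have "UNIV \<in> sets (borel_cem :: 'a option measure)" using sets.top[of borel_cem] by simp
  then have "?B s \<in> sets borel_cem" for s using * by (intro sets.Int) auto
  moreover have "cyl J B \<inter> cyl J' B' = cyl (J \<union> J') ?B" by (auto simp: cyl_def)
  ultimately show "\<exists>K C. cyl J B \<inter> cyl J' B' = cyl K C \<and> finite K \<and> (\<forall>s. C s \<in> sets borel_cem)"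
    using * by (intro exI[of _ "J \<union> J'"] exI[of _ ?B]) auto
qed

lemma sets_nat_filt_cyl: "sets (nat_filt X \<infinity>)
  = sigma_sets (space (Evt X)) {cyl J B | J B. finite J \<and> (\<forall>s. B s \<in> sets borel_cem)}" (is "_ = sigma_sets _ ?C")
proof (rule antisym)
  show "sets (nat_filt X \<infinity>) \<subseteq> sigma_sets (space (Evt X)) ?C"
    unfolding sets_nat_filt
  proof (rule sigma_sets_mono, safe)
    fix s and B :: "'a option set" assume "B \<in> sets borel_cem"
    then show "Pos X s -` B \<inter> space (Evt X) \<in> sigma_sets (space (Evt X)) ?C"
      by (intro sigma_sets.Basic CollectI exI[of _ "{s}"] exI[of _ "\<lambda>_. B"]) (auto simp: cyl_def)
  qed
  have "cyl J B \<in> sets (nat_filt X \<infinity>)" if "finite J" "\<forall>s. B s \<in> sets borel_cem" for J B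
  proof -
    have "{\<omega>\<in>space (nat_filt X \<infinity>). Pos X s \<omega> \<in> B s} \<in> sets (nat_filt X \<infinity>)" for s
      using measurable_sets[OF measurable_Pos_nat_filt, of "B s" s] that by (simp add: vimage_def Int_def conj_commute)
    then have "{\<omega>\<in>space (nat_filt X \<infinity>). \<forall>s\<in>J. Pos X s \<omega> \<in> B s} \<in> sets (nat_filt X \<infinity>)"
      using that by (intro sets.sets_Collect_finite_All) auto
    then show ?thesis by (simp add: cyl_def)
  qed
  then show "sigma_sets (space (Evt X)) ?C \<subseteq> sets (nat_filt X \<infinity>)"
    using sets.sigma_sets_subset[of ?C "nat_filt X \<infinity>"] by auto
qed

text \<open>On the natural \<sigma>-algebra, which the cylinders generate, the dependence on the
  starting point is Borel; on \<open>Evt X\<close> the laws are only universally measurable.\<close>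

definition path_law :: "'a option \<Rightarrow> 'w measure" where
  "path_law z = distr (Law X z) (nat_filt X \<infinity>) (\<lambda>\<omega>. \<omega>)"

lemma measurable_id_path: "(\<lambda>\<omega>. \<omega>) \<in> measurable (Law X z) (nat_filt X \<infinity>)"
proof (rule measurableI)
  fix E assume E: "E \<in> sets (nat_filt X \<infinity>)"
  then have "E \<subseteq> space (Evt X)" using sets.sets_into_space by fastforce
  then have "(\<lambda>\<omega>. \<omega>) -` E \<inter> space (Law X z) = E" by auto
  then show "(\<lambda>\<omega>. \<omega>) -` E \<inter> space (Law X z) \<in> sets (Law X z)"
    using E sets_nat_filt_Evt by (auto simp: sets_law)
qed simp

lemma emeasure_path_law: "E \<in> sets (nat_filt X \<infinity>) \<Longrightarrow> emeasure (path_law z) E = emeasure (Law X z) E"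
proof -
  assume E: "E \<in> sets (nat_filt X \<infinity>)"
  then have "E \<subseteq> space (Evt X)" using sets.sets_into_space by fastforce
  then show ?thesis unfolding path_law_def using E by (subst emeasure_distr[OF measurable_id_path]) (auto simp: Int_absorb2)
qed

lemma nn_integral_path_law:
  "\<Phi> \<in> borel_measurable (nat_filt X \<infinity>) \<Longrightarrow> (\<integral>\<^sup>+\<omega>. \<Phi> \<omega> \<partial>path_law z) = (\<integral>\<^sup>+\<omega>. \<Phi> \<omega> \<partial>Law X z)"
  unfolding path_law_def by (subst nn_integral_distr[OF measurable_id_path]) auto

lemma measurable_path_law: "path_law \<in> measurable borel_cem (subprob_algebra (nat_filt X \<infinity>))"
proof (rule measurable_prob_algebraD[OF measurable_prob_algebra_generated[OF sets_nat_filt_cyl Int_stable_cyl]])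
  show "{cyl J B |J B. finite J \<and> (\<forall>s. B s \<in> sets borel_cem)} \<subseteq> Pow (space (Evt X))" by (auto simp: cyl_def)
  show "prob_space (path_law z)" for z
    unfolding path_law_def by (intro prob_space.prob_space_distr prob_law measurable_id_path)
  show "sets (path_law z) = sets (nat_filt X \<infinity>)" for z by (simp add: path_law_def)
  fix E assume E: "E \<in> {cyl J B |J B. finite J \<and> (\<forall>s. B s \<in> sets borel_cem)}"
  then have "E \<in> sets (nat_filt X \<infinity>)" unfolding sets_nat_filt_cyl by (rule sigma_sets.Basic)
  then show "(\<lambda>z. emeasure (path_law z) E) \<in> borel_measurable borel_cem"
    using E by (auto simp: emeasure_path_law intro: measurable_cyl)
qed

lemma measurable_expectation:
  assumes "\<Phi> \<in> borel_measurable (nat_filt X \<infinity>)"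
  shows "(\<lambda>z. \<integral>\<^sup>+\<omega>. \<Phi> \<omega> \<partial>Law X z) \<in> borel_measurable borel_cem"
  using measurable_compose[OF measurable_path_law nn_integral_measurable_subprob_algebra[OF assms]]
  by (simp add: nn_integral_path_law[OF assms])

lemma measurable_Shift:
  assumes T: "stopping_time (Flt X) T"
  shows "(\<lambda>\<omega>. Shift X (T \<omega>) \<omega>) \<in> measurable (Evt X) (nat_filt X \<infinity>)"
  unfolding nat_filt_def
proof (rule measurable_measure_of)
  show "(\<lambda>\<omega>. Shift X (T \<omega>) \<omega>) \<in> space (Evt X) \<rightarrow> space (Evt X)" by (auto intro: shift_space)
  fix E assume "E \<in> {Pos X s -` B \<inter> space (Evt X) | s B. s \<le> \<infinity> \<and> B \<in> sets borel_cem}"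
  then obtain s B where E: "E = Pos X s -` B \<inter> space (Evt X)" "B \<in> sets borel_cem" by auto
  have "(\<lambda>\<omega>. Shift X (T \<omega>) \<omega>) -` E \<inter> space (Evt X) = (\<lambda>\<omega>. Pos X (T \<omega> + s) \<omega>) -` B \<inter> space (Evt X)"
    unfolding E by (auto simp: pos_shift shift_space)
  then show "(\<lambda>\<omega>. Shift X (T \<omega>) \<omega>) -` E \<inter> space (Evt X) \<in> sets (Evt X)"
    using measurable_sets[OF measurable_Pos_stopping[OF stopping_time_add_const[OF T, of s]] E(2)] by simp
qed auto

text \<open>Both sides integrate \<Phi> against finite measures on path space that agree on
  cylinders, an intersection-stable generator.\<close>

lemma strong_markov_path:
  assumes T: "stopping_time (Flt X) T" and D: "D \<in> sets (pre_sigma T)"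
    and \<Phi>: "\<Phi> \<in> borel_measurable (nat_filt X \<infinity>)"
  shows "(\<integral>\<^sup>+\<omega>\<in>D. \<Phi> (Shift X (T \<omega>) \<omega>) \<partial>Law X z)
       = (\<integral>\<^sup>+\<omega>\<in>D. (\<integral>\<^sup>+\<omega>'. \<Phi> \<omega>' \<partial>Law X (Pos X (T \<omega>) \<omega>)) \<partial>Law X z)"
proof -
  let ?N = "nat_filt X \<infinity>" and ?C = "{cyl J B |J B. finite J \<and> (\<forall>s. B s \<in> sets borel_cem)}"
  have D': "D \<in> sets (Evt X)" using D sets_pre_sigma_Evt[OF T] by auto
  note m1 = measurable_Shift[OF T]
  note m2 = measurable_Pos_stopping[OF T]
  have m1': "(\<lambda>\<omega>. Shift X (T \<omega>) \<omega>) \<in> measurable (restr D z) ?N"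
    using m1 by (simp add: measurable_Law_cong cong: measurable_cong_sets)
  have m3: "(\<lambda>\<omega>. path_law (Pos X (T \<omega>) \<omega>)) \<in> measurable (restr D z) (subprob_algebra ?N)"
    using measurable_compose[OF m2 measurable_path_law] by (simp add: measurable_Law_cong cong: measurable_cong_sets)
  let ?M1 = "distr (restr D z) ?N (\<lambda>\<omega>. Shift X (T \<omega>) \<omega>)"
  let ?M2 = "restr D z \<bind> (\<lambda>\<omega>. path_law (Pos X (T \<omega>) \<omega>))"
  have e1: "emeasure ?M1 E = emeasure (Law X z) {\<omega>\<in>D. Shift X (T \<omega>) \<omega> \<in> E}" if E: "E \<in> sets ?N" for E
  proof -
    have DC: "{\<omega>\<in>D. Shift X (T \<omega>) \<omega> \<in> E} \<in> sets (Evt X)"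
    proof -
      have "{\<omega>\<in>D. Shift X (T \<omega>) \<omega> \<in> E} = D \<inter> ((\<lambda>\<omega>. Shift X (T \<omega>) \<omega>) -` E \<inter> space (Evt X))"
        using sets.sets_into_space[OF D'] by auto
      then show ?thesis using D' measurable_sets[OF m1 E] by auto
    qed
    have "emeasure ?M1 E = emeasure (restr D z) ((\<lambda>\<omega>. Shift X (T \<omega>) \<omega>) -` E \<inter> space (Evt X))"
      using E m1' by (subst emeasure_distr) auto
    also have "\<dots> = (\<integral>\<^sup>+\<omega>. indicator {\<omega>\<in>D. Shift X (T \<omega>) \<omega> \<in> E} \<omega> \<partial>Law X z)"
      using D' measurable_sets[OF m1 E]
      by (subst emeasure_density) (auto simp: sets_law measurable_Law_cong intro!: nn_integral_cong split: split_indicator)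
    also have "\<dots> = emeasure (Law X z) {\<omega>\<in>D. Shift X (T \<omega>) \<omega> \<in> E}"
      using DC by (simp add: sets_law)
    finally show ?thesis .
  qed
  have e2: "emeasure ?M2 E = (\<integral>\<^sup>+\<omega>\<in>D. emeasure (Law X (Pos X (T \<omega>) \<omega>)) E \<partial>Law X z)" if E: "E \<in> sets ?N" for E
    using E measurable_compose[OF m2 measurable_compose[OF measurable_path_law measurable_emeasure_subprob_algebra[OF E]]]
    by (subst emeasure_bind[OF space_restr_nonempty m3 E], subst nn_integral_restr[OF D']) (auto simp: emeasure_path_law)
  have eq: "?M1 = ?M2"
  proof (rule measure_eqI_generator_eq[OF Int_stable_cyl])
    show "?C \<subseteq> Pow (space (Evt X))" by (auto simp: cyl_def)
    show "sets ?M1 = sigma_sets (space (Evt X)) ?C" by (simp add: sets_nat_filt_cyl[symmetric])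
    show "sets ?M2 = sigma_sets (space (Evt X)) ?C"
      using space_restr_nonempty unfolding sets_nat_filt_cyl[symmetric] by (subst sets_bind) (auto simp: path_law_def)
    have \<Omega>: "space (Evt X) = cyl {} (\<lambda>_. {})" by (simp add: cyl_def)
    show "range (\<lambda>_::nat. space (Evt X)) \<subseteq> ?C" unfolding \<Omega> by force
    show "(\<Union>i::nat. space (Evt X)) = space (Evt X)" by auto
    interpret prob_space "Law X z" by (rule prob_law)
    have "emeasure ?M1 (space (Evt X)) \<le> emeasure (Law X z) (space (Law X z))"
      using sets.top[of ?N] sets.sets_into_space[OF D'] by (subst e1) (auto intro!: emeasure_mono simp: sets_law)
    then show "emeasure ?M1 (space (Evt X)) \<noteq> \<infinity>" for i :: nat by (auto simp: emeasure_space_1 top_unique)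
    fix E assume E: "E \<in> ?C"
    then have EN: "E \<in> sets ?N" unfolding sets_nat_filt_cyl by (rule sigma_sets.Basic)
    from E obtain J B where JB: "E = cyl J B" "finite J" "\<And>s. B s \<in> sets borel_cem" by auto
    have "{\<omega>\<in>D. Shift X (T \<omega>) \<omega> \<in> E} = {\<omega>\<in>D. \<forall>s\<in>J. Pos X (T \<omega> + s) \<omega> \<in> B s}"
      using sets.sets_into_space[OF D'] unfolding JB by (auto simp: cyl_def pos_shift shift_space)
    then show "emeasure ?M1 E = emeasure ?M2 E"
      unfolding e1[OF EN] e2[OF EN] using strong_markov_cyl[OF JB(2,3) T D, of z] by (simp add: JB(1))
  qed
  have "(\<integral>\<^sup>+\<omega>\<in>D. \<Phi> (Shift X (T \<omega>) \<omega>) \<partial>Law X z) = (\<integral>\<^sup>+\<omega>. \<Phi> \<omega> \<partial>?M1)"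
    using \<Phi> m1' measurable_compose[OF m1 \<Phi>] by (subst nn_integral_distr) (auto simp: nn_integral_restr[OF D'])
  also have "\<dots> = (\<integral>\<^sup>+\<omega>. \<integral>\<^sup>+\<omega>'. \<Phi> \<omega>' \<partial>path_law (Pos X (T \<omega>) \<omega>) \<partial>restr D z)"
    unfolding eq by (rule nn_integral_bind[OF \<Phi> m3])
  also have "\<dots> = (\<integral>\<^sup>+\<omega>. (\<integral>\<^sup>+\<omega>'. \<Phi> \<omega>' \<partial>Law X (Pos X (T \<omega>) \<omega>)) \<partial>restr D z)"
    by (simp add: nn_integral_path_law[OF \<Phi>])
  also have "\<dots> = (\<integral>\<^sup>+\<omega>\<in>D. (\<integral>\<^sup>+\<omega>'. \<Phi> \<omega>' \<partial>Law X (Pos X (T \<omega>) \<omega>)) \<partial>Law X z)"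
    by (rule nn_integral_restr[OF D' measurable_compose[OF m2 measurable_expectation[OF \<Phi>]]])
  finally show ?thesis .
qed

subsection \<open>Completed path functionals\<close>

lemma space_nat_filt_compl [simp]: "space (nat_filt_compl X t) = space (Evt X)"
  unfolding nat_filt_compl_def by (subst space_measure_of_conv) simp

lemma sets_nat_filt_compl: "sets (nat_filt_compl X t) =
    sigma_sets (space (Evt X)) (completed X (sets (nat_filt X t)) (sets (nat_filt X \<infinity>)))"
  unfolding nat_filt_compl_def by (subst sets_measure_of) (auto simp: completed_def)

lemma completed_mono: "S \<subseteq> S' \<Longrightarrow> T \<subseteq> T' \<Longrightarrow> completed X S T \<subseteq> completed X S' T'"
  unfolding completed_def by blast

lemma sets_nat_filt_compl_Flt: "sets (nat_filt_compl X t) \<subseteq> sets (Flt X t)"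
proof -
  have "completed X (sets (nat_filt X t)) (sets (nat_filt X \<infinity>)) \<subseteq> sets (Flt X t)"
    using completed_mono[OF sets_nat_filt_Flt sets_nat_filt_Evt] filt_complete by blast
  then show ?thesis unfolding sets_nat_filt_compl using sets.sigma_sets_subset[of _ "Flt X t"] by simp
qed

lemma sets_nat_filt_compl_Evt: "sets (nat_filt_compl X t) \<subseteq> sets (Evt X)"
  using sets_nat_filt_compl_Flt filt_events by blast

lemma sets_nat_filt_subset_compl: "sets (nat_filt X t) \<subseteq> sets (nat_filt_compl X t)"
proof
  fix E assume E: "E \<in> sets (nat_filt X t)"
  then have "E \<subseteq> space (Evt X)" using sets.sets_into_space by fastforce
  then have "E \<in> completed X (sets (nat_filt X t)) (sets (nat_filt X \<infinity>))"
    using E unfolding completed_def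
    by (intro CollectI conjI allI impI bexI[of _ E] bexI[of _ "{}"]) (simp_all add: init_prob_def)
  then show "E \<in> sets (nat_filt_compl X t)" unfolding sets_nat_filt_compl by (rule sigma_sets.Basic)
qed

lemma measurable_Pos_nat_filt_compl: "Pos X s \<in> measurable (nat_filt_compl X \<infinity>) borel_cem"
  using measurable_Pos_nat_filt[of s] sets_nat_filt_subset_compl[of \<infinity>] by (auto simp: measurable_def)

lemma measurable_nat_filt_compl_Evt: "f \<in> measurable (nat_filt_compl X t) M \<Longrightarrow> f \<in> measurable (Evt X) M"
  using sets_nat_filt_compl_Evt by (auto simp: measurable_def)

text \<open>The completion allows a null set for each initial distribution. Choosing the law of X at
  time T, the strong Markov property identifies its probability with that of the shifted path
  falling into the null set.\<close>

lemma sets_nat_filt_compl_completion: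
  assumes T: "stopping_time (Flt X) T"
  shows "sets (nat_filt_compl X \<infinity>) \<subseteq> sets (completion (distr (Law X z) (nat_filt X \<infinity>) (\<lambda>\<omega>. Shift X (T \<omega>) \<omega>)))"
    (is "_ \<subseteq> sets (completion ?P)")
proof -
  have m: "(\<lambda>\<omega>. Shift X (T \<omega>) \<omega>) \<in> measurable (Law X z) (nat_filt X \<infinity>)"
    unfolding measurable_Law_cong by (rule measurable_Shift[OF T])
  have XT: "(\<lambda>\<omega>. Pos X (T \<omega>) \<omega>) \<in> measurable (Law X z) borel_cem"
    unfolding measurable_Law_cong by (rule measurable_Pos_stopping[OF T])
  let ?\<nu> = "distr (Law X z) borel_cem (\<lambda>\<omega>. Pos X (T \<omega>) \<omega>)"
  have "completed X (sets (nat_filt X \<infinity>)) (sets (nat_filt X \<infinity>)) \<subseteq> sets (completion ?P)"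
  proof
    fix E assume E: "E \<in> completed X (sets (nat_filt X \<infinity>)) (sets (nat_filt X \<infinity>))"
    have \<nu>: "prob_space ?\<nu>" "sets ?\<nu> = sets borel_cem"
      by (intro prob_space.prob_space_distr prob_law XT) simp
    have "\<forall>\<nu>. prob_space \<nu> \<longrightarrow> sets \<nu> = sets borel_cem \<longrightarrow> (\<exists>B\<in>sets (nat_filt X \<infinity>).
        \<exists>N\<in>sets (nat_filt X \<infinity>). init_prob X \<nu> N = 0 \<and> (E - B) \<union> (B - E) \<subseteq> N)"
      using E unfolding completed_def by blast
    from this[rule_format, OF \<nu>] obtain B N where BN: "B \<in> sets (nat_filt X \<infinity>)" "N \<in> sets (nat_filt X \<infinity>)" "init_prob X ?\<nu> N = 0"
      "(E - B) \<union> (B - E) \<subseteq> N"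
      by blast
    have meas: "(\<lambda>y. emeasure (Law X y) N) \<in> borel_measurable borel_cem"
      using measurable_compose[OF measurable_path_law measurable_emeasure_subprob_algebra[OF BN(2)]]
      by (simp add: emeasure_path_law[OF BN(2)])
    have "emeasure ?P N = (\<integral>\<^sup>+\<omega>. indicator N \<omega> \<partial>?P)" using BN(2) by simp
    also have "\<dots> = (\<integral>\<^sup>+\<omega>\<in>space (Evt X). indicator N (Shift X (T \<omega>) \<omega>) \<partial>Law X z)"
      using m BN(2) by (subst nn_integral_distr) (auto intro!: nn_integral_cong)
    also have "\<dots> = (\<integral>\<^sup>+\<omega>\<in>space (Evt X). (\<integral>\<^sup>+\<omega>'. indicator N \<omega>' \<partial>Law X (Pos X (T \<omega>) \<omega>)) \<partial>Law X z)"
      using BN(2) sets.top[of "pre_sigma T"] by (intro strong_markov_path[OF T]) (auto simp: space_pre_sigma)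
    also have "\<dots> = (\<integral>\<^sup>+\<omega>. emeasure (Law X (Pos X (T \<omega>) \<omega>)) N \<partial>Law X z)"
    proof -
      have "N \<in> sets (Law X y)" for y using BN(2) sets_nat_filt_Evt by (auto simp: sets_law)
      then show ?thesis by (intro nn_integral_cong) simp
    qed
    also have "\<dots> = init_prob X ?\<nu> N"
      unfolding init_prob_def using XT meas by (simp add: nn_integral_completion nn_integral_distr)
    finally have "N \<in> null_sets ?P" using BN by (simp add: null_sets_def)
    moreover have "E \<subseteq> space (Evt X)" using E by (simp add: completed_def)
    then have "E = (B - N) \<union> (E \<inter> N)" using BN(4) by auto
    ultimately show "E \<in> sets (completion ?P)"
      using BN(1,2) by (intro sets_completionI[of _ "B - N" "E \<inter> N" N]) auto
  qed
  then show ?thesis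
    unfolding sets_nat_filt_compl using sets.sigma_sets_subset[of _ "completion ?P"] by simp
qed

text \<open>A version \<open>\<Phi>1\<close> for the natural \<sigma>-algebra differs from \<Phi> on
  a set that is null for the shifted path, hence null under the law started at X_T for almost every
  path; so the inner expectations agree. A Borel \<phi> is demanded because expectations of
  completed functionals are Borel in the starting point only case by case. The function \<Psi>
  admits identities, such as additivity, that hold almost surely.\<close>

lemma strong_markov_completed:
  assumes T: "stopping_time (Flt X) T" and D: "D \<in> sets (pre_sigma T)"
    and \<Phi>: "\<Phi> \<in> borel_measurable (nat_filt_compl X \<infinity>)"
    and \<phi>: "\<phi> \<in> borel_measurable borel_cem" "\<And>y. \<phi> y = (\<integral>\<^sup>+\<omega>. \<Phi> \<omega> \<partial>Law X y)"
    and \<Psi>: "AE \<omega> in Law X z. \<omega> \<in> D \<longrightarrow> \<Psi> \<omega> = \<Phi> (Shift X (T \<omega>) \<omega>)"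
  shows "(\<integral>\<^sup>+\<omega>\<in>D. \<Psi> \<omega> \<partial>Law X z) = (\<integral>\<^sup>+\<omega>\<in>D. \<phi> (Pos X (T \<omega>) \<omega>) \<partial>Law X z)"
proof -
  let ?P = "distr (Law X z) (nat_filt X \<infinity>) (\<lambda>\<omega>. Shift X (T \<omega>) \<omega>)"
  have m: "(\<lambda>\<omega>. Shift X (T \<omega>) \<omega>) \<in> measurable (Law X z) (nat_filt X \<infinity>)"
    unfolding measurable_Law_cong by (rule measurable_Shift[OF T])
  have "\<Phi> \<in> borel_measurable (completion ?P)"
    using \<Phi> sets_nat_filt_compl_completion[OF T, of z] by (auto simp: measurable_def)
  then obtain \<Phi>1 where \<Phi>1: "\<Phi>1 \<in> borel_measurable ?P" "AE \<omega> in ?P. \<Phi> \<omega> = \<Phi>1 \<omega>"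
    using completion_ex_borel_measurable by blast
  have \<Phi>1m: "\<Phi>1 \<in> borel_measurable (nat_filt X \<infinity>)" using \<Phi>1(1) by simp
  obtain N where N: "{\<omega>\<in>space ?P. \<not> \<Phi> \<omega> = \<Phi>1 \<omega>} \<subseteq> N" "emeasure ?P N = 0" "N \<in> sets ?P"
    using \<Phi>1(2) by (rule AE_E)
  have NN: "N \<in> sets (nat_filt X \<infinity>)" using N(3) by simp
  have "(\<integral>\<^sup>+\<omega>\<in>space (Evt X). (\<integral>\<^sup>+\<omega>'. indicator N \<omega>' \<partial>Law X (Pos X (T \<omega>) \<omega>)) \<partial>Law X z)
     = (\<integral>\<^sup>+\<omega>\<in>space (Evt X). indicator N (Shift X (T \<omega>) \<omega>) \<partial>Law X z)"
    using NN sets.top[of "pre_sigma T"] by (intro strong_markov_path[OF T, symmetric]) (auto simp: space_pre_sigma)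
  also have "\<dots> = (\<integral>\<^sup>+\<omega>. indicator N \<omega> \<partial>?P)"
    using m NN by (subst nn_integral_distr) (auto intro!: nn_integral_cong)
  also have "\<dots> = 0" using N by simp
  finally have "(\<integral>\<^sup>+\<omega>\<in>space (Evt X). (\<integral>\<^sup>+\<omega>'. indicator N \<omega>' \<partial>Law X (Pos X (T \<omega>) \<omega>)) \<partial>Law X z) = 0" .
  moreover have "(\<integral>\<^sup>+\<omega>\<in>space (Evt X). (\<integral>\<^sup>+\<omega>'. indicator N \<omega>' \<partial>Law X (Pos X (T \<omega>) \<omega>)) \<partial>Law X z)
      = (\<integral>\<^sup>+\<omega>. (\<integral>\<^sup>+\<omega>'. indicator N \<omega>' \<partial>Law X (Pos X (T \<omega>) \<omega>)) \<partial>Law X z)"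
    by (intro nn_integral_cong) simp
  ultimately have 0: "(\<integral>\<^sup>+\<omega>. (\<integral>\<^sup>+\<omega>'. indicator N \<omega>' \<partial>Law X (Pos X (T \<omega>) \<omega>)) \<partial>Law X z) = 0" by simp
  have "(\<lambda>\<omega>. \<integral>\<^sup>+\<omega>'. indicator N \<omega>' \<partial>Law X (Pos X (T \<omega>) \<omega>)) \<in> borel_measurable (Law X z)"
    unfolding measurable_Law_cong
    using NN by (intro measurable_compose[OF measurable_Pos_stopping[OF T] measurable_expectation]) auto
  then have "AE \<omega> in Law X z. (\<integral>\<^sup>+\<omega>'. indicator N \<omega>' \<partial>Law X (Pos X (T \<omega>) \<omega>)) = 0"
    using 0 by (subst (asm) nn_integral_0_iff_AE)
  then have ae: "AE \<omega> in Law X z. (\<integral>\<^sup>+\<omega>'. \<Phi>1 \<omega>' \<partial>Law X (Pos X (T \<omega>) \<omega>)) = \<phi> (Pos X (T \<omega>) \<omega>)"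
  proof (rule AE_mp, intro AE_I2 impI)
    fix \<omega> assume \<omega>: "\<omega> \<in> space (Law X z)"
      "(\<integral>\<^sup>+\<omega>'. indicator N \<omega>' \<partial>Law X (Pos X (T \<omega>) \<omega>)) = 0"
    have "N \<in> sets (Law X y)" for y using NN sets_nat_filt_Evt by (auto simp: sets_law)
    then have "N \<in> null_sets (Law X (Pos X (T \<omega>) \<omega>))" using \<omega> by (simp add: null_sets_def)
    then have "AE \<omega>' in Law X (Pos X (T \<omega>) \<omega>). \<Phi>1 \<omega>' = \<Phi> \<omega>'"
      by (rule AE_I') (use N(1) in auto)
    then show "(\<integral>\<^sup>+\<omega>'. \<Phi>1 \<omega>' \<partial>Law X (Pos X (T \<omega>) \<omega>)) = \<phi> (Pos X (T \<omega>) \<omega>)"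
      unfolding \<phi>(2) by (rule nn_integral_cong_AE)
  qed
  have "AE \<omega> in Law X z. \<Phi> (Shift X (T \<omega>) \<omega>) = \<Phi>1 (Shift X (T \<omega>) \<omega>)"
    using AE_distrD[OF m \<Phi>1(2)] .
  with \<Psi> have "AE \<omega> in Law X z. \<Psi> \<omega> * indicator D \<omega> = \<Phi>1 (Shift X (T \<omega>) \<omega>) * indicator D \<omega>"
    by eventually_elim (auto split: split_indicator)
  then have "(\<integral>\<^sup>+\<omega>\<in>D. \<Psi> \<omega> \<partial>Law X z) = (\<integral>\<^sup>+\<omega>\<in>D. \<Phi>1 (Shift X (T \<omega>) \<omega>) \<partial>Law X z)"
    by (rule nn_integral_cong_AE)
  also have "\<dots> = (\<integral>\<^sup>+\<omega>\<in>D. (\<integral>\<^sup>+\<omega>'. \<Phi>1 \<omega>' \<partial>Law X (Pos X (T \<omega>) \<omega>)) \<partial>Law X z)"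
    by (rule strong_markov_path[OF T D \<Phi>1m])
  also have "\<dots> = (\<integral>\<^sup>+\<omega>\<in>D. \<phi> (Pos X (T \<omega>) \<omega>) \<partial>Law X z)"
    using ae by (intro nn_integral_cong_AE) (auto elim!: eventually_mono)
  finally show ?thesis .
qed

end

section \<open>Inverse clocks\<close>

definition right_inverse :: "(ennreal \<Rightarrow> ennreal) \<Rightarrow> real \<Rightarrow> ennreal" where
  "right_inverse a t = Inf {s. ennreal t < a s}"

lemma inv_clock_eq: "inv_clock A t \<omega> = right_inverse (\<lambda>s. A s \<omega>) t"
  by (simp add: inv_clock_def right_inverse_def)

definition clock_path :: "(ennreal \<Rightarrow> ennreal) \<Rightarrow> bool" where
  "clock_path a \<longleftrightarrow> a 0 = 0 \<and> mono a \<and> continuous_on UNIV a"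

text \<open>By continuity a value above t at s persists slightly to the left of s, so the infimum
  lies strictly below s. Measurability and the stopping-time property of the inverse clock all rest
  on this equivalence.\<close>

lemma right_inverse_less_iff:
  assumes "clock_path a"
  shows "right_inverse a t < s \<longleftrightarrow> ennreal t < a s"
proof
  assume "right_inverse a t < s"
  then obtain r where "ennreal t < a r" "r < s" unfolding right_inverse_def Inf_less_iff by auto
  moreover have "a r \<le> a s" using assms \<open>r < s\<close> by (auto simp: clock_path_def mono_def)
  ultimately show "ennreal t < a s" by simp
next
  assume s: "ennreal t < a s"
  have "open (a -` {ennreal t<..})"
    using assms by (intro open_vimage) (auto simp: clock_path_def)
  moreover have "0 < s" using s assms by (cases "s = 0") (auto simp: clock_path_def zero_less_iff_neq_zero)
  ultimately obtain b where b: "b < s" "{b<..s} \<subseteq> a -` {ennreal t<..}"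
    using open_left[of "a -` {ennreal t<..}" s 0] s by auto
  obtain r where "b < r" "r < s" using dense[OF b(1)] by blast
  then have "r \<in> a -` {ennreal t<..}" using b(2) by (intro subsetD[OF b(2)]) auto
  then have "right_inverse a t \<le> r" unfolding right_inverse_def by (intro Inf_lower) auto
  then show "right_inverse a t < s" using \<open>r < s\<close> by (rule le_less_trans)
qed

lemma right_inverse_mono: "s \<le> t \<Longrightarrow> right_inverse a s \<le> right_inverse a t"
  unfolding right_inverse_def by (intro Inf_superset_mono) (auto intro: le_less_trans ennreal_leI)

text \<open>A continuous clock cannot jump across t. If the inverse is infinite, the clock may stop
  below t for ever.\<close>

lemma clock_right_inverse:
  assumes a: "clock_path a" and fin: "right_inverse a t < \<infinity>"
  shows "a (right_inverse a t) = ennreal t"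
proof (rule antisym)
  show "a (right_inverse a t) \<le> ennreal t" using right_inverse_less_iff[OF a, of t "right_inverse a t"] by simp
  show "ennreal t \<le> a (right_inverse a t)"
  proof (rule ccontr)
    assume "\<not> ennreal t \<le> a (right_inverse a t)"
    then have m: "right_inverse a t \<in> a -` {..<ennreal t}" by simp
    have "open (a -` {..<ennreal t})" using a by (intro open_vimage) (auto simp: clock_path_def)
    then obtain b where b: "right_inverse a t < b" "{right_inverse a t..<b} \<subseteq> a -` {..<ennreal t}"
      using open_right[of "a -` {..<ennreal t}", OF _ m fin] by auto
    obtain r where r: "right_inverse a t < r" "r < b" using dense[OF b(1)] by blast
    then have "r \<in> {right_inverse a t..<b}" by auto
    then have "r \<in> a -` {..<ennreal t}" using b(2) by blast
    then have "a r < ennreal t" by simp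
    then show False using right_inverse_less_iff[OF a, of t r] r by auto
  qed
qed

lemma right_inverse_right_continuous:
  assumes a: "clock_path a" and t: "0 \<le> t"
  shows "(right_inverse a \<longlongrightarrow> right_inverse a t) (at_right t)"
proof (rule order_tendstoI)
  fix y assume y: "y < right_inverse a t"
  have "\<forall>\<^sub>F s in at_right t. t < s" by (simp add: eventually_at_filter)
  then show "\<forall>\<^sub>F s in at_right t. y < right_inverse a s"
    by eventually_elim (use y right_inverse_mono in \<open>auto intro: less_le_trans less_imp_le\<close>)
next
  fix y assume "right_inverse a t < y"
  then have "ennreal t < a y" using right_inverse_less_iff[OF a] by simp
  then obtain c where c: "ennreal t < c" "c < a y" using dense by blast
  then obtain r where r: "c = ennreal r" "0 \<le> r" by (cases c) auto
  have "t < r" using c(1) r t by (simp add: ennreal_less_iff)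
  then have "\<forall>\<^sub>F s in at_right t. s < r" by (auto simp: eventually_at_right)
  then show "\<forall>\<^sub>F s in at_right t. right_inverse a s < y"
  proof eventually_elim
    case (elim s)
    then have "ennreal s \<le> c" using r by (auto intro: ennreal_leI)
    then show ?case using c right_inverse_less_iff[OF a] by auto
  qed
qed

text \<open>Extended numbers are equal once they have the same finite strict upper bounds, and
  \<open>right_inverse_less_iff\<close> translates every such bound into a statement on clock
  values, where additivity applies.\<close>

lemma right_inverse_add:
  assumes a: "clock_path a" and b: "clock_path b" and ts: "0 \<le> t" "0 \<le> s"
    and fin: "right_inverse a t < \<infinity>"
    and add: "\<And>r. r < \<infinity> \<Longrightarrow> a (right_inverse a t + r) = a (right_inverse a t) + b r"
  shows "right_inverse a (t + s) = right_inverse a t + right_inverse b s"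
proof -
  let ?T = "right_inverse a t"
  have *: "right_inverse a (t + s) < y \<longleftrightarrow> ?T + right_inverse b s < y" if y: "y < \<infinity>" for y
  proof (cases "y \<le> ?T")
    case True
    then have "\<not> right_inverse a (t + s) < y" using right_inverse_mono[of t "t + s" a] ts by auto
    moreover have "\<not> ?T + right_inverse b s < y" using True by (auto simp: not_less intro: add_increasing2)
    ultimately show ?thesis by simp
  next
    case False
    define r where "r = y - ?T"
    have yr: "y = ?T + r" unfolding r_def using False by (simp add: add_diff_inverse_ennreal)
    have r: "r < \<infinity>" using y yr by (auto simp: less_top)
    have "right_inverse a (t + s) < y \<longleftrightarrow> ennreal (t + s) < a (?T + r)"
      unfolding yr by (rule right_inverse_less_iff[OF a])
    also have "\<dots> \<longleftrightarrow> ennreal t + ennreal s < ennreal t + b r"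
      using add[OF r] clock_right_inverse[OF a fin] ts by simp
    also have "\<dots> \<longleftrightarrow> ennreal s < b r"
      by (simp add: ennreal_add_left_cancel_less)
    also have "\<dots> \<longleftrightarrow> right_inverse b s < r" by (simp add: right_inverse_less_iff[OF b])
    also have "\<dots> \<longleftrightarrow> ?T + right_inverse b s < y"
      unfolding yr using fin by (simp add: ennreal_add_left_cancel_less less_top[symmetric])
    finally show ?thesis .
  qed
  have eq: "u = v" if "\<And>y. y < \<infinity> \<Longrightarrow> u < y \<longleftrightarrow> v < y" for u v :: ennreal
  proof (rule ccontr)
    assume "u \<noteq> v"
    then obtain y where "u < y \<and> y < v \<or> v < y \<and> y < u" by (metis dense linorder_neqE)
    moreover then have "y < \<infinity>" by (auto intro: less_le_trans[OF _ top_greatest])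
    ultimately show False using that[of y] by auto
  qed
  show ?thesis by (rule eq) (rule *)
qed

lemma measurable_right_inverse:
  assumes "clock_path a" shows "right_inverse a \<in> borel_measurable borel"
proof (rule borel_measurableI_less)
  fix y
  have "{t \<in> space borel. right_inverse a t < y} = {t \<in> space borel. ennreal t < a y}"
    using right_inverse_less_iff[OF assms] by auto
  also have "\<dots> \<in> sets borel" by measurable
  finally show "{t \<in> space borel. right_inverse a t < y} \<in> sets borel" .
qed

text \<open>Change of variables: the Stieltjes measure of a clock is the image of Lebesgue measure
  under the inverse clock. Truncating the clock at height k amounts to keeping the times t <
  k.\<close>

lemma interval_measure_right_inverse:
  fixes k :: nat
  assumes a: "clock_path a"
  defines "F \<equiv> (\<lambda>s. enn2real (min (a (ennreal s)) (of_nat k)))"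
  defines "I \<equiv> {t. 0 \<le> t \<and> t < real k \<and> right_inverse a t < \<infinity>}"
  shows "interval_measure F = distr (restrict_space lborel I) borel (\<lambda>t. enn2real (right_inverse a t))"
proof -
  let ?\<tau> = "right_inverse a"
  let ?\<rho> = "distr (restrict_space lborel I) borel (\<lambda>t. enn2real (?\<tau> t))"
  note [measurable] = measurable_right_inverse[OF a]
  have I: "I \<in> sets lborel" unfolding I_def by measurable
  have m: "(\<lambda>t. enn2real (?\<tau> t)) \<in> measurable (restrict_space lborel I) borel"
    by (intro measurable_restrict_space1) measurable
  have top: "min (a (ennreal s)) (of_nat k) < \<top>" for s by (auto simp: min_less_iff_disj of_nat_less_top)
  have F: "ennreal (F s) = min (a (ennreal s)) (of_nat k)" "0 \<le> F s" for s
    unfolding F_def using top[of s] by auto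
  have mono: "F x \<le> F y" if "x \<le> y" for x y
    unfolding F_def using ennreal_leI[OF that] a top
    by (intro enn2real_mono min.mono) (auto simp: clock_path_def mono_def)
  have "(F \<longlongrightarrow> F x) (at_right x)" for x
    unfolding F_def
  proof (rule tendsto_enn2real)
    have "isCont a (ennreal x)" using a by (simp add: clock_path_def continuous_on_eq_continuous_at)
    then have "((\<lambda>s. a (ennreal s)) \<longlongrightarrow> a (ennreal x)) (at_right x)"
      by (rule isCont_tendsto_compose) (intro tendsto_ennrealI tendsto_ident_at)
    then have "((\<lambda>s. min (a (ennreal s)) (of_nat k)) \<longlongrightarrow> min (a (ennreal x)) (of_nat k)) (at_right x)"
      by (intro tendsto_min tendsto_const)
    then show "((\<lambda>s. min (a (ennreal s)) (of_nat k)) \<longlongrightarrow> ennreal (enn2real (min (a (ennreal x)) (of_nat k)))) (at_right x)"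
      using top[of x] by simp
  qed auto
  then have cont: "continuous (at_right x) F" for x by (simp add: continuous_within)
  \<comment> \<open>At the level t = F x the inverse may equal x, where the equivalence fails; one
    level is a Lebesgue null set.\<close>
  have key: "enn2real (?\<tau> t) \<le> x \<longleftrightarrow> t < F x" if t: "t \<in> I" "t \<noteq> F x" for t x
  proof (cases "x < 0")
    case True
    then have "F x = 0" using a by (simp add: F_def clock_path_def ennreal_neg)
    moreover have "\<not> enn2real (?\<tau> t) \<le> x" using True enn2real_nonneg[of "?\<tau> t"] by linarith
    ultimately show ?thesis using t(1) by (simp add: I_def)
  next
    case False
    have fin: "?\<tau> t < \<infinity>" "0 \<le> t" "t < real k" using t by (auto simp: I_def)
    have "enn2real (?\<tau> t) \<le> x \<longleftrightarrow> ?\<tau> t \<le> ennreal x"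
      using False fin(1) by (cases "?\<tau> t") auto
    also have "\<dots> \<longleftrightarrow> t < F x"
    proof
      assume "?\<tau> t \<le> ennreal x"
      then have "a (?\<tau> t) \<le> a (ennreal x)" using a by (auto simp: clock_path_def mono_def)
      then have "ennreal t \<le> ennreal (F x)"
        unfolding F clock_right_inverse[OF a fin(1)] using fin by (simp add: ennreal_of_nat_eq_real_of_nat ennreal_leI)
      then show "t < F x" using t(2) F(2)[of x] by simp
    next
      assume "t < F x"
      then have "ennreal t < ennreal (F x)" using fin by (simp add: ennreal_less_iff)
      then have "ennreal t < a (ennreal x)" unfolding F by simp
      then show "?\<tau> t \<le> ennreal x" using right_inverse_less_iff[OF a] by (auto intro: less_imp_le)
    qed
    finally show ?thesis .
  qed
  have mem: "t \<in> I" if "F x < t" "t < F y" for t x y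
  proof -
    have "0 \<le> t" using that F(2)[of x] by simp
    have "ennreal t < ennreal (F y)" using that \<open>0 \<le> t\<close> by (simp add: ennreal_less_iff)
    then have "ennreal t < a (ennreal y)" "ennreal t < of_nat k" unfolding F by auto
    moreover have "right_inverse a t < ennreal y" using right_inverse_less_iff[OF a] calculation by simp
    then have "right_inverse a t < \<infinity>" by (auto intro: less_trans)
    ultimately show ?thesis using \<open>0 \<le> t\<close> by (auto simp: I_def ennreal_of_nat_eq_real_of_nat ennreal_less_iff)
  qed
  let ?E = "range (\<lambda>(x, y). {x<..y::real})"
  have Ioc: "emeasure ?\<rho> {x<..y} = ennreal (F y - F x)" if xy: "x \<le> y" for x y
  proof -
    have s: "(\<lambda>t. enn2real (?\<tau> t)) -` {x<..y} \<inter> I \<in> sets lborel"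
      using measurable_sets[OF m, of "{x<..y}"] I
      by (simp add: space_restrict_space sets_restrict_space_iff Int_commute) 
    have "emeasure ?\<rho> {x<..y} = emeasure (restrict_space lborel I) ((\<lambda>t. enn2real (?\<tau> t)) -` {x<..y} \<inter> I)"
      using m by (subst emeasure_distr) (auto simp: space_restrict_space)
    also have "\<dots> = emeasure lborel ((\<lambda>t. enn2real (?\<tau> t)) -` {x<..y} \<inter> I)"
      using I by (intro emeasure_restrict_space) auto
    also have "\<dots> = emeasure lborel {F x<..<F y}"
    proof (rule emeasure_eq_AE)
      have "AE t in lborel. t \<noteq> F x" "AE t in lborel. t \<noteq> F y" by (rule AE_lborel_singleton)+
      then show "AE t in lborel. t \<in> (\<lambda>t. enn2real (?\<tau> t)) -` {x<..y} \<inter> I \<longleftrightarrow> t \<in> {F x<..<F y}"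
      proof eventually_elim
        case (elim t)
        show ?case
        proof (cases "t \<in> I")
          case True
          then show ?thesis using key[OF True elim(1)] key[OF True elim(2)] elim by auto
        next
          case False
          then show ?thesis using mem[of x t y] by auto
        qed
      qed
    qed (use s in auto)
    also have "\<dots> = ennreal (F y - F x)" using mono[OF xy] by simp
    finally show ?thesis .
  qed
  show ?thesis
  proof (rule measure_eqI_generator_eq[of ?E UNIV _ _ "\<lambda>n. {- real n<..real n}"])
    have "{x<..y} \<inter> {x'<..y'} = {max x x'<..min y y'}" for x y x' y' :: real by auto
    then show "Int_stable ?E" by (auto simp: Int_stable_def)
    show "sets (interval_measure F) = sigma_sets UNIV ?E" "sets ?\<rho> = sigma_sets UNIV ?E"
      by (simp_all add: borel_sigma_sets_Ioc)
    show "emeasure (interval_measure F) E = emeasure ?\<rho> E" if EE: "E \<in> ?E" for E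
    proof -
      obtain x y where E: "E = {x<..y}" using EE by auto
      show ?thesis
      proof (cases "x \<le> y")
        case True
        then show ?thesis unfolding E using Ioc emeasure_interval_measure_Ioc[OF True mono cont] by simp
      qed (simp add: E)
    qed
    show "(\<Union>n. {- real n<..real n}) = UNIV"
    proof (intro set_eqI iffI UNIV_I UN_I)
      fix x :: real
      show "x \<in> {- real (nat \<lceil>\<bar>x\<bar>\<rceil> + 1)<..real (nat \<lceil>\<bar>x\<bar>\<rceil> + 1)}" by (simp; linarith)
    qed
    show "emeasure (interval_measure F) {- real n<..real n} \<noteq> \<infinity>" for n
      using emeasure_interval_measure_Ioc[OF _ mono cont, of "- real n" "real n"] by simp
  qed auto
qed

text \<open>The supremum over truncation heights becomes monotone convergence of the restrictions t
  < k. It is this form of the potential identity that describes the time-changed process.\<close>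

lemma stieltjes_integral_right_inverse:
  assumes a: "clock_path a" and [measurable]: "f \<in> borel_measurable borel"
  shows "stieltjes_integral f a =
    (\<integral>\<^sup>+t. f (enn2real (right_inverse a t)) * indicator {t. 0 \<le> t \<and> right_inverse a t < \<infinity>} t \<partial>lborel)"
proof -
  let ?\<tau> = "right_inverse a"
  define I where "I k = {t. 0 \<le> t \<and> t < real k \<and> ?\<tau> t < \<infinity>}" for k
  note [measurable] = measurable_right_inverse[OF a]
  have I [measurable]: "I k \<in> sets borel" for k unfolding I_def by measurable
  have m: "(\<lambda>t. enn2real (?\<tau> t)) \<in> measurable (restrict_space lborel (I k)) borel" for k
    by (intro measurable_restrict_space1) measurable
  have "stieltjes_integral f a = (SUP k. \<integral>\<^sup>+t. f (enn2real (?\<tau> t)) * indicator (I k) t \<partial>lborel)"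
    unfolding stieltjes_integral_def interval_measure_right_inverse[OF a] I_def[symmetric]
    using I by (subst nn_integral_distr[OF m]) (auto simp: nn_integral_restrict_space)
  also have "\<dots> = (\<integral>\<^sup>+t. (SUP k. f (enn2real (?\<tau> t)) * indicator (I k) t) \<partial>lborel)"
    by (intro nn_integral_monotone_convergence_SUP[symmetric])
       (auto simp: incseq_def le_fun_def I_def intro!: mult_left_mono split: split_indicator)
  also have "\<dots> = (\<integral>\<^sup>+t. f (enn2real (?\<tau> t)) * indicator {t. 0 \<le> t \<and> ?\<tau> t < \<infinity>} t \<partial>lborel)"
  proof (intro nn_integral_cong)
    fix t :: real
    show "(SUP k. f (enn2real (?\<tau> t)) * indicator (I k) t) = f (enn2real (?\<tau> t)) * indicator {t. 0 \<le> t \<and> ?\<tau> t < \<infinity>} t"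
    proof (cases "0 \<le> t \<and> ?\<tau> t < \<infinity>")
      case True
      obtain k where k: "t < real k" using reals_Archimedean2 by blast
      show ?thesis
      proof (rule antisym)
        have "f (enn2real (?\<tau> t)) * indicator (I k) t \<le> (SUP k. f (enn2real (?\<tau> t)) * indicator (I k) t)"
          by (rule SUP_upper) simp
        then show "f (enn2real (?\<tau> t)) * indicator {t. 0 \<le> t \<and> ?\<tau> t < \<infinity>} t \<le> (SUP k. f (enn2real (?\<tau> t)) * indicator (I k) t)"
          using True k by (simp add: I_def)
      qed (use True in \<open>auto intro!: SUP_least split: split_indicator\<close>)
    next
      case False
      then have "t \<notin> I k" for k by (auto simp: I_def)
      then show ?thesis using False by simp
    qed
  qed
  finally show ?thesis .
qed

section \<open>Time change of a standard process\<close>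

context standard_process
begin

section \<open>Path regularity, joint measurability and null sets\<close>

lemma Pos_after: "\<omega> \<in> space (Evt X) \<Longrightarrow> Pos X s \<omega> = None \<Longrightarrow> s \<le> t \<Longrightarrow> Pos X t \<omega> = None"
  using cemetery_trap by blast

lemma lifetime_le: "Pos X t \<omega> = None \<Longrightarrow> lifetime X \<omega> \<le> t"
  unfolding lifetime_def by (intro Inf_lower) auto

lemma Pos_before_lifetime: "t < lifetime X \<omega> \<Longrightarrow> Pos X t \<omega> \<noteq> None"
  using lifetime_le[of t \<omega>] leD by blast

lemma Pos_right_open:
  assumes \<omega>: "\<omega> \<in> space (Evt X)" and x: "Pos X t \<omega> = Some x" and U: "open U" "x \<in> U"
  shows "\<forall>\<^sub>F s in at_right t. Pos X s \<omega> \<in> Some ` U"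
proof -
  have "t \<noteq> \<infinity>" using pos_infinity[OF \<omega>] x by auto
  then have "limitin cem_top (\<lambda>s. Pos X s \<omega>) (Some x) (at_right t)"
    using right_continuous[OF \<omega>, of t] x by (simp add: less_top)
  then show ?thesis using U unfolding limitin_def by auto
qed

text \<open>Right continuity keeps the path in an open set for a short while, long enough to contain
  a rational time. Visits to open sets thereby become countable unions of events.\<close>

lemma Pos_rational_right:
  assumes \<omega>: "\<omega> \<in> space (Evt X)" and t: "Pos X t \<omega> \<in> Some ` U" "open U" and s: "t < s"
  obtains q where "q \<in> \<rat>" "0 < q" "t < ennreal q" "ennreal q < s" "Pos X (ennreal q) \<omega> \<in> Some ` U"
proof -
  obtain y where y: "Pos X t \<omega> = Some y" "y \<in> U" using t(1) by auto
  have "\<forall>\<^sub>F r in at_right t. Pos X r \<omega> \<in> Some ` U" by (rule Pos_right_open[OF \<omega> y(1) t(2) y(2)])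
  then obtain b where b: "t < b" "\<And>r. t < r \<Longrightarrow> r < b \<Longrightarrow> Pos X r \<omega> \<in> Some ` U"
    unfolding eventually_at_right[OF s] by (elim exE conjE) simp
  have "t < min b s" using b s by simp
  then obtain u where u: "t < u" "u < min b s" using dense by blast
  obtain t' where t': "t = ennreal t'" "0 \<le> t'" using u by (cases t) auto
  obtain u' where u': "u = ennreal u'" "0 \<le> u'" using u by (cases u) auto
  have "t' < u'" using u(1) t' u' by (simp add: ennreal_less_iff)
  then obtain q where q: "q \<in> \<rat>" "t' < q" "q < u'" using Rats_dense_in_real by blast
  have tq: "t < ennreal q" "ennreal q < u" unfolding t' u' using q t' by (auto intro: ennreal_lessI)
  show thesis
  proof (rule that[OF q(1) _ tq(1)])
    show "0 < q" using q t' by simp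
    show "ennreal q < s" using less_trans[OF tq(2) u(2)] by simp
    show "Pos X (ennreal q) \<omega> \<in> Some ` U" using b(2)[OF tq(1)] less_trans[OF tq(2) u(2)] by simp
  qed
qed

lemma Pos_right_continuous:
  assumes \<omega>: "\<omega> \<in> space (Evt X)" and w: "continuous_on UNIV w"
  shows "((\<lambda>s. ext0 w (Pos X s \<omega>) :: real) \<longlongrightarrow> ext0 w (Pos X t \<omega>)) (at_right t)"
proof (cases "Pos X t \<omega>")
  case None
  have "\<forall>\<^sub>F s in at_right t. t < s" by (simp add: eventually_at_filter)
  then have "\<forall>\<^sub>F s in at_right t. ext0 w (Pos X s \<omega>) = ext0 w (Pos X t \<omega>)"
    by eventually_elim (use Pos_after[OF \<omega> None] None in auto)
  then show ?thesis by (rule tendsto_eventually)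
next
  case (Some x)
  show ?thesis
  proof (rule tendstoI)
    fix e :: real assume e: "0 < e"
    have "open (w -` ball (w x) e)" using w by (intro open_vimage) auto
    then have "\<forall>\<^sub>F s in at_right t. Pos X s \<omega> \<in> Some ` (w -` ball (w x) e)"
      using e by (intro Pos_right_open[OF \<omega> Some]) auto
    then show "\<forall>\<^sub>F s in at_right t. dist (ext0 w (Pos X s \<omega>)) (ext0 w (Pos X t \<omega>)) < e"
      by eventually_elim (auto simp: Some dist_commute)
  qed
qed

text \<open>The next dyadic number of level k strictly above s: the added 1 keeps it off s even if s
  is dyadic, so the approach is from the right only.\<close>

definition dyadic_above :: "nat \<Rightarrow> ennreal \<Rightarrow> ennreal" where
  "dyadic_above k s = (if s = \<infinity> then \<infinity> else ennreal (real (nat \<lfloor>2 ^ k * enn2real s\<rfloor> + 1) / 2 ^ k))"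

lemma dyadic_above_tendsto:
  assumes "s < \<infinity>" shows "filterlim (\<lambda>k. dyadic_above k s) (at_right s) sequentially"
proof -
  obtain r where r: "s = ennreal r" "0 \<le> r" using assms by (cases s) auto
  let ?d = "\<lambda>k. real (nat \<lfloor>2 ^ k * r\<rfloor> + 1) / 2 ^ k"
  have d: "dyadic_above k (ennreal r) = ennreal (?d k)" for k using r by (simp add: dyadic_above_def)
  have b: "r < ?d k" "?d k \<le> r + (1/2) ^ k" for k
  proof -
    have "0 \<le> \<lfloor>2 ^ k * r\<rfloor>" using r by simp
    then have n: "real (nat \<lfloor>2 ^ k * r\<rfloor>) = of_int \<lfloor>2 ^ k * r\<rfloor>" by simp
    have "2 ^ k * r < real (nat \<lfloor>2 ^ k * r\<rfloor> + 1)" "real (nat \<lfloor>2 ^ k * r\<rfloor> + 1) \<le> 2 ^ k * r + 1"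
      unfolding of_nat_add n by linarith+
    then show "r < ?d k" "?d k \<le> r + (1/2) ^ k" by (auto simp: field_simps power_divide)
  qed
  have "(\<lambda>k. r + (1/2) ^ k) \<longlonglongrightarrow> r + 0" by (intro tendsto_intros LIMSEQ_realpow_zero) auto
  then have "?d \<longlonglongrightarrow> r"
    using b by (intro tendsto_sandwich[of "\<lambda>_. r" ?d _ "\<lambda>k. r + (1/2) ^ k"]) (auto intro: always_eventually less_imp_le)
  then have "(\<lambda>k. ennreal (?d k)) \<longlonglongrightarrow> ennreal r" by (rule tendsto_ennrealI)
  moreover have "ennreal r < ennreal (?d k)" for k using b(1)[of k] r by (intro ennreal_lessI) auto
  moreover have "ennreal (?d k) \<noteq> ennreal r" for k using calculation(2)[of k] by simp
  ultimately show ?thesis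
    unfolding r(1) d by (auto simp: filterlim_at intro!: always_eventually)
qed

text \<open>The state space is only a subset of its compactification, so path regularity is used through
  a function \<open>w\<close> that is positive exactly on a given open set \<open>U\<close>; the cemetery is a trap, hence
  \<open>ext0 w\<close> along the path is right continuous whether or not \<open>w\<close> vanishes at infinity.\<close>

lemma measurable_Pos_joint:
  "(\<lambda>(s, \<omega>). Pos X s \<omega>) \<in> measurable (borel \<Otimes>\<^sub>M nat_filt_compl X \<infinity>) borel_cem"
proof (rule measurable_borel_cemI)
  let ?M = "borel \<Otimes>\<^sub>M nat_filt_compl X \<infinity>"
  fix U :: "'a set" assume U: "open U"
  define w where "w y = (if U = UNIV then 1 else infdist y (- U))" for y :: 'a
  have w: "continuous_on UNIV w"
    unfolding w_def by (cases "U = UNIV") (auto intro!: continuous_intros)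
  have wpos: "0 < w y \<longleftrightarrow> y \<in> U" for y
  proof (cases "U = UNIV")
    case False
    then show ?thesis using U in_closed_iff_infdist_zero[of "- U" y] infdist_nonneg[of y "- U"]
      by (auto simp: w_def closed_def less_le)
  qed (simp add: w_def)
  have wm: "w \<in> borel_measurable borel" by (rule borel_measurable_continuous_onI[OF w])
  have step: "(\<lambda>(s, \<omega>). ext0 w (Pos X (dyadic_above k s) \<omega>)) \<in> borel_measurable ?M" for k
  proof -
    \<comment> \<open>The index 0 is reserved for the time \<infinity>; finite times have index at
      least 1.\<close>
    let ?p = "\<lambda>i :: nat. if i = 0 then \<infinity> else ennreal (real i / 2 ^ k)"
    let ?n = "\<lambda>s. if s = \<infinity> then 0 else nat \<lfloor>2 ^ k * enn2real s\<rfloor> + 1"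
    have eq: "dyadic_above k s = ?p (?n s)" for s by (auto simp: dyadic_above_def)
    have n: "?n \<in> measurable borel (count_space UNIV)" by measurable
    have "(\<lambda>z. ext0 w (Pos X (?p i) (snd z))) \<in> borel_measurable ?M" for i
      by (intro measurable_compose[OF measurable_compose[OF measurable_snd measurable_Pos_nat_filt_compl] measurable_ext0] wm)
    then have "(\<lambda>z. (\<lambda>i z. ext0 w (Pos X (?p i) (snd z))) (?n (fst z)) z) \<in> borel_measurable ?M"
      by (rule measurable_compose_countable) (rule measurable_compose[OF measurable_fst n])
    then show ?thesis unfolding eq by (simp add: split_beta' cong: if_cong)
  qed
  have "(\<lambda>(s, \<omega>). ext0 w (Pos X s \<omega>)) \<in> borel_measurable ?M"
  proof (rule borel_measurable_LIMSEQ_metric[OF step])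
    fix z :: "ennreal \<times> 'w" assume z: "z \<in> space ?M"
    obtain s \<omega> where s: "z = (s, \<omega>)" by (cases z)
    have \<omega>: "\<omega> \<in> space (Evt X)" using z s by (simp add: space_pair_measure)
    show "(\<lambda>k. case z of (s, \<omega>) \<Rightarrow> ext0 w (Pos X (dyadic_above k s) \<omega>)) \<longlonglongrightarrow> (case z of (s, \<omega>) \<Rightarrow> ext0 w (Pos X s \<omega>))"
    proof (cases "s = \<infinity>")
      case False
      then have "filterlim (\<lambda>k. dyadic_above k s) (at_right s) sequentially"
        by (intro dyadic_above_tendsto) (simp add: less_top)
      then show ?thesis unfolding s prod.case by (rule filterlim_compose[OF Pos_right_continuous[OF \<omega> w]])
    qed (simp add: s dyadic_above_def)
  qed
  then have "{z\<in>space ?M. 0 < (\<lambda>(s, \<omega>). ext0 w (Pos X s \<omega>)) z} \<in> sets ?M" by measurable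
  also have "{z\<in>space ?M. 0 < (\<lambda>(s, \<omega>). ext0 w (Pos X s \<omega>)) z} = (\<lambda>(s, \<omega>). Pos X s \<omega>) -` (Some ` U) \<inter> space ?M"
  proof (intro set_eqI)
    fix z show "z \<in> {z\<in>space ?M. 0 < (\<lambda>(s, \<omega>). ext0 w (Pos X s \<omega>)) z} \<longleftrightarrow> z \<in> (\<lambda>(s, \<omega>). Pos X s \<omega>) -` (Some ` U) \<inter> space ?M"
      by (cases "Pos X (fst z) (snd z)") (auto simp: split_beta wpos)
  qed
  finally show "(\<lambda>(s, \<omega>). Pos X s \<omega>) -` (Some ` U) \<inter> space ?M \<in> sets ?M" .
qed

text \<open>The event T \<le> t is the intersection of events T < u_n with u_n decreasing to t,
  hence known at every time s > t; right continuity of the filtration brings it to time t.\<close>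

lemma stopping_time_lessI:
  assumes "\<And>s. s < \<infinity> \<Longrightarrow> {\<omega>\<in>space (Evt X). T \<omega> < s} \<in> sets (Flt X s)"
  shows "stopping_time (Flt X) T"
proof
  fix t :: ennreal
  show "Measurable.pred (Flt X t) (\<lambda>\<omega>. T \<omega> \<le> t)"
  proof (cases "t < \<infinity>")
    case True
    have "{\<omega>\<in>space (Evt X). T \<omega> \<le> t} \<in> sets (Flt X s)" if s: "t < s" for s
    proof -
      obtain s' where s': "t < s'" "s' < s" using dense[OF s] by blast
      obtain u :: "nat \<Rightarrow> ennreal" where u: "\<And>n. t < u n" "\<And>n. u n < s'" "u \<longlonglongrightarrow> t"
        using approx_from_above_dense_linorder[OF s'(1)] s'(1)
      proof -
        obtain v :: "nat \<Rightarrow> ennreal" where v: "\<And>n. t < v n" "v \<longlonglongrightarrow> t"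
          using approx_from_above_dense_linorder[OF s'(1)] by blast
        have "\<forall>\<^sub>F n in sequentially. v n < s'" using v(2) s'(1) by (rule order_tendstoD)
        then obtain N where "\<And>n. n \<ge> N \<Longrightarrow> v n < s'" by (auto simp: eventually_sequentially)
        then show thesis using v LIMSEQ_ignore_initial_segment[OF v(2), of N]
          by (intro that[of "\<lambda>n. v (n + N)"]) auto
      qed
      have "{\<omega>\<in>space (Evt X). T \<omega> < u n} \<in> sets (Flt X s)" for n
      proof -
        have "u n < s" using u(2)[of n] s'(2) by (rule less_trans)
        then have "u n < \<infinity>" "u n \<le> s" by (auto intro: less_le_trans[OF _ top_greatest])
        then show ?thesis using assms[of "u n"] sets_F_mono[of "u n" s] by auto
      qed
      then have "(\<Inter>n. {\<omega>\<in>space (Evt X). T \<omega> < u n}) \<in> sets (Flt X s)" by auto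
      also have "(\<Inter>n. {\<omega>\<in>space (Evt X). T \<omega> < u n}) = {\<omega>\<in>space (Evt X). T \<omega> \<le> t}"
      proof -
        have "T \<omega> \<le> t \<longleftrightarrow> (\<forall>n. T \<omega> < u n)" for \<omega>
        proof
          assume "\<forall>n. T \<omega> < u n"
          then have "\<exists>N. \<forall>n\<ge>N. T \<omega> \<le> u n" by (auto intro: less_imp_le)
          then show "T \<omega> \<le> t" by (rule LIMSEQ_le_const[OF u(3)])
        qed (use u(1) in \<open>auto intro: le_less_trans\<close>)
        then show ?thesis by blast
      qed
      finally show ?thesis .
    qed
    then have "{\<omega>\<in>space (Evt X). T \<omega> \<le> t} \<in> (\<Inter>s\<in>{t<..}. sets (Flt X s))" by auto
    then show ?thesis using filt_right_continuous[OF True] by (simp add: pred_def)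
  next
    case False
    then have "t = \<infinity>" by (simp add: less_top[symmetric])
    then show ?thesis by simp
  qed
qed

text \<open>Null under every law, including the one started at the cemetery. By completeness such
  sets belong to the filtration at all times, so random variables may be altered on them and stay
  adapted.\<close>

definition polar_set :: "'w set \<Rightarrow> bool" where
  "polar_set N \<longleftrightarrow> N \<in> sets (Evt X) \<and> (\<forall>z. emeasure (Law X z) N = 0)"

lemma sets_Flt_polar:
  assumes E: "E \<in> sets (Flt X t)" and D: "D \<subseteq> space (Evt X)" and N: "polar_set N"
    and DE: "(D - E) \<union> (E - D) \<subseteq> N"
  shows "D \<in> sets (Flt X t)"
proof -
  have "D \<in> completed X (sets (Flt X t)) (sets (Evt X))"
    unfolding completed_def using E D N DE
    by (intro CollectI conjI allI impI bexI[of _ E] bexI[of _ N]) (auto simp: polar_set_def init_prob_def)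
  then show ?thesis using filt_complete by simp
qed

lemma measurable_Flt_polar:
  assumes g: "g \<in> measurable (Flt X t) M" and N: "polar_set N"
    and fg: "\<And>\<omega>. \<omega> \<in> space (Evt X) \<Longrightarrow> \<omega> \<notin> N \<Longrightarrow> f \<omega> = g \<omega>"
    and f: "\<And>\<omega>. \<omega> \<in> space (Evt X) \<Longrightarrow> f \<omega> \<in> space M"
  shows "f \<in> measurable (Flt X t) M"
proof (rule measurableI)
  fix B assume "B \<in> sets M"
  then have "g -` B \<inter> space (Flt X t) \<in> sets (Flt X t)" by (rule measurable_sets[OF g])
  then show "f -` B \<inter> space (Flt X t) \<in> sets (Flt X t)"
    by (rule sets_Flt_polar[OF _ _ N]) (use fg in auto)
qed (use f in auto)

lemma polar_set_AE: "polar_set N \<Longrightarrow> AE \<omega> in Law X z. \<omega> \<notin> N"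
  by (intro AE_not_in) (auto simp: polar_set_def null_sets_def sets_law)

end

text \<open>An additive functional freed from its defining set: monotonicity, continuity and
  constancy after the lifetime hold on all paths, and additivity holds almost surely for all pairs
  of times at once.\<close>

locale time_change = standard_process X
  for X :: "('w, 'a::{metric_space, second_countable_topology}) process" +
  fixes A :: "ennreal \<Rightarrow> 'w \<Rightarrow> ennreal"
  assumes clock_path: "\<And>\<omega>. clock_path (\<lambda>t. A t \<omega>)"
    and measurable_A: "\<And>t. A t \<in> borel_measurable (nat_filt_compl X \<infinity>)"
    and adapted_A: "\<And>t. A t \<in> borel_measurable (Flt X t)"
    and A_lifetime: "\<And>t \<omega>. lifetime X \<omega> \<le> t \<Longrightarrow> A t \<omega> = A (lifetime X \<omega>) \<omega>"
    and A_add: "\<And>z. AE \<omega> in Law X z. \<forall>t s. t < \<infinity> \<longrightarrow> s < \<infinity> \<longrightarrow> A (t + s) \<omega> = A t \<omega> + A s (Shift X t \<omega>)"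

context standard_process
begin

lemma pcaf_time_change:
  assumes "pcaf X A"
  obtains B N where "time_change X B" "polar_set N"
    "\<And>\<omega>. \<omega> \<in> space (Evt X) \<Longrightarrow> \<omega> \<notin> N \<Longrightarrow> Pos X 0 \<omega> \<noteq> None \<Longrightarrow> (\<lambda>t. A t \<omega>) = (\<lambda>t. B t \<omega>)"
proof -
  have Am: "\<And>t. A t \<in> borel_measurable (nat_filt_compl X t)" using assms by (simp add: pcaf_def)
  obtain \<Lambda> where \<Lambda>0: "\<Lambda> \<in> sets (nat_filt_compl X \<infinity>)" "\<forall>x. emeasure (Law X (Some x)) \<Lambda> = 1"
      "\<forall>t<\<infinity>. Shift X t ` \<Lambda> \<subseteq> \<Lambda>"
    and A0: "\<forall>\<omega>\<in>\<Lambda>. A 0 \<omega> = 0 \<and> mono (\<lambda>t. A t \<omega>) \<and> continuous_on UNIV (\<lambda>t. A t \<omega>) \<and>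
           (\<forall>t < lifetime X \<omega>. A t \<omega> < \<infinity>) \<and>
           (\<forall>t \<ge> lifetime X \<omega>. A t \<omega> = A (lifetime X \<omega>) \<omega>) \<and>
           (\<forall>t<\<infinity>. \<forall>s<\<infinity>. A (t + s) \<omega> = A t \<omega> + A s (Shift X t \<omega>))"
    using conjunct2[OF assms[unfolded pcaf_def]] by (elim bexE conjE) (rule that)
  note \<Lambda> = \<Lambda>0(1) \<Lambda>0(2,3)[rule_format]
  note A0' = bspec[OF A0, THEN conjunct2, THEN conjunct2]
  have A1: "clock_path (\<lambda>t. A t \<omega>)" if "\<omega> \<in> \<Lambda>" for \<omega>
    using bspec[OF A0 that] unfolding clock_path_def by (elim conjE, intro conjI)
  note A = A1 A0'[THEN conjunct2, THEN conjunct2, THEN conjunct1, rule_format]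
    A0'[THEN conjunct2, THEN conjunct2, THEN conjunct2, rule_format]
  have \<Lambda>E: "\<Lambda> \<in> sets (Evt X)" "\<Lambda> \<subseteq> space (Evt X)"
    using \<Lambda>(1) sets_nat_filt_compl_Evt sets.sets_into_space[OF \<Lambda>(1)] by auto
  \<comment> \<open>The defining set has full measure only for starting points in the state space.
    Paths that start dead receive the zero clock, which makes the exceptional set null for the
    cemetery as well.\<close>
  define alive where "alive = {\<omega>\<in>space (Evt X). Pos X 0 \<omega> \<noteq> None}"
  have alive0: "alive \<in> sets (nat_filt_compl X \<infinity>)" "alive \<in> sets (Flt X t)" for t
  proof -
    have n: "- {None} \<in> sets (borel_cem :: 'a option measure)"
      using sets.compl_sets[OF None_borel_cem] by (simp add: Compl_eq_Diff_UNIV)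
    have eq: "alive = Pos X 0 -` (- {None}) \<inter> space (Evt X)" by (auto simp: alive_def)
    show "alive \<in> sets (nat_filt_compl X \<infinity>)"
      unfolding eq using measurable_sets[OF measurable_Pos_nat_filt_compl n, of 0] by simp
    have "alive \<in> sets (Flt X 0)"
      unfolding eq using measurable_sets[OF adapted n, of 0] by simp
    then show "alive \<in> sets (Flt X t)" using sets_F_mono[of 0 t] by auto
  qed
  define B where "B t \<omega> = (if \<omega> \<in> \<Lambda> \<inter> alive then A t \<omega> else 0)" for t \<omega>
  define N where "N = alive - \<Lambda>"
  have N: "polar_set N"
    unfolding polar_set_def
  proof (intro conjI allI)
    show NE: "N \<in> sets (Evt X)" unfolding N_def using alive0(1) \<Lambda>E sets_nat_filt_compl_Evt by auto
    fix z show "emeasure (Law X z) N = 0"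
    proof (cases z)
      case None
      have "AE \<omega> in Law X z. \<omega> \<notin> N" using normal[of z] None by (auto simp: N_def alive_def elim!: eventually_mono)
      then show ?thesis using NE by (subst (asm) AE_iff_null_sets[symmetric]) (auto simp: sets_law)
    next
      case (Some x)
      interpret prob_space "Law X z" by (rule prob_law)
      have "AE \<omega> in Law X z. \<omega> \<in> \<Lambda>"
        using \<Lambda>(2)[of x] \<Lambda>E Some by (subst AE_in_set_eq_1) (auto simp: sets_law measure_def)
      then have "AE \<omega> in Law X z. \<omega> \<notin> N" by (auto simp: N_def elim!: eventually_mono)
      then show ?thesis using NE by (subst (asm) AE_iff_null_sets[symmetric]) (auto simp: sets_law)
    qed
  qed
  have "time_change X B"
  proof
    show "clock_path (\<lambda>t. B t \<omega>)" for \<omega>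
      using A(1)[of \<omega>] by (cases "\<omega> \<in> \<Lambda> \<inter> alive") (auto simp: B_def clock_path_def mono_def)
    show "B t \<in> borel_measurable (nat_filt_compl X \<infinity>)" for t
    proof -
      have "A t \<in> borel_measurable (Evt X)" by (rule measurable_nat_filt_compl_Evt[OF Am])
      have "sets (nat_filt_compl X t) \<subseteq> sets (nat_filt_compl X \<infinity>)"
      proof -
        have "sets (nat_filt X t) \<subseteq> sets (nat_filt X \<infinity>)"
          unfolding sets_nat_filt by (rule sigma_sets_mono') auto
        then show ?thesis unfolding sets_nat_filt_compl by (intro sigma_sets_mono' completed_mono) auto
      qed
      then have "A t \<in> borel_measurable (nat_filt_compl X \<infinity>)" using Am[of t] by (auto simp: measurable_def)
      moreover have "\<Lambda> \<inter> alive \<in> sets (nat_filt_compl X \<infinity>)" using \<Lambda>(1) alive0 by auto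
      moreover have "\<Lambda> \<inter> alive \<inter> space (Evt X) = \<Lambda> \<inter> alive" using \<Lambda>E(2) by auto
      ultimately show ?thesis unfolding B_def by (intro measurable_If_set) auto
    qed
    \<comment> \<open>The set \<Lambda> is known to be measurable only at time \<infinity>. The
      function below leaves it out and differs from B only on the polar set N.\<close>
    show "B t \<in> borel_measurable (Flt X t)" for t
    proof (rule measurable_Flt_polar[OF _ N])
      have "A t \<in> borel_measurable (Flt X t)"
        using Am[of t] sets_nat_filt_compl_Flt[of t] by (auto simp: measurable_def)
      then show "(\<lambda>\<omega>. if \<omega> \<in> alive then A t \<omega> else 0) \<in> borel_measurable (Flt X t)"
        using alive0(2)[of t] sets.Int_space_eq2[OF alive0(2)[of t]] by (intro measurable_If_set) auto
    qed (auto simp: B_def N_def)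
    show "B t \<omega> = B (lifetime X \<omega>) \<omega>" if "lifetime X \<omega> \<le> t" for t \<omega>
      using A(2)[of \<omega> t] that by (auto simp: B_def)
    show "AE \<omega> in Law X z. \<forall>t s. t < \<infinity> \<longrightarrow> s < \<infinity> \<longrightarrow> B (t + s) \<omega> = B t \<omega> + B s (Shift X t \<omega>)" for z
      using polar_set_AE[OF N]
    proof (rule AE_mp, intro AE_I2 impI allI)
      fix \<omega> and t s :: ennreal assume \<omega>: "\<omega> \<in> space (Law X z)" "\<omega> \<notin> N" and t: "t < \<infinity>" and s: "s < \<infinity>"
      have \<omega>E: "\<omega> \<in> space (Evt X)" using \<omega> by simp
      have P0: "Pos X 0 (Shift X t \<omega>) = Pos X t \<omega>" using pos_shift[OF \<omega>E, of 0 t] by simp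
      show "B (t + s) \<omega> = B t \<omega> + B s (Shift X t \<omega>)"
      proof (cases "\<omega> \<in> alive")
        case False
        then have "Pos X 0 \<omega> = None" using \<omega>E by (simp add: alive_def)
        then have "Pos X t \<omega> = None" using Pos_after[OF \<omega>E, of 0 t] by simp
        then have "Shift X t \<omega> \<notin> alive" using P0 by (simp add: alive_def)
        then show ?thesis using False by (simp add: B_def)
      next
        case True
        then have \<omega>\<Lambda>: "\<omega> \<in> \<Lambda>" using \<omega> by (simp add: N_def)
        have sh: "Shift X t \<omega> \<in> \<Lambda>" using \<Lambda>(3)[OF t] \<omega>\<Lambda> by auto
        show ?thesis
        proof (cases "Pos X t \<omega> = None")
          case None: True
          \<comment> \<open>A path dead at time t has used up its clock, and its shift carries the
            zero clock, so both increments vanish.\<close>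
          then have "lifetime X \<omega> \<le> t" by (rule lifetime_le)
          then have "A (t + s) \<omega> = A t \<omega>"
            using A(2)[OF \<omega>\<Lambda>, of t] A(2)[OF \<omega>\<Lambda>, of "t + s"] by (simp add: add_increasing2)
          moreover have "Shift X t \<omega> \<notin> alive" using P0 None by (simp add: alive_def)
          ultimately show ?thesis using True \<omega>\<Lambda> by (simp add: B_def)
        next
          case False
          then have "Shift X t \<omega> \<in> alive" using P0 shift_space[OF \<omega>E] by (simp add: alive_def)
          then show ?thesis using True \<omega>\<Lambda> sh A(3)[OF \<omega>\<Lambda> t s] by (simp add: B_def)
        qed
      qed
    qed
  qed
  moreover have "(\<lambda>t. A t \<omega>) = (\<lambda>t. B t \<omega>)" if "\<omega> \<in> space (Evt X)" "\<omega> \<notin> N" "Pos X 0 \<omega> \<noteq> None" for \<omega>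
    using that by (auto simp: B_def N_def alive_def)
  ultimately show thesis using N that by blast
qed

end

section \<open>The inverse clock and the time-changed process\<close>

context time_change
begin

definition tau :: "real \<Rightarrow> 'w \<Rightarrow> ennreal" where
  "tau t \<omega> = right_inverse (\<lambda>s. A s \<omega>) t"

lemma tau_less_iff: "tau t \<omega> < s \<longleftrightarrow> ennreal t < A s \<omega>"
  unfolding tau_def by (rule right_inverse_less_iff[OF clock_path])

lemma tau_mono: "s \<le> t \<Longrightarrow> tau s \<omega> \<le> tau t \<omega>"
  unfolding tau_def by (rule right_inverse_mono)

lemma A_tau: "tau t \<omega> < \<infinity> \<Longrightarrow> A (tau t \<omega>) \<omega> = ennreal t"
  unfolding tau_def by (rule clock_right_inverse[OF clock_path])

text \<open>From the lifetime on the clock is constant; a finite inverse there would need a later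
  increase beyond t.\<close>

lemma tau_before_lifetime: "tau t \<omega> < \<infinity> \<Longrightarrow> tau t \<omega> < lifetime X \<omega>"
proof (rule ccontr)
  assume fin: "tau t \<omega> < \<infinity>" and "\<not> tau t \<omega> < lifetime X \<omega>"
  then have l: "lifetime X \<omega> \<le> tau t \<omega>" by simp
  have "ennreal t < A \<infinity> \<omega>" using fin tau_less_iff by simp
  also have "A \<infinity> \<omega> = A (tau t \<omega>) \<omega>" using A_lifetime[OF l] A_lifetime[of \<omega> \<infinity>] by simp
  also have "\<dots> = ennreal t" by (rule A_tau[OF fin])
  finally show False by simp
qed

lemma stopping_time_tau: "stopping_time (Flt X) (tau t)"
proof (rule stopping_time_lessI)
  fix s :: ennreal
  have "{\<omega>\<in>space (Flt X s). ennreal t < A s \<omega>} \<in> sets (Flt X s)"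
    using adapted_A[of s] by measurable
  then show "{\<omega>\<in>space (Evt X). tau t \<omega> < s} \<in> sets (Flt X s)" by (simp add: tau_less_iff)
qed

lemma measurable_tau_joint: "(\<lambda>(t, \<omega>). tau t \<omega>) \<in> borel_measurable (borel \<Otimes>\<^sub>M nat_filt_compl X \<infinity>)"
proof (rule borel_measurableI_less)
  fix y
  note [measurable] = measurable_A[of y]
  let ?M = "borel \<Otimes>\<^sub>M nat_filt_compl X \<infinity> :: (real \<times> 'w) measure"
  have "{z\<in>space ?M. (case z of (t, \<omega>) \<Rightarrow> tau t \<omega>) < y} = {z\<in>space ?M. ennreal (fst z) < A y (snd z)}"
    by (auto simp: tau_less_iff)
  also have "\<dots> \<in> sets ?M" by measurable
  finally show "{z\<in>space ?M. (case z of (t, \<omega>) \<Rightarrow> tau t \<omega>) < y} \<in> sets ?M" .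
qed

text \<open>Once the clock can no longer exceed t, \<open>tau\<close> is infinite and Y is at the
  cemetery, the position at time \<infinity>.\<close>

definition Y :: "real \<Rightarrow> 'w \<Rightarrow> 'a option" where
  "Y t \<omega> = Pos X (tau t \<omega>) \<omega>"

lemma measurable_Y_joint: "(\<lambda>(t, \<omega>). Y t \<omega>) \<in> measurable (borel \<Otimes>\<^sub>M nat_filt_compl X \<infinity>) borel_cem"
proof -
  have "(\<lambda>z. (tau (fst z) (snd z), snd z)) \<in> measurable (borel \<Otimes>\<^sub>M nat_filt_compl X \<infinity>) (borel \<Otimes>\<^sub>M nat_filt_compl X \<infinity>)"
    using measurable_tau_joint by (intro measurable_Pair measurable_snd) (simp add: split_beta')
  from measurable_compose[OF this measurable_Pos_joint] show ?thesis by (simp add: Y_def split_beta')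
qed

lemma measurable_pair_Law:
  "f \<in> measurable (borel \<Otimes>\<^sub>M nat_filt_compl X \<infinity>) M \<Longrightarrow> f \<in> measurable (lborel \<Otimes>\<^sub>M Law X z) M"
proof -
  assume f: "f \<in> measurable (borel \<Otimes>\<^sub>M nat_filt_compl X \<infinity>) M"
  have "(\<lambda>\<omega>. \<omega>) \<in> measurable (nat_filt_compl X \<infinity>) (nat_filt_compl X \<infinity>)" by simp
  then have "(\<lambda>\<omega>. \<omega>) \<in> measurable (Law X z) (nat_filt_compl X \<infinity>)"
    unfolding measurable_Law_cong by (rule measurable_nat_filt_compl_Evt)
  then have "(\<lambda>z. (fst z, snd z)) \<in> measurable (lborel \<Otimes>\<^sub>M Law X z) (borel \<Otimes>\<^sub>M nat_filt_compl X \<infinity>)"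
    by (intro measurable_Pair measurable_compose[OF measurable_snd]) auto
  from measurable_compose[OF this f] show ?thesis by simp
qed

lemma measurable_Y [measurable]: "Y t \<in> measurable (Law X z) borel_cem"
  unfolding Y_def measurable_Law_cong by (rule measurable_Pos_stopping[OF stopping_time_tau])

text \<open>The inverse clocks add up along the shift by \<open>right_inverse_add\<close>; if the
  first is infinite, both sides are at the cemetery. The exceptional set is the same for all s and t
  because additivity of the clock has this form.\<close>

lemma Y_add: "AE \<omega> in Law X z. \<forall>t\<ge>0. \<forall>s\<ge>0. Y (t + s) \<omega> = Y s (Shift X (tau t \<omega>) \<omega>)"
  using A_add[of z]
proof (rule AE_mp, intro AE_I2 impI allI)
  fix \<omega> and t s :: real assume \<omega>: "\<omega> \<in> space (Law X z)"
    and add: "\<forall>t s. t < \<infinity> \<longrightarrow> s < \<infinity> \<longrightarrow> A (t + s) \<omega> = A t \<omega> + A s (Shift X t \<omega>)" and t: "0 \<le> t" and s: "0 \<le> s"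
  have \<omega>E: "\<omega> \<in> space (Evt X)" using \<omega> by simp
  have Ys: "Y s (Shift X (tau t \<omega>) \<omega>) = Pos X (tau t \<omega> + tau s (Shift X (tau t \<omega>) \<omega>)) \<omega>"
    unfolding Y_def by (rule pos_shift[OF \<omega>E])
  show "Y (t + s) \<omega> = Y s (Shift X (tau t \<omega>) \<omega>)"
  proof (cases "tau t \<omega> < \<infinity>")
    case True
    have "tau (t + s) \<omega> = tau t \<omega> + tau s (Shift X (tau t \<omega>) \<omega>)"
      unfolding tau_def[of "t + s"] tau_def[of s] tau_def[of t \<omega>]
      using True add t s by (intro right_inverse_add clock_path) (auto simp: tau_def)
    then show ?thesis unfolding Ys by (simp add: Y_def)
  next
    case False
    then have "tau t \<omega> = \<infinity>" by (simp add: less_top[symmetric])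
    moreover then have "tau (t + s) \<omega> = \<infinity>" using tau_mono[of t "t + s" \<omega>] s by (simp add: top_unique)
    ultimately show ?thesis unfolding Ys using pos_infinity[OF \<omega>E] by (simp add: Y_def)
  qed
qed

end

context standard_process
begin

lemma Law_None: "AE \<omega> in Law X None. \<forall>t. Pos X t \<omega> = None"
  using normal[of None] by (rule AE_mp) (auto intro!: AE_I2 intro: Pos_after[of _ 0])

lemma measurable_Pos_path:
  assumes "\<omega> \<in> space (Evt X)"
  shows "(\<lambda>t. Pos X t \<omega>) \<in> measurable borel borel_cem"
  using measurable_compose[OF measurable_Pair2'[of \<omega>] measurable_Pos_joint] assms
  by (simp add: measurable_Pair2')

lemma measurable_Pos_real_joint:
  "(\<lambda>(t, \<omega>). Pos X (ennreal t) \<omega>) \<in> measurable (borel \<Otimes>\<^sub>M nat_filt_compl X \<infinity>) borel_cem"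
proof -
  have "(\<lambda>z. (ennreal (fst z), snd z)) \<in> measurable (borel \<Otimes>\<^sub>M nat_filt_compl X \<infinity>) (borel \<Otimes>\<^sub>M nat_filt_compl X \<infinity>)"
    by measurable
  from measurable_compose[OF this measurable_Pos_joint] show ?thesis by (simp add: split_beta')
qed

lemma measurable_nn_integral_time:
  assumes "(\<lambda>(t, \<omega>). F t \<omega>) \<in> borel_measurable (borel \<Otimes>\<^sub>M nat_filt_compl X \<infinity>)"
  shows "(\<lambda>\<omega>. \<integral>\<^sup>+t. F t \<omega> \<partial>lborel) \<in> borel_measurable (nat_filt_compl X \<infinity>)"
proof -
  have "(\<lambda>(\<omega>, t). F t \<omega>) \<in> borel_measurable (nat_filt_compl X \<infinity> \<Otimes>\<^sub>M lborel)"
    using measurable_compose[OF measurable_Pair[OF measurable_snd measurable_fst] assms]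
    by (simp add: split_beta' cong: measurable_cong_sets)
  then show ?thesis by (rule lborel.borel_measurable_nn_integral)
qed

lemma borel_measurable_Law_nat_filt_compl:
  "f \<in> measurable (nat_filt_compl X \<infinity>) M \<Longrightarrow> f \<in> measurable (Law X z) M"
  unfolding measurable_Law_cong by (rule measurable_nat_filt_compl_Evt)

end

lemma measurable_the_borel_cem: "the \<in> measurable borel_cem (borel :: 'a::t2_space measure)"
  by (rule measurable_from_borel_cem) auto

section \<open>The occupation measure of the time-changed process\<close>

context time_change
begin

lemma pair_sigma_finite_Law: "pair_sigma_finite lborel (Law X z)"
  by (intro pair_sigma_finite.intro lborel.sigma_finite_measure_axioms
      prob_space_imp_sigma_finite prob_law)

lemma measurable_ext0_Y:
  assumes F: "F \<in> borel_measurable (borel :: (real \<times> 'a) measure)"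
  shows "(\<lambda>(t, \<omega>). ext0 (\<lambda>y. F (t, y)) (Y t \<omega>)) \<in> borel_measurable (borel \<Otimes>\<^sub>M nat_filt_compl X \<infinity>)"
    (is "_ \<in> borel_measurable ?M")
proof -
  note [measurable] = F measurable_Y_joint
  have Ym: "(\<lambda>z. Y (fst z) (snd z)) \<in> measurable ?M borel_cem"
    using measurable_Y_joint by (simp add: split_beta')
  have 1: "(\<lambda>z. (fst z, the (Y (fst z) (snd z)))) \<in> measurable ?M borel"
    unfolding borel_prod[symmetric]
    by (intro measurable_Pair measurable_fst measurable_compose[OF Ym measurable_the_borel_cem])
  have 2: "{z\<in>space ?M. Y (fst z) (snd z) = None} \<in> sets ?M"
    using measurable_sets[OF Ym None_borel_cem] by (simp add: vimage_def Int_def conj_commute)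
  have "(\<lambda>z. if Y (fst z) (snd z) = None then 0 else F (fst z, the (Y (fst z) (snd z)))) \<in> borel_measurable ?M"
    using 2 by (intro measurable_If measurable_const measurable_compose[OF 1 F]) auto
  also have "(\<lambda>z. if Y (fst z) (snd z) = None then 0 else F (fst z, the (Y (fst z) (snd z))))
      = (\<lambda>(t, \<omega>). ext0 (\<lambda>y. F (t, y)) (Y t \<omega>))"
    by (auto simp: fun_eq_iff)
  finally show ?thesis .
qed

lemma measurable_Y_path_functional:
  fixes f :: "'a \<Rightarrow> ennreal"
  assumes f: "f \<in> borel_measurable (borel :: 'a measure)" and S: "S \<in> sets borel"
  shows "(\<lambda>(t, \<omega>). ext0 f (Y t \<omega>) * indicator S t) \<in> borel_measurable (borel \<Otimes>\<^sub>M nat_filt_compl X \<infinity>)"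
proof -
  have 1: "(\<lambda>z. ext0 f (Y (fst z) (snd z))) \<in> borel_measurable (borel \<Otimes>\<^sub>M nat_filt_compl X \<infinity>)"
    using measurable_compose[OF measurable_Y_joint measurable_ext0[OF f]] by (simp add: split_beta')
  show ?thesis
    unfolding split_beta' by (intro borel_measurable_times_ennreal 1 measurable_compose[OF measurable_fst borel_measurable_indicator] assms)
qed

text \<open>An image of Lebesgue measure times the law, restricted to nonnegative times at which Y
  is alive; the cemetery carries no mass, which is why the total can be finite.\<close>

definition occ :: "'a \<Rightarrow> (real \<times> 'a) measure" where
  "occ x = distr (restrict_space (lborel \<Otimes>\<^sub>M Law X (Some x)) {z. 0 \<le> fst z \<and> Y (fst z) (snd z) \<noteq> None})
     borel (\<lambda>z. (fst z, the (Y (fst z) (snd z))))"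

lemma occ_measurable:
  shows sets_occ_domain: "{z. 0 \<le> fst z \<and> Y (fst z) (snd z) \<noteq> None} \<inter> space (lborel \<Otimes>\<^sub>M Law X z0)
      \<in> sets (lborel \<Otimes>\<^sub>M Law X z0)"
    and measurable_occ_map: "(\<lambda>z. (fst z, the (Y (fst z) (snd z))))
      \<in> measurable (restrict_space (lborel \<Otimes>\<^sub>M Law X z0) {z. 0 \<le> fst z \<and> Y (fst z) (snd z) \<noteq> None}) borel"
proof -
  let ?M = "(lborel :: real measure) \<Otimes>\<^sub>M Law X z0"
  have Ym: "(\<lambda>z. Y (fst z) (snd z)) \<in> measurable ?M borel_cem"
    using measurable_pair_Law[OF measurable_Y_joint] by (simp add: split_beta')
  have "fst -` {0..} \<inter> space ?M \<in> sets ?M" by (rule measurable_sets[OF measurable_fst]) (simp add: borel_closed)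
  then have "{z\<in>space ?M. 0 \<le> fst z} \<in> sets ?M" by (simp add: vimage_def Int_def conj_commute)
  moreover have "{z\<in>space ?M. Y (fst z) (snd z) = None} \<in> sets ?M"
    using measurable_sets[OF Ym None_borel_cem] by (simp add: vimage_def Int_def conj_commute)
  ultimately have "{z\<in>space ?M. 0 \<le> fst z} - {z\<in>space ?M. Y (fst z) (snd z) = None} \<in> sets ?M" by (rule sets.Diff)
  also have "{z\<in>space ?M. 0 \<le> fst z} - {z\<in>space ?M. Y (fst z) (snd z) = None}
      = {z. 0 \<le> fst z \<and> Y (fst z) (snd z) \<noteq> None} \<inter> space ?M" by auto
  finally show "{z. 0 \<le> fst z \<and> Y (fst z) (snd z) \<noteq> None} \<inter> space ?M \<in> sets ?M" .
  have "(\<lambda>z. (fst z, the (Y (fst z) (snd z)))) \<in> measurable ?M borel"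
    unfolding borel_prod[symmetric]
    by (intro measurable_Pair measurable_compose[OF Ym measurable_the_borel_cem]) measurable
  then show "(\<lambda>z. (fst z, the (Y (fst z) (snd z))))
      \<in> measurable (restrict_space ?M {z. 0 \<le> fst z \<and> Y (fst z) (snd z) \<noteq> None}) borel"
    by (rule measurable_restrict_space1)
qed

lemma nn_integral_occ_pair:
  assumes F: "F \<in> borel_measurable borel"
  shows "(\<integral>\<^sup>+z. F z \<partial>occ x) = (\<integral>\<^sup>+z. ext0 (\<lambda>y. F (fst z, y)) (Y (fst z) (snd z)) * indicator {0..} (fst z) \<partial>(lborel \<Otimes>\<^sub>M Law X (Some x)))"
  unfolding occ_def
  by (subst nn_integral_distr[OF measurable_occ_map])
     (use F sets_occ_domain in \<open>auto simp: nn_integral_restrict_space intro!: nn_integral_cong split: split_indicator\<close>)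

lemma
  assumes F: "F \<in> borel_measurable borel"
  shows nn_integral_occ: "(\<integral>\<^sup>+z. F z \<partial>occ x)
      = (\<integral>\<^sup>+t\<in>{0..}. (\<integral>\<^sup>+\<omega>. ext0 (\<lambda>y. F (t, y)) (Y t \<omega>) \<partial>Law X (Some x)) \<partial>lborel)"
    and nn_integral_occ_swap: "(\<integral>\<^sup>+z. F z \<partial>occ x)
      = (\<integral>\<^sup>+\<omega>. (\<integral>\<^sup>+t\<in>{0..}. ext0 (\<lambda>y. F (t, y)) (Y t \<omega>) \<partial>lborel) \<partial>Law X (Some x))"
proof -
  let ?L = "Law X (Some x)"
  interpret pair_sigma_finite lborel ?L by (rule pair_sigma_finite_Law)
  have m: "(\<lambda>(t, \<omega>). ext0 (\<lambda>y. F (t, y)) (Y t \<omega>)) \<in> borel_measurable (lborel \<Otimes>\<^sub>M ?L)"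
    by (rule measurable_pair_Law[OF measurable_ext0_Y[OF F]])
  then have m': "(\<lambda>(t, \<omega>). ext0 (\<lambda>y. F (t, y)) (Y t \<omega>) * indicator {0..} t) \<in> borel_measurable (lborel \<Otimes>\<^sub>M ?L)"
    unfolding split_beta' by measurable
  have 1: "(\<integral>\<^sup>+t. \<integral>\<^sup>+\<omega>. ext0 (\<lambda>y. F (t, y)) (Y t \<omega>) * indicator {0..} t \<partial>?L \<partial>lborel) = (\<integral>\<^sup>+z. F z \<partial>occ x)"
    using M2.nn_integral_fst[OF m'] unfolding nn_integral_occ_pair[OF F] by (simp add: split_beta')
  have mt: "(\<lambda>\<omega>. ext0 (\<lambda>y. F (t, y)) (Y t \<omega>)) \<in> borel_measurable ?L" for t
    using measurable_compose[OF measurable_Pair1'[of t lborel ?L] m] by simp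
  show "(\<integral>\<^sup>+z. F z \<partial>occ x) = (\<integral>\<^sup>+t\<in>{0..}. (\<integral>\<^sup>+\<omega>. ext0 (\<lambda>y. F (t, y)) (Y t \<omega>) \<partial>?L) \<partial>lborel)"
    unfolding 1[symmetric] by (intro nn_integral_cong) (simp add: nn_integral_multc[OF mt])
  show "(\<integral>\<^sup>+z. F z \<partial>occ x) = (\<integral>\<^sup>+\<omega>. (\<integral>\<^sup>+t\<in>{0..}. ext0 (\<lambda>y. F (t, y)) (Y t \<omega>) \<partial>lborel) \<partial>?L)"
    unfolding 1[symmetric] using Fubini'[OF m'] by simp
qed

lemma sets_occ [simp]: "sets (occ x) = sets borel"
  by (simp add: occ_def)

lemma space_occ [simp]: "space (occ x) = UNIV"
  by (simp add: occ_def)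

end

text \<open>The assumption \<open>potential\<close> is the potential identity of order 0 after the
  Stieltjes integral has been rewritten through the inverse clock.\<close>

locale kato_time_change = time_change X A + green_kernel G
  for X :: "('w, 'a::{metric_space, second_countable_topology}) process"
    and A :: "ennreal \<Rightarrow> 'w \<Rightarrow> ennreal" and G :: "'a \<Rightarrow> 'a \<Rightarrow> ennreal" +
  fixes \<mu> :: "'a measure"
  assumes kato: "kato_measure \<mu>"
    and potential: "\<And>u x. u \<in> borel_measurable borel \<Longrightarrow>
      (\<integral>\<^sup>+\<omega>. (\<integral>\<^sup>+t\<in>{0..}. ext0 u (Y t \<omega>) \<partial>lborel) \<partial>Law X (Some x)) = (\<integral>\<^sup>+y. G x y * u y \<partial>\<mu>)"
begin

lemma sets_\<mu>: "sets \<mu> = sets borel"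
  using kato by (simp add: kato_measure_def radon_measure_def)

lemma measurable_snd_borel: "(snd :: real \<times> 'a \<Rightarrow> 'a) \<in> borel_measurable borel"
  "(fst :: real \<times> 'a \<Rightarrow> real) \<in> borel_measurable borel"
  by (intro borel_measurable_continuous_onI continuous_on_snd continuous_on_fst continuous_on_id)+

lemma nn_potential_occ:
  assumes f: "f \<in> borel_measurable borel"
  shows "(\<integral>\<^sup>+z. f (snd z) \<partial>occ x) = (\<integral>\<^sup>+y. G x y * f y \<partial>\<mu>)"
  using potential[OF f, of x] measurable_compose[OF measurable_snd_borel(1) f]
  by (subst nn_integral_occ_swap) auto

lemma measurable_nn_potential:
  "f \<in> borel_measurable borel \<Longrightarrow> (\<lambda>x. \<integral>\<^sup>+y. G x y * f y \<partial>\<mu>) \<in> borel_measurable borel"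
  by (rule measurable_lower_semicont[OF lower_semicont_potential[OF lsc sets_\<mu>]])

text \<open>The strong Markov property at the stopping time \<open>tau t\<close>, for the functional
  that integrates f along the whole time-changed path. Events D of the past are retained because the
  minimum of two potentials will be treated by splitting such an event.\<close>

lemma Y_markov:
  assumes f: "f \<in> borel_measurable borel" and t: "0 \<le> t" and D: "D \<in> sets (pre_sigma (tau t))"
  shows "(\<integral>\<^sup>+\<omega>\<in>D. ext0 (\<lambda>x. \<integral>\<^sup>+y. G x y * f y \<partial>\<mu>) (Y t \<omega>) \<partial>Law X z)
    = (\<integral>\<^sup>+\<omega>\<in>D. (\<integral>\<^sup>+s\<in>{t..}. ext0 f (Y s \<omega>) \<partial>lborel) \<partial>Law X z)"
proof -
  define \<Phi> where "\<Phi> \<omega> = (\<integral>\<^sup>+s\<in>{0..}. ext0 f (Y s \<omega>) \<partial>lborel)" for \<omega>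
  define \<Psi> where "\<Psi> \<omega> = (\<integral>\<^sup>+s\<in>{t..}. ext0 f (Y s \<omega>) \<partial>lborel)" for \<omega>
  let ?V = "\<lambda>x. \<integral>\<^sup>+y. G x y * f y \<partial>\<mu>"
  have \<Phi>: "\<Phi> \<in> borel_measurable (nat_filt_compl X \<infinity>)"
    unfolding \<Phi>_def by (intro measurable_nn_integral_time measurable_Y_path_functional f) auto
  have \<phi>: "ext0 ?V y = (\<integral>\<^sup>+\<omega>. \<Phi> \<omega> \<partial>Law X y)" for y
  proof (cases y)
    case (Some x)
    then show ?thesis using potential[OF f, of x] by (simp add: \<Phi>_def)
  next
    case None
    have "(\<integral>\<^sup>+\<omega>. \<Phi> \<omega> \<partial>Law X y) = (\<integral>\<^sup>+\<omega>. 0 \<partial>Law X y)"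
      using Law_None unfolding None
      by (intro nn_integral_cong_AE) (auto elim!: eventually_mono simp: \<Phi>_def Y_def)
    then show ?thesis using None by simp
  qed
  have AE: "AE \<omega> in Law X z. \<omega> \<in> D \<longrightarrow> \<Psi> \<omega> = \<Phi> (Shift X (tau t \<omega>) \<omega>)"
    using Y_add[of z]
  proof (rule AE_mp, intro AE_I2 impI)
    fix \<omega> assume \<omega>: "\<omega> \<in> space (Law X z)" and add: "\<forall>t\<ge>0. \<forall>s\<ge>0. Y (t + s) \<omega> = Y s (Shift X (tau t \<omega>) \<omega>)"
    have "(\<lambda>s. ext0 f (Y s \<omega>)) \<in> borel_measurable borel"
      using measurable_compose[OF measurable_Pair2'[of \<omega> "nat_filt_compl X \<infinity>" borel] measurable_Y_joint] \<omega> f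
      by (auto intro: measurable_compose)
    then have m: "(\<lambda>s. ext0 f (Y s \<omega>) * indicator {t..} s) \<in> borel_measurable borel" by measurable
    have "\<Psi> \<omega> = (\<integral>\<^sup>+s. ext0 f (Y (t + s) \<omega>) * indicator {t..} (t + s) \<partial>lborel)"
      unfolding \<Psi>_def using nn_integral_real_affine[OF m, of 1 t] by simp
    also have "\<dots> = \<Phi> (Shift X (tau t \<omega>) \<omega>)"
      unfolding \<Phi>_def using add t by (intro nn_integral_cong) (auto split: split_indicator)
    finally show "\<Psi> \<omega> = \<Phi> (Shift X (tau t \<omega>) \<omega>)" .
  qed
  show ?thesis
    using strong_markov_completed[OF stopping_time_tau D \<Phi> measurable_ext0[OF measurable_nn_potential[OF f]] \<phi> AE]
    by (simp add: Y_def \<Psi>_def)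
qed

lemma space_in_pre_sigma: "space (Evt X) \<in> sets (pre_sigma T)"
  using sets.top[of "pre_sigma T"] by (simp add: space_pre_sigma)

lemma nn_integral_space: "(\<integral>\<^sup>+\<omega>\<in>space (Evt X). f \<omega> \<partial>Law X z) = (\<integral>\<^sup>+\<omega>. f \<omega> \<partial>Law X z)"
  by (intro nn_integral_cong) simp

lemma measurable_expect_Y:
  assumes "f \<in> borel_measurable (borel :: 'a measure)"
  shows "(\<lambda>t. \<integral>\<^sup>+\<omega>. ext0 f (Y t \<omega>) \<partial>Law X z) \<in> (borel_measurable borel :: (real \<Rightarrow> ennreal) set)"
proof -
  interpret sigma_finite_measure "Law X z" by (intro prob_space_imp_sigma_finite prob_law)
  have "(\<lambda>(t, \<omega>). ext0 f (Y t \<omega>)) \<in> borel_measurable (lborel \<Otimes>\<^sub>M Law X z)"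
    using measurable_pair_Law[OF measurable_compose[OF measurable_Y_joint measurable_ext0[OF assms]]]
    by (simp add: split_beta')
  from borel_measurable_nn_integral[OF this] show ?thesis by (simp add: measurable_lborel1)
qed

lemma expect_Y_potential:
  assumes f: "f \<in> borel_measurable borel" and t: "0 \<le> t"
  shows "(\<integral>\<^sup>+\<omega>. ext0 (\<lambda>x. \<integral>\<^sup>+y. G x y * f y \<partial>\<mu>) (Y t \<omega>) \<partial>Law X z)
    = (\<integral>\<^sup>+s\<in>{t..}. (\<integral>\<^sup>+\<omega>. ext0 f (Y s \<omega>) \<partial>Law X z) \<partial>lborel)"
proof -
  interpret pair_sigma_finite lborel "Law X z" by (rule pair_sigma_finite_Law)
  have m: "(\<lambda>(s, \<omega>). ext0 f (Y s \<omega>) * indicator {t..} s) \<in> borel_measurable (lborel \<Otimes>\<^sub>M Law X z)"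
    by (intro measurable_pair_Law measurable_Y_path_functional f) auto
  have mt: "(\<lambda>\<omega>. ext0 f (Y s \<omega>)) \<in> borel_measurable (Law X z)" for s
    by (intro measurable_compose[OF measurable_Y measurable_ext0] f)
  show ?thesis
    using Y_markov[OF f t space_in_pre_sigma, of z] Fubini'[OF m]
    unfolding nn_integral_space by (simp add: nn_integral_multc[OF mt])
qed

lemma occupation_occ:
  assumes N: "1 \<le> N" "\<And>x. gpot \<mu> (\<lambda>_. 1) x \<le> ennreal N"
  shows "occupation occ N"
proof
  note fst_snd [measurable] = measurable_snd_borel
  show "1 \<le> N" by fact
  show "sets (occ x) = sets borel" for x by simp
  show "AE z in occ x. 0 \<le> fst z" for x
  proof -
    have s: "{z :: real \<times> 'a. fst z < 0} \<in> sets borel"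
      using measurable_sets[OF fst_snd(2), of "{..<0}"] by (simp add: vimage_def)
    then have m: "indicator {z. fst z < 0} \<in> (borel_measurable borel :: (real \<times> 'a \<Rightarrow> ennreal) set)" by measurable
    have "emeasure (occ x) {z. fst z < 0} = (\<integral>\<^sup>+z. indicator {z. fst z < 0} z \<partial>occ x)" using s by simp
    also have "\<dots> = (\<integral>\<^sup>+t. 0 \<partial>(lborel :: real measure))"
      unfolding nn_integral_occ[OF m]
    proof (intro nn_integral_cong)
      fix t :: real
      have "0 \<le> t \<Longrightarrow> ext0 (\<lambda>y. indicator {z. fst z < 0} (t, y)) (Y t \<omega>) = (0 :: ennreal)" for \<omega>
        by (cases "Y t \<omega>") auto
      then show "(\<integral>\<^sup>+\<omega>. ext0 (\<lambda>y. indicator {z. fst z < 0} (t, y)) (Y t \<omega>) \<partial>Law X (Some x)) * indicator {0..} t = 0"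
        by (auto split: split_indicator)
    qed
    finally have "{z. fst z < 0} \<in> null_sets (occ x)" using s by (auto simp: null_sets_def)
    from AE_not_in[OF this] show ?thesis by (auto simp: not_less)
  qed
  show "emeasure (occ x) UNIV \<le> ennreal N" for x
  proof -
    have "emeasure (occ x) UNIV = (\<integral>\<^sup>+z. 1 \<partial>occ x)" by simp
    also have "\<dots> = gpot \<mu> (\<lambda>_. 1) x" using nn_potential_occ[of "\<lambda>_. 1" x] by (simp add: gpot_def)
    finally show ?thesis using N(2) by simp
  qed
  show "emeasure (occ x) ({a..b} \<times> UNIV) \<le> ennreal (b - a)" if "a \<le> b" for x a b
  proof -
    have s: "{a..b} \<times> (UNIV :: 'a set) \<in> sets borel" by (intro borel_closed closed_Times) auto
    then have m: "indicator ({a..b} \<times> UNIV) \<in> (borel_measurable borel :: (real \<times> 'a \<Rightarrow> ennreal) set)" by measurable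
    have "emeasure (occ x) ({a..b} \<times> UNIV) = (\<integral>\<^sup>+z. indicator ({a..b} \<times> UNIV) z \<partial>occ x)" using s by simp
    also have "\<dots> \<le> (\<integral>\<^sup>+t. indicator {a..b} t \<partial>lborel)"
      unfolding nn_integral_occ[OF m]
    proof (intro nn_integral_mono)
      fix t :: real
      have "ext0 (\<lambda>y. indicator ({a..b} \<times> UNIV) (t, y)) (Y t \<omega>) \<le> (indicator {a..b} t :: ennreal)" for \<omega>
        by (cases "Y t \<omega>") (auto split: split_indicator)
      then have "(\<integral>\<^sup>+\<omega>. ext0 (\<lambda>y. indicator ({a..b} \<times> UNIV) (t, y)) (Y t \<omega>) \<partial>Law X (Some x))
          \<le> (\<integral>\<^sup>+\<omega>. indicator {a..b} t \<partial>Law X (Some x))" by (rule nn_integral_mono)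
      also have "\<dots> = indicator {a..b} t" using prob_space.emeasure_space_1[OF prob_law[of "Some x"]] by simp
      finally show "(\<integral>\<^sup>+\<omega>. ext0 (\<lambda>y. indicator ({a..b} \<times> UNIV) (t, y)) (Y t \<omega>) \<partial>Law X (Some x)) * indicator {0..} t \<le> indicator {a..b} t"
        by (auto split: split_indicator)
    qed
    also have "\<dots> = ennreal (b - a)" using that by simp
    finally show ?thesis .
  qed
  show "(\<lambda>x. \<integral>\<^sup>+z. f (snd z) \<partial>occ x) \<in> borel_measurable borel" if "f \<in> borel_measurable borel" for f
    unfolding nn_potential_occ[OF that] by (rule measurable_nn_potential[OF that])
  show "(\<integral>\<^sup>+z. ennreal (fst z ^ k) * (\<integral>\<^sup>+w. f (snd w) \<partial>occ (snd z)) \<partial>occ x) =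
      (\<integral>\<^sup>+z. ennreal (fst z ^ Suc k / real (Suc k)) * f (snd z) \<partial>occ x)"
    if f [measurable]: "f \<in> borel_measurable borel" for f k x
  proof -
    let ?V = "\<lambda>x. \<integral>\<^sup>+y. G x y * f y \<partial>\<mu>"
    define e where "e s = (\<integral>\<^sup>+\<omega>. ext0 f (Y s \<omega>) \<partial>Law X (Some x))" for s
    note [measurable] = measurable_nn_potential[OF f]
    have e [measurable]: "e \<in> borel_measurable borel" unfolding e_def by (rule measurable_expect_Y[OF f])
    have pull: "(\<integral>\<^sup>+\<omega>. ext0 (\<lambda>y. c * g y) (Y t \<omega>) \<partial>Law X (Some x)) = c * (\<integral>\<^sup>+\<omega>. ext0 g (Y t \<omega>) \<partial>Law X (Some x))"
      if "g \<in> borel_measurable borel" for c g t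
    proof -
      have "ext0 (\<lambda>y. c * g y) z = c * ext0 g z" for z by (cases z) auto
      moreover have "(\<lambda>\<omega>. ext0 g (Y t \<omega>)) \<in> borel_measurable (Law X (Some x))"
        by (intro measurable_compose[OF measurable_Y measurable_ext0] that)
      ultimately show ?thesis by (simp add: nn_integral_cmult)
    qed
    have m1: "(\<lambda>z. ennreal (fst z ^ k) * ?V (snd z)) \<in> borel_measurable borel" by measurable
    have m2: "(\<lambda>z :: real \<times> 'a. ennreal (fst z ^ Suc k / real (Suc k)) * f (snd z)) \<in> borel_measurable borel"
      by (intro borel_measurable_times_ennreal measurable_compose[OF fst_snd(1) f]) measurable
    have "(\<integral>\<^sup>+z. ennreal (fst z ^ k) * (\<integral>\<^sup>+w. f (snd w) \<partial>occ (snd z)) \<partial>occ x)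
        = (\<integral>\<^sup>+t\<in>{0..}. ennreal (t ^ k) * (\<integral>\<^sup>+\<omega>. ext0 ?V (Y t \<omega>) \<partial>Law X (Some x)) \<partial>lborel)"
      unfolding nn_potential_occ[OF f] nn_integral_occ[OF m1] fst_conv snd_conv
      by (intro nn_integral_cong) (simp add: pull[OF measurable_nn_potential[OF f]])
    \<comment> \<open>The potential at time t is the integral of \<open>e\<close> from t onwards;
      exchanging the integrals over 0 \<le> t \<le> s leaves the integral of t^k over
      [0, s].\<close>
    also have "\<dots> = (\<integral>\<^sup>+t. (\<integral>\<^sup>+s. ennreal (t ^ k) * e s * indicator {0..} t * indicator {t..} s \<partial>lborel) \<partial>lborel)"
    proof (intro nn_integral_cong)
      fix t :: real
      show "ennreal (t ^ k) * (\<integral>\<^sup>+\<omega>. ext0 ?V (Y t \<omega>) \<partial>Law X (Some x)) * indicator {0..} t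
          = (\<integral>\<^sup>+s. ennreal (t ^ k) * e s * indicator {0..} t * indicator {t..} s \<partial>lborel)"
      proof (cases "0 \<le> t")
        case True
        have "(\<integral>\<^sup>+s. ennreal (t ^ k) * e s * indicator {0..} t * indicator {t..} s \<partial>lborel)
            = (\<integral>\<^sup>+s. ennreal (t ^ k) * (e s * indicator {t..} s) \<partial>lborel)"
          using True by (simp add: mult.assoc)
        also have "\<dots> = ennreal (t ^ k) * (\<integral>\<^sup>+s. e s * indicator {t..} s \<partial>lborel)"
          by (intro nn_integral_cmult) simp
        finally show ?thesis using True expect_Y_potential[OF f True, of "Some x"] by (simp add: e_def)
      qed simp
    qed
    also have "\<dots> = (\<integral>\<^sup>+s. (\<integral>\<^sup>+t. ennreal (t ^ k) * e s * indicator {0..} t * indicator {t..} s \<partial>lborel) \<partial>lborel)"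
    proof (rule lborel_pair.Fubini')
      have "(\<lambda>z :: real \<times> real. ennreal (snd z ^ k) * e (fst z) * indicator {0..} (snd z) * indicator {z. snd z \<le> fst z} z)
          \<in> borel_measurable (lborel \<Otimes>\<^sub>M lborel)" by measurable
      also have "(\<lambda>z :: real \<times> real. ennreal (snd z ^ k) * e (fst z) * indicator {0..} (snd z) * indicator {z. snd z \<le> fst z} z)
        = (\<lambda>(s, t). ennreal (t ^ k) * e s * indicator {0..} t * indicator {t..} s)"
        by (auto simp: fun_eq_iff split: split_indicator)
      finally show "(\<lambda>(s, t). ennreal (t ^ k) * e s * indicator {0..} t * indicator {t..} s)
          \<in> borel_measurable (lborel \<Otimes>\<^sub>M lborel)" .
    qed
    also have "\<dots> = (\<integral>\<^sup>+s\<in>{0..}. ennreal (s ^ Suc k / real (Suc k)) * e s \<partial>lborel)"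
    proof (intro nn_integral_cong)
      fix s :: real
      show "(\<integral>\<^sup>+t. ennreal (t ^ k) * e s * indicator {0..} t * indicator {t..} s \<partial>lborel)
          = ennreal (s ^ Suc k / real (Suc k)) * e s * indicator {0..} s"
      proof (cases "0 \<le> s")
        case True
        have "(\<integral>\<^sup>+t. ennreal (t ^ k) * e s * indicator {0..} t * indicator {t..} s \<partial>lborel)
            = (\<integral>\<^sup>+t. e s * (ennreal (t ^ k) * indicator {0..s} t) \<partial>lborel)"
          by (intro nn_integral_cong) (auto split: split_indicator simp: mult.commute)
        also have "\<dots> = e s * (\<integral>\<^sup>+t. ennreal (t ^ k) * indicator {0..s} t \<partial>lborel)"
          by (intro nn_integral_cmult) measurable
        also have "(\<integral>\<^sup>+t. ennreal (t ^ k) * indicator {0..s} t \<partial>lborel) = ennreal (s ^ Suc k / real (Suc k) - 0 ^ Suc k / real (Suc k))"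
        proof (rule nn_integral_FTC_Icc)
          fix t :: real
          show "((\<lambda>t. t ^ Suc k / real (Suc k)) has_field_derivative t ^ k) (at t)"
            by (rule derivative_eq_intros refl | simp del: power_Suc of_nat_Suc)+
        qed (use True in auto)
        finally show ?thesis using True by (simp add: mult.commute)
      next
        case False
        then have "(\<integral>\<^sup>+t. ennreal (t ^ k) * e s * indicator {0..} t * indicator {t..} s \<partial>lborel)
            = (\<integral>\<^sup>+t. 0 \<partial>(lborel :: real measure))"
          by (intro nn_integral_cong) (auto split: split_indicator)
        then show ?thesis using False by (simp del: nn_integral_0_iff_AE)
      qed
    qed
    also have "\<dots> = (\<integral>\<^sup>+z. ennreal (fst z ^ Suc k / real (Suc k)) * f (snd z) \<partial>occ x)"
      unfolding nn_integral_occ[OF m2] fst_conv snd_conv e_def by (simp only: pull[OF f])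
    finally show ?thesis .
  qed
qed

end

section \<open>The semigroup and the resolvent as integrals\<close>

context standard_process
begin

text \<open>Completeness of the filtration makes f measurable as well. Without that the Bochner
  integral of f would fall back to 0 and almost sure equality would prove nothing.\<close>

lemma integral_polar:
  fixes g :: "'w \<Rightarrow> real"
  assumes g: "g \<in> borel_measurable (nat_filt_compl X \<infinity>)" and N: "polar_set N"
    and fg: "\<And>\<omega>. \<omega> \<in> space (Evt X) \<Longrightarrow> \<omega> \<notin> N \<Longrightarrow> f \<omega> = g \<omega>"
  shows "(\<integral>\<omega>. f \<omega> \<partial>Law X z) = (\<integral>\<omega>. g \<omega> \<partial>Law X z)"
proof (rule integral_cong_AE)
  have gF: "g \<in> borel_measurable (Flt X \<infinity>)"
    using g sets_nat_filt_compl_Flt[of \<infinity>] by (auto simp: measurable_def)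
  have "f \<in> borel_measurable (Flt X \<infinity>)" by (rule measurable_Flt_polar[OF gF N fg]) auto
  then show "f \<in> borel_measurable (Law X z)" unfolding measurable_Law_cong by (rule measurable_Flt_Evt)
  show "g \<in> borel_measurable (Law X z)" by (rule borel_measurable_Law_nat_filt_compl[OF g])
  show "AE \<omega> in Law X z. f \<omega> = g \<omega>"
    using polar_set_AE[OF N, of z] by (rule AE_mp) (auto intro!: AE_I2 fg)
qed

end

context time_change
begin

lemma measurable_Y_nat_filt_compl: "Y t \<in> measurable (nat_filt_compl X \<infinity>) borel_cem"
  using measurable_compose[OF measurable_Pair1'[of t borel] measurable_Y_joint] by simp

definition Qt :: "real \<Rightarrow> ('a \<Rightarrow> real) \<Rightarrow> 'a \<Rightarrow> real" where
  "Qt t f x = (\<integral>\<omega>. ext0 f (Y t \<omega>) \<partial>Law X (Some x))"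

lemma abs_ext0_le: "0 \<le> C \<Longrightarrow> (\<And>y. \<bar>f y\<bar> \<le> C) \<Longrightarrow> \<bar>ext0 f z\<bar> \<le> (C :: real)"
  by (cases z) auto

lemma integrable_Y:
  assumes "f \<in> bmeas" shows "integrable (Law X z) (\<lambda>\<omega>. ext0 f (Y t \<omega>))"
proof -
  interpret prob_space "Law X z" by (rule prob_law)
  obtain C where "0 \<le> C" "\<And>y. \<bar>f y\<bar> \<le> C" by (rule bmeasE[OF assms]) blast
  then have "\<bar>ext0 f (Y t \<omega>)\<bar> \<le> C" for \<omega> by (rule abs_ext0_le)
  moreover have "(\<lambda>\<omega>. ext0 f (Y t \<omega>)) \<in> borel_measurable (Law X z)"
    by (intro measurable_compose[OF measurable_Y measurable_ext0] bmeasD assms)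
  ultimately show ?thesis by (intro integrable_const_bound[of _ C]) auto
qed

lemma Qt_bound:
  assumes f: "f \<in> borel_measurable borel" "\<And>y. \<bar>f y\<bar> \<le> C"
  shows "\<bar>Qt t f x\<bar> \<le> C"
proof -
  interpret prob_space "Law X (Some x)" by (rule prob_law)
  have C: "0 \<le> C" using f(2) by (meson abs_ge_zero order_trans)
  have i: "integrable (Law X (Some x)) (\<lambda>\<omega>. ext0 f (Y t \<omega>))" using f by (intro integrable_Y bmeasI)
  have "\<bar>Qt t f x\<bar> \<le> (\<integral>\<omega>. \<bar>ext0 f (Y t \<omega>)\<bar> \<partial>Law X (Some x))" unfolding Qt_def by (rule integral_abs_bound)
  also have "\<dots> \<le> (\<integral>\<omega>. C \<partial>Law X (Some x))"
    using C f(2) by (intro integral_mono integrable_abs i integrable_const abs_ext0_le) auto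
  also have "\<dots> = C" using prob_space by simp
  finally show ?thesis .
qed

lemma Qt_diff: "f \<in> bmeas \<Longrightarrow> g \<in> bmeas \<Longrightarrow> Qt t (\<lambda>y. f y - g y) x = Qt t f x - Qt t g x"
proof -
  assume fg: "f \<in> bmeas" "g \<in> bmeas"
  have "ext0 (\<lambda>y. f y - g y) z = ext0 f z - ext0 g z" for z by (cases z) auto
  then show ?thesis unfolding Qt_def using fg by (simp add: integrable_Y)
qed

lemma integral_occ:
  assumes i: "integrable (occ x) (\<lambda>z. \<phi> (fst z) * f (snd z))"
    and \<phi>: "\<phi> \<in> borel_measurable borel" and f: "f \<in> borel_measurable borel"
  shows "(\<integral>\<omega>. (LINT t:{0..}|lborel. \<phi> t * ext0 f (Y t \<omega>)) \<partial>Law X (Some x)) = wint occ \<phi> f x"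
proof -
  let ?L = "Law X (Some x)"
  let ?S = "{z. 0 \<le> fst z \<and> Y (fst z) (snd z) \<noteq> None}"
  interpret pair_sigma_finite lborel ?L by (rule pair_sigma_finite_Law)
  have m: "(\<lambda>z. \<phi> (fst z) * f (snd z)) \<in> borel_measurable borel"
    using borel_measurable_integrable[OF i] by (simp add: measurable_cong_sets[OF sets_occ refl])
  have eq: "indicator ?S z *\<^sub>R (\<phi> (fst z) * f (the (Y (fst z) (snd z))))
      = (\<lambda>(t, \<omega>). indicator {0..} t *\<^sub>R (\<phi> t * ext0 f (Y t \<omega>))) z" for z :: "real \<times> 'w"
    by (cases "Y (fst z) (snd z)") (auto simp: split_beta split: split_indicator)
  have "integrable (restrict_space (lborel \<Otimes>\<^sub>M ?L) ?S) (\<lambda>z. \<phi> (fst z) * f (the (Y (fst z) (snd z))))"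
    using i unfolding occ_def by (subst (asm) integrable_distr_eq[OF measurable_occ_map m]) simp
  then have "integrable (lborel \<Otimes>\<^sub>M ?L) (\<lambda>(t, \<omega>). indicator {0..} t *\<^sub>R (\<phi> t * ext0 f (Y t \<omega>)))"
    by (subst (asm) integrable_restrict_space) (use sets_occ_domain eq in \<open>auto simp: set_integrable_def\<close>)
  from integral_snd[OF this]
  have "(\<integral>\<omega>. (LINT t:{0..}|lborel. \<phi> t * ext0 f (Y t \<omega>)) \<partial>?L)
      = (\<integral>z. (\<lambda>(t, \<omega>). indicator {0..} t *\<^sub>R (\<phi> t * ext0 f (Y t \<omega>))) z \<partial>(lborel \<Otimes>\<^sub>M ?L))"
    unfolding set_lebesgue_integral_def by simp
  also have "\<dots> = (\<integral>z. indicator ?S z *\<^sub>R (\<phi> (fst z) * f (the (Y (fst z) (snd z)))) \<partial>(lborel \<Otimes>\<^sub>M ?L))"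
    unfolding eq ..
  also have "\<dots> = (\<integral>z. \<phi> (fst z) * f (the (Y (fst z) (snd z))) \<partial>restrict_space (lborel \<Otimes>\<^sub>M ?L) ?S)"
    using sets_occ_domain[of "Some x"] by (subst integral_restrict_space) (auto simp: set_lebesgue_integral_def)
  also have "\<dots> = wint occ \<phi> f x"
    unfolding wint_def occ_def by (subst integral_distr[OF measurable_occ_map m]) simp
  finally show ?thesis .
qed

lemma measurable_LINT_Y:
  fixes \<phi> :: "real \<Rightarrow> real"
  assumes f: "f \<in> borel_measurable borel" and [measurable]: "\<phi> \<in> borel_measurable borel"
  shows "(\<lambda>\<omega>. LINT t:{0..}|lborel. \<phi> t * ext0 f (Y t \<omega>)) \<in> borel_measurable (nat_filt_compl X \<infinity>)"
proof -
  have [measurable]: "(\<lambda>z. ext0 f (Y (fst z) (snd z))) \<in> borel_measurable (borel \<Otimes>\<^sub>M nat_filt_compl X \<infinity>)"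
    using measurable_compose[OF measurable_Y_joint measurable_ext0[OF f]] by (simp add: split_beta')
  have "(\<lambda>z. indicator {0..} (fst z) *\<^sub>R (\<phi> (fst z) * ext0 f (Y (fst z) (snd z)))) \<in> borel_measurable (borel \<Otimes>\<^sub>M nat_filt_compl X \<infinity>)"
    by measurable
  from measurable_compose[OF measurable_Pair[OF measurable_snd measurable_fst] this]
  have "(\<lambda>(\<omega>, t). indicator {0..} t *\<^sub>R (\<phi> t * ext0 f (Y t \<omega>))) \<in> borel_measurable (nat_filt_compl X \<infinity> \<Otimes>\<^sub>M lborel)"
    by (simp add: split_beta' cong: measurable_cong_sets)
  then show ?thesis
    unfolding set_lebesgue_integral_def by (rule lborel.borel_measurable_lebesgue_integral)
qed

end

text \<open>The operators of the theorem are built from the given functional A, the results hold for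
  the regular version B. Paths starting at the cemetery are excluded from the comparison, since
  either clock leaves them there.\<close>

locale clock_version = time_change X B for X :: "('w, 'a::{metric_space, second_countable_topology}) process" and B +
  fixes A :: "ennreal \<Rightarrow> 'w \<Rightarrow> ennreal" and N0 :: "'w set"
  assumes polar: "polar_set N0"
    and version: "\<And>\<omega>. \<omega> \<in> space (Evt X) \<Longrightarrow> \<omega> \<notin> N0 \<Longrightarrow> Pos X 0 \<omega> \<noteq> None \<Longrightarrow> (\<lambda>t. A t \<omega>) = (\<lambda>t. B t \<omega>)"
begin

lemma Pos_inv_clock:
  assumes "\<omega> \<in> space (Evt X)" "\<omega> \<notin> N0"
  shows "Pos X (inv_clock A t \<omega>) \<omega> = Y t \<omega>"
proof (cases "Pos X 0 \<omega> = None")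
  case True
  then show ?thesis using Pos_after[OF assms(1) True] by (simp add: Y_def)
next
  case False
  then show ?thesis using version[OF assms False] by (simp add: inv_clock_eq Y_def tau_def)
qed

lemma tc_semigroup_eq:
  assumes "f \<in> borel_measurable borel"
  shows "tc_semigroup X A t f x = Qt t f x"
  unfolding tc_semigroup_def Qt_def
  by (rule integral_polar[OF _ polar])
     (use Pos_inv_clock measurable_compose[OF measurable_Y_nat_filt_compl measurable_ext0[OF assms]] in auto)

lemma tc_resolvent_eq:
  assumes f: "f \<in> borel_measurable borel" and i: "integrable (occ x) (\<lambda>z. exp (- \<alpha> * fst z) * f (snd z))"
  shows "tc_resolvent X A \<alpha> f x = wint occ (\<lambda>t. exp (- \<alpha> * t)) f x"
proof -
  have "tc_resolvent X A \<alpha> f x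
      = (\<integral>\<omega>. (LINT t:{0..}|lborel. exp (- \<alpha> * t) * ext0 f (Y t \<omega>)) \<partial>Law X (Some x))"
    unfolding tc_resolvent_def
    by (rule integral_polar[OF measurable_LINT_Y[OF f] polar]) (auto simp: Pos_inv_clock)
  also have "\<dots> = wint occ (\<lambda>t. exp (- \<alpha> * t)) f x" by (rule integral_occ[OF i _ f]) measurable
  finally show ?thesis .
qed

end

locale kato_bounded = kato_time_change X A G \<mu>
  for X :: "('w, 'a::{metric_space, second_countable_topology}) process" and A G \<mu> +
  fixes N :: real
  assumes N_ge_1: "1 \<le> N" and N_bound: "\<And>x. gpot \<mu> (\<lambda>_. 1) x \<le> ennreal N"

sublocale kato_bounded \<subseteq> occupation occ N
  by (rule occupation_occ[OF N_ge_1 N_bound])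

context kato_bounded
begin

lemma ennreal_pot_gpot:
  assumes "f \<in> bmeas" "\<And>y. 0 \<le> f y" shows "ennreal (pot occ f x) = gpot \<mu> f x"
  using nn_potential_occ[of "\<lambda>y. ennreal (f y)" x] bmeasD[OF assms(1)]
  by (simp add: ennreal_pot[OF assms] gpot_def)

lemma pot_gpot:
  assumes "f \<in> bmeas" "\<And>y. 0 \<le> f y" shows "pot occ f x = enn2real (gpot \<mu> f x)"
  by (simp add: ennreal_pot_gpot[OF assms, symmetric] pot_nonneg[OF assms(2)])

lemma pot_C0: "f \<in> bmeas \<Longrightarrow> pot occ f \<in> C0"
proof -
  assume f: "f \<in> bmeas"
  have nn: "pot occ g \<in> C0" if g: "g \<in> bmeas" "\<And>y. 0 \<le> g y" for g
  proof -
    obtain C where C: "\<And>y. \<bar>g y\<bar> \<le> C" by (rule bmeasE[OF g(1)]) blast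
    have "(\<lambda>x. enn2real (gpot \<mu> g x)) \<in> C0"
      using C g(2) by (intro gpot_C0(1)[OF kato bmeasD[OF g(1)] g(2), of C]) (metis abs_le_D1)
    moreover have "pot occ g = (\<lambda>x. enn2real (gpot \<mu> g x))" by (intro ext pot_gpot g)
    ultimately show ?thesis by simp
  qed
  obtain g h where gh: "g \<in> bmeas" "h \<in> bmeas" "\<And>y. 0 \<le> g y" "\<And>y. 0 \<le> h y" "f = (\<lambda>y. g y - h y)"
    by (rule pos_neg_parts[OF f]) blast
  have "pot occ f = (\<lambda>x. pot occ g x - pot occ h x)"
    unfolding gh(5) using pot_diff[OF gh(1,2)] by auto
  then show ?thesis using C0_diff[OF nn[OF gh(1,3)] nn[OF gh(2,4)]] by simp
qed

lemma potential_space_C0: "potential_space occ N C0"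
  by unfold_locales (auto intro: C0_bmeas pot_C0 C0_add C0_cmult)

lemma potential_space_bmeas: "potential_space occ N bmeas"
  by unfold_locales (auto intro: pot_bmeas bmeas_add bmeas_cmult)

lemma wint_initial:
  assumes f: "f \<in> bmeas" and d: "0 \<le> d"
  shows "wint occ (indicator {0..<d}) f x = pot occ f x - wint occ (indicator {d..}) f x"
proof -
  have "pot occ f x - wint occ (indicator {d..}) f x = (\<integral>z. f (snd z) - indicator {d..} (fst z) * f (snd z) \<partial>occ x)"
    unfolding pot_def wint_def
    by (intro Bochner_Integration.integral_diff[symmetric] integrable_pot integrable_bounded_weight f) (auto split: split_indicator)
  also have "\<dots> = wint occ (indicator {0..<d}) f x"
    unfolding wint_def
  proof (rule integral_cong_AE)
    note [measurable] = bmeasD[OF f]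
    show "(\<lambda>z. f (snd z) - indicator {d..} (fst z) * f (snd z)) \<in> borel_measurable (occ x)"
      "(\<lambda>z. indicator {0..<d} (fst z) * f (snd z)) \<in> borel_measurable (occ x)" by measurable
    show "AE z in occ x. f (snd z) - indicator {d..} (fst z) * f (snd z) = indicator {0..<d} (fst z) * f (snd z)"
      using time_nonneg[of x] by eventually_elim (auto split: split_indicator)
  qed
  finally show ?thesis ..
qed

lemma Qt_pot:
  assumes f: "f \<in> bmeas" and t: "0 \<le> t"
  shows "Qt t (pot occ f) x = wint occ (indicator {t..}) f x"
proof -
  have nn: "Qt t (pot occ g) x = wint occ (indicator {t..}) g x" if g: "g \<in> bmeas" "\<And>y. 0 \<le> g y" for g
  proof -
    have gm: "(\<lambda>y. ennreal (g y)) \<in> borel_measurable borel" using bmeasD[OF g(1)] by simp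
    have e1: "ennreal (ext0 (pot occ g) z) = ext0 (\<lambda>x. \<integral>\<^sup>+y. G x y * ennreal (g y) \<partial>\<mu>) z" for z
      using ennreal_pot_gpot[OF g] by (cases z) (auto simp: gpot_def)
    have e2: "0 \<le> ext0 (pot occ g) z" for z using pot_nonneg[OF g(2)] by (cases z) auto
    have e3: "ext0 (\<lambda>y. ennreal (g y)) z * indicator {t..} s = ext0 (\<lambda>y. indicator {t..} s * ennreal (g y)) z" for s z
      by (cases z) (auto simp: mult.commute)
    have m: "(\<lambda>z. indicator {t..} (fst z) * ennreal (g (snd z))) \<in> borel_measurable borel"
      using gm measurable_snd_borel
      by (intro borel_measurable_times_ennreal measurable_compose[OF measurable_snd_borel(2) borel_measurable_indicator]
          measurable_compose[OF measurable_snd_borel(1) gm]) auto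
    have "ennreal (Qt t (pot occ g) x) = (\<integral>\<^sup>+\<omega>. ennreal (ext0 (pot occ g) (Y t \<omega>)) \<partial>Law X (Some x))"
      unfolding Qt_def using e2 by (intro nn_integral_eq_integral[symmetric] integrable_Y pot_bmeas g) auto
    also have "\<dots> = (\<integral>\<^sup>+s\<in>{t..}. (\<integral>\<^sup>+\<omega>. ext0 (\<lambda>y. ennreal (g y)) (Y s \<omega>) \<partial>Law X (Some x)) \<partial>lborel)"
      unfolding e1 by (rule expect_Y_potential[OF gm t])
    also have "\<dots> = (\<integral>\<^sup>+s\<in>{0..}. (\<integral>\<^sup>+\<omega>. ext0 (\<lambda>y. indicator {t..} s * ennreal (g y)) (Y s \<omega>) \<partial>Law X (Some x)) \<partial>lborel)"
    proof (intro nn_integral_cong)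
      fix s
      have "(\<lambda>\<omega>. ext0 (\<lambda>y. ennreal (g y)) (Y s \<omega>)) \<in> borel_measurable (Law X (Some x))"
        by (intro measurable_compose[OF measurable_Y measurable_ext0] gm)
      then show "(\<integral>\<^sup>+\<omega>. ext0 (\<lambda>y. ennreal (g y)) (Y s \<omega>) \<partial>Law X (Some x)) * indicator {t..} s
        = (\<integral>\<^sup>+\<omega>. ext0 (\<lambda>y. indicator {t..} s * ennreal (g y)) (Y s \<omega>) \<partial>Law X (Some x)) * indicator {0..} s"
        using t unfolding e3[symmetric] by (simp add: nn_integral_multc split: split_indicator)
    qed
    also have "\<dots> = (\<integral>\<^sup>+z. indicator {t..} (fst z) * ennreal (g (snd z)) \<partial>occ x)"
      using nn_integral_occ[OF m, of x] by simp
    also have "\<dots> = (\<integral>\<^sup>+z. ennreal (indicator {t..} (fst z) * g (snd z)) \<partial>occ x)"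
      by (intro nn_integral_cong) (auto split: split_indicator)
    also have "\<dots> = ennreal (wint occ (indicator {t..}) g x)"
      unfolding wint_def using g
      by (intro nn_integral_eq_integral integrable_bounded_weight) (auto split: split_indicator)
    finally have "ennreal (Qt t (pot occ g) x) = ennreal (wint occ (indicator {t..}) g x)" .
    moreover have "0 \<le> Qt t (pot occ g) x" unfolding Qt_def using e2 by (intro integral_nonneg_AE) auto
    moreover have "0 \<le> wint occ (indicator {t..}) g x" unfolding wint_def using g(2) by (intro integral_nonneg_AE) auto
    ultimately show ?thesis by simp
  qed
  obtain g h where gh: "g \<in> bmeas" "h \<in> bmeas" "\<And>y. 0 \<le> g y" "\<And>y. 0 \<le> h y" "f = (\<lambda>y. g y - h y)"
    by (rule pos_neg_parts[OF f]) blast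
  have "pot occ f = (\<lambda>x. pot occ g x - pot occ h x)"
    unfolding gh(5) using pot_diff[OF gh(1,2)] by auto
  then have "Qt t (pot occ f) x = Qt t (pot occ g) x - Qt t (pot occ h) x"
    using Qt_diff[OF pot_bmeas pot_bmeas, OF gh(1,2)] by simp
  also have "\<dots> = wint occ (indicator {t..}) g x - wint occ (indicator {t..}) h x"
    by (simp add: nn gh)
  also have "\<dots> = wint occ (indicator {t..}) f x"
    unfolding wint_def gh(5) right_diff_distrib
    by (intro Bochner_Integration.integral_diff[symmetric] integrable_bounded_weight gh) (auto split: split_indicator)
  finally show ?thesis .
qed

end

locale kato_limit = lim: kato_bounded X A G \<mu> N
  for X :: "('w, 'a::{metric_space, second_countable_topology}) process" and A G \<mu> N +
  fixes An :: "nat \<Rightarrow> ennreal \<Rightarrow> 'w \<Rightarrow> ennreal" and \<nu> :: "nat \<Rightarrow> 'a measure"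
  assumes approx: "\<And>n. kato_bounded X (An n) G (\<nu> n) N"
    and vague: "vague_conv \<nu> \<mu>"
    and uniform: "uniform_limit UNIV (\<lambda>n x. enn2real (lim.gpot (\<nu> n) (\<lambda>_. 1) x))
        (\<lambda>x. enn2real (lim.gpot \<mu> (\<lambda>_. 1) x)) sequentially"
begin

abbreviation occn :: "nat \<Rightarrow> 'a \<Rightarrow> (real \<times> 'a) measure" where
  "occn n \<equiv> time_change.occ X (An n)"

lemma pot_conv:
  assumes f: "f \<in> C0"
  shows "uniform_limit UNIV (\<lambda>n. pot (occn n) f) (pot lim.occ f) sequentially"
proof -
  have fb: "f \<in> bmeas" by (rule C0_bmeas[OF f])
  obtain D where D: "0 \<le> D" "\<And>y. \<bar>f y\<bar> \<le> D" by (rule bmeasE[OF fb]) blast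
  \<comment> \<open>A strictly positive bound, so that the positive and negative parts of f can be
    scaled into [0, 1] even when f is 0.\<close>
  define C where "C = D + 1"
  have C: "0 < C" "\<bar>f y\<bar> \<le> C" for y using D(1) D(2)[of y] by (auto simp: C_def)
  have cont: "continuous_on UNIV f" using f by (simp add: C0_def)
  have kn: "lim.kato_measure (\<nu> n)" for n
  proof -
    interpret n: kato_bounded X "An n" G "\<nu> n" N by (rule approx)
    show ?thesis by (rule n.kato)
  qed
  have unit: "uniform_limit UNIV (\<lambda>n. pot (occn n) u) (pot lim.occ u) sequentially"
    if u: "continuous_on UNIV u" "\<And>y. 0 \<le> u y" "\<And>y. u y \<le> 1" for u
  proof -
    have ub: "u \<in> bmeas" using u by (intro bmeasI[of _ 1] borel_measurable_continuous_onI) auto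
    have "pot (occn n) u = (\<lambda>x. enn2real (lim.gpot (\<nu> n) u x))" for n
      using kato_bounded.pot_gpot[OF approx ub u(2)] by auto
    moreover have "pot lim.occ u = (\<lambda>x. enn2real (lim.gpot \<mu> u x))" using lim.pot_gpot[OF ub u(2)] by auto
    ultimately show ?thesis using lim.gpot_uniform[OF lim.kato kn vague uniform u] by simp
  qed
  define g where "g y = max 0 (f y / C)" for y
  define h where "h y = max 0 (- f y / C)" for y
  have gh: "continuous_on UNIV g" "\<And>y. 0 \<le> g y" "\<And>y. g y \<le> 1" "continuous_on UNIV h" "\<And>y. 0 \<le> h y" "\<And>y. h y \<le> 1"
  proof -
    show "continuous_on UNIV g" "continuous_on UNIV h"
      unfolding g_def h_def using cont C(1) by (auto intro!: continuous_intros)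
    show "0 \<le> g y" "0 \<le> h y" for y by (auto simp: g_def h_def)
    show "g y \<le> 1" "h y \<le> 1" for y using C(1) C(2)[of y] by (auto simp: g_def h_def abs_le_iff pos_le_divide_eq pos_divide_le_eq)
  qed
  have ghb: "g \<in> bmeas" "h \<in> bmeas" using gh by (auto intro!: bmeasI[of _ 1] borel_measurable_continuous_onI)
  have f_eq: "f = (\<lambda>y. C * g y - C * h y)" using C(1) by (auto simp: g_def h_def max_def fun_eq_iff)
  have p: "pot K f x = C * pot K g x - C * pot K h x" if "occupation K N" for K :: "'a \<Rightarrow> _" and x
  proof -
    interpret occupation K N by fact
    show ?thesis unfolding f_eq by (simp add: pot_diff[OF bmeas_cmult bmeas_cmult] ghb pot_cmult)
  qed
  have on: "occupation (occn n) N" for n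
  proof -
    interpret n: kato_bounded X "An n" G "\<nu> n" N by (rule approx)
    show ?thesis by (rule n.occupation_axioms)
  qed
  have "pot (occn n) f = (\<lambda>x. C * pot (occn n) g x - C * pot (occn n) h x)" for n using p[OF on] by auto
  moreover have "pot lim.occ f = (\<lambda>x. C * pot lim.occ g x - C * pot lim.occ h x)" using p[OF lim.occupation_axioms] by auto
  ultimately show ?thesis
    by (simp only:) (intro uniform_limit_minus bounded_linear.uniform_limit[OF bounded_linear_mult_right] unit gh)
qed

lemma occupation_limit: "occupation_limit lim.occ N C0 occn"
proof -
  interpret potential_space lim.occ N C0 by (rule lim.potential_space_C0)
  have on: "occupation (occn n) N" for n
  proof -
    interpret n: kato_bounded X "An n" G "\<nu> n" N by (rule approx)
    show ?thesis by (rule n.occupation_axioms)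
  qed
  show ?thesis
    by (intro occupation_limit.intro occupation_limit_axioms.intro lim.potential_space_C0 on pot_conv)
qed

text \<open>Each semigroup is understood only on potentials of its own process. So w is replaced by
  V h, then V h by V_n h inside the n-th semigroup, which is a contraction; the steps of the
  occupation measures converge, and the way back to w is the contraction of the limit semigroup.
  Each of these costs e / 4.\<close>

theorem semigroup_conv:
  assumes w: "w \<in> bmeas" and closure: "\<And>e. 0 < e \<Longrightarrow> \<exists>h\<in>C0. \<forall>x. \<bar>w x - pot lim.occ h x\<bar> \<le> e" and e: "0 < e"
  shows "\<forall>\<^sub>F n in sequentially. \<forall>t\<in>{0..b}. \<forall>x. \<bar>time_change.Qt X (An n) t w x - lim.Qt t w x\<bar> \<le> e"
proof -
  interpret ol: occupation_limit lim.occ N C0 occn by (rule occupation_limit)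
  obtain h where h: "h \<in> C0" "\<And>x. \<bar>w x - pot lim.occ h x\<bar> \<le> e / 4"
    using closure[of "e / 4"] e by auto
  have hb: "h \<in> bmeas" by (rule C0_bmeas[OF h(1)])
  have hV: "pot lim.occ h \<in> bmeas" by (rule lim.pot_bmeas[OF hb])
  have "\<forall>\<^sub>F n in sequentially. \<forall>x\<in>UNIV. dist (pot (occn n) h x) (pot lim.occ h x) < e / 4"
    using pot_conv[OF h(1)] e by (intro uniform_limitD) auto
  moreover have "\<forall>\<^sub>F n in sequentially. \<forall>t\<in>{0..b}. \<forall>x.
      \<bar>wint (occn n) (indicator {t..}) h x - wint lim.occ (indicator {t..}) h x\<bar> \<le> e / 4"
    using e by (intro ol.wint_step_conv_compact h) auto
  ultimately show ?thesis
  proof eventually_elim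
    case (elim n)
    interpret n: kato_bounded X "An n" G "\<nu> n" N by (rule approx)
    show ?case
    proof (intro ballI allI)
      fix t x assume t: "t \<in> {0..b}"
      then have t0: "0 \<le> t" by simp
      have nV: "pot n.occ h \<in> bmeas" by (rule n.pot_bmeas[OF hb])
      have 1: "\<bar>n.Qt t w x - n.Qt t (pot lim.occ h) x\<bar> \<le> e / 4"
        unfolding n.Qt_diff[OF w hV, symmetric]
        by (intro n.Qt_bound h bmeasD[OF bmeas_diff[OF w hV]])
      have 2: "\<bar>n.Qt t (pot lim.occ h) x - n.Qt t (pot n.occ h) x\<bar> \<le> e / 4"
        unfolding n.Qt_diff[OF hV nV, symmetric]
      proof (intro n.Qt_bound bmeasD[OF bmeas_diff[OF hV nV]])
        fix y
        have "dist (pot n.occ h y) (pot lim.occ h y) < e / 4" using elim(1) by simp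
        then show "\<bar>pot lim.occ h y - pot n.occ h y\<bar> \<le> e / 4" by (simp add: dist_real_def abs_minus_commute)
      qed
      have 3: "\<bar>n.Qt t (pot n.occ h) x - lim.Qt t (pot lim.occ h) x\<bar> \<le> e / 4"
        unfolding n.Qt_pot[OF hb t0] lim.Qt_pot[OF hb t0] using elim(2) t by blast
      have 4: "\<bar>lim.Qt t w x - lim.Qt t (pot lim.occ h) x\<bar> \<le> e / 4"
        unfolding lim.Qt_diff[OF w hV, symmetric]
        by (intro lim.Qt_bound h bmeasD[OF bmeas_diff[OF w hV]])
      show "\<bar>n.Qt t w x - lim.Qt t w x\<bar> \<le> e" using 1 2 3 4 by linarith
    qed
  qed
qed

end

section \<open>The fine support\<close>

lemma nn_integral_eq_imp_AE_eq:
  assumes [measurable]: "f \<in> borel_measurable M" "g \<in> borel_measurable M"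
    and le: "\<And>x. x \<in> space M \<Longrightarrow> f x \<le> g x" and eq: "(\<integral>\<^sup>+x. f x \<partial>M) = (\<integral>\<^sup>+x. g x \<partial>M)"
    and fin: "(\<integral>\<^sup>+x. g x \<partial>M) < \<infinity>"
  shows "AE x in M. f x = g x"
proof -
  have "(\<integral>\<^sup>+x. g x - f x \<partial>M) = (\<integral>\<^sup>+x. g x \<partial>M) - (\<integral>\<^sup>+x. f x \<partial>M)"
    using fin le eq by (intro nn_integral_diff) auto
  also have "\<dots> = 0" using eq fin by (simp add: ennreal_minus_eq_0)
  finally have "AE x in M. g x - f x = 0" by (subst (asm) nn_integral_0_iff_AE) auto
  moreover have "AE x in M. x \<in> space M" by (rule AE_space)
  moreover have "AE x in M. g x \<noteq> \<infinity>" using fin by (intro nn_integral_noteq_infinite) auto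
  ultimately show ?thesis
  proof (eventually_elim)
    case (elim x)
    then have "g x \<le> f x" by (simp add: diff_eq_0_iff_ennreal less_top)
    show ?case
    proof (rule antisym)
      show "g x \<le> f x" by fact
      show "f x \<le> g x"
        using elim le by auto
    qed
  qed
qed

lemma nn_integral_shift:
  fixes h :: "ennreal \<Rightarrow> ennreal"
  assumes m: "(\<lambda>s. h (ennreal s)) \<in> borel_measurable borel" and top: "h \<infinity> = 0"
  shows "(\<integral>\<^sup>+s\<in>{0..}. h (T + ennreal s) \<partial>lborel)
    = (\<integral>\<^sup>+s\<in>{0..}. h (ennreal s) * indicator {s. T \<le> ennreal s} s \<partial>lborel)"
proof (cases T)
  case (real r)
  have m': "(\<lambda>s. h (ennreal s) * indicator {r..} s) \<in> borel_measurable borel"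
    using m by (intro borel_measurable_times_ennreal) auto
  have "(\<integral>\<^sup>+s\<in>{0..}. h (ennreal s) * indicator {s. T \<le> ennreal s} s \<partial>lborel)
      = (\<integral>\<^sup>+s. h (ennreal s) * indicator {r..} s \<partial>lborel)"
    using real by (intro nn_integral_cong) (auto split: split_indicator)
  also have "\<dots> = (\<integral>\<^sup>+s. h (ennreal (r + s)) * indicator {r..} (r + s) \<partial>lborel)"
    using nn_integral_real_affine[OF m', of 1 r] by simp
  also have "\<dots> = (\<integral>\<^sup>+s\<in>{0..}. h (T + ennreal s) \<partial>lborel)"
    using real by (intro nn_integral_cong) (auto split: split_indicator)
  finally show ?thesis ..
next
  case top
  moreover have "{s. \<top> \<le> ennreal s} = {}" by (auto simp: top_unique)
  ultimately show ?thesis using assms(2) by simp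
qed

lemma lower_semicont_SUP:
  assumes "\<And>k. lower_semicont (h k)" shows "lower_semicont (\<lambda>x. SUP k. h k x)"
proof -
  have "{z. c < (SUP k. h k z)} = (\<Union>k. {z. c < h k z})" for c by (auto simp: less_SUP_iff)
  then show ?thesis using assms by (auto simp: lower_semicont_def)
qed

lemma lower_semicont_continuous:
  assumes "continuous_on UNIV (h :: 'a::topological_space \<Rightarrow> real)" shows "lower_semicont (\<lambda>x. ennreal (h x))"
proof -
  have "continuous_on UNIV (\<lambda>x. ennreal (h x))" by (intro continuous_on_ennreal assms)
  then have "open ((\<lambda>x. ennreal (h x)) -` {c<..})" for c by (intro open_vimage) auto
  then show ?thesis by (simp add: lower_semicont_def vimage_def)
qed

lemma lower_semicont_cmult:
  assumes "lower_semicont h" "c < \<infinity>" shows "lower_semicont (\<lambda>x. c * h x)"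
proof -
  have "{z. b < c * h z} = (if c = 0 then {} else {z. b / c < h z})" for b
    using assms(2) by (auto simp: divide_less_ennreal mult.commute zero_less_iff_neq_zero)
  then show ?thesis using assms(1) by (auto simp: lower_semicont_def)
qed

locale fine_support = kato_bounded X A G \<mu> N
  for X :: "('w, 'a::{metric_space, second_countable_topology}) process" and A G \<mu> N +
  fixes m :: "'a measure" and g :: "'a \<Rightarrow> ennreal"
  assumes sets_m: "sets m = sets borel" and g_measurable: "g \<in> borel_measurable borel"
    and g_pos: "\<And>x. 0 < g x" and G_pos: "\<And>x y. 0 < G x y"
    and potential_g: "\<And>x. (\<integral>\<^sup>+\<omega>. (\<integral>\<^sup>+t\<in>{0..}. ext0 g (Pos X (ennreal t) \<omega>) \<partial>lborel) \<partial>Law X (Some x))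
      = (\<integral>\<^sup>+y. G x y * g y \<partial>m)"
    and finite_potential_g: "\<And>x. (\<integral>\<^sup>+y. G x y * g y \<partial>m) < \<infinity>"
begin

definition U :: "'a \<Rightarrow> ennreal" where "U x = (\<integral>\<^sup>+y. G x y * g y \<partial>m)"

definition \<Phi>U :: "'w \<Rightarrow> ennreal" where
  "\<Phi>U \<omega> = (\<integral>\<^sup>+s\<in>{0..}. ext0 g (Pos X (ennreal s) \<omega>) \<partial>lborel)"

text \<open>The part of \<open>\<Phi>U\<close> collected after the clock starts. What is missing is
  the integral of the positive g over times up to \<open>tau 0\<close>, so for a live path with
  finite \<open>\<Phi>U\<close> equality of the two forces \<open>tau 0\<close> to be 0.\<close>

definition \<Phi>S :: "'w \<Rightarrow> ennreal" where
  "\<Phi>S \<omega> = (\<integral>\<^sup>+s\<in>{0..}. ext0 g (Pos X (ennreal s) \<omega>) * indicator {s. tau 0 \<omega> < ennreal s} s \<partial>lborel)"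

text \<open>By the strong Markov property this is the expectation of U at the position
  \<open>Y 0\<close>, the excessive regularization of U for the time-changed process.\<close>

definition fU :: "'a \<Rightarrow> ennreal" where "fU x = (\<integral>\<^sup>+\<omega>. \<Phi>S \<omega> \<partial>Law X (Some x))"

definition S :: "'a set" where "S = {x. fU x = U x}"

lemma lower_semicont_U: "lower_semicont U"
  unfolding U_def by (rule lower_semicont_potential[OF lsc sets_m g_measurable])

lemma measurable_U: "U \<in> borel_measurable borel"
  by (rule measurable_lower_semicont[OF lower_semicont_U])

lemma measurable_g_joint: "(\<lambda>z. ext0 g (Pos X (ennreal (fst z)) (snd z))) \<in> borel_measurable (borel \<Otimes>\<^sub>M nat_filt_compl X \<infinity>)"
  using measurable_compose[OF measurable_Pos_real_joint measurable_ext0[OF g_measurable]] by (simp add: split_beta')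

lemma measurable_tau: "tau t \<in> borel_measurable (nat_filt_compl X \<infinity>)"
  using measurable_compose[OF measurable_Pair1'[of t borel] measurable_tau_joint] by simp

lemma measurable_window:
  "(\<lambda>(s, \<omega>). ext0 g (Pos X (ennreal s) \<omega>) * indicator {s. tau t \<omega> \<le> ennreal s} s * indicator {0..} s)
     \<in> borel_measurable (borel \<Otimes>\<^sub>M nat_filt_compl X \<infinity>)" (is ?A)
  "(\<lambda>(s, \<omega>). ext0 g (Pos X (ennreal s) \<omega>) * indicator {s. tau t \<omega> < ennreal s} s * indicator {0..} s)
     \<in> borel_measurable (borel \<Otimes>\<^sub>M nat_filt_compl X \<infinity>)" (is ?B)
  "(\<lambda>(s, \<omega>). ext0 g (Pos X (ennreal s) \<omega>) * indicator {0..} s)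
     \<in> borel_measurable (borel \<Otimes>\<^sub>M nat_filt_compl X \<infinity>)" (is ?C)
proof -
  let ?M = "(borel :: real measure) \<Otimes>\<^sub>M nat_filt_compl X \<infinity>"
  note [measurable] = measurable_g_joint measurable_tau
  have "{z \<in> space ?M. tau t (snd z) \<le> ennreal (fst z)} \<in> sets ?M" by measurable
  then have 1: "(\<lambda>z. indicator {z \<in> space ?M. tau t (snd z) \<le> ennreal (fst z)} z :: ennreal) \<in> borel_measurable ?M" by (rule borel_measurable_indicator)
  have "{z \<in> space ?M. tau t (snd z) < ennreal (fst z)} \<in> sets ?M" by measurable
  then have 2: "(\<lambda>z. indicator {z \<in> space ?M. tau t (snd z) < ennreal (fst z)} z :: ennreal) \<in> borel_measurable ?M" by (rule borel_measurable_indicator)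
  have 3: "(\<lambda>z. indicator {0..} (fst z) :: ennreal) \<in> borel_measurable ?M"
    by (rule measurable_compose[OF measurable_fst]) simp
  show ?A
    unfolding split_beta'
    by (rule measurable_cong[THEN iffD2, OF _ borel_measurable_times_ennreal[OF borel_measurable_times_ennreal[OF measurable_g_joint 1] 3]])
       (auto split: split_indicator)
  show ?B
    unfolding split_beta'
    by (rule measurable_cong[THEN iffD2, OF _ borel_measurable_times_ennreal[OF borel_measurable_times_ennreal[OF measurable_g_joint 2] 3]])
       (auto split: split_indicator)
  show ?C
    unfolding split_beta' by (rule borel_measurable_times_ennreal[OF measurable_g_joint 3])
qed

lemma measurable_\<Phi>U: "\<Phi>U \<in> borel_measurable (nat_filt_compl X \<infinity>)"
  unfolding \<Phi>U_def by (rule measurable_nn_integral_time[OF measurable_window(3)])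

lemma measurable_\<Phi>S: "\<Phi>S \<in> borel_measurable (nat_filt_compl X \<infinity>)"
  unfolding \<Phi>S_def by (rule measurable_nn_integral_time[OF measurable_window(2)])

lemma measurable_g_path: "\<omega> \<in> space (Evt X) \<Longrightarrow> (\<lambda>s. ext0 g (Pos X (ennreal s) \<omega>)) \<in> borel_measurable borel"
  using measurable_compose[OF measurable_Pair2'[of \<omega> "nat_filt_compl X \<infinity>" borel] measurable_g_joint] by simp

lemma \<Phi>S_le_\<Phi>U: "\<Phi>S \<omega> \<le> \<Phi>U \<omega>"
  unfolding \<Phi>S_def \<Phi>U_def by (intro nn_integral_mono) (auto split: split_indicator)

lemma U_eq: "U x = (\<integral>\<^sup>+\<omega>. \<Phi>U \<omega> \<partial>Law X (Some x))"
  using potential_g[of x] by (simp add: U_def \<Phi>U_def)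

lemma U_finite: "U x < \<infinity>"
  using finite_potential_g by (simp add: U_def)

lemma fU_le: "fU x \<le> U x"
  unfolding U_eq fU_def by (intro nn_integral_mono \<Phi>S_le_\<Phi>U)

lemma \<Phi>_None: "(\<integral>\<^sup>+\<omega>. \<Phi>U \<omega> \<partial>Law X None) = 0" "(\<integral>\<^sup>+\<omega>. \<Phi>S \<omega> \<partial>Law X None) = 0"
proof -
  have "(\<integral>\<^sup>+\<omega>. \<Phi>U \<omega> \<partial>Law X None) = (\<integral>\<^sup>+\<omega>. 0 \<partial>Law X None)"
    using Law_None by (intro nn_integral_cong_AE) (auto elim!: eventually_mono simp: \<Phi>U_def)
  then show 1: "(\<integral>\<^sup>+\<omega>. \<Phi>U \<omega> \<partial>Law X None) = 0" by simp
  have "(\<integral>\<^sup>+\<omega>. \<Phi>S \<omega> \<partial>Law X None) \<le> (\<integral>\<^sup>+\<omega>. \<Phi>U \<omega> \<partial>Law X None)" by (intro nn_integral_mono \<Phi>S_le_\<Phi>U)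
  then show "(\<integral>\<^sup>+\<omega>. \<Phi>S \<omega> \<partial>Law X None) = 0" using 1 by simp
qed

lemma U_markov:
  assumes "stopping_time (Flt X) T" "D \<in> sets (pre_sigma T)"
  shows "(\<integral>\<^sup>+\<omega>\<in>D. ext0 U (Pos X (T \<omega>) \<omega>) \<partial>Law X z) = (\<integral>\<^sup>+\<omega>\<in>D. \<Phi>U (Shift X (T \<omega>) \<omega>) \<partial>Law X z)"
proof -
  have "ext0 U y = (\<integral>\<^sup>+\<omega>. \<Phi>U \<omega> \<partial>Law X y)" for y by (cases y) (auto simp: U_eq \<Phi>_None)
  from strong_markov_completed[OF assms measurable_\<Phi>U measurable_ext0[OF measurable_U] this, where z = z and \<Psi> = "\<lambda>\<omega>. \<Phi>U (Shift X (T \<omega>) \<omega>)"]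
  show ?thesis by simp
qed

lemma shift_integral:
  assumes \<omega>: "\<omega> \<in> space (Evt X)"
  shows "(\<integral>\<^sup>+s\<in>{0..}. ext0 g (Pos X (T + ennreal s) \<omega>) \<partial>lborel)
    = (\<integral>\<^sup>+s\<in>{0..}. ext0 g (Pos X (ennreal s) \<omega>) * indicator {s. T \<le> ennreal s} s \<partial>lborel)"
  using measurable_g_path[OF \<omega>] pos_infinity[OF \<omega>]
  by (intro nn_integral_shift[of "\<lambda>s. ext0 g (Pos X s \<omega>)"]) auto

lemma \<Phi>U_shift: "\<omega> \<in> space (Evt X) \<Longrightarrow>
  \<Phi>U (Shift X T \<omega>) = (\<integral>\<^sup>+s\<in>{0..}. ext0 g (Pos X (ennreal s) \<omega>) * indicator {s. T \<le> ennreal s} s \<partial>lborel)"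
  unfolding shift_integral[symmetric] \<Phi>U_def by (simp add: pos_shift)

lemma \<Phi>U_shift_le: "\<omega> \<in> space (Evt X) \<Longrightarrow> \<Phi>U (Shift X T \<omega>) \<le> \<Phi>U \<omega>"
  unfolding \<Phi>U_shift unfolding \<Phi>U_def by (intro nn_integral_mono) (auto split: split_indicator)

lemma expect_U:
  "(\<integral>\<^sup>+\<omega>. ext0 U (Y t \<omega>) \<partial>Law X z) = (\<integral>\<^sup>+\<omega>. (\<integral>\<^sup>+s\<in>{0..}. ext0 g (Pos X (ennreal s) \<omega>) * indicator {s. tau t \<omega> \<le> ennreal s} s \<partial>lborel) \<partial>Law X z)"
proof -
  have "(\<integral>\<^sup>+\<omega>. ext0 U (Y t \<omega>) \<partial>Law X z) = (\<integral>\<^sup>+\<omega>\<in>space (Evt X). ext0 U (Pos X (tau t \<omega>) \<omega>) \<partial>Law X z)"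
    unfolding nn_integral_space by (simp add: Y_def)
  also have "\<dots> = (\<integral>\<^sup>+\<omega>\<in>space (Evt X). \<Phi>U (Shift X (tau t \<omega>) \<omega>) \<partial>Law X z)"
    by (rule U_markov[OF stopping_time_tau space_in_pre_sigma])
  also have "\<dots> = (\<integral>\<^sup>+\<omega>. \<Phi>U (Shift X (tau t \<omega>) \<omega>) \<partial>Law X z)" by (rule nn_integral_space)
  also have "\<dots> = (\<integral>\<^sup>+\<omega>. (\<integral>\<^sup>+s\<in>{0..}. ext0 g (Pos X (ennreal s) \<omega>) * indicator {s. tau t \<omega> \<le> ennreal s} s \<partial>lborel) \<partial>Law X z)"
    by (intro nn_integral_cong) (simp add: \<Phi>U_shift)
  finally show ?thesis .
qed

lemma AE_ennreal_neq: "AE s in (lborel :: real measure). s \<in> {0..} \<longrightarrow> T \<noteq> ennreal s"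
proof (cases T)
  case (real r)
  have "AE s in lborel. s \<noteq> r" by (rule AE_lborel_singleton)
  then show ?thesis using real by (auto elim!: eventually_mono)
qed simp

text \<open>As t decreases to 0, the windows after \<open>tau t\<close> increase to the window after
  \<open>tau 0\<close>: a time s > \<open>tau 0\<close> has a positive clock value, which exceeds
  some 1 / (j + 1). The time s = \<open>tau 0\<close> is Lebesgue null.\<close>

lemma SUP_expect_U: "(SUP j. \<integral>\<^sup>+\<omega>. ext0 U (Y (1 / real (Suc j)) \<omega>) \<partial>Law X (Some x)) = fU x"
proof -
  let ?h = "\<lambda>j \<omega> s. ext0 g (Pos X (ennreal s) \<omega>) * indicator {s. tau (1 / real (Suc j)) \<omega> \<le> ennreal s} s * indicator {0..} s"
  have mono: "tau (1 / real (Suc k)) \<omega> \<le> tau (1 / real (Suc j)) \<omega>" if "j \<le> k" for j k \<omega>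
    using that by (intro tau_mono frac_le) auto
  have inc: "incseq (\<lambda>j. ?h j \<omega>)" for \<omega>
    unfolding incseq_def le_fun_def
    by (intro allI impI mult_mono order_refl)
       (auto split: split_indicator intro: order_trans[OF mono] simp del: of_nat_Suc)
  have sup: "(SUP j. \<integral>\<^sup>+s. ?h j \<omega> s \<partial>lborel) = \<Phi>S \<omega>" if \<omega>: "\<omega> \<in> space (Law X (Some x))" for \<omega>
  proof -
    have mh: "(\<lambda>s. ?h j \<omega> s) \<in> borel_measurable lborel" for j
      using measurable_compose[OF measurable_Pair2'[of \<omega> "nat_filt_compl X \<infinity>" borel] measurable_window(1)[of "1 / real (Suc j)"]] \<omega>
      by simp
    have "(SUP j. \<integral>\<^sup>+s. ?h j \<omega> s \<partial>lborel) = (\<integral>\<^sup>+s. (SUP j. ?h j \<omega> s) \<partial>lborel)"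
      by (intro nn_integral_monotone_convergence_SUP[symmetric] inc mh)
    also have "\<dots> = \<Phi>S \<omega>"
      unfolding \<Phi>S_def
    proof (rule nn_integral_cong_AE, use AE_ennreal_neq[of "tau 0 \<omega>"] in eventually_elim)
      fix s :: real assume s: "s \<in> {0..} \<longrightarrow> tau 0 \<omega> \<noteq> ennreal s"
      show "(SUP j. ?h j \<omega> s) = ext0 g (Pos X (ennreal s) \<omega>) * indicator {s. tau 0 \<omega> < ennreal s} s * indicator {0..} s"
      proof (cases "0 \<le> s \<and> tau 0 \<omega> < ennreal s")
        case True
        then have "0 < A (ennreal s) \<omega>" using tau_less_iff[of 0 \<omega>] by simp
        then obtain c where c: "0 < c" "c < A (ennreal s) \<omega>" using dense by blast
        then obtain c' where c': "c = ennreal c'" "0 < c'" using c by (cases c) auto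
        obtain j where "1 / real (Suc j) < c'" by (rule nat_approx_posE[OF c'(2)]) blast
        then have "ennreal (1 / real (Suc j)) < A (ennreal s) \<omega>"
        proof -
          have "ennreal (1 / real (Suc j)) \<le> ennreal c'" by (intro ennreal_leI less_imp_le) fact
          then show ?thesis using c(2) unfolding c'(1) by (rule le_less_trans)
        qed
        then have j: "tau (1 / real (Suc j)) \<omega> < ennreal s" by (simp only: tau_less_iff)
        show ?thesis
        proof (rule antisym)
          have "?h j \<omega> s \<le> (SUP j. ?h j \<omega> s)" by (rule SUP_upper) simp
          then show "ext0 g (Pos X (ennreal s) \<omega>) * indicator {s. tau 0 \<omega> < ennreal s} s * indicator {0..} s \<le> (SUP j. ?h j \<omega> s)"
            using True j by (simp add: less_imp_le)
        qed (use True in \<open>auto intro!: SUP_least split: split_indicator\<close>)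
      next
        case False
        have "?h j \<omega> s = 0" for j
        proof (cases "0 \<le> s")
          case True
          then have "ennreal s < tau 0 \<omega>" using False s by auto
          also have "\<dots> \<le> tau (1 / real (Suc j)) \<omega>" by (rule tau_mono) simp
          finally show ?thesis by simp
        qed simp
        then have "(SUP j. ?h j \<omega> s) = (SUP j::nat. 0)" by (intro SUP_cong refl)
        moreover have "ext0 g (Pos X (ennreal s) \<omega>) * indicator {s. tau 0 \<omega> < ennreal s} s * indicator {0..} s = 0"
          using False by (auto split: split_indicator)
        ultimately show ?thesis by simp
      qed
    qed
    finally show ?thesis .
  qed
  have mi: "(\<lambda>\<omega>. \<integral>\<^sup>+s. ?h j \<omega> s \<partial>lborel) \<in> borel_measurable (Law X (Some x))" for j
    by (rule borel_measurable_Law_nat_filt_compl[OF measurable_nn_integral_time[OF measurable_window(1)]])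
  have "(SUP j. \<integral>\<^sup>+\<omega>. ext0 U (Y (1 / real (Suc j)) \<omega>) \<partial>Law X (Some x))
      = (SUP j. \<integral>\<^sup>+\<omega>. (\<integral>\<^sup>+s. ?h j \<omega> s \<partial>lborel) \<partial>Law X (Some x))"
    unfolding expect_U ..
  also have "\<dots> = (\<integral>\<^sup>+\<omega>. (SUP j. \<integral>\<^sup>+s. ?h j \<omega> s \<partial>lborel) \<partial>Law X (Some x))"
    using inc by (intro nn_integral_monotone_convergence_SUP[symmetric] mi)
      (auto simp: incseq_def le_fun_def intro!: nn_integral_mono)
  also have "\<dots> = fU x" unfolding fU_def by (intro nn_integral_cong sup)
  finally show ?thesis .
qed

lemma expect_U_antimono: "s \<le> t \<Longrightarrow> (\<integral>\<^sup>+\<omega>. ext0 U (Y t \<omega>) \<partial>Law X z) \<le> (\<integral>\<^sup>+\<omega>. ext0 U (Y s \<omega>) \<partial>Law X z)"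
  unfolding expect_U
  by (intro nn_integral_mono mult_right_mono mult_left_mono) (auto split: split_indicator intro: order_trans[OF tau_mono])

lemma expect_U_le_fU: "0 < t \<Longrightarrow> (\<integral>\<^sup>+\<omega>. ext0 U (Y t \<omega>) \<partial>Law X (Some x)) \<le> fU x"
proof -
  assume t: "0 < t"
  obtain j where "1 / real (Suc j) < t" by (rule nat_approx_posE[OF t]) blast
  then have "(\<integral>\<^sup>+\<omega>. ext0 U (Y t \<omega>) \<partial>Law X (Some x)) \<le> (\<integral>\<^sup>+\<omega>. ext0 U (Y (1 / real (Suc j)) \<omega>) \<partial>Law X (Some x))"
    by (intro expect_U_antimono) simp
  also have "\<dots> \<le> fU x" unfolding SUP_expect_U[symmetric] by (rule SUP_upper) simp
  finally show ?thesis .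
qed

text \<open>The tail integral is a uniform limit of potentials of bounded measurable functions, and
  these potentials are in \<open>C0\<close>; f need not be continuous.\<close>

lemma continuous_wint_initial:
  assumes f: "f \<in> bmeas" and d: "0 \<le> d"
  shows "continuous_on UNIV (wint occ (indicator {0..<d}) f)"
proof -
  interpret ps: potential_space occ N bmeas by (rule potential_space_bmeas)
  have "wint occ (indicator {d..}) f \<in> C0"
    by (rule C0_limit) (metis ps.wint_step_closure[OF f d] pot_C0)
  moreover have "wint occ (indicator {0..<d}) f = (\<lambda>x. pot occ f x - wint occ (indicator {d..}) f x)"
    using wint_initial[OF f d] by blast
  ultimately show ?thesis using pot_C0[OF f] by (auto simp: C0_def intro!: continuous_intros)
qed

text \<open>\<open>fU\<close> is the supremum of the averages of \<open>E\<^sub>x U(Y\<^sub>t)\<close> over \<open>[0, 1/j)\<close>; truncating \<open>U\<close> makes these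
  continuous in \<open>x\<close>.\<close>

lemma lower_semicont_fU: "lower_semicont fU"
proof -
  define J where "J j x = (\<integral>\<^sup>+z. indicator {0..<1 / real (Suc j)} (fst z) * U (snd z) \<partial>occ x)" for j x
  note mU [measurable] = measurable_compose[OF measurable_snd_borel(1) measurable_U]
  have mi: "(\<lambda>z. indicator {0..<d} (fst z) :: ennreal) \<in> borel_measurable (borel :: (real \<times> 'a) measure)" for d :: real
    by (rule measurable_compose[OF measurable_snd_borel(2)]) simp
  have lsc_J: "lower_semicont (J j)" for j
  proof -
    let ?d = "1 / real (Suc j)"
    \<comment> \<open>U may be unbounded, whereas continuity is known only for bounded integrands;
      suprema of continuous functions are still lower semicontinuous.\<close>
    define w where "w k y = enn2real (min (U y) (of_nat k))" for k y
    have w: "ennreal (w k y) = min (U y) (of_nat k)" "0 \<le> w k y" for k y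
      by (auto simp: w_def min_less_iff_disj of_nat_less_top)
    have "w k y \<le> real k" for k y
    proof -
      have "ennreal (w k y) \<le> ennreal (real k)" unfolding w by (simp add: ennreal_of_nat_eq_real_of_nat)
      then show ?thesis by simp
    qed
    moreover have "w k \<in> borel_measurable borel" for k unfolding w_def using measurable_U by measurable
    ultimately have wb: "w k \<in> bmeas" for k using w(2) by (intro bmeasI[of _ "real k"]) auto
    have U_SUP: "(SUP k. ennreal (w k y)) = U y" for y
    proof (rule antisym)
      show "(SUP k. ennreal (w k y)) \<le> U y" by (intro SUP_least) (simp add: w)
      obtain r where r: "U y = ennreal r" "0 \<le> r" using U_finite[of y] by (cases "U y") auto
      obtain k where "r \<le> real k" using real_arch_simple by blast
      then have "U y = ennreal (w k y)" unfolding w r by (simp add: ennreal_of_nat_eq_real_of_nat min_def ennreal_leI)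
      also have "\<dots> \<le> (SUP k. ennreal (w k y))" by (rule SUP_upper) simp
      finally show "U y \<le> (SUP k. ennreal (w k y))" .
    qed
    have "J j x = (SUP k. ennreal (wint occ (indicator {0..<?d}) (w k) x))" for x
    proof -
      have "J j x = (\<integral>\<^sup>+z. (SUP k. indicator {0..<?d} (fst z) * ennreal (w k (snd z))) \<partial>occ x)"
        unfolding J_def U_SUP[symmetric] by (simp add: SUP_mult_left_ennreal)
      also have "\<dots> = (SUP k. \<integral>\<^sup>+z. indicator {0..<?d} (fst z) * ennreal (w k (snd z)) \<partial>occ x)"
      proof (rule nn_integral_monotone_convergence_SUP)
        have "ennreal (w k y) \<le> ennreal (w (Suc k) y)" for k y
          unfolding w by (intro min.mono) (auto simp: of_nat_mono simp del: of_nat_Suc)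
        then show "incseq (\<lambda>k z. indicator {0..<?d} (fst z) * ennreal (w k (snd z)))"
          by (intro incseq_SucI le_funI mult_left_mono) auto
        show "(\<lambda>z. indicator {0..<?d} (fst z) * ennreal (w k (snd z))) \<in> borel_measurable (occ x)" for k
          unfolding measurable_cong_sets[OF sets_occ refl]
          using measurable_compose[OF measurable_snd_borel(1) bmeasD[OF wb[of k]]]
          by (intro borel_measurable_times_ennreal mi) measurable
      qed
      also have "\<dots> = (SUP k. ennreal (wint occ (indicator {0..<?d}) (w k) x))"
      proof (intro SUP_cong refl)
        fix k
        have "(\<integral>\<^sup>+z. indicator {0..<?d} (fst z) * ennreal (w k (snd z)) \<partial>occ x)
            = (\<integral>\<^sup>+z. ennreal (indicator {0..<?d} (fst z) * w k (snd z)) \<partial>occ x)"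
          by (intro nn_integral_cong) (auto split: split_indicator)
        also have "\<dots> = ennreal (wint occ (indicator {0..<?d}) (w k) x)"
          unfolding wint_def using wb w(2)
          by (intro nn_integral_eq_integral integrable_bounded_weight) (auto split: split_indicator)
        finally show "(\<integral>\<^sup>+z. indicator {0..<?d} (fst z) * ennreal (w k (snd z)) \<partial>occ x)
            = ennreal (wint occ (indicator {0..<?d}) (w k) x)" .
      qed
      finally show ?thesis .
    qed
    then have "J j = (\<lambda>x. SUP k. ennreal (wint occ (indicator {0..<?d}) (w k) x))" by auto
    then show ?thesis using wb by (auto intro!: lower_semicont_SUP lower_semicont_continuous continuous_wint_initial)
  qed
  have J_eq: "J j x = (\<integral>\<^sup>+t\<in>{0..<1 / real (Suc j)}. (\<integral>\<^sup>+\<omega>. ext0 U (Y t \<omega>) \<partial>Law X (Some x)) \<partial>lborel)" for j x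
  proof -
    have m: "(\<lambda>z. indicator {0..<1 / real (Suc j)} (fst z) * U (snd z)) \<in> borel_measurable borel"
      by (intro borel_measurable_times_ennreal mi mU)
    have e: "ext0 (\<lambda>y. c * U y) z = c * ext0 U z" for c z by (cases z) auto
    have mY: "(\<lambda>\<omega>. ext0 U (Y t \<omega>)) \<in> borel_measurable (Law X (Some x))" for t
      by (intro measurable_compose[OF measurable_Y measurable_ext0] measurable_U)
    show ?thesis
      unfolding J_def nn_integral_occ[OF m] fst_conv snd_conv e
      by (intro nn_integral_cong) (auto simp: nn_integral_cmult[OF mY] split: split_indicator)
  qed
  \<comment> \<open>The factor j + 1 turns the integral into an average. Since the expectations of U
    decrease in t, the average is at least the value at the right end point and at most
    \<open>fU\<close>.\<close>
  have "fU x = (SUP j. ennreal (real (Suc j)) * J j x)" for x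
  proof (rule antisym)
    let ?u = "\<lambda>t. \<integral>\<^sup>+\<omega>. ext0 U (Y t \<omega>) \<partial>Law X (Some x)"
    have one: "ennreal (real (Suc j)) * (\<integral>\<^sup>+t\<in>{0..<1 / real (Suc j)}. c \<partial>lborel) = c" for c j
    proof -
      have "ennreal (real (Suc j)) * ennreal (1 / real (Suc j)) = 1"
        by (subst ennreal_mult[symmetric]) (auto simp: field_simps)
      then show ?thesis by (simp add: nn_integral_cmult_indicator mult.left_commute[of _ c] del: of_nat_Suc)
    qed
    show "fU x \<le> (SUP j. ennreal (real (Suc j)) * J j x)"
      unfolding SUP_expect_U[symmetric]
    proof (rule SUP_mono)
      fix j
      have "?u (1 / real (Suc j)) = ennreal (real (Suc j)) * (\<integral>\<^sup>+t\<in>{0..<1 / real (Suc j)}. ?u (1 / real (Suc j)) \<partial>lborel)"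
        by (rule one[symmetric])
      also have "\<dots> \<le> ennreal (real (Suc j)) * J j x"
        unfolding J_eq
        by (intro mult_left_mono nn_integral_mono) (auto split: split_indicator intro!: expect_U_antimono)
      finally show "\<exists>i\<in>UNIV. ?u (1 / real (Suc j)) \<le> ennreal (real (Suc i)) * J i x" by blast
    qed
    show "(SUP j. ennreal (real (Suc j)) * J j x) \<le> fU x"
    proof (rule SUP_least)
      fix j
      have "J j x \<le> (\<integral>\<^sup>+t\<in>{0..<1 / real (Suc j)}. fU x \<partial>lborel)"
        unfolding J_eq
      proof (rule nn_integral_mono_AE)
        have "AE t in lborel. t \<noteq> (0::real)" by (rule AE_lborel_singleton)
        then show "AE t in lborel. ?u t * indicator {0..<1 / real (Suc j)} t \<le> fU x * indicator {0..<1 / real (Suc j)} t"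
          by eventually_elim (auto split: split_indicator intro!: expect_U_le_fU)
      qed
      then have "ennreal (real (Suc j)) * J j x \<le> ennreal (real (Suc j)) * (\<integral>\<^sup>+t\<in>{0..<1 / real (Suc j)}. fU x \<partial>lborel)"
        by (rule mult_left_mono) simp
      then show "ennreal (real (Suc j)) * J j x \<le> fU x" unfolding one .
    qed
  qed
  then have "fU = (\<lambda>x. SUP j. ennreal (real (Suc j)) * J j x)" by auto
  then show ?thesis using lsc_J by (auto intro!: lower_semicont_SUP lower_semicont_cmult)
qed

lemma measurable_fU: "fU \<in> borel_measurable borel"
  by (rule measurable_lower_semicont[OF lower_semicont_fU])

lemma S_borel: "S \<in> sets borel"
  unfolding S_def using measurable_fU measurable_U by measurable

lemma S_markov:
  assumes "stopping_time (Flt X) T" "D \<in> sets (pre_sigma T)"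
  shows "(\<integral>\<^sup>+\<omega>\<in>D. ext0 fU (Pos X (T \<omega>) \<omega>) \<partial>Law X z) = (\<integral>\<^sup>+\<omega>\<in>D. \<Phi>S (Shift X (T \<omega>) \<omega>) \<partial>Law X z)"
proof -
  have "ext0 fU y = (\<integral>\<^sup>+\<omega>. \<Phi>S \<omega> \<partial>Law X y)" for y by (cases y) (auto simp: fU_def \<Phi>_None)
  from strong_markov_completed[OF assms measurable_\<Phi>S measurable_ext0[OF measurable_fU] this, where z = z and \<Psi> = "\<lambda>\<omega>. \<Phi>S (Shift X (T \<omega>) \<omega>)"]
  show ?thesis by simp
qed

end

lemma (in standard_process) nearly_borel_Borel: "B \<in> sets borel \<Longrightarrow> nearly_borel X B"
  unfolding nearly_borel_def
  by (intro allI impI bexI[of _ B] conjI bexI[of _ "{}"]) (auto simp: init_prob_def)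

context fine_support
begin

text \<open>Directly after \<open>tau t\<close> the clock exceeds t, so the shifted path starts its
  clock at once and \<open>\<Phi>S\<close> equals \<open>\<Phi>U\<close> along it. Hence
  \<open>fU\<close> and U have the same finite expectation at \<open>Y t\<close>, and as
  \<open>fU\<close> is the smaller one they agree there almost surely.\<close>

lemma Y_in_S:
  assumes t: "0 \<le> t"
  shows "AE \<omega> in Law X (Some x). Y t \<omega> \<in> insert None (Some ` S)"
proof -
  let ?L = "Law X (Some x)"
  have eq: "AE \<omega> in ?L. \<Phi>S (Shift X (tau t \<omega>) \<omega>) = \<Phi>U (Shift X (tau t \<omega>) \<omega>)"
    using A_add[of "Some x"]
  proof (rule AE_mp, intro AE_I2 impI)
    fix \<omega> assume \<omega>: "\<omega> \<in> space ?L"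
      and add: "\<forall>t s. t < \<infinity> \<longrightarrow> s < \<infinity> \<longrightarrow> A (t + s) \<omega> = A t \<omega> + A s (Shift X t \<omega>)"
    have \<omega>E: "\<omega> \<in> space (Evt X)" using \<omega> by simp
    show "\<Phi>S (Shift X (tau t \<omega>) \<omega>) = \<Phi>U (Shift X (tau t \<omega>) \<omega>)"
    proof (cases "tau t \<omega> < \<infinity>")
      case False
      then have "Pos X (ennreal s) (Shift X (tau t \<omega>) \<omega>) = None" for s
        using pos_shift[OF \<omega>E] pos_infinity[OF \<omega>E] by (simp add: less_top[symmetric])
      then show ?thesis by (simp add: \<Phi>S_def \<Phi>U_def)
    next
      case True
      have pos: "tau 0 (Shift X (tau t \<omega>) \<omega>) < ennreal s" if s: "0 < s" for s
      proof -
        have "tau t \<omega> < tau t \<omega> + ennreal s"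
          using ennreal_add_left_cancel_less[of "tau t \<omega>" 0 "ennreal s"] True s by (simp add: less_top[symmetric])
        then have "ennreal t < A (tau t \<omega> + ennreal s) \<omega>" by (simp only: tau_less_iff)
        also have "\<dots> = ennreal t + A (ennreal s) (Shift X (tau t \<omega>) \<omega>)"
          using add True A_tau[OF True] by simp
        finally have "0 < A (ennreal s) (Shift X (tau t \<omega>) \<omega>)" by (cases "A (ennreal s) (Shift X (tau t \<omega>) \<omega>) = 0") (auto simp: zero_less_iff_neq_zero)
        then show ?thesis by (simp add: tau_less_iff)
      qed
      show ?thesis
        unfolding \<Phi>S_def \<Phi>U_def
      proof (rule nn_integral_cong_AE)
        have "AE s in lborel. s \<noteq> (0::real)" by (rule AE_lborel_singleton)
        then show "AE s in lborel. ext0 g (Pos X (ennreal s) (Shift X (tau t \<omega>) \<omega>))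
            * indicator {s. tau 0 (Shift X (tau t \<omega>) \<omega>) < ennreal s} s * indicator {0..} s
          = ext0 g (Pos X (ennreal s) (Shift X (tau t \<omega>) \<omega>)) * indicator {0..} s"
        proof eventually_elim
          case (elim s)
          then show ?case using pos[of s] by (cases "0 < s") (auto split: split_indicator)
        qed
      qed
    qed
  qed
  have U_le: "(\<integral>\<^sup>+\<omega>. ext0 U (Y t \<omega>) \<partial>?L) = (\<integral>\<^sup>+\<omega>. \<Phi>U (Shift X (tau t \<omega>) \<omega>) \<partial>?L)"
    using U_markov[OF stopping_time_tau[of t] space_in_pre_sigma, of "Some x"] unfolding nn_integral_space Y_def .
  also have "\<dots> = (\<integral>\<^sup>+\<omega>. \<Phi>S (Shift X (tau t \<omega>) \<omega>) \<partial>?L)"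
    by (rule nn_integral_cong_AE) (use eq in eventually_elim, simp)
  also have "\<dots> = (\<integral>\<^sup>+\<omega>. ext0 fU (Y t \<omega>) \<partial>?L)"
    using S_markov[OF stopping_time_tau[of t] space_in_pre_sigma, of "Some x"] unfolding nn_integral_space Y_def ..
  finally have ints: "(\<integral>\<^sup>+\<omega>. ext0 fU (Y t \<omega>) \<partial>?L) = (\<integral>\<^sup>+\<omega>. ext0 U (Y t \<omega>) \<partial>?L)" ..
  have "(\<integral>\<^sup>+\<omega>. \<Phi>U (Shift X (tau t \<omega>) \<omega>) \<partial>?L) \<le> U x"
    unfolding U_eq by (intro nn_integral_mono) (simp add: \<Phi>U_shift_le)
  then have fin: "(\<integral>\<^sup>+\<omega>. ext0 U (Y t \<omega>) \<partial>?L) < \<infinity>" unfolding U_le using U_finite by (rule le_less_trans)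
  have "AE \<omega> in ?L. ext0 fU (Y t \<omega>) = ext0 U (Y t \<omega>)"
  proof (rule nn_integral_eq_imp_AE_eq[OF _ _ _ ints fin])
    show "(\<lambda>\<omega>. ext0 fU (Y t \<omega>)) \<in> borel_measurable ?L" "(\<lambda>\<omega>. ext0 U (Y t \<omega>)) \<in> borel_measurable ?L"
      by (intro measurable_compose[OF measurable_Y measurable_ext0] measurable_fU measurable_U)+
    show "ext0 fU (Y t \<omega>) \<le> ext0 U (Y t \<omega>)" for \<omega> by (cases "Y t \<omega>") (auto intro: fU_le)
  qed
  then show ?thesis
  proof eventually_elim
    case (elim \<omega>)
    then show ?case by (cases "Y t \<omega>") (auto simp: S_def)
  qed
qed

text \<open>The time-changed process never charges the complement of S, so the potential of its
  indicator vanishes at some point; strict positivity of the kernel leaves no mass for \<mu>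
  there.\<close>

lemma S_carries: "- S \<in> null_sets (completion \<mu>)"
proof -
  let ?u = "indicator (- S) :: 'a \<Rightarrow> ennreal"
  have S': "- S \<in> sets borel" using sets.compl_sets[OF S_borel] by (simp add: Compl_eq_Diff_UNIV)
  then have um: "?u \<in> borel_measurable borel" by (rule borel_measurable_indicator)
  fix x :: 'a
  have z: "(\<integral>\<^sup>+\<omega>. ext0 ?u (Y t \<omega>) \<partial>Law X (Some x)) = 0" if "0 \<le> t" for t
  proof -
    have "(\<integral>\<^sup>+\<omega>. ext0 ?u (Y t \<omega>) \<partial>Law X (Some x)) = (\<integral>\<^sup>+\<omega>. 0 \<partial>Law X (Some x))"
      by (rule nn_integral_cong_AE, use Y_in_S[OF that, of x] in eventually_elim) auto
    then show ?thesis by simp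
  qed
  have "(\<integral>\<^sup>+y. G x y * ?u y \<partial>\<mu>) = (\<integral>\<^sup>+z. ?u (snd z) \<partial>occ x)" by (rule nn_potential_occ[OF um, symmetric])
  also have "\<dots> = (\<integral>\<^sup>+t\<in>{0..}. (\<integral>\<^sup>+\<omega>. ext0 ?u (Y t \<omega>) \<partial>Law X (Some x)) \<partial>lborel)"
    using nn_integral_occ[OF measurable_compose[OF measurable_snd_borel(1) um], of x] by simp
  also have "\<dots> = (\<integral>\<^sup>+t. 0 \<partial>(lborel :: real measure))"
    by (intro nn_integral_cong) (auto simp: z split: split_indicator)
  finally have "(\<integral>\<^sup>+y. G x y * ?u y \<partial>\<mu>) = 0" by simp
  then have "AE y in \<mu>. G x y * ?u y = 0"
    using um measurable_G[OF sets_\<mu>, of x]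
    by (subst (asm) nn_integral_0_iff_AE) (auto simp: measurable_cong_sets[OF sets_\<mu> refl])
  then have "AE y in \<mu>. y \<notin> - S"
  proof eventually_elim
    case (elim y)
    then show ?case using G_pos[of x y] by (auto simp: indicator_def split: if_splits)
  qed
  then have "- S \<in> null_sets \<mu>" using S' by (subst (asm) AE_iff_null_sets[symmetric]) (auto simp: sets_\<mu>)
  then show ?thesis by (rule null_sets_completionI)
qed

lemma measurable_window_path:
  assumes "\<omega> \<in> space (Evt X)" "B \<in> sets borel"
  shows "(\<lambda>s. ext0 g (Pos X (ennreal s) \<omega>) * indicator B s * indicator {0..} s) \<in> borel_measurable lborel"
  unfolding measurable_lborel2
  by (intro borel_measurable_times_ennreal measurable_g_path borel_measurable_indicator assms) auto

text \<open>A path alive at time 0 stays alive for a short while by right continuity, and g is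
  strictly positive.\<close>

lemma window_pos:
  assumes \<omega>: "\<omega> \<in> space (Evt X)" and x: "Pos X 0 \<omega> \<noteq> None" and r: "0 < r"
  shows "0 < (\<integral>\<^sup>+s\<in>{0..}. ext0 g (Pos X (ennreal s) \<omega>) * indicator {s. ennreal s \<le> r} s \<partial>lborel)"
proof -
  obtain y where y: "Pos X 0 \<omega> = Some y" using x by auto
  have "\<forall>\<^sub>F s in at_right 0. Pos X s \<omega> \<in> Some ` UNIV" by (rule Pos_right_open[OF \<omega> y]) auto
  then obtain b :: ennreal where b: "0 < b" "\<And>s. 0 < s \<Longrightarrow> s < b \<Longrightarrow> Pos X s \<omega> \<noteq> None"
    using eventually_at_right[of 0 "1 :: ennreal"] by force
  have "0 < min b r" using b r by simp
  then obtain c where c: "0 < c" "c < min b r" using dense by blast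
  then obtain d where d: "c = ennreal d" "0 < d" by (cases c) auto
  have pos: "0 < ext0 g (Pos X (ennreal s) \<omega>) * indicator {s. ennreal s \<le> r} s * indicator {0..} s"
    if s: "s \<in> {0<..d}" for s
  proof -
    have "ennreal s \<le> c" using s d by (auto intro: ennreal_leI)
    then have "ennreal s < b" "ennreal s \<le> r" using c(2) by auto
    moreover have "Pos X (ennreal s) \<omega> \<noteq> None" using b(2)[of "ennreal s"] calculation s by simp
    ultimately show ?thesis using s g_pos by auto
  qed
  show ?thesis
  proof (rule ccontr)
    assume "\<not> ?thesis"
    then have 0: "(\<integral>\<^sup>+s\<in>{0..}. ext0 g (Pos X (ennreal s) \<omega>) * indicator {s. ennreal s \<le> r} s \<partial>lborel) = 0"
      by (simp add: zero_less_iff_neq_zero)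
    have "{s. ennreal s \<le> r} \<in> sets borel" by measurable
    then have m: "(\<lambda>s. ext0 g (Pos X (ennreal s) \<omega>) * indicator {s. ennreal s \<le> r} s * indicator {0..} s) \<in> borel_measurable lborel"
      by (rule measurable_window_path[OF \<omega>])
    have "AE s in lborel. ext0 g (Pos X (ennreal s) \<omega>) * indicator {s. ennreal s \<le> r} s * indicator {0..} s = 0"
      using 0 nn_integral_0_iff_AE[OF m] by simp
    then have "AE s in lborel. s \<notin> {0<..d}"
    proof eventually_elim
      case (elim s)
      show ?case
      proof
        assume "s \<in> {0<..d}"
        from pos[OF this] show False unfolding elim by simp
      qed
    qed
    then have "{0<..d} \<in> null_sets lborel" by (subst (asm) AE_iff_null_sets[symmetric]) auto
    then show False using d(2) by (simp add: null_sets_def)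
  qed
qed

lemma tau_zero_eq_zero:
  assumes \<omega>: "\<omega> \<in> space (Evt X)" and eq: "\<Phi>S \<omega> = \<Phi>U \<omega>" and fin: "\<Phi>U \<omega> < \<infinity>" and x: "Pos X 0 \<omega> \<noteq> None"
  shows "tau 0 \<omega> = 0"
proof (rule ccontr)
  assume "tau 0 \<omega> \<noteq> 0"
  then have r: "0 < tau 0 \<omega>" by (simp add: zero_less_iff_neq_zero)
  let ?W = "\<integral>\<^sup>+s\<in>{0..}. ext0 g (Pos X (ennreal s) \<omega>) * indicator {s. ennreal s \<le> tau 0 \<omega>} s \<partial>lborel"
  have s1: "{s. ennreal s \<le> tau 0 \<omega>} \<in> sets borel" "{s. tau 0 \<omega> < ennreal s} \<in> sets borel" by measurable
  have m: "(\<lambda>s. ext0 g (Pos X (ennreal s) \<omega>) * indicator B s * indicator {0..} s) \<in> borel_measurable lborel"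
    if "B \<in> sets borel" for B
    by (rule measurable_window_path[OF \<omega> that])
  have "\<Phi>U \<omega> = \<Phi>S \<omega> + ?W"
    unfolding \<Phi>U_def \<Phi>S_def
    by (subst nn_integral_add[symmetric, OF m[OF s1(2)] m[OF s1(1)]], intro nn_integral_cong)
       (auto split: split_indicator)
  then have "?W = 0" using eq fin ennreal_add_left_cancel[of "\<Phi>U \<omega>" ?W 0] by (auto simp: less_top[symmetric])
  then show False using window_pos[OF \<omega> x r] by simp
qed

lemma S_regular:
  assumes "x \<in> S" shows "AE \<omega> in Law X (Some x). tau 0 \<omega> = 0"
proof -
  have mU: "\<Phi>U \<in> borel_measurable (Law X (Some x))" and mS: "\<Phi>S \<in> borel_measurable (Law X (Some x))"
    by (rule borel_measurable_Law_nat_filt_compl measurable_\<Phi>U measurable_\<Phi>S)+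
  have fin: "(\<integral>\<^sup>+\<omega>. \<Phi>U \<omega> \<partial>Law X (Some x)) < \<infinity>" using U_finite[of x] by (simp add: U_eq)
  have "AE \<omega> in Law X (Some x). \<Phi>S \<omega> = \<Phi>U \<omega>"
    using assms fin by (intro nn_integral_eq_imp_AE_eq mS mU \<Phi>S_le_\<Phi>U) (auto simp: S_def fU_def U_eq)
  moreover have "AE \<omega> in Law X (Some x). \<Phi>U \<omega> \<noteq> \<infinity>" using fin mU by (intro nn_integral_noteq_infinite) auto
  moreover note normal[of "Some x"]
  moreover have "AE \<omega> in Law X (Some x). \<omega> \<in> space (Law X (Some x))" by (rule AE_space)
  ultimately show ?thesis
    by eventually_elim (auto intro!: tau_zero_eq_zero simp: less_top)
qed

text \<open>By additivity the clock of the shifted path cannot start before the original one, that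
  is, \<open>tau 0\<close> is at most T plus \<open>tau 0\<close> of the shift. So \<open>fU\<close>
  is a supermartingale along the original process.\<close>

lemma \<Phi>S_shift_le:
  assumes \<omega>: "\<omega> \<in> space (Evt X)" and add: "\<forall>t s. t < \<infinity> \<longrightarrow> s < \<infinity> \<longrightarrow> A (t + s) \<omega> = A t \<omega> + A s (Shift X t \<omega>)"
  shows "\<Phi>S (Shift X T \<omega>) \<le> \<Phi>S \<omega>"
proof (cases "T < \<infinity>")
  case False
  then have "Pos X (ennreal s) (Shift X T \<omega>) = None" for s
    using pos_shift[OF \<omega>] pos_infinity[OF \<omega>] by (simp add: less_top[symmetric])
  then show ?thesis by (simp add: \<Phi>S_def)
next
  case True
  define h where "h s = ext0 g (Pos X s \<omega>) * indicator {s. tau 0 \<omega> < s} s" for s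
  have "{s. tau 0 \<omega> < ennreal s} \<in> sets borel" by measurable
  then have "(\<lambda>s. ext0 g (Pos X (ennreal s) \<omega>) * indicator {s. tau 0 \<omega> < ennreal s} s) \<in> borel_measurable borel"
    using measurable_g_path[OF \<omega>] by (intro borel_measurable_times_ennreal) auto
  also have "(\<lambda>s. ext0 g (Pos X (ennreal s) \<omega>) * indicator {s. tau 0 \<omega> < ennreal s} s) = (\<lambda>s. h (ennreal s))"
    by (auto simp: h_def fun_eq_iff split: split_indicator)
  finally have hm: "(\<lambda>s. h (ennreal s)) \<in> borel_measurable borel" .
  have h0: "h \<infinity> = 0" using pos_infinity[OF \<omega>] by (simp add: h_def)
  have "\<Phi>S (Shift X T \<omega>) \<le> (\<integral>\<^sup>+s\<in>{0..}. h (T + ennreal s) \<partial>lborel)"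
    unfolding \<Phi>S_def pos_shift[OF \<omega>]
  proof (intro nn_integral_mono mult_right_mono)
    fix s :: real
    show "ext0 g (Pos X (T + ennreal s) \<omega>) * indicator {s. tau 0 (Shift X T \<omega>) < ennreal s} s \<le> h (T + ennreal s)"
    proof (cases "tau 0 (Shift X T \<omega>) < ennreal s")
      case t: True
      then have "0 < A (ennreal s) (Shift X T \<omega>)" by (simp add: tau_less_iff)
      also have "\<dots> \<le> A (T + ennreal s) \<omega>" using add True by simp
      finally have "tau 0 \<omega> < T + ennreal s" by (simp add: tau_less_iff)
      then show ?thesis using t by (simp add: h_def)
    qed simp
  qed simp
  also have "\<dots> = (\<integral>\<^sup>+s\<in>{0..}. h (ennreal s) * indicator {s. T \<le> ennreal s} s \<partial>lborel)"
    by (rule nn_integral_shift[OF hm h0])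
  also have "\<dots> \<le> \<Phi>S \<omega>"
    unfolding \<Phi>S_def h_def by (intro nn_integral_mono) (auto split: split_indicator)
  finally show ?thesis .
qed

text \<open>A Doob inequality: T is the first of finitely many times with \<open>fU\<close> above c;
  on that event \<open>fU\<close> at time T exceeds c, and the strong Markov property together with
  \<open>\<Phi>S_shift_le\<close> bounds its expectation by \<open>fU\<close> at the start.\<close>

lemma maximal_inequality:
  assumes R: "finite R" and c: "c < \<infinity>"
  shows "c * emeasure (Law X (Some x)) {\<omega>\<in>space (Evt X). \<exists>r\<in>R. Pos X r \<omega> \<in> Some ` {y. c < fU y}} \<le> fU x"
proof -
  let ?B = "Some ` {y. c < fU y}"
  have "{y. c < fU y} \<in> sets borel" using lower_semicont_fU by (auto simp: lower_semicont_def)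
  then have B: "?B \<in> sets borel_cem" by (rule Some_borel_cem)
  define T where "T \<omega> = Inf {r\<in>R. Pos X r \<omega> \<in> ?B}" for \<omega>
  have hit: "{\<omega>\<in>space (Evt X). Pos X r \<omega> \<in> ?B} \<in> sets (Flt X s)" if "r \<le> s" for r s
    using measurable_sets[OF adapted[of r] B] sets_F_mono[OF that] by (auto simp: vimage_def Int_def conj_commute)
  have T: "stopping_time (Flt X) T"
  proof (rule stopping_time_lessI)
    fix s :: ennreal
    have "{\<omega>\<in>space (Evt X). T \<omega> < s} = (\<Union>r\<in>{r\<in>R. r < s}. {\<omega>\<in>space (Evt X). Pos X r \<omega> \<in> ?B})"
      by (auto simp: T_def Inf_less_iff)
    also have "\<dots> \<in> sets (Flt X s)" using R by (intro sets.finite_UN) (auto intro!: hit)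
    finally show "{\<omega>\<in>space (Evt X). T \<omega> < s} \<in> sets (Flt X s)" .
  qed
  define D where "D = {\<omega>\<in>space (Evt X). \<exists>r\<in>R. r < \<infinity> \<and> Pos X r \<omega> \<in> ?B}"
  have D: "D \<in> sets (pre_sigma T)"
  proof -
    have "T -` {..<\<infinity>} \<inter> space (pre_sigma T) \<in> sets (pre_sigma T)"
      by (rule measurable_sets[OF measurable_stopping_time_pre_sigma[OF T]]) simp
    also have "T -` {..<\<infinity>} \<inter> space (pre_sigma T) = D"
    proof -
      have "Inf {r\<in>R. P r} < \<infinity> \<longleftrightarrow> (\<exists>r\<in>R. r < \<infinity> \<and> P r)" for P
        unfolding Inf_less_iff by blast
      from this[of "\<lambda>r. Pos X r \<omega> \<in> ?B" for \<omega>]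
      show ?thesis
        by (simp only: set_eq_iff vimage_eq Int_iff lessThan_iff mem_Collect_eq T_def D_def space_pre_sigma conj_commute simp_thms)
    qed
    finally show ?thesis .
  qed
  have DE: "D \<in> sets (Evt X)" using D sets_pre_sigma_Evt[OF T] by auto
  \<comment> \<open>The restriction to finite r makes D the event that T is finite, and it loses
    nothing, since at time \<infinity> the process is at the cemetery.\<close>
  have D_eq: "D = {\<omega>\<in>space (Evt X). \<exists>r\<in>R. Pos X r \<omega> \<in> ?B}"
  proof -
    have "r < \<infinity>" if "\<omega> \<in> space (Evt X)" "Pos X r \<omega> \<in> ?B" for r \<omega>
      using pos_infinity[OF that(1)] that(2) by (cases r) auto
    then show ?thesis unfolding D_def by blast
  qed
  have XT: "Pos X (T \<omega>) \<omega> \<in> ?B" if "\<omega> \<in> D" for \<omega>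
  proof -
    have "{r\<in>R. Pos X r \<omega> \<in> ?B} \<noteq> {}" using that by (auto simp: D_eq)
    then have "T \<omega> \<in> {r\<in>R. Pos X r \<omega> \<in> ?B}"
      unfolding T_def using R by (subst cInf_eq_Min) (auto intro!: Min_in simp del: mem_Collect_eq)
    then show ?thesis by simp
  qed
  have "c * emeasure (Law X (Some x)) D = (\<integral>\<^sup>+\<omega>\<in>D. c \<partial>Law X (Some x))"
    using DE by (simp add: nn_integral_cmult_indicator sets_law)
  also have "\<dots> \<le> (\<integral>\<^sup>+\<omega>\<in>D. ext0 fU (Pos X (T \<omega>) \<omega>) \<partial>Law X (Some x))"
  proof (intro nn_integral_mono)
    fix \<omega>
    show "c * indicator D \<omega> \<le> ext0 fU (Pos X (T \<omega>) \<omega>) * indicator D \<omega>"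
    proof (cases "\<omega> \<in> D")
      case True
      then obtain y where "Pos X (T \<omega>) \<omega> = Some y" "c < fU y" using XT by blast
      then show ?thesis by (simp add: less_imp_le True)
    qed simp
  qed
  also have "\<dots> = (\<integral>\<^sup>+\<omega>\<in>D. \<Phi>S (Shift X (T \<omega>) \<omega>) \<partial>Law X (Some x))" by (rule S_markov[OF T D])
  also have "\<dots> \<le> (\<integral>\<^sup>+\<omega>. \<Phi>S \<omega> \<partial>Law X (Some x))"
  proof (rule nn_integral_mono_AE)
    show "AE \<omega> in Law X (Some x). \<Phi>S (Shift X (T \<omega>) \<omega>) * indicator D \<omega> \<le> \<Phi>S \<omega>"
      using A_add[of "Some x"] by (rule AE_mp) (auto intro!: AE_I2 \<Phi>S_shift_le split: split_indicator)
  qed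
  also have "\<dots> = fU x" by (simp add: fU_def)
  finally show ?thesis unfolding D_eq .
qed

end

section \<open>Germ events and the zero-one law\<close>

context standard_process
begin

text \<open>Visits at rational times arbitrarily close to 0. Rational times keep the event
  measurable; for open B right continuity finds them whenever there are visits at all.\<close>

definition germ_hit :: "'a set \<Rightarrow> 'w set" where
  "germ_hit B = {\<omega>\<in>space (Evt X). \<forall>k. \<exists>q\<in>\<rat> \<inter> {0<..<1 / real (Suc k)}. Pos X (ennreal q) \<omega> \<in> Some ` B}"

text \<open>The conditions become stronger with k, so the first ones may be dropped; the remaining
  ones involve only times below any prescribed t > 0.\<close>

lemma sets_germ_hit:
  assumes B: "B \<in> sets borel" and t: "0 < t"
  shows "germ_hit B \<in> sets (Flt X t)" "germ_hit B \<in> sets (nat_filt X \<infinity>)"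
proof -
  note B' = Some_borel_cem[OF B]
  let ?Q = "\<lambda>k. \<rat> \<inter> {0<..<1 / real (Suc k)}"
  have cQ: "countable (?Q k)" for k by (intro countable_Int1 countable_rat)
  let ?E = "\<lambda>q. {\<omega>\<in>space (Evt X). Pos X (ennreal q) \<omega> \<in> Some ` B}"
  have "?E q \<in> sets (nat_filt X \<infinity>)" for q
    using measurable_sets[OF measurable_Pos_nat_filt B', of "ennreal q"] by (simp add: vimage_def Int_def conj_commute)
  then have "(\<Inter>k. \<Union>q\<in>?Q k. ?E q) \<in> sets (nat_filt X \<infinity>)"
    using cQ by (intro sets.countable_INT' sets.countable_UN') auto
  also have "(\<Inter>k. \<Union>q\<in>?Q k. ?E q) = germ_hit B" by (auto simp: germ_hit_def)
  finally show "germ_hit B \<in> sets (nat_filt X \<infinity>)" .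
  obtain c where "0 < c" "c < t" using dense[OF t] by blast
  then obtain d where d: "0 < d" "ennreal d < t" by (cases c) auto
  obtain K where K: "1 / real (Suc K) < d" by (rule nat_approx_posE[OF d(1)]) blast
  have E: "?E q \<in> sets (Flt X t)" if "q \<in> ?Q (k + K)" for q k
  proof -
    have "1 / real (Suc (k + K)) \<le> 1 / real (Suc K)" by (intro frac_le) auto
    then have "q \<le> d" using that K by auto
    then have "ennreal q \<le> t" using d(2) by (meson ennreal_leI less_imp_le order_trans)
    then show ?thesis
      using measurable_sets[OF adapted B', of "ennreal q"] sets_F_mono[of "ennreal q" t]
      by (auto simp: vimage_def Int_def conj_commute)
  qed
  have "(\<Inter>k. \<Union>q\<in>?Q (k + K). ?E q) \<in> sets (Flt X t)"
  proof -
    have "(\<Union>q\<in>?Q (k + K). ?E q) \<in> sets (Flt X t)" for k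
      by (rule sets.countable_UN''[OF cQ]) (rule E)
    then show ?thesis by (intro sets.countable_INT) auto
  qed
  also have "(\<Inter>k. \<Union>q\<in>?Q (k + K). ?E q) = germ_hit B"
  proof (intro set_eqI iffI)
    fix \<omega> assume "\<omega> \<in> (\<Inter>k. \<Union>q\<in>?Q (k + K). ?E q)"
    then have *: "\<And>k. \<exists>q\<in>?Q (k + K). \<omega> \<in> ?E q" by blast
    have "\<exists>q\<in>?Q k. Pos X (ennreal q) \<omega> \<in> Some ` B" for k
    proof -
      obtain q where q: "q \<in> ?Q (k + K)" "\<omega> \<in> ?E q" using * by blast
      have "1 / real (Suc (k + K)) \<le> 1 / real (Suc k)" by (intro frac_le) auto
      then have "q \<in> ?Q k" using q by auto
      then show ?thesis using q by blast
    qed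
    moreover have "\<omega> \<in> space (Evt X)" using *[of 0] by blast
    ultimately show "\<omega> \<in> germ_hit B" by (auto simp: germ_hit_def)
  next
    fix \<omega> assume "\<omega> \<in> germ_hit B"
    then show "\<omega> \<in> (\<Inter>k. \<Union>q\<in>?Q (k + K). ?E q)" unfolding germ_hit_def by blast
  qed
  finally show "germ_hit B \<in> sets (Flt X t)" .
qed

text \<open>Blumenthal's zero-one law: right continuity puts the event into the filtration at time
  0, so the Markov property at time 0 gives it a probability equal to its own square.\<close>

lemma germ_zero_one:
  assumes B: "B \<in> sets borel"
  shows "emeasure (Law X z) (germ_hit B) = 0 \<or> emeasure (Law X z) (germ_hit B) = 1"
proof -
  let ?E = "germ_hit B"
  interpret prob_space "Law X z" by (rule prob_law)
  have E: "?E \<in> sets (nat_filt X \<infinity>)" by (rule sets_germ_hit(2)[OF B, of 1]) simp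
  have EE: "?E \<in> sets (Law X z)" for z using E sets_nat_filt_Evt by (auto simp: sets_law)
  have "?E \<in> (\<Inter>s\<in>{0<..}. sets (Flt X s))" by (auto intro: sets_germ_hit(1)[OF B])
  then have "?E \<in> sets (Flt X 0)" using filt_right_continuous[of 0] by simp
  then have "?E \<in> sets (Flt X t)" for t using sets_F_mono[of 0 t] by auto
  then have D: "?E \<in> sets (pre_sigma (\<lambda>_. 0))" by (intro sets_pre_sigmaI stopping_time_const) simp
  have inv: "Shift X 0 \<omega> \<in> ?E \<longleftrightarrow> \<omega> \<in> ?E" if "\<omega> \<in> space (Evt X)" for \<omega>
    using that by (auto simp: germ_hit_def pos_shift shift_space)
  have "emeasure (Law X z) ?E = (\<integral>\<^sup>+\<omega>. indicator ?E \<omega> \<partial>Law X z)" using EE by simp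
  also have "\<dots> = (\<integral>\<^sup>+\<omega>\<in>?E. indicator ?E (Shift X 0 \<omega>) \<partial>Law X z)"
    by (intro nn_integral_cong) (auto simp: inv split: split_indicator)
  also have "\<dots> = (\<integral>\<^sup>+\<omega>\<in>?E. (\<integral>\<^sup>+\<omega>'. indicator ?E \<omega>' \<partial>Law X (Pos X 0 \<omega>)) \<partial>Law X z)"
    using E by (intro strong_markov_path[OF stopping_time_const D]) auto
  also have "\<dots> = (\<integral>\<^sup>+\<omega>\<in>?E. emeasure (Law X z) ?E \<partial>Law X z)"
    by (rule nn_integral_cong_AE, use normal[of z] in eventually_elim) (simp add: EE)
  also have "\<dots> = emeasure (Law X z) ?E * emeasure (Law X z) ?E"
    using EE by (simp add: nn_integral_cmult_indicator)
  finally have *: "emeasure (Law X z) ?E = emeasure (Law X z) ?E * emeasure (Law X z) ?E" .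
  then have "prob ?E = prob ?E * prob ?E"
    unfolding emeasure_eq_measure by (simp add: ennreal_mult[symmetric])
  then show ?thesis unfolding emeasure_eq_measure by auto
qed

end

context fine_support
begin

text \<open>Off S a constant c separates \<open>fU\<close> from U, and S is contained in the union
  of the open set \<open>fU\<close> > c and the closed set U \<le> c. The closed set is left alone
  for a while by right continuity, because U x > c. The open one is visited immediately with
  probability 0 or 1, and the maximal inequality excludes 1.\<close>

lemma S_finely_closed: "finely_closed X S"
  unfolding finely_closed_def
proof (intro allI impI)
  fix x assume "x \<notin> S"
  then have "fU x < U x" using fU_le[of x] by (simp add: S_def less_le)
  then obtain c where c: "fU x < c" "c < U x" using dense by blast
  have cfin: "c < \<infinity>" using c(2) U_finite[of x] by (rule less_trans)
  define D1 where "D1 = {y. c < fU y}"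
  define D2 where "D2 = {y. U y \<le> c}"
  have o1: "open D1" using lower_semicont_fU by (simp add: D1_def lower_semicont_def)
  have "- D2 = {y. c < U y}" by (auto simp: D2_def)
  then have o2: "open (- D2)" using lower_semicont_U by (simp add: lower_semicont_def)
  have "D1 \<union> D2 \<in> sets borel" using o1 o2 by (intro sets.Un) (auto simp: closed_def)
  then have nb: "nearly_borel X (D1 \<union> D2)" by (rule nearly_borel_Borel)
  have SD: "S \<subseteq> D1 \<union> D2" by (auto simp: S_def D1_def D2_def not_le)
  have B1: "D1 \<in> sets borel" using o1 by simp
  let ?L = "Law X (Some x)"
  have E: "germ_hit D1 \<in> sets ?L"
    using sets_germ_hit(2)[OF B1, of 1] sets_nat_filt_Evt by (auto simp: sets_law)
  have "emeasure ?L (germ_hit D1) = 0"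
  proof -
    \<comment> \<open>An enumeration of the rational times in (0, 1): the maximal inequality holds
      for finitely many times, and its bound survives the increasing union.\<close>
    define q where "q = from_nat_into (\<rat> \<inter> {0<..<1::real})"
    have "(1/2 :: real) \<in> \<rat> \<inter> {0<..<1}" by (auto intro: Rats_divide)
    then have ne: "\<rat> \<inter> {0<..<1::real} \<noteq> {}" by blast
    have rq: "range q = \<rat> \<inter> {0<..<1}"
      unfolding q_def by (intro range_from_nat_into ne countable_Int1 countable_rat)
    define E where "E n = {\<omega>\<in>space (Evt X). \<exists>r\<in>(\<lambda>i. ennreal (q i)) ` {..n}. Pos X r \<omega> \<in> Some ` D1}" for n
    have En: "E n \<in> sets ?L" for n
    proof -
      have "E n = (\<Union>i\<in>{..n}. Pos X (ennreal (q i)) -` (Some ` D1) \<inter> space (Evt X))" by (auto simp: E_def)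
      also have "\<dots> \<in> sets (Evt X)"
        by (intro sets.finite_UN measurable_sets[OF measurable_Pos_Evt] Some_borel_cem B1) auto
      finally show ?thesis by (simp add: sets_law)
    qed
    have "germ_hit D1 \<subseteq> (\<Union>n. E n)"
    proof
      fix \<omega> assume \<omega>: "\<omega> \<in> germ_hit D1"
      then obtain p where p: "p \<in> \<rat> \<inter> {0<..<1 / real (Suc 0)}" "Pos X (ennreal p) \<omega> \<in> Some ` D1"
        unfolding germ_hit_def by blast
      then have "p \<in> range q" unfolding rq by simp
      then obtain i where "p = q i" by auto
      then have "\<omega> \<in> E i" using p \<omega> by (auto simp: E_def germ_hit_def)
      then show "\<omega> \<in> (\<Union>n. E n)" by blast
    qed
    then have "emeasure ?L (germ_hit D1) \<le> emeasure ?L (\<Union>n. E n)"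
      using En by (intro emeasure_mono) auto
    also have "\<dots> = (SUP n. emeasure ?L (E n))"
    proof (rule SUP_emeasure_incseq[symmetric])
      show "incseq E" by (auto simp: incseq_def E_def)
    qed (use En in auto)
    finally have "c * emeasure ?L (germ_hit D1) \<le> c * (SUP n. emeasure ?L (E n))" by (rule mult_left_mono) simp
    also have "\<dots> = (SUP n. c * emeasure ?L (E n))" by (rule SUP_mult_left_ennreal)
    also have "\<dots> \<le> fU x"
      unfolding E_def D1_def by (intro SUP_least maximal_inequality cfin) auto
    also have "\<dots> < c" by (rule c(1))
    finally have "emeasure ?L (germ_hit D1) \<noteq> 1" by auto
    then show ?thesis using germ_zero_one[OF B1, of "Some x"] by blast
  qed
  then have "AE \<omega> in ?L. \<omega> \<notin> germ_hit D1" using E by (intro AE_not_in) (auto simp: null_sets_def)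
  moreover have "AE \<omega> in ?L. \<omega> \<in> space ?L" by (rule AE_space)
  moreover note normal[of "Some x"]
  ultimately have "AE \<omega> in ?L. 0 < hitting_time X (D1 \<union> D2) \<omega>"
  proof eventually_elim
    case (elim \<omega>)
    have \<omega>: "\<omega> \<in> space (Evt X)" using elim by simp
    have "x \<in> - D2" using c(2) by (simp add: D2_def)
    then have "\<forall>\<^sub>F s in at_right 0. Pos X s \<omega> \<in> Some ` (- D2)"
      using Pos_right_open[OF \<omega> _ o2, of 0 x] elim(3) by simp
    then obtain b :: ennreal where b: "0 < b" "\<And>s. 0 < s \<Longrightarrow> s < b \<Longrightarrow> Pos X s \<omega> \<in> Some ` (- D2)"
      using eventually_at_right[of 0 "1 :: ennreal"] by force
    obtain k where k: "\<And>q. q \<in> \<rat> \<inter> {0<..<1 / real (Suc k)} \<Longrightarrow> Pos X (ennreal q) \<omega> \<notin> Some ` D1"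
      using elim(1) \<omega> unfolding germ_hit_def by blast
    let ?d = "min b (ennreal (1 / real (Suc k)))"
    have "Pos X t \<omega> \<notin> Some ` (D1 \<union> D2)" if t: "0 < t" "t < ?d" for t
    proof
      assume "Pos X t \<omega> \<in> Some ` (D1 \<union> D2)"
      moreover have "Pos X t \<omega> \<in> Some ` (- D2)" using b(2) t by simp
      ultimately have "Pos X t \<omega> \<in> Some ` D1" by auto
      then obtain p where p: "p \<in> \<rat>" "0 < p" "t < ennreal p" "ennreal p < ?d" "Pos X (ennreal p) \<omega> \<in> Some ` D1"
        by (rule Pos_rational_right[OF \<omega> _ o1 t(2)])
      have "p < 1 / real (Suc k)" using p(2,4) by (simp add: ennreal_less_iff del: of_nat_Suc)
      then show False using k[of p] p by auto
    qed
    then have "?d \<le> hitting_time X (D1 \<union> D2) \<omega>"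
      unfolding hitting_time_def by (intro Inf_greatest) (force simp: not_less[symmetric])
    moreover have "0 < ?d" using b(1) by simp
    ultimately show ?case by (rule less_le_trans[rotated])
  qed
  then show "\<exists>D. nearly_borel X D \<and> S \<subseteq> D \<and> (AE \<omega> in ?L. 0 < hitting_time X D \<omega>)"
    using nb SD by blast
qed

lemma S_fine_carrier: "fine_carrier X \<mu> S"
  unfolding fine_carrier_def by (intro conjI nearly_borel_Borel S_borel S_finely_closed S_carries)

lemma fine_support_subset: "is_fine_support X \<mu> F \<Longrightarrow> F \<subseteq> S"
  using S_fine_carrier by (auto simp: is_fine_support_def)

end

section \<open>Density of the potentials on the fine support\<close>

text \<open>Outside a compact set the function with index 0 is already below e and later ones are
  smaller; on the compact part finitely many indices suffice. Inserting 0 among them serves the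
  outside points and keeps the maximum defined.\<close>

lemma C0_dini:
  fixes f :: "nat \<Rightarrow> 'a::metric_space \<Rightarrow> real"
  assumes f: "\<And>n. f n \<in> C0" and F: "closed F"
    and dec: "\<And>n x. x \<in> F \<Longrightarrow> f (Suc n) x \<le> f n x"
    and small: "\<And>x. x \<in> F \<Longrightarrow> \<exists>n. f n x < e" and e: "0 < e"
  obtains n where "\<And>x. x \<in> F \<Longrightarrow> f n x < e"
proof -
  have cont: "continuous_on UNIV (f n)" for n using f[of n] by (simp add: C0_def)
  have anti: "f n x \<le> f m x" if "x \<in> F" "m \<le> n" for x m n
    using that(2) by (rule lift_Suc_antimono_le[of "\<lambda>n. f n x", rotated]) (rule dec[OF that(1)])
  have "\<forall>e>0. \<exists>K. compact K \<and> (\<forall>x. x \<notin> K \<longrightarrow> \<bar>f 0 x\<bar> < e)" using f[of 0] by (simp add: C0_def)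
  then obtain K where K: "compact K" "\<And>x. x \<notin> K \<Longrightarrow> \<bar>f 0 x\<bar> < e" using e by blast
  have "compact (K \<inter> F)" using K(1) F by (rule compact_Int_closed)
  moreover have "open {x. f n x < e}" for n using cont by (intro open_Collect_less) auto
  moreover have "K \<inter> F \<subseteq> (\<Union>n. {x. f n x < e})" using small by auto
  ultimately obtain C where C: "finite C" "K \<inter> F \<subseteq> (\<Union>n\<in>C. {x. f n x < e})"
    by (rule compactE_image[of _ UNIV]) auto
  have "f (Max (insert 0 C)) x < e" if x: "x \<in> F" for x
  proof (cases "x \<in> K")
    case True
    then obtain n where n: "n \<in> C" "f n x < e" using C(2) x by blast
    have "f (Max (insert 0 C)) x \<le> f n x" using C(1) n(1) by (intro anti x Max_ge) auto
    then show ?thesis using n(2) by simp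
  next
    case False
    have "f (Max (insert 0 C)) x \<le> f 0 x" using C(1) by (intro anti x Max_ge) auto
    then show ?thesis using K(2)[OF False] by linarith
  qed
  then show thesis using that by blast
qed

text \<open>A lattice version of Mazur's lemma: the suprema \<open>g\<close> of long blocks of the sequence exceed
  \<open>u - e\<close>, and finite infima of them fall below \<open>u + e\<close>; both times Dini's argument applies.\<close>

lemma C0_lattice_approx:
  fixes u :: "'a::metric_space \<Rightarrow> real"
  assumes L: "L \<subseteq> C0" and max_L: "\<And>f g. f \<in> L \<Longrightarrow> g \<in> L \<Longrightarrow> (\<lambda>x. max (f x) (g x)) \<in> L"
    and min_L: "\<And>f g. f \<in> L \<Longrightarrow> g \<in> L \<Longrightarrow> (\<lambda>x. min (f x) (g x)) \<in> L"
    and v: "\<And>j. v j \<in> L" "\<And>x. x \<in> F \<Longrightarrow> (\<lambda>j. v j x) \<longlonglongrightarrow> u x"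
    and u: "u \<in> C0" and F: "closed F" and e: "0 < e"
  obtains f where "f \<in> L" "\<And>x. x \<in> F \<Longrightarrow> \<bar>f x - u x\<bar> < e"
proof -
  \<comment> \<open>\<open>g J K\<close> is the maximum of the block \<open>v J\<close>, ...,
    \<open>v (J + K)\<close>.\<close>
  define g where "g J = rec_nat (v J) (\<lambda>K f x. max (f x) (v (J + Suc K) x))" for J
  have g0: "g J 0 = v J" and gS: "g J (Suc K) = (\<lambda>x. max (g J K x) (v (J + Suc K) x))" for J K
    by (simp_all add: g_def)
  have gL: "g J K \<in> L" for J K by (induction K) (simp_all only: g0 gS v(1) max_L)
  have g_ge: "v (J + K) x \<le> g J K x" for J K x by (cases K) (simp_all add: g0 gS)
  have g_le: "g J K x \<le> c" if "\<And>j. J \<le> j \<Longrightarrow> v j x \<le> c" for J K x c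
    by (induction K) (simp_all add: g0 gS that)
  have ev: "\<exists>J. \<forall>j\<ge>J. \<bar>v j x - u x\<bar> < d" if "x \<in> F" "0 < d" for x d
    using tendstoD[OF v(2)[OF that(1)] that(2)] by (simp add: eventually_sequentially dist_real_def)
  have "\<exists>K. \<forall>x\<in>F. u x - g J K x < e" for J
  proof -
    obtain n where "\<And>x. x \<in> F \<Longrightarrow> u x - g J n x < e"
    proof (rule C0_dini[of "\<lambda>n x. u x - g J n x", OF _ F _ _ e])
      show "(\<lambda>x. u x - g J n x) \<in> C0" for n using L gL by (intro C0_diff u) blast
      show "u x - g J (Suc n) x \<le> u x - g J n x" for n x by (simp add: gS)
      fix x assume x: "x \<in> F"
      obtain j where j: "\<forall>i\<ge>j. \<bar>v i x - u x\<bar> < e" using ev[OF x e] by blast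
      then have "\<bar>v (J + j) x - u x\<bar> < e" by simp
      then have "u x - g J j x < e" using g_ge[of J j x] by linarith
      then show "\<exists>n. u x - g J n x < e" by blast
    qed blast
    then show ?thesis by blast
  qed
  then obtain k where k: "\<And>J x. x \<in> F \<Longrightarrow> u x - g J (k J) x < e" by metis
  \<comment> \<open>\<open>h M\<close> is the minimum of the block maxima with indices 0 to M, each
    block long enough to exceed u - e on F.\<close>
  define h where "h = rec_nat (g 0 (k 0)) (\<lambda>M f x. min (f x) (g (Suc M) (k (Suc M)) x))"
  have h0: "h 0 = g 0 (k 0)" and hS: "h (Suc M) = (\<lambda>x. min (h M x) (g (Suc M) (k (Suc M)) x))" for M
    by (simp_all add: h_def)
  have hL: "h M \<in> L" for M by (induction M) (simp_all only: h0 hS gL min_L)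
  have h_le: "h M x \<le> g M (k M) x" for M x by (cases M) (simp_all add: h0 hS)
  have h_gt: "u x - e < h M x" if "x \<in> F" for M x
    using k[OF that] by (induction M) (auto simp: h0 hS less_diff_eq diff_less_eq add.commute)
  obtain n where n: "\<And>x. x \<in> F \<Longrightarrow> h n x - u x < e"
  proof (rule C0_dini[of "\<lambda>n x. h n x - u x", OF _ F _ _ e])
    show "(\<lambda>x. h n x - u x) \<in> C0" for n using L hL by (intro C0_diff u) blast
    show "h (Suc n) x - u x \<le> h n x - u x" for n x by (simp add: hS)
    fix x assume x: "x \<in> F"
    obtain J where J: "\<forall>i\<ge>J. \<bar>v i x - u x\<bar> < e / 2" using ev[OF x half_gt_zero[OF e]] by blast
    have "g J (k J) x \<le> u x + e / 2"
    proof (rule g_le)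
      fix j assume "J \<le> j"
      then have "\<bar>v j x - u x\<bar> < e / 2" using J by blast
      then show "v j x \<le> u x + e / 2" by linarith
    qed
    then have "h J x - u x < e" using h_le[of J x] e by linarith
    then show "\<exists>n. h n x - u x < e" by blast
  qed blast
  have "\<bar>h n x - u x\<bar> < e" if "x \<in> F" for x using n[OF that] h_gt[OF that, of n] by linarith
  then show thesis using hL that by blast
qed

lemma average_tendsto:
  fixes h :: "real \<Rightarrow> real"
  assumes h: "h \<in> borel_measurable borel" "\<And>t. \<bar>h t\<bar> \<le> C" and lim: "(h \<longlongrightarrow> h 0) (at_right 0)"
  shows "(\<lambda>j. real (Suc j) * (LINT t:{0..}|lborel. indicator {0..<1 / real (Suc j)} t * h t)) \<longlonglongrightarrow> h 0"
proof (rule tendstoI)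
  fix e :: real assume e: "0 < e"
  have "\<forall>\<^sub>F t in at_right 0. dist (h t) (h 0) < e / 2" by (rule tendstoD[OF lim half_gt_zero[OF e]])
  then obtain b :: real where b: "0 < b" "\<And>t. 0 < t \<Longrightarrow> t < b \<Longrightarrow> dist (h t) (h 0) < e / 2"
    unfolding eventually_at_right_field by blast
  obtain K where K: "1 / real (Suc K) < b" by (rule nat_approx_posE[OF b(1)])
  have "dist (real (Suc j) * (LINT t:{0..}|lborel. indicator {0..<1 / real (Suc j)} t * h t)) (h 0) < e" if j: "K \<le> j" for j
  proof -
    let ?d = "1 / real (Suc j)"
    have "?d \<le> 1 / real (Suc K)" using j by (intro frac_le) auto
    then have d: "0 < ?d" "?d < b" using K by auto
    have b': "\<bar>h t - h 0\<bar> \<le> e / 2" if "t \<in> {0..<?d}" for t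
      using b(2)[of t] that d e by (cases "t = 0") (auto simp: dist_real_def)
    have i1: "integrable lborel (\<lambda>t. indicator {0..<?d} t * c)" for c :: real by simp
    have i2: "integrable lborel (\<lambda>t. indicator {0..<?d} t * h t)"
    proof (rule Bochner_Integration.integrable_bound[OF i1[of C]])
      show "(\<lambda>t. indicator {0..<?d} t * h t) \<in> borel_measurable lborel" using h(1) by measurable
      show "AE t in lborel. norm (indicator {0..<?d} t * h t) \<le> norm (indicator {0..<?d} t * C)"
      proof (rule AE_I2)
        fix t show "norm (indicator {0..<?d} t * h t) \<le> norm (indicator {0..<?d} t * C)"
          using h(2)[of t] by (auto split: split_indicator)
      qed
    qed
    have eq: "(LINT t:{0..}|lborel. indicator {0..<?d} t * h t) = (\<integral>t. indicator {0..<?d} t * h t \<partial>lborel)"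
      unfolding set_lebesgue_integral_def by (intro Bochner_Integration.integral_cong) (auto split: split_indicator)
    have c: "(\<integral>t. indicator {0..<?d} t * c \<partial>lborel) = ?d * c" for c :: real
      using d by (simp add: integral_mult_left_zero)
    have "\<bar>(\<integral>t. indicator {0..<?d} t * h t \<partial>lborel) - (\<integral>t. indicator {0..<?d} t * h 0 \<partial>lborel)\<bar>
        = \<bar>\<integral>t. indicator {0..<?d} t * h t - indicator {0..<?d} t * h 0 \<partial>lborel\<bar>"
      by (subst Bochner_Integration.integral_diff[OF i2 i1]) simp
    also have "\<dots> \<le> (\<integral>t. \<bar>indicator {0..<?d} t * h t - indicator {0..<?d} t * h 0\<bar> \<partial>lborel)"
      by (rule integral_abs_bound)
    also have "\<dots> \<le> (\<integral>t. indicator {0..<?d} t * (e / 2) \<partial>lborel)"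
    proof (rule integral_mono)
      show "integrable lborel (\<lambda>t. \<bar>indicator {0..<?d} t * h t - indicator {0..<?d} t * h 0\<bar>)"
        by (intro integrable_abs Bochner_Integration.integrable_diff i1 i2)
      show "\<bar>indicator {0..<?d} t * h t - indicator {0..<?d} t * h 0\<bar> \<le> indicator {0..<?d} t * (e / 2)" for t
        using b'[of t] by (auto split: split_indicator)
    qed (rule i1)
    finally have 1: "\<bar>(\<integral>t. indicator {0..<?d} t * h t \<partial>lborel) - ?d * h 0\<bar> \<le> ?d * (e / 2)" unfolding c .
    have "dist (real (Suc j) * (LINT t:{0..}|lborel. indicator {0..<?d} t * h t)) (h 0)
        = real (Suc j) * \<bar>(\<integral>t. indicator {0..<?d} t * h t \<partial>lborel) - ?d * h 0\<bar>"
      unfolding eq dist_real_def by (subst abs_of_pos[of "real (Suc j)", symmetric], simp, subst abs_mult[symmetric]) (simp add: right_diff_distrib del: of_nat_Suc)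
    also have "\<dots> \<le> real (Suc j) * (?d * (e / 2))" using 1 by (intro mult_left_mono) auto
    also have "\<dots> = e / 2" by (simp del: of_nat_Suc)
    finally show ?thesis using e by linarith
  qed
  then show "\<forall>\<^sub>F j in sequentially. dist (real (Suc j) * (LINT t:{0..}|lborel. indicator {0..<1 / real (Suc j)} t * h t)) (h 0) < e"
    by (auto simp: eventually_sequentially)
qed

section \<open>Averages of the time-changed semigroup\<close>

context time_change
begin

lemma Y_right_open:
  assumes \<omega>: "\<omega> \<in> space (Evt X)" and t: "0 \<le> t" and y: "Y t \<omega> = Some y" and U: "open U" "y \<in> U"
  shows "\<forall>\<^sub>F s in at_right t. Y s \<omega> \<in> Some ` U"
proof -
  have fin: "tau t \<omega> < \<infinity>" using y pos_infinity[OF \<omega>] by (cases "tau t \<omega>") (auto simp: Y_def)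
  have P: "Pos X (tau t \<omega>) \<omega> = Some y" using y by (simp add: Y_def)
  have "\<forall>\<^sub>F r in at_right (tau t \<omega>). Pos X r \<omega> \<in> Some ` U" by (rule Pos_right_open[OF \<omega> P U])
  then obtain b where b: "tau t \<omega> < b" "\<And>r. tau t \<omega> < r \<Longrightarrow> r < b \<Longrightarrow> Pos X r \<omega> \<in> Some ` U"
    unfolding eventually_at_right[OF fin] by (elim exE conjE) simp
  have "((\<lambda>s. tau s \<omega>) \<longlongrightarrow> tau t \<omega>) (at_right t)"
    unfolding tau_def by (rule right_inverse_right_continuous[OF clock_path t])
  from order_tendstoD(2)[OF this b(1)] have "\<forall>\<^sub>F s in at_right t. tau s \<omega> < b" .
  moreover have "\<forall>\<^sub>F s in at_right t. t < s" by (rule eventually_at_right_less)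
  ultimately show ?thesis
  proof eventually_elim
    case (elim s)
    have "tau t \<omega> \<le> tau s \<omega>" using elim by (intro tau_mono) simp
    then show ?case using b(2)[of "tau s \<omega>"] elim P U by (cases "tau t \<omega> = tau s \<omega>") (auto simp: Y_def order_le_less)
  qed
qed

lemma Y_right_continuous:
  assumes \<omega>: "\<omega> \<in> space (Evt X)" and t: "0 \<le> t" and y: "Y t \<omega> = Some y" and w: "continuous_on UNIV w"
  shows "((\<lambda>s. ext0 w (Y s \<omega>) :: real) \<longlongrightarrow> w y) (at_right t)"
proof (rule tendstoI)
  fix e :: real assume e: "0 < e"
  have "open (w -` ball (w y) e)" using w by (intro open_vimage) auto
  then have "\<forall>\<^sub>F s in at_right t. Y s \<omega> \<in> Some ` (w -` ball (w y) e)"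
    using e by (intro Y_right_open[OF \<omega> t y]) auto
  then show "\<forall>\<^sub>F s in at_right t. dist (ext0 w (Y s \<omega>)) (w y) < e"
    by eventually_elim (auto simp: dist_commute)
qed

end

context kato_bounded
begin

text \<open>The mean of the semigroup applied to f over the time interval [0, 1/(j+1)).\<close>

definition avg :: "nat \<Rightarrow> ('a \<Rightarrow> real) \<Rightarrow> 'a \<Rightarrow> real" where
  "avg j f x = real (Suc j) * wint occ (indicator {0..<1 / real (Suc j)}) f x"

text \<open>The average is j + 1 times the potential of f minus its tail from time 1/(j+1) on, and
  the tail is itself a uniform limit of potentials by \<open>wint_step_closure\<close>.\<close>

lemma avg_approx:
  assumes f: "f \<in> C0" and e: "0 < e"
  shows "\<exists>h\<in>C0. \<forall>x. \<bar>avg j f x - pot occ h x\<bar> \<le> e"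
proof -
  interpret ps: potential_space occ N C0 by (rule potential_space_C0)
  have "0 < e / real (Suc j)" using e by simp
  then obtain g where g: "g \<in> C0" "\<And>x. \<bar>wint occ (indicator {1 / real (Suc j)..}) f x - pot occ g x\<bar> \<le> e / real (Suc j)"
    using ps.wint_step_closure[OF f, of "1 / real (Suc j)" "e / real (Suc j)"] by (metis divide_nonneg_nonneg of_nat_0_le_iff zero_le_one)
  have "\<bar>avg j f x - pot occ (\<lambda>y. real (Suc j) * (f y - g y)) x\<bar> \<le> e" for x
  proof -
    have "avg j f x - pot occ (\<lambda>y. real (Suc j) * (f y - g y)) x
        = - (real (Suc j) * (wint occ (indicator {1 / real (Suc j)..}) f x - pot occ g x))"
      using wint_initial[OF C0_bmeas[OF f], of "1 / real (Suc j)" x] pot_diff[OF C0_bmeas[OF f] C0_bmeas[OF g(1)], of x]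
      by (simp only: avg_def pot_cmult) (simp add: right_diff_distrib del: of_nat_Suc)
    then have "\<bar>avg j f x - pot occ (\<lambda>y. real (Suc j) * (f y - g y)) x\<bar>
        = real (Suc j) * \<bar>wint occ (indicator {1 / real (Suc j)..}) f x - pot occ g x\<bar>"
      by (simp only: abs_minus_cancel abs_mult abs_of_nat)
    also have "\<dots> \<le> real (Suc j) * (e / real (Suc j))" by (intro mult_left_mono g(2)) simp
    finally show ?thesis by simp
  qed
  moreover have "(\<lambda>y. real (Suc j) * (f y - g y)) \<in> C0" by (intro C0_cmult C0_diff f g(1))
  ultimately show ?thesis by blast
qed

lemma avg_C0: "f \<in> C0 \<Longrightarrow> avg j f \<in> C0"
  by (rule C0_limit) (metis avg_approx pot_C0 C0_bmeas)

lemma avg_eq: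
  assumes f: "f \<in> bmeas"
  shows "avg j f x = (\<integral>\<omega>. real (Suc j) * (LINT t:{0..}|lborel. indicator {0..<1 / real (Suc j)} t * ext0 f (Y t \<omega>)) \<partial>Law X (Some x))"
proof -
  have "integrable (occ x) (\<lambda>z. indicator {0..<1 / real (Suc j)} (fst z) * f (snd z))"
    by (intro integrable_bounded_weight f) (auto split: split_indicator)
  from integral_occ[OF this _ bmeasD[OF f]] show ?thesis by (simp add: avg_def)
qed

text \<open>If the clock starts at once, the time-changed path starts at x and is right continuous;
  dominated convergence does the rest. At other points the limit would be an expectation at
  \<open>Y 0\<close>.\<close>

lemma avg_tendsto:
  assumes f: "f \<in> C0" and x: "AE \<omega> in Law X (Some x). tau 0 \<omega> = 0"
  shows "(\<lambda>j. avg j f x) \<longlonglongrightarrow> f x"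
proof -
  interpret L: prob_space "Law X (Some x)" by (rule prob_law)
  have fb: "f \<in> bmeas" and cont: "continuous_on UNIV f" using f C0_bmeas by (auto simp: C0_def)
  obtain C where C: "0 \<le> C" "\<And>y. \<bar>f y\<bar> \<le> C" by (rule bmeasE[OF fb]) blast
  define B where "B j \<omega> = real (Suc j) * (LINT t:{0..}|lborel. indicator {0..<1 / real (Suc j)} t * ext0 f (Y t \<omega>))" for j \<omega>
  have mB: "B j \<in> borel_measurable (Law X (Some x))" for j
    unfolding B_def using borel_measurable_Law_nat_filt_compl[OF measurable_LINT_Y[OF bmeasD[OF fb], of "indicator {0..<1 / real (Suc j)}"]] by measurable
  have path: "(\<lambda>t. ext0 f (Y t \<omega>)) \<in> borel_measurable borel" if "\<omega> \<in> space (Evt X)" for \<omega>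
    using measurable_compose[OF measurable_Pair2'[of \<omega> "nat_filt_compl X \<infinity>" borel] measurable_compose[OF measurable_Y_joint measurable_ext0[OF bmeasD[OF fb]]]] that
    by simp
  have "(\<lambda>j. \<integral>\<omega>. B j \<omega> \<partial>Law X (Some x)) \<longlonglongrightarrow> (\<integral>\<omega>. f x \<partial>Law X (Some x))"
  proof (rule integral_dominated_convergence[where w = "\<lambda>_. C"])
    have "AE \<omega> in Law X (Some x). \<omega> \<in> space (Evt X)" using AE_space[of "Law X (Some x)"] by simp
    with x normal[of "Some x"] show "AE \<omega> in Law X (Some x). (\<lambda>j. B j \<omega>) \<longlonglongrightarrow> f x"
    proof eventually_elim
      case (elim \<omega>)
      have Y0: "Y 0 \<omega> = Some x" using elim by (simp add: Y_def)
      show ?case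
        using average_tendsto[of "\<lambda>t. ext0 f (Y t \<omega>)" C, OF path[OF elim(3)] abs_ext0_le[of C f, OF C]]
          Y_right_continuous[OF elim(3) _ Y0 cont] by (simp add: B_def Y0)
    qed
    show "AE \<omega> in Law X (Some x). norm (B j \<omega>) \<le> C" for j
    proof (rule AE_I2)
      fix \<omega> assume "\<omega> \<in> space (Law X (Some x))"
      let ?d = "1 / real (Suc j)"
      have c: "(\<integral>t. indicator {0..<?d} t * C \<partial>lborel) = ?d * C" by (simp add: integral_mult_left_zero)
      have "\<bar>LINT t:{0..}|lborel. indicator {0..<?d} t * ext0 f (Y t \<omega>)\<bar>
          \<le> (\<integral>t. \<bar>indicator {0..} t *\<^sub>R (indicator {0..<?d} t * ext0 f (Y t \<omega>))\<bar> \<partial>lborel)"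
        unfolding set_lebesgue_integral_def by (rule integral_abs_bound)
      also have "\<dots> \<le> (\<integral>t. indicator {0..<?d} t * C \<partial>lborel)"
        by (rule integral_mono') (use abs_ext0_le[OF C] C(1) in \<open>auto split: split_indicator\<close>)
      finally have "\<bar>LINT t:{0..}|lborel. indicator {0..<?d} t * ext0 f (Y t \<omega>)\<bar> \<le> ?d * C" unfolding c .
      then have "real (Suc j) * \<bar>LINT t:{0..}|lborel. indicator {0..<?d} t * ext0 f (Y t \<omega>)\<bar> \<le> real (Suc j) * (?d * C)"
        by (rule mult_left_mono) simp
      also have "\<dots> = C" by simp
      finally show "norm (B j \<omega>) \<le> C" by (simp add: B_def abs_mult del: of_nat_Suc)
    qed
  qed (use mB in auto)
  then show ?thesis using L.prob_space by (simp add: avg_eq[OF fb] B_def)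
qed

text \<open>The minimum \<open>w\<close> of two potentials is excessive for the time-changed process: on the event
  that \<open>w(Y\<^sub>s)\<close> is the first potential, apply the Markov property to that one.\<close>

lemma expect_min_antimono:
  assumes h1: "h1 \<in> bmeas" and h2: "h2 \<in> bmeas" and st: "0 \<le> s" "s \<le> t"
  shows "(\<integral>\<^sup>+\<omega>. ext0 (\<lambda>y. min (gpot \<mu> h1 y) (gpot \<mu> h2 y)) (Y t \<omega>) \<partial>Law X z)
    \<le> (\<integral>\<^sup>+\<omega>. ext0 (\<lambda>y. min (gpot \<mu> h1 y) (gpot \<mu> h2 y)) (Y s \<omega>) \<partial>Law X z)"
proof -
  let ?a = "gpot \<mu> h1" and ?b = "gpot \<mu> h2" and ?L = "Law X z"
  have gm: "gpot \<mu> h \<in> borel_measurable borel" if "h \<in> bmeas" for h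
    by (rule measurable_lower_semicont[OF lower_semicont_gpot[OF sets_\<mu> bmeasD[OF that]]])
  have mE: "(\<lambda>\<omega>. ext0 (gpot \<mu> h) (Y r \<omega>)) \<in> borel_measurable ?L" if "h \<in> bmeas" for h r
    by (intro measurable_compose[OF measurable_Y measurable_ext0] gm that)
  have mP: "(\<lambda>\<omega>. ext0 (gpot \<mu> h) (Y s \<omega>)) \<in> borel_measurable (pre_sigma (tau s))" if "h \<in> bmeas" for h
    unfolding Y_def by (intro measurable_compose[OF pos_stopping[OF stopping_time_tau] measurable_ext0] gm that)
  define D where "D = {\<omega>\<in>space (Evt X). ext0 ?a (Y s \<omega>) \<le> ext0 ?b (Y s \<omega>)}"
  define D' where "D' = {\<omega>\<in>space (Evt X). \<not> ext0 ?a (Y s \<omega>) \<le> ext0 ?b (Y s \<omega>)}"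
  have "{\<omega>\<in>space (pre_sigma (tau s)). ext0 ?a (Y s \<omega>) \<le> ext0 ?b (Y s \<omega>)} \<in> sets (pre_sigma (tau s))"
    using mP[OF h1] mP[OF h2] by measurable
  then have D: "D \<in> sets (pre_sigma (tau s))" by (simp add: D_def space_pre_sigma)
  have "{\<omega>\<in>space (pre_sigma (tau s)). \<not> ext0 ?a (Y s \<omega>) \<le> ext0 ?b (Y s \<omega>)} \<in> sets (pre_sigma (tau s))"
    using mP[OF h1] mP[OF h2] by measurable
  then have D': "D' \<in> sets (pre_sigma (tau s))" by (simp add: D'_def space_pre_sigma)
  have mono: "sets (pre_sigma (tau s)) \<subseteq> sets (pre_sigma (tau t))"
    using mono_pre_sigma[OF stopping_time_tau stopping_time_tau] tau_mono[OF st(2)] by blast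
  have dec: "(\<integral>\<^sup>+\<omega>\<in>E. ext0 (gpot \<mu> h) (Y t \<omega>) \<partial>?L) \<le> (\<integral>\<^sup>+\<omega>\<in>E. ext0 (gpot \<mu> h) (Y s \<omega>) \<partial>?L)"
    if h: "h \<in> bmeas" and E: "E \<in> sets (pre_sigma (tau s))" for h E
  proof -
    have hm: "(\<lambda>y. ennreal (h y)) \<in> borel_measurable borel" using bmeasD[OF h] by measurable
    have g: "gpot \<mu> h = (\<lambda>x. \<integral>\<^sup>+y. G x y * ennreal (h y) \<partial>\<mu>)" by (simp add: gpot_def fun_eq_iff)
    have E': "E \<in> sets (pre_sigma (tau t))" using E mono by blast
    have t: "0 \<le> t" using st by simp
    have le: "(\<integral>\<^sup>+r\<in>{t..}. ext0 (\<lambda>y. ennreal (h y)) (Y r \<omega>) \<partial>lborel) \<le> (\<integral>\<^sup>+r\<in>{s..}. ext0 (\<lambda>y. ennreal (h y)) (Y r \<omega>) \<partial>lborel)" for \<omega>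
      using st by (intro nn_integral_mono) (auto split: split_indicator)
    show ?thesis
      unfolding g Y_markov[OF hm t E'] Y_markov[OF hm st(1) E]
      by (intro nn_integral_mono mult_right_mono le) simp
  qed
  have DE: "D \<in> sets ?L" "D' \<in> sets ?L"
    using D D' sets_pre_sigma_Evt[OF stopping_time_tau] by (auto simp: sets_law)
  have "(\<integral>\<^sup>+\<omega>. ext0 (\<lambda>y. min (?a y) (?b y)) (Y t \<omega>) \<partial>?L)
      \<le> (\<integral>\<^sup>+\<omega>. ext0 ?a (Y t \<omega>) * indicator D \<omega> + ext0 ?b (Y t \<omega>) * indicator D' \<omega> \<partial>?L)"
  proof (rule nn_integral_mono)
    fix \<omega> assume "\<omega> \<in> space ?L"
    then show "ext0 (\<lambda>y. min (?a y) (?b y)) (Y t \<omega>) \<le> ext0 ?a (Y t \<omega>) * indicator D \<omega> + ext0 ?b (Y t \<omega>) * indicator D' \<omega>"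
      by (cases "Y t \<omega>") (auto simp: D_def D'_def split: split_indicator)
  qed
  also have "\<dots> = (\<integral>\<^sup>+\<omega>\<in>D. ext0 ?a (Y t \<omega>) \<partial>?L) + (\<integral>\<^sup>+\<omega>\<in>D'. ext0 ?b (Y t \<omega>) \<partial>?L)"
    by (intro nn_integral_add borel_measurable_times_ennreal mE h1 h2 borel_measurable_indicator DE)
  also have "\<dots> \<le> (\<integral>\<^sup>+\<omega>\<in>D. ext0 ?a (Y s \<omega>) \<partial>?L) + (\<integral>\<^sup>+\<omega>\<in>D'. ext0 ?b (Y s \<omega>) \<partial>?L)"
    by (intro add_mono dec h1 h2 D D')
  also have "\<dots> = (\<integral>\<^sup>+\<omega>. ext0 ?a (Y s \<omega>) * indicator D \<omega> + ext0 ?b (Y s \<omega>) * indicator D' \<omega> \<partial>?L)"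
    by (intro nn_integral_add[symmetric] borel_measurable_times_ennreal mE h1 h2 borel_measurable_indicator DE)
  also have "\<dots> = (\<integral>\<^sup>+\<omega>. ext0 (\<lambda>y. min (?a y) (?b y)) (Y s \<omega>) \<partial>?L)"
  proof (rule nn_integral_cong)
    fix \<omega> assume "\<omega> \<in> space ?L"
    then show "ext0 ?a (Y s \<omega>) * indicator D \<omega> + ext0 ?b (Y s \<omega>) * indicator D' \<omega> = ext0 (\<lambda>y. min (?a y) (?b y)) (Y s \<omega>)"
      by (cases "Y s \<omega>") (auto simp: D_def D'_def min_def)
  qed
  finally show ?thesis .
qed

text \<open>Rescaling time puts all averages on the common interval [0, 1), so that they can be
  compared pointwise in s as j varies.\<close>

lemma avg_scaled:
  assumes w: "w \<in> bmeas" "\<And>y. 0 \<le> w y"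
  shows "ennreal (avg j w x)
    = (\<integral>\<^sup>+s\<in>{0..<1}. (\<integral>\<^sup>+\<omega>. ext0 (\<lambda>y. ennreal (w y)) (Y (s / real (Suc j)) \<omega>) \<partial>Law X (Some x)) \<partial>lborel)"
proof -
  let ?d = "1 / real (Suc j)"
  let ?E = "\<lambda>t. \<integral>\<^sup>+\<omega>. ext0 (\<lambda>y. ennreal (w y)) (Y t \<omega>) \<partial>Law X (Some x)"
  have wm: "(\<lambda>y. ennreal (w y)) \<in> borel_measurable borel" using bmeasD[OF w(1)] by measurable
  have Em: "?E \<in> borel_measurable borel" by (rule measurable_expect_Y[OF wm])
  have m: "(\<lambda>z. indicator {0..<?d} (fst z) * ennreal (w (snd z))) \<in> borel_measurable (borel :: (real \<times> 'a) measure)"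
    by (intro borel_measurable_times_ennreal measurable_compose[OF measurable_snd_borel(2)] measurable_compose[OF measurable_snd_borel(1) wm]) auto
  have e: "ext0 (\<lambda>y. c * ennreal (w y)) z = c * ext0 (\<lambda>y. ennreal (w y)) z" for c z by (cases z) auto
  have mY: "(\<lambda>\<omega>. ext0 (\<lambda>y. ennreal (w y)) (Y t \<omega>)) \<in> borel_measurable (Law X (Some x))" for t
    by (intro measurable_compose[OF measurable_Y measurable_ext0] wm)
  have "ennreal (wint occ (indicator {0..<?d}) w x) = (\<integral>\<^sup>+z. ennreal (indicator {0..<?d} (fst z) * w (snd z)) \<partial>occ x)"
    unfolding wint_def using w
    by (intro nn_integral_eq_integral[symmetric] integrable_bounded_weight) (auto split: split_indicator)
  also have "\<dots> = (\<integral>\<^sup>+z. indicator {0..<?d} (fst z) * ennreal (w (snd z)) \<partial>occ x)"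
    by (intro nn_integral_cong) (auto split: split_indicator)
  also have "\<dots> = (\<integral>\<^sup>+t\<in>{0..<?d}. ?E t \<partial>lborel)"
    unfolding nn_integral_occ[OF m] fst_conv snd_conv e
    by (intro nn_integral_cong) (auto simp: nn_integral_cmult[OF mY] split: split_indicator)
  also have "\<dots> = ennreal ?d * (\<integral>\<^sup>+s. ?E (?d * s) * indicator {0..<?d} (?d * s) \<partial>lborel)"
    using nn_integral_real_affine[of "\<lambda>t. ?E t * indicator {0..<?d} t" ?d 0] Em by (simp del: of_nat_Suc)
  also have "(\<integral>\<^sup>+s. ?E (?d * s) * indicator {0..<?d} (?d * s) \<partial>lborel) = (\<integral>\<^sup>+s\<in>{0..<1}. ?E (s / real (Suc j)) \<partial>lborel)"
    by (intro nn_integral_cong) (auto simp: divide_simps split: split_indicator simp del: of_nat_Suc)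
  finally have *: "ennreal (wint occ (indicator {0..<?d}) w x) = ennreal ?d * (\<integral>\<^sup>+s\<in>{0..<1}. ?E (s / real (Suc j)) \<partial>lborel)" .
  have "ennreal (real (Suc j)) * ennreal ?d = 1" by (subst ennreal_mult[symmetric]) auto
  moreover have "ennreal (avg j w x) = ennreal (real (Suc j)) * ennreal (wint occ (indicator {0..<?d}) w x)"
    unfolding avg_def by (rule ennreal_mult') simp
  ultimately show ?thesis unfolding * by (simp add: mult.assoc[symmetric] del: of_nat_Suc)
qed

lemma avg_min_mono:
  assumes h: "h1 \<in> bmeas" "h2 \<in> bmeas" "\<And>y. 0 \<le> h1 y" "\<And>y. 0 \<le> h2 y"
  defines "w \<equiv> (\<lambda>y. min (pot occ h1 y) (pot occ h2 y))"
  shows "avg j w x \<le> avg (Suc j) w x"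
    and "AE \<omega> in Law X (Some x). tau 0 \<omega> = 0 \<Longrightarrow> avg j w x \<le> w x"
proof -
  have w0: "0 \<le> w y" for y unfolding w_def using h by (auto intro: pot_nonneg)
  have wb: "w \<in> bmeas" unfolding w_def by (intro C0_bmeas C0_min pot_C0 h)
  have avg0: "0 \<le> avg i w x" for i unfolding avg_def wint_def using w0 by simp
  let ?E = "\<lambda>t. \<integral>\<^sup>+\<omega>. ext0 (\<lambda>y. ennreal (w y)) (Y t \<omega>) \<partial>Law X (Some x)"
  have "(\<lambda>y. ennreal (w y)) = (\<lambda>y. min (gpot \<mu> h1 y) (gpot \<mu> h2 y))"
    unfolding w_def using h by (simp add: fun_eq_iff ennreal_pot_gpot[symmetric] min_def ennreal_le_iff pot_nonneg)
  then have anti: "?E t \<le> ?E s" if "0 \<le> s" "s \<le> t" for s t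
    using expect_min_antimono[OF h(1,2) that, of "Some x"] by simp
  have "ennreal (avg j w x) \<le> ennreal (avg (Suc j) w x)"
    unfolding avg_scaled[OF wb w0]
  proof (intro nn_integral_mono)
    fix s :: real
    have "0 \<le> s \<Longrightarrow> s / real (Suc (Suc j)) \<le> s / real (Suc j)" by (intro divide_left_mono) auto
    then show "?E (s / real (Suc j)) * indicator {0..<1} s \<le> ?E (s / real (Suc (Suc j))) * indicator {0..<1} s"
      by (auto split: split_indicator intro!: anti)
  qed
  then show "avg j w x \<le> avg (Suc j) w x" using avg0 by simp
  assume "AE \<omega> in Law X (Some x). tau 0 \<omega> = 0"
  with normal[of "Some x"] have "AE \<omega> in Law X (Some x). ext0 (\<lambda>y. ennreal (w y)) (Y 0 \<omega>) = ennreal (w x)"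
    by eventually_elim (simp add: Y_def)
  then have "?E 0 = (\<integral>\<^sup>+\<omega>. ennreal (w x) \<partial>Law X (Some x))" by (rule nn_integral_cong_AE)
  then have E0: "?E 0 = ennreal (w x)" using prob_space.emeasure_space_1[OF prob_law[of "Some x"]] by simp
  have "ennreal (avg j w x) \<le> (\<integral>\<^sup>+s\<in>{0..<1}. ennreal (w x) \<partial>(lborel :: real measure))"
    unfolding avg_scaled[OF wb w0]
  proof (intro nn_integral_mono)
    fix s :: real
    show "?E (s / real (Suc j)) * indicator {0..<1} s \<le> ennreal (w x) * indicator {0..<1} s"
      unfolding E0[symmetric] by (auto split: split_indicator intro!: anti)
  qed
  also have "\<dots> = ennreal (w x)" by (simp add: nn_integral_cmult_indicator)
  finally show "avg j w x \<le> w x" using w0 by simp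
qed

lemma potential_dense:
  assumes F: "closed F" and reg: "\<And>x. x \<in> F \<Longrightarrow> AE \<omega> in Law X (Some x). tau 0 \<omega> = 0"
    and u: "u \<in> C0" and e: "0 < e"
  shows "\<exists>h\<in>C0. \<forall>x\<in>F. \<bar>u x - pot occ h x\<bar> \<le> e"
proof -
  define L where "L = {w\<in>C0. \<forall>e>0. \<exists>h\<in>C0. \<forall>x\<in>F. \<bar>w x - pot occ h x\<bar> \<le> e}"
  have LI: "w \<in> L" if "w \<in> C0" "\<And>e. 0 < e \<Longrightarrow> \<exists>h\<in>C0. \<forall>x\<in>F. \<bar>w x - pot occ h x\<bar> \<le> e" for w
    using that by (simp add: L_def)
  have LE: "\<exists>h\<in>C0. \<forall>x\<in>F. \<bar>w x - pot occ h x\<bar> \<le> e" if "w \<in> L" "0 < e" for w e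
    using that by (simp add: L_def)
  have LC: "w \<in> C0" if "w \<in> L" for w using that by (simp add: L_def)
  have pot_C: "pot occ h \<in> C0" if "h \<in> C0" for h by (rule pot_C0[OF C0_bmeas[OF that]])
  have min_pos: "\<exists>h\<in>C0. \<forall>x\<in>F. \<bar>min (pot occ h1 x) (pot occ h2 x) - pot occ h x\<bar> \<le> e"
    if h: "h1 \<in> C0" "h2 \<in> C0" "\<And>y. 0 \<le> h1 y" "\<And>y. 0 \<le> h2 y" and e: "0 < e" for h1 h2 e
  proof -
    let ?w = "\<lambda>y. min (pot occ h1 y) (pot occ h2 y)"
    have w: "?w \<in> C0" by (intro C0_min pot_C h)
    note hb = C0_bmeas[OF h(1)] C0_bmeas[OF h(2)] h(3,4)
    obtain n where n: "\<And>x. x \<in> F \<Longrightarrow> ?w x - avg n ?w x < e / 2"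
    proof (rule C0_dini[of "\<lambda>n x. ?w x - avg n ?w x", OF _ F _ _ half_gt_zero[OF e]])
      show "(\<lambda>x. ?w x - avg n ?w x) \<in> C0" for n by (intro C0_diff avg_C0 w)
      show "?w x - avg (Suc n) ?w x \<le> ?w x - avg n ?w x" for n x
        using avg_min_mono(1)[OF hb] by simp
      fix x assume "x \<in> F"
      from tendstoD[OF avg_tendsto[OF w reg[OF this]] half_gt_zero[OF e]]
      obtain n where "dist (avg n ?w x) (?w x) < e / 2" by (auto simp: eventually_sequentially)
      then have "?w x - avg n ?w x < e / 2" unfolding dist_real_def by linarith
      then show "\<exists>n. ?w x - avg n ?w x < e / 2" by blast
    qed blast
    obtain h where h': "h \<in> C0" "\<And>x. \<bar>avg n ?w x - pot occ h x\<bar> \<le> e / 2"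
      using avg_approx[OF w half_gt_zero[OF e], of n] by blast
    have "\<bar>?w x - pot occ h x\<bar> \<le> e" if "x \<in> F" for x
      using n[OF that] avg_min_mono(2)[OF hb reg[OF that], of n] h'(2)[of x] by linarith
    then show ?thesis using h'(1) by blast
  qed
  have min_pot: "\<exists>h\<in>C0. \<forall>x\<in>F. \<bar>min (pot occ h1 x) (pot occ h2 x) - pot occ h x\<bar> \<le> e"
    if h: "h1 \<in> C0" "h2 \<in> C0" and e: "0 < e" for h1 h2 e
  proof -
    \<comment> \<open>Adding c makes both functions nonnegative, which the excessivity argument
      requires; the minimum commutes with adding the potential of c, which is subtracted again
      afterwards.\<close>
    define c where "c y = \<bar>h1 y\<bar> + \<bar>h2 y\<bar>" for y
    have c: "c \<in> C0" unfolding c_def by (intro C0_add C0_abs h)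
    have "\<exists>k\<in>C0. \<forall>x\<in>F. \<bar>min (pot occ (\<lambda>y. h1 y + c y) x) (pot occ (\<lambda>y. h2 y + c y) x) - pot occ k x\<bar> \<le> e"
    proof (rule min_pos[OF C0_add[OF h(1) c] C0_add[OF h(2) c] _ _ e])
      show "0 \<le> h1 y + c y" "0 \<le> h2 y + c y" for y unfolding c_def by linarith+
    qed
    then obtain k where k: "k \<in> C0" "\<And>x. x \<in> F \<Longrightarrow> \<bar>min (pot occ (\<lambda>y. h1 y + c y) x) (pot occ (\<lambda>y. h2 y + c y) x) - pot occ k x\<bar> \<le> e"
      by blast
    have "\<bar>min (pot occ h1 x) (pot occ h2 x) - pot occ (\<lambda>y. k y - c y) x\<bar> \<le> e" if "x \<in> F" for x
      using k(2)[OF that] unfolding pot_add[OF C0_bmeas[OF h(1)] C0_bmeas[OF c]] pot_add[OF C0_bmeas[OF h(2)] C0_bmeas[OF c]]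
        pot_diff[OF C0_bmeas[OF k(1)] C0_bmeas[OF c]] min_add_distrib_left[symmetric] by (simp add: min_def split: if_splits)
    then show ?thesis using C0_diff[OF k(1) c] by blast
  qed
  have min_L: "(\<lambda>x. min (f x) (g x)) \<in> L" if f: "f \<in> L" and g: "g \<in> L" for f g
  proof (rule LI)
    show "(\<lambda>x. min (f x) (g x)) \<in> C0" by (intro C0_min LC f g)
    fix e :: real assume "0 < e"
    then have e: "0 < e / 2" by simp
    obtain h1 where h1: "h1 \<in> C0" "\<And>x. x \<in> F \<Longrightarrow> \<bar>f x - pot occ h1 x\<bar> \<le> e / 2" using LE[OF f e] by blast
    obtain h2 where h2: "h2 \<in> C0" "\<And>x. x \<in> F \<Longrightarrow> \<bar>g x - pot occ h2 x\<bar> \<le> e / 2" using LE[OF g e] by blast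
    obtain h where h: "h \<in> C0" "\<And>x. x \<in> F \<Longrightarrow> \<bar>min (pot occ h1 x) (pot occ h2 x) - pot occ h x\<bar> \<le> e / 2"
      using min_pot[OF h1(1) h2(1) e] by blast
    have "\<bar>min (f x) (g x) - pot occ h x\<bar> \<le> e" if "x \<in> F" for x
    proof -
      have "\<bar>min a b - min c d\<bar> \<le> r" if "\<bar>a - c\<bar> \<le> r" "\<bar>b - d\<bar> \<le> r" for a b c d r :: real
        using that unfolding abs_le_iff min_def by (simp split: if_split)
      from this[OF h1(2)[OF that] h2(2)[OF that]] h(2)[OF that] show ?thesis by linarith
    qed
    then show "\<exists>h\<in>C0. \<forall>x\<in>F. \<bar>min (f x) (g x) - pot occ h x\<bar> \<le> e" using h(1) by blast
  qed
  have neg_L: "(\<lambda>x. - f x) \<in> L" if f: "f \<in> L" for f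
  proof (rule LI)
    show "(\<lambda>x. - f x) \<in> C0" using C0_cmult[OF LC[OF f], of "-1"] by simp
    fix e :: real assume "0 < e"
    then obtain h where h: "h \<in> C0" "\<And>x. x \<in> F \<Longrightarrow> \<bar>f x - pot occ h x\<bar> \<le> e" using LE[OF f] by blast
    have "\<bar>- f x - pot occ (\<lambda>y. -1 * h y) x\<bar> \<le> e" if "x \<in> F" for x
      using h(2)[OF that] unfolding pot_cmult by linarith
    then show "\<exists>h\<in>C0. \<forall>x\<in>F. \<bar>- f x - pot occ h x\<bar> \<le> e" using C0_cmult[OF h(1), of "-1"] by blast
  qed
  \<comment> \<open>A maximum is the negative of a minimum of negatives, so minima and the vector
    space structure of the potentials suffice.\<close>
  have max_L: "(\<lambda>x. max (f x) (g x)) \<in> L" if "f \<in> L" "g \<in> L" for f g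
    using neg_L[OF min_L[OF neg_L[OF that(1)] neg_L[OF that(2)]]] by (simp add: minus_min_eq_max)
  have avg_L: "avg j u \<in> L" for j
    by (rule LI[OF avg_C0[OF u]]) (use avg_approx[OF u] in blast)
  have e': "0 < e / 2" using e by simp
  obtain f where f: "f \<in> L" "\<And>x. x \<in> F \<Longrightarrow> \<bar>f x - u x\<bar> < e / 2"
    by (rule C0_lattice_approx[of L "\<lambda>j. avg j u" F u "e / 2"])
       (use LC max_L min_L avg_L avg_tendsto[OF u reg] u F e' in auto)
  obtain h where h: "h \<in> C0" "\<And>x. x \<in> F \<Longrightarrow> \<bar>f x - pot occ h x\<bar> \<le> e / 2" using LE[OF f(1) e'] by blast
  have "\<bar>u x - pot occ h x\<bar> \<le> e" if "x \<in> F" for x using f(2)[OF that] h(2)[OF that] by linarith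
  then show ?thesis using h(1) by blast
qed

end

section \<open>Hitting the support\<close>

text \<open>The integral is a supremum over simple functions below f, attained by a countable
  supremum that is measurable and squeezed between f and g. No measurability of f enters; this is
  applied to \<open>\<Phi>S\<close> composed with a random shift.\<close>

lemma nn_integral_eq_imp_AE_eq_lower:
  assumes g [measurable]: "g \<in> borel_measurable M"
    and le: "\<And>x. x \<in> space M \<Longrightarrow> f x \<le> g x" and eq: "(\<integral>\<^sup>+x. f x \<partial>M) = (\<integral>\<^sup>+x. g x \<partial>M)"
    and fin: "(\<integral>\<^sup>+x. g x \<partial>M) < \<infinity>"
  shows "AE x in M. f x = g x"
proof -
  let ?S = "{s. simple_function M s \<and> s \<le> f}"
  have "?S \<noteq> {}" using simple_function_const[of M "0 :: ennreal"] by (auto simp: le_fun_def intro!: exI[of _ "\<lambda>_. 0"])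
  then obtain r :: "nat \<Rightarrow> ennreal" where r: "range r \<subseteq> integral\<^sup>S M ` ?S" "(SUP i\<in>?S. integral\<^sup>S M i) = Sup (range r)"
    using ennreal_SUP_countable_SUP[of ?S "integral\<^sup>S M"] by blast
  have "\<exists>s. s \<in> ?S \<and> r k = integral\<^sup>S M s" for k using r(1) by (auto dest: subsetD[of _ _ "r k"])
  then obtain s where s': "\<And>k. s k \<in> ?S" "\<And>k. r k = integral\<^sup>S M (s k)" by metis
  have s: "range s \<subseteq> ?S" "(SUP i\<in>?S. integral\<^sup>S M i) = (SUP k. integral\<^sup>S M (s k))"
    using s' r(2) by auto
  define h where "h x = (SUP k. s k x)" for x
  have sk: "simple_function M (s k)" "s k x \<le> f x" for k x using s(1) by (auto simp: le_fun_def)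
  have [measurable]: "s k \<in> borel_measurable M" for k by (rule borel_measurable_simple_function[OF sk(1)])
  have [measurable]: "h \<in> borel_measurable M" unfolding h_def by measurable
  have hf: "h x \<le> f x" for x unfolding h_def by (intro SUP_least sk)
  have "(\<integral>\<^sup>+x. f x \<partial>M) = (SUP k. integral\<^sup>S M (s k))" using s(2) by (simp add: nn_integral_def)
  also have "\<dots> \<le> (\<integral>\<^sup>+x. h x \<partial>M)"
  proof (rule SUP_least)
    fix k
    have "integral\<^sup>S M (s k) = (\<integral>\<^sup>+x. s k x \<partial>M)" by (rule nn_integral_eq_simple_integral[OF sk(1), symmetric])
    also have "\<dots> \<le> (\<integral>\<^sup>+x. h x \<partial>M)" unfolding h_def by (intro nn_integral_mono SUP_upper) simp
    finally show "integral\<^sup>S M (s k) \<le> (\<integral>\<^sup>+x. h x \<partial>M)" .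
  qed
  finally have "(\<integral>\<^sup>+x. g x \<partial>M) \<le> (\<integral>\<^sup>+x. h x \<partial>M)" unfolding eq .
  moreover have hg: "h x \<le> g x" if "x \<in> space M" for x using hf le[OF that] by (rule order_trans)
  moreover have "(\<integral>\<^sup>+x. h x \<partial>M) \<le> (\<integral>\<^sup>+x. g x \<partial>M)" by (intro nn_integral_mono hg)
  ultimately have "(\<integral>\<^sup>+x. h x \<partial>M) = (\<integral>\<^sup>+x. g x \<partial>M)" by simp
  then have "AE x in M. h x = g x" using hg fin by (intro nn_integral_eq_imp_AE_eq) auto
  moreover have "AE x in M. x \<in> space M" by (rule AE_space)
  ultimately show ?thesis
  proof eventually_elim
    case (elim x)
    then show ?case using hf[of x] le[of x] by (intro antisym) auto
  qed
qed

section \<open>First entrance into a closed set\<close>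

context standard_process
begin

text \<open>Right continuity supplies a later time at which the path is still alive, which separates
  t from the infimum defining the lifetime.\<close>

lemma before_lifetime:
  assumes \<omega>: "\<omega> \<in> space (Evt X)" and t: "Pos X t \<omega> \<noteq> None"
  shows "t < lifetime X \<omega>"
proof -
  have tf: "t < \<infinity>" using t pos_infinity[OF \<omega>] by (cases t) auto
  have "Pos X t \<omega> \<in> Some ` UNIV" using t by auto
  then obtain q where "q \<in> \<rat>" "0 < q" and q: "t < ennreal q" and "ennreal q < \<infinity>" and q': "Pos X (ennreal q) \<omega> \<in> Some ` UNIV"
    by (rule Pos_rational_right[OF \<omega> _ open_UNIV tf])
  have "ennreal q \<le> lifetime X \<omega>"
    unfolding lifetime_def
  proof (rule Inf_greatest)
    fix s assume "s \<in> {t. Pos X t \<omega> = None}"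
    then show "ennreal q \<le> s" using Pos_after[OF \<omega>, of s "ennreal q"] q' by (cases "s \<le> ennreal q") auto
  qed
  then show ?thesis using q by simp
qed

lemma stopping_time_hitting_open:
  assumes V: "open V"
  shows "stopping_time (Flt X) (hitting_time X V)"
proof (rule stopping_time_lessI)
  fix s :: ennreal
  let ?Q = "{q\<in>\<rat>. 0 < q \<and> ennreal q < s}"
  have "{\<omega>\<in>space (Evt X). hitting_time X V \<omega> < s} = (\<Union>q\<in>?Q. {\<omega>\<in>space (Evt X). Pos X (ennreal q) \<omega> \<in> Some ` V})"
  proof (intro set_eqI iffI)
    fix \<omega> assume "\<omega> \<in> {\<omega>\<in>space (Evt X). hitting_time X V \<omega> < s}"
    then obtain t where t: "\<omega> \<in> space (Evt X)" "Pos X t \<omega> \<in> Some ` V" "t < s"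
      unfolding hitting_time_def Inf_less_iff by blast
    obtain q where "q \<in> \<rat>" "0 < q" "t < ennreal q" "ennreal q < s" "Pos X (ennreal q) \<omega> \<in> Some ` V"
      by (rule Pos_rational_right[OF t(1,2) V t(3)])
    then show "\<omega> \<in> (\<Union>q\<in>?Q. {\<omega>\<in>space (Evt X). Pos X (ennreal q) \<omega> \<in> Some ` V})" using t(1) by blast
  next
    fix \<omega> assume "\<omega> \<in> (\<Union>q\<in>?Q. {\<omega>\<in>space (Evt X). Pos X (ennreal q) \<omega> \<in> Some ` V})"
    then obtain q where q: "0 < q" "ennreal q < s" "\<omega> \<in> space (Evt X)" "Pos X (ennreal q) \<omega> \<in> Some ` V" by blast
    then have "hitting_time X V \<omega> \<le> ennreal q" unfolding hitting_time_def by (intro Inf_lower) simp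
    then show "\<omega> \<in> {\<omega>\<in>space (Evt X). hitting_time X V \<omega> < s}" using q by simp
  qed
  also have "\<dots> \<in> sets (Flt X s)"
  proof (rule sets.countable_UN'')
    show "countable ?Q" by (rule countable_subset[OF _ countable_rat]) blast
    fix q assume "q \<in> ?Q"
    then have "sets (Flt X (ennreal q)) \<subseteq> sets (Flt X s)" by (intro sets_F_mono) (simp add: less_imp_le)
    then show "{\<omega>\<in>space (Evt X). Pos X (ennreal q) \<omega> \<in> Some ` V} \<in> sets (Flt X s)"
      using measurable_sets[OF adapted Some_borel_cem, of V "ennreal q"] V by (auto simp: vimage_def Int_def conj_commute)
  qed
  finally show "{\<omega>\<in>space (Evt X). hitting_time X V \<omega> < s} \<in> sets (Flt X s)" .
qed

text \<open>The first entrance of a closed set is approached, by quasi-left-continuity, through the hitting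
  times of its neighbourhoods.\<close>

lemma closed_debut:
  assumes F: "closed F" "F \<noteq> {}"
  shows "\<exists>T. stopping_time (Flt X) T \<and> (\<forall>\<omega> t. 0 < t \<longrightarrow> Pos X t \<omega> \<in> Some ` F \<longrightarrow> T \<omega> \<le> t) \<and>
    (\<forall>z. AE \<omega> in Law X z. Pos X (T \<omega>) \<omega> \<in> insert None (Some ` F))"
proof (intro exI conjI allI impI)
  define V where "V k = {y. infdist y F < 1 / real (Suc k)}" for k
  define S where "S k = hitting_time X (V k)" for k
  define T where "T \<omega> = (SUP k. S k \<omega>)" for \<omega>
  have V: "open (V k)" for k unfolding V_def by (intro open_Collect_less continuous_intros)
  have stop: "stopping_time (Flt X) (S k)" for k unfolding S_def by (rule stopping_time_hitting_open[OF V])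
  have inc: "incseq (\<lambda>k. S k \<omega>)" for \<omega>
  proof (rule incseq_SucI)
    fix k
    have "1 / real (Suc (Suc k)) \<le> 1 / real (Suc k)" by (intro frac_le) auto
    then have "V (Suc k) \<subseteq> V k" by (auto simp: V_def)
    then show "S k \<omega> \<le> S (Suc k) \<omega>" unfolding S_def hitting_time_def by (intro Inf_superset_mono) auto
  qed
  show "stopping_time (Flt X) T"
  proof (rule stopping_timeI)
    fix t
    have "Measurable.pred (Flt X t) (\<lambda>\<omega>. \<forall>k. S k \<omega> \<le> t)"
      by (intro pred_intros_countable stopping_timeD[OF stop])
    then show "Measurable.pred (Flt X t) (\<lambda>\<omega>. T \<omega> \<le> t)" by (simp add: T_def SUP_le_iff)
  qed
  show "T \<omega> \<le> t" if "0 < t" "Pos X t \<omega> \<in> Some ` F" for \<omega> t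
    unfolding T_def S_def hitting_time_def using that
    by (intro SUP_least Inf_lower) (auto simp: V_def)
  show "AE \<omega> in Law X z. Pos X (T \<omega>) \<omega> \<in> insert None (Some ` F)" for z
  proof -
    have "AE \<omega> in Law X z. (SUP k. S k \<omega>) < lifetime X \<omega> \<longrightarrow>
        limitin cem_top (\<lambda>k. Pos X (S k \<omega>) \<omega>) (Pos X (SUP k. S k \<omega>) \<omega>) sequentially"
      by (rule quasi_left_continuous[OF stop inc])
    moreover have "AE \<omega> in Law X z. \<omega> \<in> space (Law X z)" by (rule AE_space)
    ultimately show ?thesis
    proof eventually_elim
      case (elim \<omega>)
      then have \<omega>: "\<omega> \<in> space (Evt X)" by simp
      show ?case
      proof (cases "Pos X (T \<omega>) \<omega>")
        case (Some y)
        then have "T \<omega> < lifetime X \<omega>" by (intro before_lifetime[OF \<omega>]) simp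
        then have lim: "limitin cem_top (\<lambda>k. Pos X (S k \<omega>) \<omega>) (Some y) sequentially"
          using elim(1) Some by (simp add: T_def)
        have "y \<in> F"
        proof (rule ccontr)
          assume "y \<notin> F"
          then have d: "0 < infdist y F" using infdist_pos_not_in_closed[OF F] by blast
          let ?U = "{z. infdist y F / 2 < infdist z F}"
          have U: "open ?U" by (intro open_Collect_less continuous_intros)
          have "\<forall>\<^sub>F k in sequentially. Pos X (S k \<omega>) \<omega> \<in> Some ` ?U"
            using lim U d unfolding limitin_def by auto
          then obtain K where K: "\<And>k. K \<le> k \<Longrightarrow> Pos X (S k \<omega>) \<omega> \<in> Some ` ?U"
            unfolding eventually_sequentially by blast
          have "0 < infdist y F / 2" using d by simp
          then obtain j where j: "1 / real (Suc j) < infdist y F / 2" using nat_approx_posE by blast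
          let ?k = "max K j"
          have "1 / real (Suc ?k) \<le> 1 / real (Suc j)" by (intro frac_le) auto
          then have k: "1 / real (Suc ?k) < infdist y F / 2" using j by linarith
          have P: "Pos X (S ?k \<omega>) \<omega> \<in> Some ` ?U" by (rule K) simp
          then obtain z where z: "Pos X (S ?k \<omega>) \<omega> = Some z" "z \<in> ?U" by blast
          have fin: "S ?k \<omega> < \<infinity>" using z(1) pos_infinity[OF \<omega>] by (cases "S ?k \<omega>") auto
          have "\<forall>\<^sub>F r in at_right (S ?k \<omega>). Pos X r \<omega> \<in> Some ` ?U" by (rule Pos_right_open[OF \<omega> z(1) U z(2)])
          then obtain b where b: "S ?k \<omega> < b" "\<And>r. S ?k \<omega> < r \<Longrightarrow> r < b \<Longrightarrow> Pos X r \<omega> \<in> Some ` ?U"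
            unfolding eventually_at_right[OF fin] by (elim exE conjE) simp
          \<comment> \<open>The infimum need not be attained, so the contradiction is not at the
            time \<open>S ?k\<close> alone: at that time and up to b the path stays in
            \<open>?U\<close>, which is disjoint from \<open>V ?k\<close>, and the infimum would be
            at least b.\<close>
          have "b \<le> S ?k \<omega>"
            unfolding S_def hitting_time_def
          proof (rule Inf_greatest)
            fix t assume t: "t \<in> {t. 0 < t \<and> Pos X t \<omega> \<in> Some ` V ?k}"
            then have "S ?k \<omega> \<le> t" unfolding S_def hitting_time_def by (rule Inf_lower)
            moreover have "Pos X t \<omega> \<notin> Some ` ?U"
            proof
              assume "Pos X t \<omega> \<in> Some ` ?U"
              then obtain z where "Pos X t \<omega> = Some z" "infdist y F / 2 < infdist z F" by blast
              then show False using t k unfolding V_def by auto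
            qed
            ultimately have "t \<noteq> S ?k \<omega>" "S ?k \<omega> < t \<Longrightarrow> \<not> t < b" using b(2)[of t] P by metis+
            then show "b \<le> t" using \<open>S ?k \<omega> \<le> t\<close> by (metis not_less order_le_less)
          qed
          then show False using b(1) by simp
        qed
        then show ?thesis using Some by simp
      qed simp
    qed
  qed
qed

end

context kato_time_change
begin

text \<open>The potential of the indicator of the complement vanishes, so almost every path spends
  no time there. As the complement is open, a single visit would by right continuity last for a
  positive time; one null set therefore serves all t.\<close>

lemma carrier_polar:
  assumes F: "closed F" and null: "emeasure \<mu> (- F) = 0"
  shows "\<exists>N. polar_set N \<and> (\<forall>\<omega>\<in>space (Evt X) - N. \<forall>t\<ge>0. Y t \<omega> \<in> insert None (Some ` F))"
proof (intro exI conjI ballI allI impI)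
  let ?u = "indicator (- F) :: 'a \<Rightarrow> ennreal"
  have um: "?u \<in> borel_measurable borel" using F by (intro borel_measurable_indicator) auto
  define I where "I \<omega> = (\<integral>\<^sup>+t\<in>{0..}. ext0 ?u (Y t \<omega>) \<partial>lborel)" for \<omega>
  define N where "N = {\<omega>\<in>space (Evt X). I \<omega> \<noteq> 0}"
  have Im: "I \<in> borel_measurable (nat_filt_compl X \<infinity>)"
    unfolding I_def by (intro measurable_nn_integral_time measurable_Y_path_functional um) auto
  have N: "N \<in> sets (Evt X)"
    using measurable_nat_filt_compl_Evt[OF Im] unfolding N_def by measurable
  have "emeasure (Law X z) N = 0" for z
  proof -
    have "(\<integral>\<^sup>+\<omega>. I \<omega> \<partial>Law X z) = 0"
    proof (cases z)
      case None
      have "(\<integral>\<^sup>+\<omega>. I \<omega> \<partial>Law X None) = (\<integral>\<^sup>+\<omega>. 0 \<partial>Law X None)"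
        using Law_None by (intro nn_integral_cong_AE) (auto elim!: eventually_mono simp: I_def Y_def)
      then show ?thesis using None by simp
    next
      case (Some x)
      have "- F \<in> null_sets \<mu>" using F null by (auto simp: null_sets_def sets_\<mu>)
      then have "AE y in \<mu>. y \<notin> - F" by (rule AE_not_in)
      then have "(\<integral>\<^sup>+y. G x y * ?u y \<partial>\<mu>) = (\<integral>\<^sup>+y. 0 \<partial>\<mu>)"
        by (intro nn_integral_cong_AE) (auto elim!: eventually_mono)
      then show ?thesis using potential[OF um, of x] Some by (simp add: I_def)
    qed
    then have "AE \<omega> in Law X z. I \<omega> = 0"
      using nn_integral_0_iff_AE[OF borel_measurable_Law_nat_filt_compl[OF Im]] by simp
    then have "AE \<omega> in Law X z. \<omega> \<notin> N" by (auto simp: N_def elim!: eventually_mono)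
    moreover have "N \<in> sets (Law X z)" using N by (simp add: sets_law)
    ultimately have "N \<in> null_sets (Law X z)" by (simp add: AE_iff_null_sets)
    then show ?thesis by (rule null_setsD1)
  qed
  then show "polar_set N" using N by (simp add: polar_set_def)
  fix \<omega> t assume "\<omega> \<in> space (Evt X) - N" and t: "0 \<le> (t :: real)"
  then have \<omega>: "\<omega> \<in> space (Evt X)" "\<omega> \<notin> N" by auto
  show "Y t \<omega> \<in> insert None (Some ` F)"
  proof (rule ccontr)
    assume "Y t \<omega> \<notin> insert None (Some ` F)"
    then obtain y where y: "Y t \<omega> = Some y" "y \<in> - F" by (cases "Y t \<omega>") auto
    have "\<forall>\<^sub>F s in at_right t. Y s \<omega> \<in> Some ` (- F)"
      using F y by (intro Y_right_open[OF \<omega>(1) t y(1)]) auto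
    then obtain b where b: "t < b" "\<And>s. t < s \<Longrightarrow> s < b \<Longrightarrow> Y s \<omega> \<in> Some ` (- F)"
      unfolding eventually_at_right_field by blast
    have "ennreal (b - t) = (\<integral>\<^sup>+s. indicator {t<..<b} s \<partial>lborel)" using b by simp
    also have "\<dots> \<le> I \<omega>"
      unfolding I_def
    proof (rule nn_integral_mono)
      fix s show "indicator {t<..<b} s \<le> ext0 ?u (Y s \<omega>) * indicator {0..} s"
      proof (cases "s \<in> {t<..<b}")
        case True
        then obtain y where "Y s \<omega> = Some y" "y \<in> - F" using b(2)[of s] by auto
        then show ?thesis using True t by simp
      qed simp
    qed
    also have "\<dots> = 0" using \<omega> by (simp add: N_def)
    finally show False using b(1) by simp
  qed
qed

end

locale closed_support = fine_support X A G \<mu> N m g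
  for X :: "('w, 'a::{metric_space, second_countable_topology}) process" and A G \<mu> N m g +
  fixes F :: "'a set"
  assumes closed_F: "closed F" and F_S: "F \<subseteq> S" and null_F: "emeasure \<mu> (- F) = 0"
begin

text \<open>On the event that X_T lies in F, \<open>fU\<close> and U agree at X_T, so the strong
  Markov property equates the finite expectations of \<open>\<Phi>S\<close> and
  \<open>\<Phi>U\<close> along the shifted path; the former is the smaller one.\<close>

lemma tau_zero_shift:
  assumes T: "stopping_time (Flt X) T"
  shows "AE \<omega> in Law X z. Pos X (T \<omega>) \<omega> \<in> Some ` F \<longrightarrow> tau 0 (Shift X (T \<omega>) \<omega>) = 0"
proof -
  let ?L = "Law X z"
  define D where "D = {\<omega>\<in>space (Evt X). Pos X (T \<omega>) \<omega> \<in> Some ` F}"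
  have "(\<lambda>\<omega>. Pos X (T \<omega>) \<omega>) -` (Some ` F) \<inter> space (pre_sigma T) \<in> sets (pre_sigma T)"
    using closed_F by (intro measurable_sets[OF pos_stopping[OF T]] Some_borel_cem) auto
  also have "(\<lambda>\<omega>. Pos X (T \<omega>) \<omega>) -` (Some ` F) \<inter> space (pre_sigma T) = D"
    by (auto simp: D_def space_pre_sigma)
  finally have D: "D \<in> sets (pre_sigma T)" .
  then have DL: "D \<in> sets ?L" using sets_pre_sigma_Evt[OF T] by (auto simp: sets_law)
  have Tm: "T \<in> borel_measurable ?L"
    unfolding measurable_Law_cong by (rule measurable_pre_sigma_Evt[OF T measurable_stopping_time_pre_sigma[OF T]])
  have \<Phi>Um: "(\<lambda>\<omega>. \<Phi>U (Shift X (T \<omega>) \<omega>)) \<in> borel_measurable ?L"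
  proof -
    let ?M = "?L \<Otimes>\<^sub>M (lborel :: real measure)"
    have 1: "(\<lambda>z. ext0 g (Pos X (ennreal (snd z)) (fst z))) \<in> borel_measurable ?M"
      using measurable_compose[OF measurable_Pair[OF measurable_snd measurable_fst] measurable_pair_Law[OF measurable_g_joint]]
      by simp
    note [measurable] = Tm
    have "{z \<in> space ?M. T (fst z) \<le> ennreal (snd z)} \<in> sets ?M" by measurable
    then have 2: "(\<lambda>z. indicator {z \<in> space ?M. T (fst z) \<le> ennreal (snd z)} z :: ennreal) \<in> borel_measurable ?M"
      by (rule borel_measurable_indicator)
    have 3: "(\<lambda>z. indicator {0..} (snd z) :: ennreal) \<in> borel_measurable ?M"
      by (rule measurable_compose[OF measurable_snd]) simp
    have "(\<lambda>(\<omega>, s). ext0 g (Pos X (ennreal s) \<omega>) * indicator {s. T \<omega> \<le> ennreal s} s * indicator {0..} s) \<in> borel_measurable ?M"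
      unfolding split_beta'
      by (rule measurable_cong[THEN iffD2, OF _ borel_measurable_times_ennreal[OF borel_measurable_times_ennreal[OF 1 2] 3]])
         (auto split: split_indicator)
    then have "(\<lambda>\<omega>. \<integral>\<^sup>+s. ext0 g (Pos X (ennreal s) \<omega>) * indicator {s. T \<omega> \<le> ennreal s} s * indicator {0..} s \<partial>lborel) \<in> borel_measurable ?L"
      by (rule lborel.borel_measurable_nn_integral)
    then show ?thesis by (rule measurable_cong[THEN iffD2, rotated]) (simp add: \<Phi>U_shift)
  qed
  have "(\<integral>\<^sup>+\<omega>. \<Phi>S (Shift X (T \<omega>) \<omega>) * indicator D \<omega> \<partial>?L) = (\<integral>\<^sup>+\<omega>\<in>D. ext0 fU (Pos X (T \<omega>) \<omega>) \<partial>?L)"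
    by (rule S_markov[OF T D, symmetric])
  also have "\<dots> = (\<integral>\<^sup>+\<omega>\<in>D. ext0 U (Pos X (T \<omega>) \<omega>) \<partial>?L)"
    using F_S by (intro nn_integral_cong) (auto simp: D_def S_def split: split_indicator)
  also have "\<dots> = (\<integral>\<^sup>+\<omega>. \<Phi>U (Shift X (T \<omega>) \<omega>) * indicator D \<omega> \<partial>?L)"
    by (rule U_markov[OF T D])
  finally have eq: "(\<integral>\<^sup>+\<omega>. \<Phi>S (Shift X (T \<omega>) \<omega>) * indicator D \<omega> \<partial>?L) = (\<integral>\<^sup>+\<omega>. \<Phi>U (Shift X (T \<omega>) \<omega>) * indicator D \<omega> \<partial>?L)" .
  have \<Phi>U_fin: "(\<integral>\<^sup>+\<omega>. \<Phi>U \<omega> \<partial>?L) < \<infinity>" using U_finite by (cases z) (auto simp: \<Phi>_None U_eq[symmetric])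
  have "(\<integral>\<^sup>+\<omega>. \<Phi>U (Shift X (T \<omega>) \<omega>) * indicator D \<omega> \<partial>?L) \<le> (\<integral>\<^sup>+\<omega>. \<Phi>U \<omega> \<partial>?L)"
    by (intro nn_integral_mono) (auto split: split_indicator intro: \<Phi>U_shift_le)
  then have fin: "(\<integral>\<^sup>+\<omega>. \<Phi>U (Shift X (T \<omega>) \<omega>) * indicator D \<omega> \<partial>?L) < \<infinity>" using \<Phi>U_fin by (rule le_less_trans)
  have "AE \<omega> in ?L. \<Phi>S (Shift X (T \<omega>) \<omega>) * indicator D \<omega> = \<Phi>U (Shift X (T \<omega>) \<omega>) * indicator D \<omega>"
    by (rule nn_integral_eq_imp_AE_eq_lower[OF _ _ eq fin])
       (auto intro!: borel_measurable_times_ennreal \<Phi>Um borel_measurable_indicator DL mult_right_mono \<Phi>S_le_\<Phi>U)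
  moreover have "AE \<omega> in ?L. \<Phi>U \<omega> \<noteq> \<infinity>"
    using \<Phi>U_fin by (intro nn_integral_noteq_infinite borel_measurable_Law_nat_filt_compl[OF measurable_\<Phi>U]) auto
  moreover have "AE \<omega> in ?L. \<omega> \<in> space ?L" by (rule AE_space)
  ultimately show ?thesis
  proof eventually_elim
    case (elim \<omega>)
    then have \<omega>: "\<omega> \<in> space (Evt X)" by simp
    show ?case
    proof
      assume P: "Pos X (T \<omega>) \<omega> \<in> Some ` F"
      then have "\<omega> \<in> D" using \<omega> by (simp add: D_def)
      then have "\<Phi>S (Shift X (T \<omega>) \<omega>) = \<Phi>U (Shift X (T \<omega>) \<omega>)" using elim(1) by simp
      moreover have "\<Phi>U (Shift X (T \<omega>) \<omega>) < \<infinity>"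
        using \<Phi>U_shift_le[OF \<omega>, of "T \<omega>"] elim(2) by (simp add: less_top[symmetric] top_unique) (metis top_unique)
      moreover have "Pos X 0 (Shift X (T \<omega>) \<omega>) \<noteq> None" using pos_shift[OF \<omega>, of 0 "T \<omega>"] P by auto
      ultimately show "tau 0 (Shift X (T \<omega>) \<omega>) = 0" by (intro tau_zero_eq_zero shift_space \<omega>)
    qed
  qed
qed

text \<open>The clock of the path shifted by T runs at once, so by additivity the original clock is
  positive at every time after T.\<close>

lemma tau_zero_le:
  assumes T: "stopping_time (Flt X) T"
  shows "AE \<omega> in Law X z. Pos X (T \<omega>) \<omega> \<in> Some ` F \<longrightarrow> tau 0 \<omega> \<le> T \<omega>"
proof -
  have "AE \<omega> in Law X z. \<omega> \<in> space (Law X z)" by (rule AE_space)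
  with tau_zero_shift[OF T, of z] A_add[of z] show ?thesis
  proof eventually_elim
    case (elim \<omega>)
    then have \<omega>: "\<omega> \<in> space (Evt X)" by simp
    show ?case
    proof
      assume P: "Pos X (T \<omega>) \<omega> \<in> Some ` F"
      then have fin: "T \<omega> < \<infinity>" using pos_infinity[OF \<omega>] by (cases "T \<omega>") auto
      have z: "tau 0 (Shift X (T \<omega>) \<omega>) = 0" using elim(1) P by blast
      show "tau 0 \<omega> \<le> T \<omega>"
      proof (rule ccontr)
        assume "\<not> tau 0 \<omega> \<le> T \<omega>"
        then obtain s where s: "T \<omega> < s" "s < tau 0 \<omega>" using dense by (metis not_less)
        have sf: "s < \<infinity>" using s(2) by (metis less_le_trans top_greatest infinity_ennreal_def)
        have s': "s = T \<omega> + (s - T \<omega>)" using s(1) by (simp add: add_diff_inverse_ennreal)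
        have "0 < s - T \<omega>" using s(1) fin by (simp add: ennreal_minus_pos_iff diff_gt_0_iff_gt_ennreal)
        then have "ennreal 0 < A (s - T \<omega>) (Shift X (T \<omega>) \<omega>)" using z tau_less_iff by metis
        moreover have "A s \<omega> = A (T \<omega>) \<omega> + A (s - T \<omega>) (Shift X (T \<omega>) \<omega>)"
        proof -
          have "s - T \<omega> < \<infinity>" using sf by (simp add: less_top[symmetric])
          then show ?thesis using elim(2) fin s' by metis
        qed
        ultimately have "ennreal 0 < A s \<omega>" by (simp add: add_pos_nonneg add_nonneg_pos)
        then have "tau 0 \<omega> < s" by (simp only: tau_less_iff)
        then show False using s(2) by simp
      qed
    qed
  qed
qed

text \<open>For s > 0 the positions at \<open>tau s\<close> lie in F and these times are positive,
  so the hitting time is at most their limit \<open>tau 0\<close>; passing to the limit matters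
  because hitting counts only positive times. Conversely, the entrance time T precedes every visit,
  and if the process is in F at T the clock starts no later than T.\<close>

lemma hitting_time_tau:
  "\<exists>N'. polar_set N' \<and> (\<forall>\<omega>\<in>space (Evt X) - N'. hitting_time X F \<omega> = tau 0 \<omega> \<and> (\<forall>t\<ge>0. Y t \<omega> \<in> insert None (Some ` F)))"
proof -
  obtain Nc where Nc: "polar_set Nc"
    "\<And>\<omega> t. \<omega> \<in> space (Evt X) \<Longrightarrow> \<omega> \<notin> Nc \<Longrightarrow> 0 \<le> t \<Longrightarrow> Y t \<omega> \<in> insert None (Some ` F)"
    using carrier_polar[OF closed_F null_F] by (elim exE conjE) auto
  have Pos_tau: "Pos X (tau t \<omega>) \<omega> \<in> Some ` F" if "\<omega> \<in> space (Evt X)" "\<omega> \<notin> Nc" "0 \<le> t" "tau t \<omega> < \<infinity>" for \<omega> t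
    using Nc(2)[OF that(1-3)] Pos_before_lifetime[OF tau_before_lifetime[OF that(4)]] by (auto simp: Y_def)
  have le: "hitting_time X F \<omega> \<le> tau 0 \<omega>" if \<omega>: "\<omega> \<in> space (Evt X)" "\<omega> \<notin> Nc" for \<omega>
  proof (cases "tau 0 \<omega> < \<infinity>")
    case True
    have lim: "((\<lambda>s. tau s \<omega>) \<longlongrightarrow> tau 0 \<omega>) (at_right 0)"
      unfolding tau_def by (rule right_inverse_right_continuous[OF clock_path order_refl])
    have "\<forall>\<^sub>F s in at_right (0::real). 0 < s" by (rule eventually_at_right_less)
    with order_tendstoD(2)[OF lim True] have "\<forall>\<^sub>F s in at_right 0. hitting_time X F \<omega> \<le> tau s \<omega>"
    proof eventually_elim
      case (elim s)
      have "A (tau s \<omega>) \<omega> = ennreal s" by (rule A_tau[OF elim(1)])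
      then have "tau s \<omega> \<noteq> 0" using clock_path[of \<omega>] elim(2) by (auto simp: clock_path_def)
      then show ?case
        unfolding hitting_time_def using Pos_tau[OF \<omega> _ elim(1)] elim(2)
        by (intro Inf_lower) (simp add: zero_less_iff_neq_zero)
    qed
    then show ?thesis using lim by (intro tendsto_lowerbound) auto
  qed (simp add: less_top[symmetric])
  show ?thesis
  proof (cases "F = {}")
    case True
    have "hitting_time X F \<omega> = tau 0 \<omega>" if "\<omega> \<in> space (Evt X)" "\<omega> \<notin> Nc" for \<omega>
      using le[OF that] by (simp add: True hitting_time_def top_unique)
    then show ?thesis using Nc by (intro exI[of _ Nc]) auto
  next
    case False
    obtain T where T: "stopping_time (Flt X) T"
      "\<forall>\<omega> t. 0 < t \<longrightarrow> Pos X t \<omega> \<in> Some ` F \<longrightarrow> T \<omega> \<le> t"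
      "\<forall>z. AE \<omega> in Law X z. Pos X (T \<omega>) \<omega> \<in> insert None (Some ` F)"
      using closed_debut[OF closed_F False] by (elim exE conjE)
    have Pm: "{\<omega>\<in>space (Evt X). Pos X (T \<omega>) \<omega> \<in> Some ` B} \<in> sets (Evt X)" if "B \<in> sets borel" for B
      using measurable_sets[OF measurable_Pos_stopping[OF T(1)] Some_borel_cem[OF that]]
      by (simp add: vimage_def Int_def conj_commute)
    define Na where "Na = {\<omega>\<in>space (Evt X). Pos X (T \<omega>) \<omega> \<in> Some ` (- F)}"
    define Nb where "Nb = {\<omega>\<in>space (Evt X). Pos X (T \<omega>) \<omega> \<in> Some ` F} \<inter> {\<omega>\<in>space (Evt X). T \<omega> < tau 0 \<omega>}"
    note [measurable] = measurable_pre_sigma_Evt[OF T(1) measurable_stopping_time_pre_sigma[OF T(1)]]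
      measurable_nat_filt_compl_Evt[OF measurable_tau[of 0]]
    have Na: "Na \<in> sets (Evt X)" unfolding Na_def using closed_F by (intro Pm) auto
    have "{\<omega>\<in>space (Evt X). T \<omega> < tau 0 \<omega>} \<in> sets (Evt X)" by measurable
    then have Nb: "Nb \<in> sets (Evt X)" unfolding Nb_def using closed_F by (intro sets.Int Pm) auto
    have "Nc \<in> sets (Evt X)" using Nc(1) by (simp add: polar_set_def)
    with Na Nb have Nabc: "Na \<union> (Nb \<union> Nc) \<in> sets (Evt X)" by (intro sets.Un)
    have "emeasure (Law X z) (Na \<union> (Nb \<union> Nc)) = 0" for z
    proof -
      have "AE \<omega> in Law X z. \<omega> \<notin> Na \<union> (Nb \<union> Nc)"
        using spec[OF T(3), of z] tau_zero_le[OF T(1), of z] polar_set_AE[OF Nc(1), of z]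
        by eventually_elim (auto simp: Na_def Nb_def)
      moreover have "Na \<union> (Nb \<union> Nc) \<in> sets (Law X z)" using Nabc by (simp only: sets_law)
      ultimately have "Na \<union> (Nb \<union> Nc) \<in> null_sets (Law X z)" by (simp add: AE_iff_null_sets)
      then show ?thesis by (rule null_setsD1)
    qed
    then have polar: "polar_set (Na \<union> (Nb \<union> Nc))" using Nabc by (simp only: polar_set_def simp_thms)
    have "hitting_time X F \<omega> = tau 0 \<omega>" if \<omega>: "\<omega> \<in> space (Evt X)" "\<omega> \<notin> Na \<union> (Nb \<union> Nc)" for \<omega>
    proof (rule antisym)
      show "hitting_time X F \<omega> \<le> tau 0 \<omega>" using \<omega> by (intro le) auto
      show "tau 0 \<omega> \<le> hitting_time X F \<omega>"
        unfolding hitting_time_def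
      proof (rule Inf_greatest)
        fix t assume t: "t \<in> {t. 0 < t \<and> Pos X t \<omega> \<in> Some ` F}"
        then have Tt: "T \<omega> \<le> t" using T(2) by simp
        have "Pos X t \<omega> \<noteq> None" using t by auto
        \<comment> \<open>The process is alive at the later time t, so it cannot already be at the
          cemetery at T; this excludes the alternative left open for the entrance time.\<close>
        then have "Pos X (T \<omega>) \<omega> \<noteq> None" by (rule contrapos_nn) (rule Pos_after[OF \<omega>(1) _ Tt])
        then have "Pos X (T \<omega>) \<omega> \<in> Some ` F" using \<omega> by (auto simp: Na_def)
        then have "\<not> T \<omega> < tau 0 \<omega>" using \<omega> by (auto simp: Nb_def)
        then show "tau 0 \<omega> \<le> t" using Tt by simp
      qed
    qed
    then show ?thesis using polar Nc(2) by (intro exI[of _ "Na \<union> (Nb \<union> Nc)"]) auto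
  qed
qed

lemma regular_F: "x \<in> F \<Longrightarrow> AE \<omega> in Law X (Some x). tau 0 \<omega> = 0"
  using S_regular F_S by blast

lemma hitting_op_eq:
  assumes u: "u \<in> borel_measurable borel"
  shows "hitting_op X F u x = Qt 0 u x"
proof -
  obtain N' where N': "polar_set N'"
    "\<forall>\<omega>\<in>space (Evt X) - N'. hitting_time X F \<omega> = tau 0 \<omega> \<and> (\<forall>t\<ge>0. Y t \<omega> \<in> insert None (Some ` F))"
    using hitting_time_tau by (elim exE conjE)
  show ?thesis
    unfolding hitting_op_def Qt_def
    by (rule integral_polar[OF measurable_compose[OF measurable_Y_nat_filt_compl measurable_ext0[OF u]] N'(1)])
       (use N'(2) in \<open>simp add: Y_def\<close>)
qed

text \<open>The time-changed process is in F or dead, so only the values on F count; closeness on F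
  becomes closeness everywhere once the semigroup is applied.\<close>

lemma Qt_F_bound:
  assumes f: "f \<in> bmeas" and h: "h \<in> bmeas" and t: "0 \<le> t" and le: "\<And>x. x \<in> F \<Longrightarrow> \<bar>f x - h x\<bar> \<le> e" and e: "0 \<le> e"
  shows "\<bar>Qt t f x - Qt t h x\<bar> \<le> e"
proof -
  obtain N' where N': "polar_set N'"
    "\<forall>\<omega>\<in>space (Evt X) - N'. hitting_time X F \<omega> = tau 0 \<omega> \<and> (\<forall>t\<ge>0. Y t \<omega> \<in> insert None (Some ` F))"
    using hitting_time_tau by (elim exE conjE)
  let ?d = "\<lambda>y. indicator F y * (f y - h y)"
  have dm: "?d \<in> borel_measurable borel"
    using bmeasD[OF f] bmeasD[OF h] closed_F by (intro borel_measurable_times borel_measurable_diff borel_measurable_indicator) auto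
  have "Qt t (\<lambda>y. f y - h y) x = Qt t ?d x"
    unfolding Qt_def
  proof (rule integral_cong_AE)
    show "(\<lambda>\<omega>. ext0 (\<lambda>y. f y - h y) (Y t \<omega>)) \<in> borel_measurable (Law X (Some x))"
      by (rule borel_measurable_integrable[OF integrable_Y[OF bmeas_diff[OF f h]]])
    show "(\<lambda>\<omega>. ext0 ?d (Y t \<omega>)) \<in> borel_measurable (Law X (Some x))"
      by (rule measurable_compose[OF measurable_Y measurable_ext0[OF dm]])
    have "AE \<omega> in Law X (Some x). \<omega> \<in> space (Law X (Some x))" by (rule AE_space)
    with polar_set_AE[OF N'(1), of "Some x"] show "AE \<omega> in Law X (Some x). ext0 (\<lambda>y. f y - h y) (Y t \<omega>) = ext0 ?d (Y t \<omega>)"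
    proof eventually_elim
      case (elim \<omega>)
      then have "Y t \<omega> \<in> insert None (Some ` F)" using N'(2) t by simp
      then show ?case by auto
    qed
  qed
  moreover have "\<bar>Qt t ?d x\<bar> \<le> e"
    by (rule Qt_bound[OF dm]) (use le e in \<open>auto split: split_indicator\<close>)
  ultimately show ?thesis using Qt_diff[OF f h] by simp
qed

lemma Qt_zero_pot:
  assumes f: "f \<in> bmeas" shows "Qt 0 (pot occ f) x = pot occ f x"
proof -
  have "wint occ (indicator {0..<0}) f x = 0" by (simp add: wint_def)
  then show ?thesis using Qt_pot[OF f order_refl, of x] wint_initial[OF f order_refl, of x] by simp
qed

text \<open>Density provides a potential close to u on F only. The operator at time 0 spreads the
  estimate to the whole space while reproducing the potential exactly.\<close>

lemma hitting_op_approx: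
  assumes u: "u \<in> C0" and e: "0 < e"
  shows "\<exists>h\<in>C0. \<forall>x. \<bar>hitting_op X F u x - pot occ h x\<bar> \<le> e"
proof -
  obtain h where h: "h \<in> C0" "\<And>x. x \<in> F \<Longrightarrow> \<bar>u x - pot occ h x\<bar> \<le> e"
    using potential_dense[OF closed_F regular_F u e] by blast
  have "\<bar>hitting_op X F u x - pot occ h x\<bar> \<le> e" for x
    using Qt_F_bound[OF C0_bmeas[OF u] C0_bmeas[OF pot_C0[OF C0_bmeas[OF h(1)]]] order_refl h(2)] e
    by (simp add: hitting_op_eq[OF bmeasD[OF C0_bmeas[OF u]]] Qt_zero_pot[OF C0_bmeas[OF h(1)]])
  then show ?thesis using h(1) by blast
qed

lemma hitting_op_C0: "u \<in> C0 \<Longrightarrow> hitting_op X F u \<in> C0"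
  by (rule C0_limit) (metis hitting_op_approx pot_C0 C0_bmeas)

text \<open>Points of F are regular, so the hitting operator leaves u unchanged there. This accounts
  for u, rather than its image under the hitting operator, in the limit semigroup.\<close>

lemma Qt_hitting_op:
  assumes u: "u \<in> C0" and t: "0 \<le> t"
  shows "Qt t (hitting_op X F u) x = Qt t u x"
proof -
  interpret L: prob_space "Law X z" for z by (rule prob_law)
  have "hitting_op X F u y = u y" if "y \<in> F" for y
  proof -
    have um: "u \<in> borel_measurable borel" by (rule bmeasD[OF C0_bmeas[OF u]])
    have "Qt 0 u y = (\<integral>\<omega>. u y \<partial>Law X (Some y))"
      unfolding Qt_def
    proof (rule integral_cong_AE)
      show "(\<lambda>\<omega>. ext0 u (Y 0 \<omega>)) \<in> borel_measurable (Law X (Some y))"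
        by (rule measurable_compose[OF measurable_Y measurable_ext0[OF um]])
      show "AE \<omega> in Law X (Some y). ext0 u (Y 0 \<omega>) = u y"
        using regular_F[OF that] normal[of "Some y"] by eventually_elim (simp add: Y_def)
    qed simp
    then show ?thesis using L.prob_space[of "Some y"] by (simp add: hitting_op_eq[OF um])
  qed
  then have "\<bar>Qt t (hitting_op X F u) x - Qt t u x\<bar> \<le> 0"
    by (intro Qt_F_bound C0_bmeas hitting_op_C0 u t) auto
  then show ?thesis by simp
qed

end

section \<open>Convergence of the time-changed semigroups\<close>

lemma sup_norm_conv:
  fixes D :: "nat \<Rightarrow> real \<Rightarrow> 'a \<Rightarrow> real"
  assumes D: "\<And>b e. 0 < e \<Longrightarrow> \<forall>\<^sub>F n in sequentially. \<forall>t\<in>{0..b}. \<forall>x. \<bar>D n t x\<bar> \<le> e"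
  shows "(\<forall>t\<ge>0. (\<lambda>n. sup_norm (D n t)) \<longlonglongrightarrow> 0) \<and>
    (\<forall>a\<ge>0. \<forall>b\<ge>a. (\<lambda>n. SUP t\<in>{a..b}. sup_norm (D n t)) \<longlonglongrightarrow> 0)"
proof -
  have conv: "(\<lambda>n. SUP t\<in>{a..b}. sup_norm (D n t)) \<longlonglongrightarrow> 0" if a: "0 \<le> a" for a b
  proof (rule order_tendstoI)
    fix e :: ennreal assume "0 < e"
    then obtain c where c: "0 < c" "c < e" using dense by blast
    then obtain d where d: "c = ennreal d" "0 < d" by (cases c) auto
    from D[OF d(2), of b] show "\<forall>\<^sub>F n in sequentially. (SUP t\<in>{a..b}. sup_norm (D n t)) < e"
    proof eventually_elim
      case (elim n)
      have "(SUP t\<in>{a..b}. sup_norm (D n t)) \<le> c"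
        unfolding sup_norm_def d using elim a by (intro SUP_least ennreal_leI) auto
      then show ?case using c(2) by simp
    qed
  qed simp
  show ?thesis
  proof (intro conjI allI impI)
    show "(\<lambda>n. sup_norm (D n t)) \<longlonglongrightarrow> 0" if "0 \<le> t" for t using conv[OF that, of t] by simp
  qed (rule conv)
qed

section \<open>The Green kernel and the potential identities\<close>

lemma radon_sigma_finite:
  fixes m :: "'a::{metric_space, second_countable_topology} measure"
  assumes lc: "locally_compact_space (euclidean :: 'a topology)" and m: "radon_measure m"
  shows "sigma_finite_measure m"
proof -
  obtain U :: "nat \<Rightarrow> 'a set" where U: "\<And>n. open (U n)" "\<And>n. compact (closure (U n))" "incseq U" "(\<Union>n. U n) = UNIV"
    using compact_exhaustion[OF lc] by metis
  have s: "sets m = sets borel" using m by (simp add: radon_measure_def)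
  then have sp: "space m = UNIV" by (metis sets_eq_imp_space_eq space_borel)
  have "emeasure m (U n) \<noteq> \<infinity>" for n
  proof -
    have "emeasure m (U n) \<le> emeasure m (closure (U n))"
      using s by (intro emeasure_mono closure_subset) auto
    also have "\<dots> < \<infinity>" using m U(2) by (simp add: radon_measure_def)
    finally show ?thesis by simp
  qed
  then show ?thesis
    by (intro sigma_finite_measure.intro exI[of _ "range U"]) (use U s sp in auto)
qed

lemma (in standard_process) nn_integral_trans_op:
  assumes g: "g \<in> borel_measurable borel"
  shows "(\<integral>\<^sup>+\<omega>. (\<integral>\<^sup>+t\<in>{0..}. ext0 g (Pos X (ennreal t) \<omega>) \<partial>lborel) \<partial>Law X (Some x))
    = (\<integral>\<^sup>+t\<in>{0..}. trans_op X t g x \<partial>lborel)"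
proof -
  let ?L = "Law X (Some x)"
  interpret pair_sigma_finite lborel ?L
    by (intro pair_sigma_finite.intro lborel.sigma_finite_measure_axioms prob_space_imp_sigma_finite prob_law)
  have "(\<lambda>\<omega>. \<omega>) \<in> measurable (nat_filt_compl X \<infinity>) (nat_filt_compl X \<infinity>)" by simp
  then have id: "(\<lambda>\<omega>. \<omega>) \<in> measurable ?L (nat_filt_compl X \<infinity>)" by (rule borel_measurable_Law_nat_filt_compl)
  have "(\<lambda>z. (fst z, snd z)) \<in> measurable (lborel \<Otimes>\<^sub>M ?L) (borel \<Otimes>\<^sub>M nat_filt_compl X \<infinity>)"
    by (intro measurable_Pair measurable_compose[OF measurable_snd id]) auto
  from measurable_compose[OF this measurable_compose[OF measurable_Pos_real_joint measurable_ext0[OF g]]]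
  have [measurable]: "(\<lambda>z. ext0 g (Pos X (ennreal (fst z)) (snd z))) \<in> borel_measurable (lborel \<Otimes>\<^sub>M ?L)"
    by (simp add: split_beta')
  have m: "(\<lambda>(t, \<omega>). ext0 g (Pos X (ennreal t) \<omega>) * indicator {0..} t) \<in> borel_measurable (lborel \<Otimes>\<^sub>M ?L)"
    unfolding split_beta' by measurable
  have mt: "(\<lambda>\<omega>. ext0 g (Pos X (ennreal t) \<omega>)) \<in> borel_measurable ?L" for t
    by (intro measurable_compose[OF measurable_Pos_Law measurable_ext0] g)
  show ?thesis
    using Fubini'[OF m] by (simp add: trans_op_def nn_integral_multc[OF mt])
qed

context
  fixes m :: "'a::{metric_space, second_countable_topology} measure" and p :: "real \<Rightarrow> 'a \<Rightarrow> 'a \<Rightarrow> ennreal"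
    and X :: "('w, 'a) process"
  assumes sf: "sigma_finite_measure m" and sets_m: "sets m = sets borel" and td: "transition_density X m p"
begin

lemma measurable_density:
  "(\<lambda>(t, y). p t x y) \<in> borel_measurable (restrict_space lborel {0<..} \<Otimes>\<^sub>M m)"
proof -
  have p: "(\<lambda>(t, x, y). p t x y) \<in> borel_measurable (restrict_space borel {0<..} \<Otimes>\<^sub>M borel \<Otimes>\<^sub>M borel)"
    using td by (simp add: transition_density_def)
  have "(\<lambda>z. (fst z, x, snd z)) \<in> measurable (restrict_space lborel {0<..} \<Otimes>\<^sub>M m) (restrict_space borel {0<..} \<Otimes>\<^sub>M borel \<Otimes>\<^sub>M borel)"
  proof (intro measurable_Pair measurable_const)
    have "sets (restrict_space borel ({0<..} :: real set)) = sets (restrict_space lborel {0<..})"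
      by (intro sets_restrict_space_cong) simp
    from measurable_cong_sets[OF refl this]
    show "fst \<in> measurable (restrict_space lborel {0<..} \<Otimes>\<^sub>M m) (restrict_space borel {0<..})" by simp
    show "snd \<in> measurable (restrict_space lborel {0<..} \<Otimes>\<^sub>M m) borel"
      unfolding measurable_cong_sets[OF refl sets_m[symmetric]] by simp
  qed simp
  from measurable_compose[OF this p] show ?thesis by (simp add: split_beta')
qed

lemma green_zero: "green p 0 x y = (\<integral>\<^sup>+t. p t x y \<partial>restrict_space lborel {0<..})"
  unfolding green_def by (simp add: nn_integral_restrict_space)

lemma measurable_density_time: "(\<lambda>t. p t x y) \<in> borel_measurable (restrict_space lborel {0<..})"
proof -
  have "y \<in> space m" using sets_eq_imp_space_eq[OF sets_m] by simp
  from measurable_compose[OF measurable_Pair2'[OF this] measurable_density] show ?thesis by simp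
qed

lemma green_pos:
  assumes pos: "\<And>t x y. 0 < t \<Longrightarrow> 0 < p t x y"
  shows "0 < green p 0 x y"
proof (rule ccontr)
  assume "\<not> 0 < green p 0 x y"
  then have "(\<integral>\<^sup>+t. p t x y \<partial>restrict_space lborel {0<..}) = 0" by (simp add: green_zero)
  then have "AE t in restrict_space lborel {0<..}. p t x y = 0"
    by (simp add: nn_integral_0_iff_AE[OF measurable_density_time])
  then have "AE t in lborel. t \<notin> {0<..<1::real}"
    by (subst (asm) AE_restrict_space_iff) (use pos in \<open>auto elim!: eventually_mono simp: less_le\<close>)
  then have "{0<..<1::real} \<in> null_sets lborel" by (subst (asm) AE_iff_null_sets[symmetric]) auto
  then show False by (simp add: null_sets_def)
qed

lemma green_potential:
  assumes g: "g \<in> borel_measurable borel"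
  shows "(\<integral>\<^sup>+t\<in>{0..}. trans_op X t g x \<partial>lborel) = (\<integral>\<^sup>+y. green p 0 x y * g y \<partial>m)"
proof -
  let ?R = "restrict_space lborel {0<..} :: real measure"
  interpret m: sigma_finite_measure m by (rule sf)
  interpret R: sigma_finite_measure ?R
    by (rule sigma_finite_measure_restrict_space[OF lborel.sigma_finite_measure_axioms]) simp
  interpret pair_sigma_finite ?R m ..
  have gm: "g \<in> borel_measurable m" using g by (simp add: measurable_cong_sets[OF sets_m refl])
  have mm: "(\<lambda>(t, y). p t x y * g y) \<in> borel_measurable (?R \<Otimes>\<^sub>M m)"
    using measurable_density[of x] measurable_compose[OF measurable_snd gm]
    unfolding split_beta' by (rule borel_measurable_times_ennreal)
  have "(\<integral>\<^sup>+t\<in>{0..}. trans_op X t g x \<partial>lborel) = (\<integral>\<^sup>+t\<in>{0<..}. trans_op X t g x \<partial>lborel)"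
  proof (rule nn_integral_cong_AE)
    have "AE t in lborel. t \<noteq> (0::real)" by (rule AE_lborel_singleton)
    then show "AE t in lborel. trans_op X t g x * indicator {0..} t = trans_op X t g x * indicator {0<..} t"
      by eventually_elim (auto split: split_indicator)
  qed
  also have "\<dots> = (\<integral>\<^sup>+t. trans_op X t g x \<partial>?R)" by (simp add: nn_integral_restrict_space)
  also have "\<dots> = (\<integral>\<^sup>+t. (\<integral>\<^sup>+y. p t x y * g y \<partial>m) \<partial>?R)"
    using td g by (intro nn_integral_cong) (simp add: transition_density_def space_restrict_space)
  also have "\<dots> = (\<integral>\<^sup>+y. (\<integral>\<^sup>+t. p t x y * g y \<partial>?R) \<partial>m)"
    using Fubini'[OF mm] by simp
  also have "\<dots> = (\<integral>\<^sup>+y. green p 0 x y * g y \<partial>m)"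
    unfolding green_zero by (simp add: nn_integral_multc[OF measurable_density_time])
  finally show ?thesis .
qed

end

text \<open>The potential identity of order 0 after the change of variables; almost surely the given
  functional and its regular version have the same path, and at infinite inverse times both
  integrands are 0.\<close>

lemma (in clock_version) version_potential:
  assumes pid: "potential_identity X p A \<mu>" and u: "u \<in> borel_measurable borel"
  shows "(\<integral>\<^sup>+\<omega>. (\<integral>\<^sup>+t\<in>{0..}. ext0 u (Y t \<omega>) \<partial>lborel) \<partial>Law X (Some x)) = (\<integral>\<^sup>+y. green p 0 x y * u y \<partial>\<mu>)"
proof -
  let ?L = "Law X (Some x)"
  have "(\<integral>\<^sup>+y. green p 0 x y * u y \<partial>\<mu>)
      = (\<integral>\<^sup>+\<omega>. stieltjes_integral (\<lambda>t. ext0 u (Pos X (ennreal t) \<omega>)) (\<lambda>t. A t \<omega>) \<partial>?L)"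
    using pid[unfolded potential_identity_def, rule_format, OF u order_refl, of x] by (simp add: green_pot_def)
  also have "\<dots> = (\<integral>\<^sup>+\<omega>. (\<integral>\<^sup>+t\<in>{0..}. ext0 u (Y t \<omega>) \<partial>lborel) \<partial>?L)"
  proof (rule nn_integral_cong_AE)
    have "AE \<omega> in ?L. \<omega> \<in> space ?L" by (rule AE_space)
    with polar_set_AE[OF polar, of "Some x"] normal[of "Some x"]
    show "AE \<omega> in ?L. stieltjes_integral (\<lambda>t. ext0 u (Pos X (ennreal t) \<omega>)) (\<lambda>t. A t \<omega>) = (\<integral>\<^sup>+t\<in>{0..}. ext0 u (Y t \<omega>) \<partial>lborel)"
    proof eventually_elim
      case (elim \<omega>)
      then have \<omega>: "\<omega> \<in> space (Evt X)" by simp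
      have path: "(\<lambda>t. A t \<omega>) = (\<lambda>t. B t \<omega>)" using version[OF \<omega>] elim by simp
      have m: "(\<lambda>t. ext0 u (Pos X (ennreal t) \<omega>)) \<in> borel_measurable borel"
        by (rule measurable_compose[OF measurable_ennreal measurable_compose[OF measurable_Pos_path[OF \<omega>] measurable_ext0[OF u]]])
      show ?case
        unfolding path stieltjes_integral_right_inverse[OF clock_path m]
      proof (rule nn_integral_cong)
        fix t
        show "ext0 u (Pos X (ennreal (enn2real (right_inverse (\<lambda>t. B t \<omega>) t))) \<omega>)
            * indicator {t. 0 \<le> t \<and> right_inverse (\<lambda>t. B t \<omega>) t < \<infinity>} t = ext0 u (Y t \<omega>) * indicator {0..} t"
          using pos_infinity[OF \<omega>]
          by (cases "tau t \<omega>") (auto simp: Y_def tau_def[symmetric] split: split_indicator)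
      qed
    qed
  qed
  finally show ?thesis ..
qed

lemma (in kato_limit) tc_semigroup_conv:
  assumes cv: "clock_version X A A' N0" "\<And>n. clock_version X (An n) (An' n) (Nn n)"
    and w: "w \<in> bmeas" and closure: "\<And>e. 0 < e \<Longrightarrow> \<exists>h\<in>C0. \<forall>x. \<bar>w x - pot lim.occ h x\<bar> \<le> e"
    and v: "v \<in> bmeas" "\<And>t x. 0 \<le> t \<Longrightarrow> lim.Qt t w x = lim.Qt t v x"
  shows "(\<forall>t\<ge>0. (\<lambda>n. sup_norm (\<lambda>x. tc_semigroup X (An' n) t w x - tc_semigroup X A' t v x)) \<longlonglongrightarrow> 0) \<and>
    (\<forall>a\<ge>0. \<forall>b\<ge>a. (\<lambda>n. SUP t\<in>{a..b}. sup_norm (\<lambda>x. tc_semigroup X (An' n) t w x - tc_semigroup X A' t v x)) \<longlonglongrightarrow> 0)"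
proof (rule sup_norm_conv)
  fix b e :: real assume e: "0 < e"
  have "\<forall>\<^sub>F n in sequentially. \<forall>t\<in>{0..b}. \<forall>x. \<bar>time_change.Qt X (An n) t w x - lim.Qt t w x\<bar> \<le> e"
    by (rule semigroup_conv[OF w _ e]) (rule closure)
  then show "\<forall>\<^sub>F n in sequentially. \<forall>t\<in>{0..b}. \<forall>x. \<bar>tc_semigroup X (An' n) t w x - tc_semigroup X A' t v x\<bar> \<le> e"
    by eventually_elim
       (auto simp: clock_version.tc_semigroup_eq[OF cv(1) bmeasD[OF v(1)]] clock_version.tc_semigroup_eq[OF cv(2) bmeasD[OF w]] v(2)[symmetric])
qed

lemma (in kato_bounded) resolvent_range_closure:
  assumes cv: "clock_version X A A' N0" and \<alpha>: "0 \<le> \<alpha>"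
    and u: "u \<in> C0_closure (tc_resolvent X A' \<alpha> ` C0)" and e: "0 < e"
  shows "\<exists>h\<in>C0. \<forall>x. \<bar>u x - pot occ h x\<bar> \<le> e"
proof -
  interpret ps: potential_space occ N C0 by (rule potential_space_C0)
  have "0 < ennreal (e / 2)" using e by simp
  then obtain f where f: "f \<in> C0" "sup_norm (\<lambda>x. tc_resolvent X A' \<alpha> f x - u x) < ennreal (e / 2)"
    using u unfolding C0_closure_def by blast
  have close: "\<bar>tc_resolvent X A' \<alpha> f x - u x\<bar> \<le> e / 2" for x
  proof -
    have "ennreal \<bar>tc_resolvent X A' \<alpha> f x - u x\<bar> \<le> sup_norm (\<lambda>x. tc_resolvent X A' \<alpha> f x - u x)"
      unfolding sup_norm_def by (rule SUP_upper) simp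
    then have "ennreal \<bar>tc_resolvent X A' \<alpha> f x - u x\<bar> \<le> ennreal (e / 2)" using f(2) by simp
    then show ?thesis using e by simp
  qed
  obtain C where C: "\<And>y. \<bar>f y\<bar> \<le> C" using bmeasE[OF C0_bmeas[OF f(1)]] by metis
  have "integrable (occ x) (\<lambda>z. exp (- \<alpha> * fst z) * f (snd z))" for x
  proof (rule integrable_weight[OF _ _ bmeasD[OF C0_bmeas[OF f(1)]] C])
    fix t :: real assume "0 \<le> t"
    then have "- \<alpha> * t \<le> 0" "0 \<le> rate * t" using \<alpha> rate_pos by auto
    then show "\<bar>exp (- \<alpha> * t)\<bar> \<le> 1 * exp (rate * t)" by simp
  qed simp
  note res = clock_version.tc_resolvent_eq[OF cv bmeasD[OF C0_bmeas[OF f(1)]] this]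
  obtain h where h: "h \<in> C0" "\<And>x. \<bar>wint occ (\<lambda>t. exp (- \<alpha> * t)) f x - pot occ h x\<bar> \<le> e / 2"
    using ps.wint_exp_closure[OF f(1) \<alpha> half_gt_zero[OF e]] by metis
  have "\<bar>u x - pot occ h x\<bar> \<le> e" for x
    using close[of x] h(2)[of x] unfolding res by linarith
  then show ?thesis using h(1) by blast
qed

theorem theorem3p2:
  fixes X :: "('w, 'a::{metric_space, second_countable_topology}) process"
    and Xdual :: "('v, 'a) process"
    and m :: "'a measure"
    and p :: "real \<Rightarrow> 'a \<Rightarrow> 'a \<Rightarrow> ennreal"
    and \<mu> :: "enat \<Rightarrow> 'a measure"
    and A :: "enat \<Rightarrow> ennreal \<Rightarrow> 'w \<Rightarrow> ennreal"
    and F :: "'a set"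
  assumes "locally_compact_space (euclidean :: 'a topology)"
    and "radon_measure m" and "full_support m"
    and "standard_process X" and "transient X"
    and "standard_process Xdual" and "transient Xdual" and "in_duality X Xdual m"
    and "transition_density X m p" and "\<And>t x y. 0 < t \<Longrightarrow> 0 < p t x y"
    and "\<exists>x y. green p 0 x y \<noteq> \<infinity>"
    and "lower_semicont (\<lambda>(x, y). green p 0 x y)"
    and "\<And>n. \<mu> n \<in> kato p"
    and "\<And>n. pcaf X (A n)"
    and "\<And>n. revuz_measure X m (A n) (\<mu> n)"
    and "\<And>n. potential_identity X p (A n) (\<mu> n)"
    and "vague_conv (\<lambda>n. \<mu> (enat n)) (\<mu> \<infinity>)"
    and "uniform_limit UNIV (\<lambda>n x. enn2real (green_pot p 0 (\<mu> (enat n)) (\<lambda>_. 1) x))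
           (\<lambda>x. enn2real (green_pot p 0 (\<mu> \<infinity>) (\<lambda>_. 1) x)) sequentially"
    and "is_fine_support X (\<mu> \<infinity>) F"
  shows "(\<forall>\<alpha>\<ge>0. \<forall>u \<in> C0_closure (tc_resolvent X (A \<infinity>) \<alpha> ` C0).
            (\<forall>t\<ge>0. (\<lambda>n. sup_norm (\<lambda>x. tc_semigroup X (A (enat n)) t u x
                                         - tc_semigroup X (A \<infinity>) t u x)) \<longlonglongrightarrow> 0) \<and>
            (\<forall>a\<ge>0. \<forall>b\<ge>a. (\<lambda>n. SUP t\<in>{a..b}. sup_norm (\<lambda>x. tc_semigroup X (A (enat n)) t u x
                                         - tc_semigroup X (A \<infinity>) t u x)) \<longlonglongrightarrow> 0))
       \<and> (closed F \<longrightarrow> (\<forall>u\<in>C0.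
            (\<forall>t\<ge>0. (\<lambda>n. sup_norm (\<lambda>x. tc_semigroup X (A (enat n)) t (hitting_op X F u) x
                                         - tc_semigroup X (A \<infinity>) t u x)) \<longlonglongrightarrow> 0) \<and>
            (\<forall>a\<ge>0. \<forall>b\<ge>a. (\<lambda>n. SUP t\<in>{a..b}. sup_norm (\<lambda>x. tc_semigroup X (A (enat n)) t (hitting_op X F u) x
                                         - tc_semigroup X (A \<infinity>) t u x)) \<longlonglongrightarrow> 0)))"
proof -
  note lc = assms(1) and radon_m = assms(2) and std = assms(4) and trans = assms(5) and td = assms(9)
    and p_pos = assms(10) and lsc = assms(12) and kato = assms(13) and pcaf = assms(14) and pid = assms(16)
    and vague = assms(17) and unif = assms(18) and supp = assms(19)
  interpret standard_process X by (rule std)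
  have "\<exists>B N. clock_version X B (A n) N" for n
  proof (rule pcaf_time_change[OF pcaf[of n]])
    fix B N assume "time_change X B" "polar_set N"
      "\<And>\<omega>. \<omega> \<in> space (Evt X) \<Longrightarrow> \<omega> \<notin> N \<Longrightarrow> Pos X 0 \<omega> \<noteq> None \<Longrightarrow> (\<lambda>t. A n t \<omega>) = (\<lambda>t. B t \<omega>)"
    then have "clock_version X B (A n) N" by (intro clock_version.intro clock_version_axioms.intro)
    then show ?thesis by blast
  qed
  then obtain B N0 where cv: "\<And>n. clock_version X (B n) (A n) (N0 n)" by metis
  let ?G = "green p 0"
  interpret G: green_kernel ?G using lc lsc by unfold_locales
  have gpot: "G.gpot \<nu> (\<lambda>_. 1) x = green_pot p 0 \<nu> (\<lambda>_. 1) x" for \<nu> x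
    by (simp add: G.gpot_def green_pot_def)
  have km: "G.kato_measure (\<mu> n)" for n
    using kato[of n] unfolding G.kato_measure_def gpot kato_def by simp
  have ktc: "kato_time_change X (B n) ?G (\<mu> n)" for n
  proof -
    interpret clock_version X "B n" "A n" "N0 n" by (rule cv)
    show ?thesis
      by (intro kato_time_change.intro kato_time_change_axioms.intro time_change_axioms G.green_kernel_axioms km
          version_potential[OF pid])
  qed
  define h where "h n x = enn2real (G.gpot (\<mu> n) (\<lambda>_. 1) x)" for n x
  have "\<exists>C. \<forall>x. \<bar>h n x\<bar> \<le> C" for n
    using C0_bmeas[of "h n"] km[of n] by (simp add: h_def[abs_def] G.kato_measure_def bmeas_def)
  then obtain C where C: "\<And>n x. \<bar>h n x\<bar> \<le> C n" by metis
  have unif': "uniform_limit UNIV (\<lambda>n. h (enat n)) (h \<infinity>) sequentially"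
    using unif by (simp add: h_def[abs_def] gpot)
  have "\<forall>\<^sub>F n in sequentially. \<forall>x\<in>UNIV. dist (h (enat n) x) (h \<infinity> x) < 1"
    by (rule uniform_limitD[OF unif']) simp
  then obtain K where K: "\<And>n x. K \<le> n \<Longrightarrow> dist (h (enat n) x) (h \<infinity> x) < 1"
    unfolding eventually_sequentially by blast
  \<comment> \<open>A common bound: the finite sum covers the indices below K, and beyond K the
    potentials of 1 are within 1 of the limit, which is bounded by \<open>C \<infinity>\<close>. The
    leading 1 secures N \<ge> 1.\<close>
  define N where "N = 1 + \<bar>C \<infinity>\<bar> + 1 + (\<Sum>k<K. \<bar>C (enat k)\<bar>)"
  have N1: "1 \<le> N" unfolding N_def by (simp add: sum_nonneg)
  have hN: "h n x \<le> N" for n x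
  proof (cases n)
    case infinity
    have "0 \<le> (\<Sum>k<K. \<bar>C (enat k)\<bar>)" by (simp add: sum_nonneg)
    then show ?thesis using C[of "\<infinity>" x] unfolding infinity N_def by linarith
  next
    case (enat k)
    show ?thesis
    proof (cases "k < K")
      case True
      then have "\<bar>C (enat k)\<bar> \<le> (\<Sum>k<K. \<bar>C (enat k)\<bar>)" by (intro member_le_sum) auto
      then show ?thesis using C[of "enat k" x] unfolding \<open>n = enat k\<close> N_def by linarith
    next
      case False
      have "0 \<le> (\<Sum>k<K. \<bar>C (enat k)\<bar>)" by (simp add: sum_nonneg)
      moreover have "\<bar>h n x - h \<infinity> x\<bar> < 1" using K[of k x] False enat by (simp add: dist_real_def)
      ultimately show ?thesis using C[of "\<infinity>" x] unfolding N_def by linarith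
    qed
  qed
  have N2: "G.gpot (\<mu> n) (\<lambda>_. 1) x \<le> ennreal N" for n x
  proof -
    have "G.gpot (\<mu> n) (\<lambda>_. 1) x = ennreal (h n x)"
      using km[of n] by (simp add: G.kato_measure_def h_def)
    then show ?thesis using hN[of n x] by (simp add: ennreal_leI)
  qed
  have kb: "kato_bounded X (B n) ?G (\<mu> n) N" for n
    by (intro kato_bounded.intro kato_bounded_axioms.intro ktc N1 N2)
  have kl: "kato_limit X (B \<infinity>) ?G (\<mu> \<infinity>) N (\<lambda>n. B (enat n)) (\<lambda>n. \<mu> (enat n))"
    by (intro kato_limit.intro kato_limit_axioms.intro kb vague unif'[unfolded h_def[abs_def]])
  interpret lim: kato_bounded X "B \<infinity>" ?G "\<mu> \<infinity>" N by (rule kb)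
  note conv = kato_limit.tc_semigroup_conv[OF kl cv cv]
  show ?thesis
  proof (rule conjI; (intro allI ballI impI)?)
    fix \<alpha> u assume \<alpha>: "0 \<le> (\<alpha> :: real)" and u: "u \<in> C0_closure (tc_resolvent X (A \<infinity>) \<alpha> ` C0)"
    have ub: "u \<in> bmeas" using u by (intro C0_bmeas) (simp add: C0_closure_def)
    show "(\<forall>t\<ge>0. (\<lambda>n. sup_norm (\<lambda>x. tc_semigroup X (A (enat n)) t u x - tc_semigroup X (A \<infinity>) t u x)) \<longlonglongrightarrow> 0) \<and>
        (\<forall>a\<ge>0. \<forall>b\<ge>a. (\<lambda>n. SUP t\<in>{a..b}. sup_norm (\<lambda>x. tc_semigroup X (A (enat n)) t u x - tc_semigroup X (A \<infinity>) t u x)) \<longlonglongrightarrow> 0)"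
      by (rule conv[OF ub _ ub refl]) (rule lim.resolvent_range_closure[OF cv \<alpha> u])
  next
    fix u :: "'a \<Rightarrow> real" assume F: "closed F" and u: "u \<in> C0"
    have sets_m: "sets m = sets borel" using radon_m by (simp add: radon_measure_def)
    note sf = radon_sigma_finite[OF lc radon_m]
    obtain g where g: "g \<in> borel_measurable borel" "\<And>x. 0 < g x"
      "\<And>x. (\<integral>\<^sup>+t\<in>{0..}. trans_op X t g x \<partial>lborel) < \<infinity>"
      using trans unfolding transient_def by blast
    note gp = green_potential[OF sf sets_m td g(1)]
    have fs: "fine_support X (B \<infinity>) ?G (\<mu> \<infinity>) N m g"
      using g(3)
      by (intro fine_support.intro fine_support_axioms.intro kb sets_m g(1,2) green_pos[OF sf sets_m td p_pos])
         (simp_all only: nn_integral_trans_op[OF g(1)] gp)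
    \<comment> \<open>A fine carrier is only universally measurable in general, hence null for the
      completion; as F is closed, its complement is a null set of the measure itself.\<close>
    have "- F \<in> null_sets (completion (\<mu> \<infinity>))" using supp by (simp add: is_fine_support_def fine_carrier_def)
    moreover have "- F \<in> sets (\<mu> \<infinity>)" using F by (simp add: lim.sets_\<mu> borel_open open_Compl)
    ultimately have null: "emeasure (\<mu> \<infinity>) (- F) = 0" by (simp add: null_sets_def)
    interpret cs: closed_support X "B \<infinity>" ?G "\<mu> \<infinity>" N m g F
      by (intro closed_support.intro closed_support_axioms.intro fs F null fine_support.fine_support_subset[OF fs supp])
    show "(\<forall>t\<ge>0. (\<lambda>n. sup_norm (\<lambda>x. tc_semigroup X (A (enat n)) t (hitting_op X F u) x - tc_semigroup X (A \<infinity>) t u x)) \<longlonglongrightarrow> 0) \<and>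
        (\<forall>a\<ge>0. \<forall>b\<ge>a. (\<lambda>n. SUP t\<in>{a..b}. sup_norm (\<lambda>x. tc_semigroup X (A (enat n)) t (hitting_op X F u) x - tc_semigroup X (A \<infinity>) t u x)) \<longlonglongrightarrow> 0)"
      by (rule conv[OF C0_bmeas[OF cs.hitting_op_C0[OF u]] _ C0_bmeas[OF u]])
         (erule cs.hitting_op_approx[OF u], erule cs.Qt_hitting_op[OF u])
  qed
qed

end
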